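(* Let $N\ge 1$ be an integer, let $\frac{2N}{N+1}<p<\infty$, and let $0<\Lambda_0\le\Lambda_1<\infty$. There exists a constant $\mathbf{C}=\mathbf{C}(N,p,\Lambda_0,\Lambda_1)$, depending only on $N,p,\Lambda_0,\Lambda_1$, such that the following holds. Let $\Omega\subset\mathbb{R}^N$ be open, let $T>0$, and let $u$ be a non-negative weak solution of $$u_t-\operatorname{div}\mathcal{A}(x,t,\nabla u)=0\quad\text{in }\Omega\times(-T,T),$$ where $\mathcal{A}$ satisfies the structure conditions with exponent $p$ and constants $\Lambda_0,\Lambda_1$ (see context). Let $\sigma\in(0,1)$ and let $\rho,\theta\in(0,\infty)$ be such that $\overline{B_\rho}\times[-\theta,\theta]\subset\Omega\times(-T,T)$. Then $$\sup_{Q_{\sigma\rho,\sigma\theta}}u\;\le\;\max\left\{\mathbf{C}\,\frac{\mathbb{A}^{\frac{p(N+1)}{2N(p-1)}}}{\sigma^{\frac{p(N+1)^2}{2N(p-1)}}(1-\sigma)^{\frac{p(N+p)(N+1)}{2N(p-1)}}}\left(\frac{1}{|Q_{\rho,\theta}|}\iint_{Q_{\rho,\theta}}|u|^{p}\,dx\,dt\right)^{\frac{p(N+1)}{2N(p-1)}},\;1\right\},$$ where $$\mathbb{A}:=\frac{\theta}{\rho^p}+\left(\frac{\rho^p}{\theta}\right)^{\frac{N}{p}}.$$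
   Context: Notation: $B_r\subset\mathbb{R}^N$ is the open ball of radius $r$ centered at the origin; $Q_{r,s}:=B_r\times[-s,s]$; $|Q_{r,s}|$ is its $(N+1)$-dimensional Lebesgue measure; $\sup$ denotes the essential supremum; non-negative means $u\ge 0$ a.e. Structure conditions: $\mathcal{A}:\Omega\times(-T,T)\times\mathbb{R}^N\to\mathbb{R}^N$ is such that $(x,t)\mapsto\mathcal{A}(x,t,\nabla u(x,t))$ is measurable and, for a.e. $(x,t)\in\Omega\times(-T,T)$, $$\langle\mathcal{A}(x,t,\nabla u),\nabla u\rangle\ge\Lambda_0|\nabla u|^p,\qquad|\mathcal{A}(x,t,\nabla u)|\le\Lambda_1|\nabla u|^{p-1}.$$ Steklov average: for $h\in(0,2T)$, $[v]_h(\cdot,t):=\frac1h\int_t^{t+h}v(\cdot,\tau)\,d\tau$ if $t\in(-T,T-h)$, and $[v]_h(\cdot,t):=0$ otherwise. Weak solution: $u\in C^0(-T,T;L^2_{\mathrm{loc}}(\Omega))\cap L^p(-T,T;W^{1,p}_{\mathrm{loc}}(\Omega))$ is a weak solution if for every $h\in(0,2T)$, every $\phi\in C_c^\infty(\Omega)$ and every $t\in(-T,T-h)$, $$\int_{\Omega\times\{t\}}\left\{\frac{d[u]_h}{dt}\,\phi+\langle[\mathcal{A}(x,t,\nabla u)]_h,\nabla\phi\rangle\right\}dx=0.$$ Here "loc" means that the corresponding property holds on every open set compactly contained in $\Omega$. *)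

theory Defs
  imports "HOL-Probability.Essential_Supremum"
begin

text \<open>
  Functions on space-time are functions of a pair \<open>(x, t)\<close>. They are total; only their values
  on the domain under consideration are ever constrained. Functions that mathematically are
  classes modulo null sets are represented by measurable representatives.
\<close>

definition compactly_contained :: "'a::topological_space set \<Rightarrow> 'a set \<Rightarrow> bool" where
  "compactly_contained U \<Omega> \<longleftrightarrow> open U \<and> compact (closure U) \<and> closure U \<subseteq> \<Omega>"

subsection \<open>Test functions\<close>

fun C_k :: "nat \<Rightarrow> ('a::real_normed_vector \<Rightarrow> real) \<Rightarrow> bool" where
  "C_k 0 f \<longleftrightarrow> continuous_on UNIV f"
| "C_k (Suc k) f \<longleftrightarrow>
     (\<forall>x. f differentiable (at x)) \<and> (\<forall>v. C_k k (\<lambda>x. frechet_derivative f (at x) v))"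

text \<open>A test function on \<open>\<Omega>\<close> is extended by zero to the whole space.\<close>

definition test_functions :: "'a::real_normed_vector set \<Rightarrow> ('a \<Rightarrow> real) set" where
  "test_functions \<Omega> = {\<phi>. (\<forall>k. C_k k \<phi>) \<and>
     compact (closure {x. \<phi> x \<noteq> 0}) \<and> closure {x. \<phi> x \<noteq> 0} \<subseteq> \<Omega>}"

definition grad :: "(real^'n \<Rightarrow> real) \<Rightarrow> real^'n \<Rightarrow> real^'n" where
  "grad \<phi> x = (\<chi> i. frechet_derivative \<phi> (at x) (axis i 1))"

subsection \<open>Function spaces\<close>

definition in_Lp :: "real \<Rightarrow> 'a::euclidean_space set \<Rightarrow> ('a \<Rightarrow> 'b::euclidean_space) \<Rightarrow> bool" where
  "in_Lp p S f \<longleftrightarrow> f \<in> borel_measurable (lebesgue_on S) \<and>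
     integrable (lebesgue_on S) (\<lambda>x. norm (f x) powr p)"

definition Lp_norm :: "real \<Rightarrow> 'a::euclidean_space set \<Rightarrow> ('a \<Rightarrow> 'b::euclidean_space) \<Rightarrow> real" where
  "Lp_norm p S f = (LINT x|lebesgue_on S. norm (f x) powr p) powr (1 / p)"

definition weak_gradient :: "(real^'n) set \<Rightarrow> (real^'n \<Rightarrow> real) \<Rightarrow> (real^'n \<Rightarrow> real^'n) \<Rightarrow> bool" where
  "weak_gradient U f g \<longleftrightarrow> (\<forall>\<phi>\<in>test_functions U.
     (LINT x|lebesgue_on U. f x *\<^sub>R grad \<phi> x) = - (LINT x|lebesgue_on U. \<phi> x *\<^sub>R g x))"

text \<open>\<open>f \<in> W\<^sup>1\<^sup>,\<^sup>p(U)\<close>, with \<open>g\<close> a representative of its weak gradient.\<close>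

definition W1p :: "real \<Rightarrow> (real^'n) set \<Rightarrow> (real^'n \<Rightarrow> real) \<Rightarrow> (real^'n \<Rightarrow> real^'n) \<Rightarrow> bool" where
  "W1p p U f g \<longleftrightarrow> in_Lp p U f \<and> in_Lp p U g \<and> weak_gradient U f g"

text \<open>
  \<open>u \<in> L\<^sup>p(-T,T; W\<^sup>1\<^sup>,\<^sup>p\<^sub>l\<^sub>o\<^sub>c(\<Omega>))\<close>, with \<open>Du\<close> a representative of its weak spatial gradient. Strong
  measurability and \<open>p\<close>-integrability of \<open>t \<mapsto> u(\<cdot>,t) \<in> W\<^sup>1\<^sup>,\<^sup>p(U)\<close> are expressed by joint
  measurability and \<open>p\<close>-integrability of \<open>u\<close> and \<open>Du\<close> on \<open>U \<times> (-T,T)\<close>. The integrability is up to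
  the end times \<open>\<plusminus>T\<close>; only the space variable is localized.
\<close>

definition Lp_W1p_loc ::
    "real \<Rightarrow> (real^'n) set \<Rightarrow> real \<Rightarrow> ((real^'n) \<times> real \<Rightarrow> real) \<Rightarrow> ((real^'n) \<times> real \<Rightarrow> real^'n) \<Rightarrow> bool"
  where
  "Lp_W1p_loc p \<Omega> T u Du \<longleftrightarrow> (\<forall>U. compactly_contained U \<Omega> \<longrightarrow>
     in_Lp p (U \<times> {-T<..<T}) u \<and> in_Lp p (U \<times> {-T<..<T}) Du \<and>
     (AE t in lebesgue_on {-T<..<T}. W1p p U (\<lambda>x. u (x, t)) (\<lambda>x. Du (x, t))))"

text \<open>
  \<open>v \<in> C\<^sup>0(-T,T; L\<^sup>2\<^sub>l\<^sub>o\<^sub>c(\<Omega>))\<close>. The representative is such that every slice \<open>v(\<cdot>,t)\<close>, and not only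
  almost every one, is the value at \<open>t\<close> of the continuous curve.
\<close>

definition C0_L2_loc :: "'a::euclidean_space set \<Rightarrow> real \<Rightarrow> ('a \<times> real \<Rightarrow> real) \<Rightarrow> bool" where
  "C0_L2_loc \<Omega> T v \<longleftrightarrow> (\<forall>U. compactly_contained U \<Omega> \<longrightarrow> (\<forall>t\<in>{-T<..<T}.
     in_Lp 2 U (\<lambda>x. v (x, t)) \<and>
     ((\<lambda>s. Lp_norm 2 U (\<lambda>x. v (x, s) - v (x, t))) \<longlongrightarrow> 0) (at t)))"

text \<open>
  \<open>w = dv/dt(\<cdot>,t)\<close> as the derivative at the time \<open>t\<close> of the curve \<open>s \<mapsto> v(\<cdot>,s)\<close> in
  \<open>L\<^sup>2\<^sub>l\<^sub>o\<^sub>c(\<Omega>)\<close>; such a \<open>w\<close> is unique up to a null set.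
\<close>

definition has_L2_loc_time_derivative ::
    "'a::euclidean_space set \<Rightarrow> ('a \<times> real \<Rightarrow> real) \<Rightarrow> ('a \<Rightarrow> real) \<Rightarrow> real \<Rightarrow> bool" where
  "has_L2_loc_time_derivative \<Omega> v w t \<longleftrightarrow> (\<forall>U. compactly_contained U \<Omega> \<longrightarrow>
     in_Lp 2 U w \<and>
     (\<forall>\<^sub>F s in nhds t. in_Lp 2 U (\<lambda>x. v (x, s))) \<and>
     ((\<lambda>s. Lp_norm 2 U (\<lambda>x. (v (x, s) - v (x, t)) / (s - t) - w x)) \<longlongrightarrow> 0) (at t))"

subsection \<open>The equation\<close>

definition steklov :: "real \<Rightarrow> real \<Rightarrow> ('a \<times> real \<Rightarrow> 'b::euclidean_space) \<Rightarrow> 'a \<times> real \<Rightarrow> 'b" where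
  "steklov T h v = (\<lambda>(x, t).
     if t \<in> {-T<..<T - h} then (1 / h) *\<^sub>R (LINT \<tau>|lebesgue_on {t..t + h}. v (x, \<tau>)) else 0)"

definition structure_conditions ::
    "real \<Rightarrow> real \<Rightarrow> real \<Rightarrow> (real^'n) set \<Rightarrow> real \<Rightarrow> ((real^'n) \<times> real \<Rightarrow> real^'n \<Rightarrow> real^'n) \<Rightarrow>
     ((real^'n) \<times> real \<Rightarrow> real^'n) \<Rightarrow> bool" where
  "structure_conditions p \<Lambda>0 \<Lambda>1 \<Omega> T A Du \<longleftrightarrow>
     (\<lambda>z. A z (Du z)) \<in> borel_measurable (lebesgue_on (\<Omega> \<times> {-T<..<T})) \<and>
     (AE z in lebesgue_on (\<Omega> \<times> {-T<..<T}).
        inner (A z (Du z)) (Du z) \<ge> \<Lambda>0 * norm (Du z) powr p \<and>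
        norm (A z (Du z)) \<le> \<Lambda>1 * norm (Du z) powr (p - 1))"

text \<open>
  \<open>u\<close> is a weak solution of \<open>u\<^sub>t - div A(x,t,\<nabla>u) = 0\<close> in \<open>\<Omega> \<times> (-T,T)\<close>, with \<open>Du\<close> a representative
  of \<open>\<nabla>u\<close>.
\<close>

definition weak_solution ::
    "real \<Rightarrow> (real^'n) set \<Rightarrow> real \<Rightarrow> ((real^'n) \<times> real \<Rightarrow> real^'n \<Rightarrow> real^'n) \<Rightarrow>
     ((real^'n) \<times> real \<Rightarrow> real) \<Rightarrow> ((real^'n) \<times> real \<Rightarrow> real^'n) \<Rightarrow> bool" where
  "weak_solution p \<Omega> T A u Du \<longleftrightarrow>
     C0_L2_loc \<Omega> T u \<and> Lp_W1p_loc p \<Omega> T u Du \<and>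
     (\<forall>h\<in>{0<..<2 * T}. \<forall>t\<in>{-T<..<T - h}.
        \<exists>w. has_L2_loc_time_derivative \<Omega> (steklov T h u) w t \<and>
          (\<forall>\<phi>\<in>test_functions \<Omega>.
             (LINT x|lebesgue_on \<Omega>.
                w x * \<phi> x + inner (steklov T h (\<lambda>z. A z (Du z)) (x, t)) (grad \<phi> x)) = 0))"

definition cylinder :: "real \<Rightarrow> real \<Rightarrow> ((real^'n) \<times> real) set" where
  "cylinder r s = ball 0 r \<times> {-s..s}"

end

theory Submission
  imports Defs "HOL-Analysis.Weierstrass_Theorems"
begin

text \<open>
  The bound is proved by De Giorgi's truncation method; the two points that need care are the time
  regularity, which is only that of a Steklov formulation, and the range \<open>p < 2\<close>.

  \<^bold>\<open>Energy.\<close> Since \<open>u\<close> is continuous in time with values in \<open>L\<^sup>2\<close>, the Steklov formulation can be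
  integrated: for a spatial test function \<open>\<phi>\<close> the difference of \<open>\<integral>u(x,t)\<phi> dx\<close> between two times is
  exactly \<open>-\<integral>\<integral>A \<bullet> \<nabla>\<phi>\<close> (\<open>weak_solution_evolution\<close>). Testing with a translated mollifier gives, for the
  mollification \<open>u\<^sub>d\<close> of \<open>u\<close> in the space variable only, an absolutely continuous function of time at
  each point, so that the chain rule in time is available although \<open>u\<close> has no time derivative.
  Multiplying by \<open>F(u\<^sub>d)\<xi>\<close>, integrating by parts in space and letting \<open>d\<close> tend to \<open>0\<close> along a
  sequence for which everything converges almost everywhere under an integrable majorant yields the
  energy identity for smooth functions of \<open>u\<close>, hence for truncations \<open>(u-k)\<^sub>+\<close>, and with the structure
  conditions the Caccioppoli inequality (\<open>energy_inequality\<close>).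

  \<^bold>\<open>Gain of integrability.\<close> Instead of the Sobolev inequality, only the following consequence of the
  energy bound is used: a truncation \<open>w\<close> times a cutoff satisfies \<open>\<integral>w(x,t)\<^sup>2 dx \<le> X\<close> for almost every \<open>t\<close> and
  \<open>\<integral>\<integral>|w(x,t) - w(x-y,t)|\<^sup>p \<le> |y|\<^sup>p X\<close> for every \<open>y\<close> (\<open>de_giorgi_ingredients\<close>). Where \<open>w > s\<close>, the mean
  of \<open>w\<close> over a ball of volume \<open>4X/s\<^sup>2\<close> is at most \<open>s/2\<close>, so \<open>w\<close> is controlled there by its oscillation over
  that ball (\<open>weak_type_estimate\<close>); summing over dyadic levels bounds the integral of \<open>w\<^sup>m\<close> above a level by
  \<open>X\<close> to the power \<open>1 + p/N\<close> (\<open>strong_type_above_level\<close>), for every \<open>m\<close> with \<open>m - p < 2p/N\<close>.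

  \<^bold>\<open>Iteration.\<close> With \<open>m = max p 2\<close>, the larger of the two exponents on the right of the Caccioppoli
  inequality, this closes into a recursion for \<open>\<integral>\<integral>(u-k\<^sub>n)\<^sub>+\<^sup>m\<close> on shrinking cylinders, and \<open>u\<close> is bounded
  locally by a power of its \<open>L\<^sup>m\<close> integral (\<open>de_giorgi_bound\<close>). If \<open>p < 2\<close>, writing
  \<open>u\<^sup>2 \<le> (sup u)\<^sup>2\<^sup>-\<^sup>p u\<^sup>p\<close> and interpolating over an increasing sequence of cylinders replaces the \<open>L\<^sup>2\<close> integral by
  the \<open>L\<^sup>p\<close> integral; the power of the supremum that appears on the right is less than \<open>1\<close> for
  \<open>p\<close> in the given range (\<open>local_sup_bound\<close>). The exponent obtained is at most the one claimed
  (\<open>exponent_comparison\<close>); as the bound has the form \<open>max 1 (\<dots>)\<close>, passing to the larger exponent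
  only weakens it.
\<close>

abbreviation Borel :: "('a::topological_space => 'b::topological_space) set" where
 "Borel \<equiv> borel_measurable borel"

abbreviation L1 :: "('a::euclidean_space => 'b::{banach,second_countable_topology}) => bool" where
 "L1 \<equiv> integrable lborel"

section \<open>Test functions and mollifiers\<close>

text \<open>The powers of \<open>1/s\<close> make the family closed under differentiation.\<close>

definition flat :: "nat => real => real" where
 "flat j s = (if s > 0 then exp (- (1/s))/s^j else 0)"

lemma flat_tendsto_0: "(flat j \<longlongrightarrow> 0) (at 0)"
proof (rule filterlim_split_at)
 show "(flat j \<longlongrightarrow> 0) (at_left 0)"
  by (rule tendsto_eventually) (auto simp: flat_def eventually_at_filter)
 have "((\<lambda>s. (inverse s)^j/exp (inverse s)) \<longlongrightarrow> 0) (at_right (0::real))"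
  by (rule filterlim_compose[OF tendsto_power_div_exp_0 filterlim_inverse_at_top_right])
 moreover have "\<forall>\<^sub>F s in at_right 0. (inverse s)^j/exp (inverse s) = flat j s"
  by (auto simp: eventually_at_filter flat_def exp_minus divide_simps power_inverse)
 ultimately show "(flat j \<longlongrightarrow> 0) (at_right 0)"
  using Lim_transform_eventually by blast
qed

lemma DERIV_flat:
 "(flat j has_real_derivative (flat (j+2) s-real j*flat (j+1) s)) (at s)"
proof -
 consider "s > 0" | "s < 0" | "s = 0" by linarith
 then show ?thesis
 proof cases
  case 1
  have "((\<lambda>s. exp (- (1/s))/s^j) has_real_derivative
    (flat (j+2) s-real j*flat (j+1) s)) (at s)"
   using 1 by (auto intro!: derivative_eq_intros simp: flat_def divide_simps)
    (cases j, auto simp: algebra_simps power2_eq_square)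
  moreover have "\<forall>\<^sub>F s in nhds s. exp (- (1/s))/s^j = flat j s"
   using eventually_nhds_in_open[of "{0<..}" s] 1
   by (auto simp: flat_def elim: eventually_mono)
  ultimately show ?thesis
   by (subst DERIV_cong_ev[of s s "flat j" "\<lambda>s. exp (- (1/s))/s^j"])
    (auto simp: eventually_mono)
 next
  case 2
  have "\<forall>\<^sub>F s in nhds s. flat j s = 0"
   using eventually_nhds_in_open[of "{..<0}" s] 2
   by (auto simp: flat_def elim: eventually_mono)
  then show ?thesis
   using 2 by (subst DERIV_cong_ev[of s s "flat j" "\<lambda>_. 0"]) (auto simp: flat_def)
 next
  case 3
  have "((\<lambda>h. flat (Suc j) h) \<longlongrightarrow> 0) (at 0)" by (rule flat_tendsto_0)
  moreover have "flat (Suc j) h = (flat j h-flat j 0)/(h-0)" for h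
   by (auto simp: flat_def)
  ultimately show ?thesis
   using 3 by (auto simp: has_field_derivative_iff flat_def)
 qed
qed

lemma real_polynomial_function_derivative:
 assumes "real_polynomial_function (P :: 'a::real_normed_vector => real)"
 shows "\<exists>P'. (\<forall>x. (P has_derivative P' x) (at x)) \<and> (\<forall>v. real_polynomial_function (\<lambda>x. P' x v))"
 using assms
proof induction
 case (linear f)
 then show ?case
  by (intro exI[of _ "\<lambda>x. f"]) (auto intro: bounded_linear_imp_has_derivative)
next
 case (const c)
 then show ?case by (intro exI[of _ "\<lambda>x v. 0"]) auto
next
 case (add f g)
 then obtain f' g' where
  "\<forall>x. (f has_derivative f' x) (at x)" "\<forall>v. real_polynomial_function (\<lambda>x. f' x v)"
  "\<forall>x. (g has_derivative g' x) (at x)" "\<forall>v. real_polynomial_function (\<lambda>x. g' x v)" by blast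
 then show ?case
  by (intro exI[of _ "\<lambda>x v. f' x v + g' x v"]) (auto intro!: has_derivative_add)
next
 case (mult f g)
 then obtain f' g' where
  "\<forall>x. (f has_derivative f' x) (at x)" "\<forall>v. real_polynomial_function (\<lambda>x. f' x v)"
  "\<forall>x. (g has_derivative g' x) (at x)" "\<forall>v. real_polynomial_function (\<lambda>x. g' x v)" by blast
 with mult show ?case
  by (intro exI[of _ "\<lambda>x v. f x*g' x v + f' x v * g x"])
   (auto intro!: has_derivative_mult real_polynomial_function.intros(3,4))
qed

text \<open>Members are \<open>P(x)\<close> times \<open>flat j (d\<^sup>2 - |x - a|\<^sup>2)\<close> and sums of these. The class is closed under directional
derivatives, so its members are smooth in the sense of \<open>C_k\<close> for every \<open>k\<close>; proving this for a whole class avoids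
formulas for higher derivatives of a single bump.\<close>

inductive bump_class :: "'a::euclidean_space => real => ('a => real) => bool" for a d where
 base: "real_polynomial_function P ==> bump_class a d (\<lambda>x. P x*flat j (d\<^sup>2-(norm (x-a))\<^sup>2))"
| add: "bump_class a d f ==> bump_class a d g ==> bump_class a d (\<lambda>x. f x+g x)"

lemma bump_class_derivative:
 assumes "bump_class a d f"
 shows "\<exists>f'. (\<forall>x. (f has_derivative f' x) (at x)) \<and> (\<forall>v. bump_class a d (\<lambda>x. f' x v))"
 using assms
proof induction
 case (base P j)
 obtain P' where P': "\<And>x. (P has_derivative P' x) (at x)"
   "\<And>v. real_polynomial_function (\<lambda>x. P' x v)"
  using real_polynomial_function_derivative[OF base] by blast
 let ?r = "\<lambda>x. d\<^sup>2-(norm (x-a))\<^sup>2"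
 have r: "(?r has_derivative (\<lambda>v. - 2*((x-a)\<bullet>v))) (at x)" for x
  unfolding power2_norm_eq_inner
  by (auto intro!: derivative_eq_intros simp: inner_commute)
 have fl: "((\<lambda>x. flat j (?r x)) has_derivative
   (\<lambda>v. (flat (j+2) (?r x)-real j*flat (j+1) (?r x))*(- 2*((x-a)\<bullet>v)))) (at x)" for x
  using has_derivative_compose[OF r DERIV_flat[of j "?r x", unfolded has_field_derivative_def]] .
 define f' where "f' x v = P' x v * flat j (?r x) +
   (P x*(- 2*((x-a)\<bullet>v))*flat (j+2) (?r x) +
    P x*(2*real j*((x-a)\<bullet>v))*flat (j+1) (?r x))" for x v
 have "((\<lambda>x. P x*flat j (?r x)) has_derivative f' x) (at x)" for x
  using has_derivative_mult[OF P'(1) fl, of x]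
  by (rule has_derivative_eq_rhs) (auto simp: f'_def fun_eq_iff algebra_simps)
 moreover have lin: "real_polynomial_function (\<lambda>x. (x-a)\<bullet>v)" for v
 proof -
  have "real_polynomial_function (\<lambda>x. x\<bullet>v + - (a\<bullet>v))"
   by (intro real_polynomial_function.intros(3) real_polynomial_function.intros(1,2) bounded_linear_inner_left)
  then show ?thesis by (simp add: inner_diff_left)
 qed
 have "bump_class a d (\<lambda>x. f' x v)" for v
  unfolding f'_def
  by (intro bump_class.add bump_class.base P' real_polynomial_function.intros(2,4) base lin)
 ultimately show ?case by blast
next
 case (add f g)
 then obtain f' g' where
  "\<forall>x. (f has_derivative f' x) (at x)" "\<forall>v. bump_class a d (\<lambda>x. f' x v)"
  "\<forall>x. (g has_derivative g' x) (at x)" "\<forall>v. bump_class a d (\<lambda>x. g' x v)" by blast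
 then show ?case
  by (intro exI[of _ "\<lambda>x v. f' x v + g' x v"]) (auto intro!: has_derivative_add bump_class.add)
qed

lemma bump_class_C_k: "bump_class a d f ==> C_k k f"
proof (induction k arbitrary: f)
 case 0
 then obtain f' where "\<And>x. (f has_derivative f' x) (at x)" using bump_class_derivative by blast
 then show ?case
  by (auto intro!: has_derivative_continuous_on)
next
 case (Suc k)
 then obtain f' where f': "\<And>x. (f has_derivative f' x) (at x)" "\<And>v. bump_class a d (\<lambda>x. f' x v)"
  using bump_class_derivative by blast
 then have "frechet_derivative f (at x) = f' x" for x
  by (metis frechet_derivative_at)
 then show ?case using f' Suc.IH by (auto simp: differentiable_def)
qed

definition mollifier :: "real => 'a::euclidean_space => real" where
 "mollifier d x = flat 0 (d\<^sup>2-(norm x)\<^sup>2)/(LINT z|lborel. flat 0 (d\<^sup>2-(norm (z::'a))\<^sup>2))"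

lemma flat_bump_continuous: "continuous_on UNIV (\<lambda>x::'a::euclidean_space. flat 0 (d\<^sup>2-(norm x)\<^sup>2))"
proof -
 have "bump_class 0 d (\<lambda>x::'a. 1*flat 0 (d\<^sup>2-(norm (x-0))\<^sup>2))"
  by (rule bump_class.base) auto
 from bump_class_C_k[OF this, of 0] show ?thesis by simp
qed

lemma flat_bump_integrable:
 assumes "d > 0"
 shows "L1 (\<lambda>x::'a::euclidean_space. flat 0 (d\<^sup>2-(norm x)\<^sup>2))"
proof -
 have "L1 (\<lambda>x::'a. indicator (cball 0 d) x*\<^sub>R flat 0 (d\<^sup>2-(norm x)\<^sup>2))"
  by (rule borel_integrable_compact) (auto intro: continuous_on_subset[OF flat_bump_continuous])
 moreover have "indicator (cball 0 d) x*\<^sub>R flat 0 (d\<^sup>2-(norm x)\<^sup>2) = flat 0 (d\<^sup>2-(norm x)\<^sup>2)" for x :: 'a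
 proof (cases "norm x\<le>d")
  case False
  then have "d\<^sup>2\<le>(norm x)\<^sup>2" using assms by (intro power_mono) auto
  then have "\<not> 0 < d\<^sup>2-(norm x)\<^sup>2" by linarith
  then show ?thesis by (simp only: flat_def if_False scaleR_zero_right)
 qed simp
 ultimately show ?thesis by (simp only:)
qed

lemma flat_bump_integral_pos:
 assumes "d > 0"
 shows "(LINT x|lborel. flat 0 (d\<^sup>2-(norm (x::'a::euclidean_space))\<^sup>2)) > 0"
proof -
 let ?f = "\<lambda>x::'a. flat 0 (d\<^sup>2-(norm x)\<^sup>2)"
 have nn: "?f x\<ge>0" for x by (auto simp: flat_def)
 have "LINT x|lborel. ?f x\<noteq>0"
 proof
  assume "LINT x|lborel. ?f x = 0"
  then have "AE x in lborel. ?f x = 0"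
   using integral_nonneg_eq_0_iff_AE[OF flat_bump_integrable[OF assms]] nn by auto
  then have "AE x in lborel. x \<notin> ball (0::'a) d"
  proof eventually_elim
   case (elim x)
   then show ?case
    using power_strict_mono[of "norm x" d 2] by (auto simp: flat_def split: if_splits)
  qed
  then have "emeasure lborel (ball (0::'a) d) = 0"
   by (subst (asm) AE_iff_measurable[where N = "ball 0 d"]) auto
  then show False
  proof -
   have "unit_ball_vol (real DIM('a))*d^DIM('a) > 0" using assms by simp
   moreover have "emeasure lborel (ball (0::'a) d) = ennreal (unit_ball_vol (real DIM('a))*d^DIM('a))"
    using assms by (intro emeasure_ball) auto
   ultimately show ?thesis
    using \<open>emeasure lborel (ball (0::'a) d) = 0\<close> by (metis ennreal_eq_0_iff not_le)
  qed
 qed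
 moreover have "LINT x|lborel. ?f x\<ge>0" using nn by (intro Bochner_Integration.integral_nonneg) auto
 ultimately show ?thesis by linarith
qed

lemma grad_works:
 fixes f :: "real^'n => real"
 assumes "f differentiable (at x)"
 shows "(f has_derivative (\<lambda>h. grad f x\<bullet>h)) (at x)"
proof -
 have d: "(f has_derivative frechet_derivative f (at x)) (at x)"
  using assms frechet_derivative_works by blast
 have lin: "linear (frechet_derivative f (at x))" using d has_derivative_linear by blast
 have "frechet_derivative f (at x) h = grad f x\<bullet>h" for h
 proof -
  have "frechet_derivative f (at x) h = frechet_derivative f (at x) (\<Sum>i\<in>UNIV. h $ i*\<^sub>R axis i 1)"
   by (simp add: basis_expansion scalar_mult_eq_scaleR[symmetric])
  also have "... = (\<Sum>i\<in>UNIV. h $ i*frechet_derivative f (at x) (axis i 1))"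
   using lin by (simp add: linear_sum linear_scale)
  also have "... = grad f x\<bullet>h"
   by (simp add: grad_def inner_vec_def mult.commute)
  finally show ?thesis .
 qed
 then have "frechet_derivative f (at x) = (\<lambda>h. grad f x\<bullet>h)" by blast
 with d show ?thesis by simp
qed

lemma grad_unique:
 fixes f :: "real^'n => real"
 assumes "(f has_derivative (\<lambda>h. g\<bullet>h)) (at x)"
 shows "grad f x = g"
proof -
 have "frechet_derivative f (at x) = (\<lambda>h. g\<bullet>h)"
  using assms frechet_derivative_at by metis
 then show ?thesis by (simp add: grad_def vec_eq_iff inner_axis)
qed

text \<open>The mollifier is the normalized radial bump; the facts below are all that is used of it later. In particular
\<open>y \<mapsto> mollifier d (y - x)\<close> is an admissible test function in \<open>y\<close> whenever the closed ball of radius \<open>d\<close> about \<open>x\<close> lies in the domain.\<close>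

lemma
 fixes d :: real
 assumes "d > 0"
 shows mollifier_nonneg: "mollifier d (x::real^'n)\<ge>0"
  and mollifier_outside: "norm x\<ge>d ==> mollifier d x = 0"
  and mollifier_minus: "mollifier d (- x) = mollifier d x"
  and mollifier_integrable: "L1 (mollifier d :: real^'n => real)"
  and mollifier_integral: "(LINT x|lborel. mollifier d (x::real^'n)) = 1"
  and mollifier_continuous: "continuous_on UNIV (mollifier d :: real^'n => real)"
  and mollifier_has_derivative:
   "(mollifier d has_derivative (\<lambda>h. grad (mollifier d) x\<bullet>h)) (at x)"
  and mollifier_grad_continuous: "continuous_on UNIV (grad (mollifier d) :: real^'n => real^'n)"
  and mollifier_grad_outside: "norm x > d ==> grad (mollifier d) x = 0"
  and mollifier_test_function: "cball (y::real^'n) d \<subseteq> U ==> (\<lambda>x. mollifier d (x-y))\<in>test_functions U"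
proof -
 let ?c = "LINT z|lborel. flat 0 (d\<^sup>2-(norm (z::real^'n))\<^sup>2)"
 have c: "?c > 0" by (rule flat_bump_integral_pos[OF assms])
 have cl: "bump_class y d (\<lambda>x. mollifier d (x-y))" for y :: "real^'n"
 proof -
  have "bump_class y d (\<lambda>x. 1/?c*flat 0 (d\<^sup>2-(norm (x-y))\<^sup>2))"
   by (rule bump_class.base) auto
  then show ?thesis by (simp add: mollifier_def[abs_def])
 qed
 show "mollifier d x\<ge>0" using c by (auto simp: mollifier_def flat_def)
 show out: "norm x\<ge>d ==> mollifier d x = 0" for x :: "real^'n"
 proof -
  assume "d\<le>norm x"
  then have "d\<^sup>2\<le>(norm x)\<^sup>2" using assms by (intro power_mono) auto
  then have "\<not> 0 < d\<^sup>2-(norm x)\<^sup>2" by linarith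
  then show "mollifier d x = 0" by (simp only: mollifier_def flat_def if_False div_0)
 qed
 show "mollifier d (- x) = mollifier d x" by (simp add: mollifier_def)
 show "L1 (mollifier d :: real^'n => real)"
  unfolding mollifier_def[abs_def] using flat_bump_integrable[OF assms] by auto
 show "(LINT x|lborel. mollifier d (x::real^'n)) = 1"
  unfolding mollifier_def[abs_def] using c by simp
 have C: "C_k k (mollifier d :: real^'n => real)" for k
  using bump_class_C_k[OF cl[of 0], of k] by simp
 from C[of 0] show "continuous_on UNIV (mollifier d :: real^'n => real)" by simp
 from C[of 1] have df: "mollifier d differentiable (at x)" for x :: "real^'n" by simp
 from C[of 1] have "continuous_on UNIV (\<lambda>x. frechet_derivative (mollifier d) (at x) v)" for v :: "real^'n"
  by simp
 then show "continuous_on UNIV (grad (mollifier d) :: real^'n => real^'n)"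
  unfolding grad_def[abs_def] by (intro continuous_on_vec_lambda) auto
 show "(mollifier d has_derivative (\<lambda>h. grad (mollifier d) x\<bullet>h)) (at x)"
  by (rule grad_works[OF df])
 show "norm x > d ==> grad (mollifier d) x = 0"
 proof (rule grad_unique)
  assume "norm x > d"
  have "open {z::real^'n. norm z > d}" by (intro open_Collect_less continuous_intros)
  then have "\<forall>\<^sub>F z in nhds x. norm z > d"
   using \<open>norm x > d\<close> eventually_nhds_in_open[of "{z. norm z > d}" x] by auto
  then have "\<forall>\<^sub>F z in at x. 0 = mollifier d z"
   unfolding eventually_at_filter by eventually_elim (use out in auto)
  from has_derivative_transform_eventually[OF has_derivative_const this] 
  show "(mollifier d has_derivative (\<lambda>h. 0\<bullet>h)) (at x)"
   using out \<open>norm x > d\<close> by auto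
 qed
 show "(\<lambda>x. mollifier d (x-y))\<in>test_functions U" if "cball (y::real^'n) d \<subseteq> U"
 proof -
  have sub: "closure {x. mollifier d (x-y)\<noteq>0} \<subseteq> cball y d"
  proof (rule closure_minimal)
   show "{x. mollifier d (x-y)\<noteq>0} \<subseteq> cball y d"
   proof
    fix x assume "x\<in>{x. mollifier d (x-y)\<noteq>0}"
    then have "\<not> d\<le>norm (x-y)" using out[of "x-y"] by auto
    then show "x\<in>cball y d" by (simp add: dist_norm norm_minus_commute)
   qed
  qed auto
  then have "compact (closure {x. mollifier d (x-y)\<noteq>0})"
   using compact_cball compact_eq_bounded_closed bounded_subset closed_closure by metis
  then show ?thesis
   using sub that bump_class_C_k[OF cl] by (auto simp: test_functions_def)
 qed
qed

section \<open>Powers, translations and approximation of integrable functions\<close>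

lemma powr_sum_le:
 fixes a b r :: real
 assumes "a\<ge>0" "b\<ge>0" "r\<ge>0"
 shows "(a+b) powr r\<le>2 powr r*(a powr r+b powr r)"
proof -
 have "(a+b) powr r\<le>(2*max a b) powr r" using assms by (intro powr_mono2) auto
 also have "... = 2 powr r*max a b powr r" using assms by (simp add: powr_mult)
 also have "max a b powr r\<le>a powr r+b powr r" by (auto simp: max_def)
 finally show ?thesis by simp
qed

lemma le_one_plus_powr:
 fixes a r :: real assumes "a\<ge>0" "r\<ge>1" shows "a\<le>1+a powr r"
proof (cases "a\<le>1")
 case False
 then have "a powr 1\<le>a powr r" using assms by (intro powr_mono) auto
 then show ?thesis using assms by simp
qed (auto simp: add_increasing2)

text \<open>Convexity of \<open>a \<mapsto> a\<^sup>r\<close>: the graph lies above its tangent at \<open>c\<close>. Integrating it gives Jensen's inequality.\<close>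

lemma powr_ge_tangent:
 fixes a c r :: real
 assumes "a\<ge>0" "c > 0" "r\<ge>1"
 shows "c powr r+r * c powr (r-1)*(a-c)\<le>a powr r"
proof (cases "r = 1")
 case True then show ?thesis using assms by simp
next
 case False
 then have r: "r > 1" using assms by simp
 have "a * c powr (r-1)\<le>a powr r/r+(c powr (r-1)) powr (r/(r-1))/(r/(r-1))"
  using assms r by (intro Youngs_inequality) (auto simp: field_simps)
 also have "(c powr (r-1)) powr (r/(r-1)) = c powr r" using r by (simp add: powr_powr)
 finally have "r*(a * c powr (r-1))\<le>a powr r+(r-1) * c powr r"
  using r by (simp add: field_simps)
 moreover have "c powr (r-1) * c = c powr r"
  using assms by (simp add: powr_diff)
 ultimately show ?thesis by (simp add: algebra_simps)
qed

text \<open>Integrate the tangent inequality at \<open>c\<close> equal to the mean of \<open>F\<close> with weight \<open>w\<close>.\<close>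

lemma jensen_powr:
 fixes w F :: "'a => real"
 assumes [measurable]: "F\<in>borel_measurable M" and w: "integrable M w" "\<And>x. w x\<ge>0" "integral\<^sup>L M w = 1"
  and F: "\<And>x. F x\<ge>0" "integrable M (\<lambda>x. w x*F x powr r)" and r: "r\<ge>1"
 shows "integrable M (\<lambda>x. w x*F x)"
  and "(LINT x|M. w x*F x) powr r\<le>(LINT x|M. w x*F x powr r)"
proof -
 have [measurable]: "w\<in>borel_measurable M" using w by auto
 show int: "integrable M (\<lambda>x. w x*F x)"
 proof (rule Bochner_Integration.integrable_bound)
  show "integrable M (\<lambda>x. w x+w x*F x powr r)" using w F by auto
  show "AE x in M. norm (w x*F x)\<le>norm (w x+w x*F x powr r)"
  proof (rule AE_I2)
   fix x
   have "w x*F x\<le>w x*(1+F x powr r)"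
    by (intro mult_left_mono le_one_plus_powr F w r)
   then show "norm (w x*F x)\<le>norm (w x+w x*F x powr r)"
    using w F by (simp add: algebra_simps abs_mult)
  qed
 qed auto
 let ?c = "LINT x|M. w x*F x"
 have "?c\<ge>0" using w F by (intro Bochner_Integration.integral_nonneg) auto
 show "?c powr r\<le>(LINT x|M. w x*F x powr r)"
 proof (cases "?c = 0")
  case True
  then show ?thesis using w F r by (auto intro!: Bochner_Integration.integral_nonneg)
 next
  case False
  then have c: "?c > 0" using \<open>?c \<ge> 0\<close> by simp
  have "(LINT x|M. w x*(?c powr r-r*?c powr (r-1)*?c)+r*?c powr (r-1)*(w x*F x))
    \<le>(LINT x|M. w x*F x powr r)"
  proof (rule Bochner_Integration.integral_mono)
   show "w x*(?c powr r-r*?c powr (r-1)*?c)+r*?c powr (r-1)*(w x*F x)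
     \<le>w x*F x powr r" for x
    using mult_left_mono[OF powr_ge_tangent[OF F(1) c r] w(2), of x x] by (simp add: algebra_simps)
  qed (use w int F in auto)
  also have "(LINT x|M. w x*(?c powr r-r*?c powr (r-1)*?c)+r*?c powr (r-1)*(w x*F x))
    = ?c powr r"
   using w int by simp
  finally show ?thesis .
 qed
qed

lemma lborel_reflect: "distr lborel borel (\<lambda>x::'a::euclidean_space. a-x) = lborel"
 using lborel_affine[of "-1" a] by (simp add: density_1)

lemma nn_integral_translate:
 fixes f :: "'a::euclidean_space => ennreal"
 assumes [measurable]: "f\<in>Borel"
 shows "(\<integral>\<^sup>+x. f (x-a) \<partial>lborel) = (\<integral>\<^sup>+x. f x \<partial>lborel)"
 using lborel_distr_plus[of "-a"]
 by (subst (2) lborel_distr_plus[of "-a", symmetric], subst nn_integral_distr) auto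

lemma
 fixes f :: "'a::euclidean_space => 'b::{banach,second_countable_topology}"
 assumes [measurable]: "f\<in>Borel"
 shows integrable_reflect: "L1 (\<lambda>x. f (a-x)) \<longleftrightarrow> L1 f"
  and integral_reflect: "(LINT x|lborel. f (a-x)) = (LINT x|lborel. f x)"
  and integrable_translate: "L1 (\<lambda>x. f (x-a)) \<longleftrightarrow> L1 f"
  and integral_translate: "(LINT x|lborel. f (x-a)) = (LINT x|lborel. f x)"
proof -
 show "L1 (\<lambda>x. f (a-x)) \<longleftrightarrow> L1 f"
  by (subst (2) lborel_reflect[of a, symmetric], subst integrable_distr_eq) auto
 show "(LINT x|lborel. f (a-x)) = (LINT x|lborel. f x)"
  by (subst (2) lborel_reflect[of a, symmetric], subst integral_distr) auto
 show "L1 (\<lambda>x. f (x-a)) \<longleftrightarrow> L1 f"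
  by (subst (2) lborel_distr_plus[of "-a", symmetric], subst integrable_distr_eq) auto
 show "(LINT x|lborel. f (x-a)) = (LINT x|lborel. f x)"
  by (subst (2) lborel_distr_plus[of "-a", symmetric], subst integral_distr) auto
qed

lemma uniformly_continuous_vanishing:
 fixes g :: "'a::euclidean_space => 'b::real_normed_vector"
 assumes c: "continuous_on UNIV g" and z: "\<And>x. norm x > R ==> g x = 0"
 shows "uniformly_continuous_on UNIV g"
 unfolding uniformly_continuous_on_def
proof (intro allI impI)
 fix e :: real assume "e > 0"
 have "uniformly_continuous_on (cball 0 (R+1)) g"
  by (intro compact_uniformly_continuous continuous_on_subset[OF c]) auto
 then obtain d where d: "d > 0" "\<And>x y. x\<in>cball 0 (R+1) ==> y\<in>cball 0 (R+1) ==> dist y x < d ==> dist (g y) (g x) < e"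
  using \<open>e > 0\<close> unfolding uniformly_continuous_on_def by metis
 show "\<exists>d>0. \<forall>x\<in>UNIV. \<forall>x'\<in>UNIV. dist x' x < d --> dist (g x') (g x) < e"
 proof (intro exI[of _ "min d 1"] conjI ballI impI)
  fix x x' :: 'a assume *: "dist x' x < min d 1"
  show "dist (g x') (g x) < e"
  proof (cases "norm x\<le>R+1 \<and> norm x'\<le>R+1")
   case True then show ?thesis using d(2)[of x x'] * by auto
  next
   case False
   have "norm x'\<le>norm x+dist x' x" "norm x\<le>norm x'+dist x' x"
    by norm+
   then have "norm x > R" "norm x' > R" using False * by auto
   then show ?thesis using z \<open>e > 0\<close> by simp
  qed
 qed (use d in auto)
qed

text \<open>After truncating \<open>f\<close> to a bounded function supported in a ball (dominated convergence), continuous functions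
that converge to it almost everywhere may be truncated in the same way, and dominated convergence applies again.\<close>

lemma Lp_approx_continuous:
 fixes f :: "'a::euclidean_space => 'b::euclidean_space"
 assumes [measurable]: "f\<in>Borel"
  and int: "L1 (\<lambda>x. norm (f x) powr r)" and r: "r\<ge>1" and "e > 0"
 shows "\<exists>g R. continuous_on UNIV g \<and> (\<forall>x. norm x > R --> g x = 0) \<and>
  (\<integral>\<^sup>+x. ennreal (norm (f x-g x) powr r) \<partial>lborel) < ennreal e"
proof -
 define T where "T M v = (M/max M (norm v))*\<^sub>R v" for M :: real and v :: 'b
 define ph where "ph M x = max 0 (min 1 (M+1-norm x))" for M :: real and x :: 'a
 have nT: "norm (T M v)\<le>norm v" "norm (T M v)\<le>M" if "M > 0" for M v
  using that by (auto simp: T_def field_simps max_def mult_left_mono)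
 have ph: "0\<le>ph M x" "ph M x\<le>1" for M x by (auto simp: ph_def)
 have cT: "continuous_on UNIV (T M)" if "M > 0" for M
  unfolding T_def using that by (intro continuous_intros) (auto simp: max_def)
 have cph: "continuous_on UNIV (ph M)" for M
  unfolding ph_def by (intro continuous_intros)
 have [measurable]: "T M\<in>Borel" if "M > 0" for M
  using cT[OF that] by (rule borel_measurable_continuous_onI)
 have [measurable]: "ph M\<in>Borel" for M
  using cph by (rule borel_measurable_continuous_onI)
 define h where "h M x = ph M x*\<^sub>R T M (f x)" for M x
 have nh: "norm (h M x)\<le>norm (f x)" if "M > 0" for M x
  using mult_mono[OF ph(2) nT(1)[OF that]] ph by (auto simp: h_def)
 have "(\<lambda>n. LINT x|lborel. norm (f x-h (real (Suc n)) x) powr r) \<longlonglongrightarrow> (LINT x|(lborel::'a measure). 0)"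
 proof (rule integral_dominated_convergence)
  show "L1 (\<lambda>x. 2 powr r*(norm (f x) powr r+norm (f x) powr r))" using int by auto
  show "AE x in lborel. norm (norm (f x-h (real (Suc n)) x) powr r)
    \<le>2 powr r*(norm (f x) powr r+norm (f x) powr r)" for n
  proof (rule AE_I2)
   fix x
   have "norm (f x-h (real (Suc n)) x) powr r\<le>(norm (f x)+norm (f x)) powr r"
    using nh[of "real (Suc n)" x] r norm_triangle_ineq4[of "f x" "h (real (Suc n)) x"]
    by (intro powr_mono2) auto
   also have "\<dots>\<le>2 powr r*(norm (f x) powr r+norm (f x) powr r)"
    using r by (intro powr_sum_le) auto
   finally show "norm (norm (f x-h (real (Suc n)) x) powr r)
    \<le>2 powr r*(norm (f x) powr r+norm (f x) powr r)" by simp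
  qed
  show "AE x in lborel. (\<lambda>n. norm (f x-h (real (Suc n)) x) powr r) \<longlonglongrightarrow> 0"
  proof (rule AE_I2, rule tendsto_eventually)
   fix x
   obtain m where m: "real m > norm x" "real m > norm (f x)"
    by (metis gt_ex max_less_iff_conj reals_Archimedean2)
   show "\<forall>\<^sub>F n in sequentially. norm (f x-h (real (Suc n)) x) powr r = 0"
    using eventually_ge_at_top[of m]
   proof eventually_elim
    case (elim n)
    then have "ph (real (Suc n)) x = 1" "T (real (Suc n)) (f x) = f x"
     using m by (auto simp: ph_def T_def max_def)
    then show ?case by (simp add: h_def)
   qed
  qed
 qed (auto simp: h_def)
 then have "(\<lambda>n. LINT x|lborel. norm (f x-h (real (Suc n)) x) powr r) \<longlonglongrightarrow> 0" by simp
 then have "\<forall>\<^sub>F n in sequentially. (LINT x|lborel. norm (f x-h (real (Suc n)) x) powr r) < e/(4*2 powr r)"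
  using \<open>e > 0\<close> by (intro order_tendstoD(2)) auto
 then obtain n where n: "(LINT x|lborel. norm (f x-h (real (Suc n)) x) powr r) < e/(4*2 powr r)"
  using eventually_happens'[OF sequentially_bot] by blast
 define M where "M = real (Suc n)"
 have M: "M > 0" by (simp add: M_def)
 have intM: "L1 (\<lambda>x. norm (f x-h M x) powr r)"
 proof (rule Bochner_Integration.integrable_bound)
  show "L1 (\<lambda>x. 2 powr r*(norm (f x) powr r+norm (f x) powr r))" using int by auto
  show "AE x in lborel. norm (norm (f x-h M x) powr r)\<le>norm (2 powr r*(norm (f x) powr r+norm (f x) powr r))"
  proof (rule AE_I2)
   fix x
   have "norm (f x-h M x) powr r\<le>(norm (f x)+norm (f x)) powr r"
    using nh[OF M, of x] r norm_triangle_ineq4[of "f x" "h M x"] by (intro powr_mono2) auto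
   also have "\<dots>\<le>2 powr r*(norm (f x) powr r+norm (f x) powr r)"
    using r by (intro powr_sum_le) auto
   finally show "norm (norm (f x-h M x) powr r)\<le>norm (2 powr r*(norm (f x) powr r+norm (f x) powr r))" by simp
  qed
 qed (use M in \<open>auto simp: h_def\<close>)
 have "f measurable_on UNIV"
  by (subst measurable_on_iff_borel_measurable) (auto simp: lebesgue_on_UNIV_eq intro: measurable_completion)
 then obtain N g where N: "negligible N" and g: "\<And>k. continuous_on UNIV (g k)" 
  "\<And>x. x \<notin> N ==> (\<lambda>k. g k x) \<longlonglongrightarrow> f x"
  unfolding measurable_on_def by auto
 have [measurable]: "g k\<in>Borel" for k
  using g(1) by (rule borel_measurable_continuous_onI)
 have AEN: "AE x in lborel. x \<notin> N"
 proof -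
  have "N\<in>null_sets lebesgue" using N by (simp add: negligible_iff_null_sets)
  then have "AE x in lebesgue. x \<notin> N" by (rule AE_not_in)
  then show ?thesis by (simp add: AE_completion_iff)
 qed
 define G where "G k x = ph M x*\<^sub>R T M (g k x)" for k x
 have cG: "continuous_on UNIV (G k)" for k
  unfolding G_def
  by (intro continuous_intros cph continuous_on_compose2[OF cT[OF M] g(1)]) auto
 have zG: "G k x = 0" "h M x = 0" if "norm x > M+1" for k x using that by (simp_all add: G_def h_def ph_def)
 have bG: "norm (G k x)\<le>M" "norm (h M x)\<le>M" for k x
  using mult_mono[OF ph(2)[of M x] nT(2)[OF M, of "g k x"]] mult_mono[OF ph(2)[of M x] nT(2)[OF M, of "f x"]] ph(1)[of M x] M by (auto simp: G_def h_def)
 have "(\<lambda>k. LINT x|lborel. norm (h M x-G k x) powr r) \<longlonglongrightarrow> (LINT x|(lborel::'a measure). 0)"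
 proof (rule integral_dominated_convergence)
  have "L1 (\<lambda>x::'a. indicator (cball 0 (M+1)) x :: real)"
   using emeasure_lborel_cball_finite[of "0::'a" "M+1"] by (auto simp: integrable_indicator_iff less_top)
  then show "L1 (\<lambda>x::'a. (2*M) powr r*indicator (cball 0 (M+1)) x)" by auto
  show "AE x in lborel. norm (norm (h M x-G k x) powr r)\<le>(2*M) powr r*indicator (cball 0 (M+1)) x" for k
  proof (rule AE_I2)
   fix x
   show "norm (norm (h M x-G k x) powr r)\<le>(2*M) powr r*indicator (cball 0 (M+1)) x"
   proof (cases "norm x\<le>M+1")
    case True
    have "norm (h M x-G k x)\<le>2*M"
     using bG(1)[of k x] bG(2)[of x] norm_triangle_ineq4[of "h M x" "G k x"] by linarith
    then show ?thesis using True r by (auto intro!: powr_mono2)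
   qed (use zG r in auto)
  qed
  show "AE x in lborel. (\<lambda>k. norm (h M x-G k x) powr r) \<longlonglongrightarrow> 0"
   using AEN
  proof eventually_elim
   case (elim x)
   have "(\<lambda>k. T M (g k x)) \<longlonglongrightarrow> T M (f x)"
    using cT[OF M] isCont_tendsto_compose[of "f x" "T M", OF _ g(2)[OF elim]]
    by (simp add: continuous_on_eq_continuous_at)
   then have "(\<lambda>k. norm (h M x-G k x)) \<longlonglongrightarrow> norm (h M x-ph M x*\<^sub>R T M (f x))"
    unfolding G_def by (intro tendsto_intros)
   then have "(\<lambda>k. norm (h M x-G k x)) \<longlonglongrightarrow> 0" by (simp add: h_def)
   from tendsto_powr'[OF this tendsto_const, of r] show ?case using r by simp
  qed
 qed (use M in \<open>auto simp: h_def G_def\<close>)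
 then have "(\<lambda>k. LINT x|lborel. norm (h M x-G k x) powr r) \<longlonglongrightarrow> 0" by simp
 then have "\<forall>\<^sub>F k in sequentially. (LINT x|lborel. norm (h M x-G k x) powr r) < e/(4*2 powr r)"
  using \<open>e > 0\<close> by (intro order_tendstoD(2)) auto
 then obtain k where k: "(LINT x|lborel. norm (h M x-G k x) powr r) < e/(4*2 powr r)"
  using eventually_happens'[OF sequentially_bot] by blast
 have intG: "L1 (\<lambda>x. norm (h M x-G k x) powr r)"
 proof (rule Bochner_Integration.integrable_bound)
  have "L1 (\<lambda>x::'a. indicator (cball 0 (M+1)) x :: real)"
   using emeasure_lborel_cball_finite[of "0::'a" "M+1"] by (auto simp: integrable_indicator_iff less_top)
  then show "L1 (\<lambda>x::'a. (2*M) powr r*indicator (cball 0 (M+1)) x)" by auto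
  show "AE x in lborel. norm (norm (h M x-G k x) powr r)\<le>norm ((2*M) powr r*indicator (cball 0 (M+1)) x)"
  proof (rule AE_I2)
   fix x
   show "norm (norm (h M x-G k x) powr r)\<le>norm ((2*M) powr r*indicator (cball 0 (M+1)) x)"
   proof (cases "norm x\<le>M+1")
    case True
    have "norm (h M x-G k x)\<le>2*M"
     using bG(1)[of k x] bG(2)[of x] norm_triangle_ineq4[of "h M x" "G k x"] by linarith
    then show ?thesis using True r by (auto intro!: powr_mono2)
   qed (use zG r in auto)
  qed
 qed (use M in \<open>auto simp: h_def G_def\<close>)
 have "(\<integral>\<^sup>+x. ennreal (norm (f x-G k x) powr r) \<partial>lborel)
   \<le>(\<integral>\<^sup>+x. ennreal (2 powr r*(norm (f x-h M x) powr r+norm (h M x-G k x) powr r)) \<partial>lborel)"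
 proof (intro nn_integral_mono ennreal_leI)
  fix x
  have "norm (f x-G k x) powr r\<le>(norm (f x-h M x)+norm (h M x-G k x)) powr r"
   using r norm_triangle_ineq[of "f x-h M x" "h M x-G k x"] by (intro powr_mono2) auto
  also have "\<dots>\<le>2 powr r*(norm (f x-h M x) powr r+norm (h M x-G k x) powr r)"
   using r by (intro powr_sum_le) auto
  finally show "norm (f x-G k x) powr r\<le>2 powr r*(norm (f x-h M x) powr r+norm (h M x-G k x) powr r)" .
 qed
 also have "... = ennreal (LINT x|lborel. 2 powr r*(norm (f x-h M x) powr r+norm (h M x-G k x) powr r))"
  using intM intG by (intro nn_integral_eq_integral) auto
 also have "... < ennreal e"
 proof (rule ennreal_lessI)
  have "(LINT x|lborel. 2 powr r*(norm (f x-h M x) powr r+norm (h M x-G k x) powr r))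
    = 2 powr r*((LINT x|lborel. norm (f x-h M x) powr r)+(LINT x|lborel. norm (h M x-G k x) powr r))"
   using intM intG by simp
  also have "... < 2 powr r*(e/(4*2 powr r)+e/(4*2 powr r))"
   using n k unfolding M_def by (intro mult_strict_left_mono add_strict_mono) auto
  also have "... = e/2" by simp
  also have "... < e" using \<open>e > 0\<close> by simp
  finally show "(LINT x|lborel. 2 powr r*(norm (f x-h M x) powr r+norm (h M x-G k x) powr r)) < e" .
 qed (rule \<open>e > 0\<close>)
 finally show ?thesis using cG[of k] zG(1)[of _ k] by blast
qed

section \<open>Mollification in the space variable\<close>

text \<open>Only the space variable is smoothed: regularity in time must come from the equation.\<close>

definition mollify :: "real => ((real^'n)\<times>real => 'b::euclidean_space) => (real^'n)\<times>real => 'b" where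
 "mollify d f z = (LINT x|lborel. mollifier d (fst z-x)*\<^sub>R f (x, snd z))"

definition mollify_grad :: "real => ((real^'n)\<times>real => real) => (real^'n)\<times>real => real^'n" where
 "mollify_grad d f z = (LINT x|lborel. f (x, snd z)*\<^sub>R grad (mollifier d) (fst z-x))"

lemma mollifier_measurable [measurable]:
 "d > 0 ==> (mollifier d :: real^'n => real)\<in>Borel"
 by (rule borel_measurable_continuous_onI, rule mollifier_continuous)

lemma mollifier_grad_measurable [measurable]:
 "d > 0 ==> (grad (mollifier d) :: real^'n => real^'n)\<in>Borel"
 by (rule borel_measurable_continuous_onI, rule mollifier_grad_continuous)

lemma mollify_measurable [measurable]:
 assumes [measurable]: "f\<in>Borel" "d > 0"
 shows "mollify d f\<in>Borel"
proof -
 have [measurable]: "f\<in>borel_measurable (borel \<Otimes>\<^sub>M borel)" by (simp add: borel_prod)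
 have "(\<lambda>z. LINT x|lborel. mollifier d (fst z-x)*\<^sub>R f (x, snd z))\<in>borel_measurable (borel \<Otimes>\<^sub>M borel)"
  by measurable
 then show ?thesis by (simp add: mollify_def[abs_def] borel_prod)
qed

lemma mollify_grad_measurable [measurable]:
 assumes [measurable]: "f\<in>Borel" "d > 0"
 shows "mollify_grad d f\<in>Borel"
proof -
 have [measurable]: "f\<in>borel_measurable (borel \<Otimes>\<^sub>M borel)" by (simp add: borel_prod)
 have "(\<lambda>z. LINT x|lborel. f (x, snd z)*\<^sub>R grad (mollifier d) (fst z-x))\<in>borel_measurable (borel \<Otimes>\<^sub>M borel)"
  by measurable
 then show ?thesis by (simp add: mollify_grad_def[abs_def] borel_prod)
qed

lemma slice_measurable [measurable (raw)]:
 fixes f :: "'a::euclidean_space\<times>real => 'b::euclidean_space"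
 assumes "f\<in>Borel"
 shows "(\<lambda>x. f (x, t))\<in>Borel"
proof -
 have [measurable]: "f\<in>borel_measurable (borel \<Otimes>\<^sub>M borel)" using assms by (simp add: borel_prod)
 show ?thesis by measurable
qed

lemma mollify_eq:
 assumes [measurable]: "f\<in>Borel" and "d > 0"
 shows "mollify d f z = (LINT w|lborel. mollifier d w*\<^sub>R f (z-(w, 0)))"
proof -
 note [measurable] = mollifier_measurable[OF \<open>d > 0\<close>] slice_measurable[OF assms(1)]
 have "(LINT w|lborel. mollifier d w*\<^sub>R f (z-(w, 0))) = (LINT w|lborel. mollifier d w*\<^sub>R f (fst z-w, snd z))"
  by (cases z) simp
 also have "... = (LINT x|lborel. mollifier d (fst z-x)*\<^sub>R f (fst z-(fst z-x), snd z))"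
  by (rule integral_reflect[symmetric, where f = "\<lambda>w. mollifier d w*\<^sub>R f (fst z-w, snd z)"]) measurable
 finally show ?thesis by (simp add: mollify_def)
qed

lemma mollifier_prod_integrable:
 fixes f0 :: "real^'n => 'b::euclidean_space"
 assumes f0: "L1 f0" and g: "continuous_on UNIV (g :: real^'n => real)" "\<And>x. norm x > R ==> g x = 0"
 shows "L1 (\<lambda>x. g (y-x)*\<^sub>R f0 x)"
proof -
 have [measurable]: "f0\<in>Borel" using f0 by auto
 have [measurable]: "g\<in>Borel" using g(1) by (rule borel_measurable_continuous_onI)
 have "compact (g ` cball 0 R)"
  by (intro compact_continuous_image continuous_on_subset[OF g(1)]) auto
 then obtain B where B: "\<And>x. x\<in>cball 0 R ==> norm (g x)\<le>B"
  using bounded_iff compact_imp_bounded by (metis imageI)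
 have B': "norm (g x)\<le>max B 0" for x using B[of x] g(2)[of x] by (cases "norm x\<le>R") auto
 show ?thesis
 proof (rule Bochner_Integration.integrable_bound)
  show "L1 (\<lambda>x. max B 0*norm (f0 x))" using f0 by auto
  show "AE x in lborel. norm (g (y-x)*\<^sub>R f0 x)\<le>norm (max B 0*norm (f0 x))"
   using B' by (intro AE_I2) (auto intro!: mult_right_mono simp: abs_mult)
 qed auto
qed

lemma mollify_diff_AE:
 fixes f g :: "(real^'n)\<times>real => 'b::euclidean_space"
 assumes f: "L1 f" and g: "L1 g" and d: "d > 0"
 shows "AE z in lborel. mollify d (\<lambda>z. f z-g z) z = mollify d f z-mollify d g z"
proof -
 have [measurable]: "f\<in>Borel" "g\<in>Borel" using f g by auto
 note [measurable] = mollifier_measurable[OF d] mollify_measurable[OF _ d]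
 have "AE t in lborel. L1 (\<lambda>x. f (x, t))" "AE t in lborel. L1 (\<lambda>x. g (x, t))"
  using f g lborel_pair.AE_integrable_snd[of "\<lambda>x y. f (x,y)"] lborel_pair.AE_integrable_snd[of "\<lambda>x y. g (x,y)"]
  by (auto simp: lborel_prod)
 then have "AE t in lborel. \<forall>y. mollify d (\<lambda>z. f z-g z) (y, t) = mollify d f (y, t)-mollify d g (y, t)"
 proof eventually_elim
  case (elim t)
  show ?case
  proof
   fix y
   have out: "norm x > d ==> mollifier d x = 0" for x :: "real^'n"
    using mollifier_outside[OF d, of x] by simp
   have "L1 (\<lambda>x. mollifier d (y-x)*\<^sub>R f (x, t))"
    by (rule mollifier_prod_integrable[OF elim(1) mollifier_continuous[OF d] out])
   moreover have "L1 (\<lambda>x. mollifier d (y-x)*\<^sub>R g (x, t))"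
    by (rule mollifier_prod_integrable[OF elim(2) mollifier_continuous[OF d] out])
   ultimately show "mollify d (\<lambda>z. f z-g z) (y, t) = mollify d f (y, t)-mollify d g (y, t)"
    by (simp add: mollify_def scaleR_diff_right)
  qed
 qed
 then have *: "AE t in lborel. AE y in lborel. mollify d (\<lambda>z. f z-g z) (y, t) = mollify d f (y, t)-mollify d g (y, t)"
  by eventually_elim auto
 have S: "{z. mollify d (\<lambda>z. f z-g z) z = mollify d f z-mollify d g z}\<in>sets borel"
  by measurable
 have S': "{z. mollify d (\<lambda>z. f z-g z) z = mollify d f z-mollify d g z}\<in>sets (borel \<Otimes>\<^sub>M borel)"
  using S unfolding borel_prod .
 have "AE y in lborel. AE t in lborel. mollify d (\<lambda>z. f z-g z) (y, t) = mollify d f (y, t)-mollify d g (y, t)"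
  by (subst lborel_pair.AE_commute) (use S' * in \<open>auto simp: space_pair_measure\<close>)
 moreover have "{z\<in>space (lborel \<Otimes>\<^sub>M lborel). mollify d (\<lambda>z. f z-g z) z = mollify d f z-mollify d g z}
   \<in>sets (lborel \<Otimes>\<^sub>M lborel)"
  using S unfolding lborel_prod by simp
 ultimately show ?thesis
  using lborel_pair.AE_pair_measure[where P = "\<lambda>z. mollify d (\<lambda>z. f z-g z) z = mollify d f z-mollify d g z"]
  unfolding lborel_prod by blast
qed

text \<open>Jensen's inequality with the mollifier as weight, then Tonelli and translation invariance.\<close>

lemma nn_integral_mollify_powr_le:
 fixes f :: "(real^'n)\<times>real => 'b::euclidean_space"
 assumes [measurable]: "f\<in>Borel" and d: "d > 0" and r: "r\<ge>1"
 shows "(\<integral>\<^sup>+z. ennreal (norm (mollify d f z) powr r) \<partial>lborel)\<le>(\<integral>\<^sup>+z. ennreal (norm (f z) powr r) \<partial>lborel)"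
proof -
 note [measurable] = mollifier_measurable[OF d]
 have ms: "(\<lambda>w. f (z-(w, 0)))\<in>Borel" for z :: "(real^'n)\<times>real"
 proof -
  have [measurable]: "(\<lambda>w::real^'n. z-(w, 0::real))\<in>Borel"
   by (intro borel_measurable_continuous_onI continuous_intros)
  show ?thesis by measurable
 qed
 have pt: "ennreal (norm (mollify d f z) powr r)\<le>(\<integral>\<^sup>+w. ennreal (mollifier d w*norm (f (z-(w, 0))) powr r) \<partial>lborel)" for z
 proof (cases "(\<integral>\<^sup>+w. ennreal (mollifier d w*norm (f (z-(w, 0))) powr r) \<partial>lborel) = \<infinity>")
  case False
  note [measurable] = ms[of z]
  have int: "L1 (\<lambda>w. mollifier d w*norm (f (z-(w, 0))) powr r)"
   using False by (intro integrableI_nonneg AE_I2 mult_nonneg_nonneg mollifier_nonneg[OF d]) (auto simp: less_top)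
  have "norm (mollify d f z)\<le>(LINT w|lborel. mollifier d w*norm (f (z-(w, 0))))"
   unfolding mollify_eq[OF assms(1) d]
   by (rule order_trans[OF integral_norm_bound]) (simp add: mollifier_nonneg[OF d])
  then have "norm (mollify d f z) powr r\<le>(LINT w|lborel. mollifier d w*norm (f (z-(w, 0)))) powr r"
   using r by (intro powr_mono2) auto
  also have "\<dots>\<le>(LINT w|lborel. mollifier d w*norm (f (z-(w, 0))) powr r)"
   by (rule jensen_powr) (use int r mollifier_nonneg[OF d] mollifier_integral[OF d] mollifier_integrable[OF d] in auto)
  finally show ?thesis
   by (subst nn_integral_eq_integral[OF int])
    (auto intro!: ennreal_leI AE_I2 mult_nonneg_nonneg mollifier_nonneg[OF d])
 qed simp
 have m2: "(\<lambda>(z, w). f (z-(w, 0)))\<in>borel_measurable (borel \<Otimes>\<^sub>M borel)"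
 proof -
  have "(\<lambda>p::((real^'n)\<times>real)\<times>(real^'n). fst p-(snd p, 0::real))\<in>Borel"
   by (intro borel_measurable_continuous_onI continuous_intros)
  then have [measurable]: "(\<lambda>p::((real^'n)\<times>real)\<times>(real^'n). fst p-(snd p, 0::real))\<in>borel_measurable (borel \<Otimes>\<^sub>M borel)"
   by (simp add: borel_prod)
  have "(\<lambda>p. f (fst p-(snd p, 0)))\<in>borel_measurable (borel \<Otimes>\<^sub>M borel)"
   by measurable
  then show ?thesis by (simp add: case_prod_beta')
 qed
 note [measurable] = m2
 have "(\<integral>\<^sup>+z. ennreal (norm (mollify d f z) powr r) \<partial>lborel)
   \<le>(\<integral>\<^sup>+z. \<integral>\<^sup>+w. ennreal (mollifier d w*norm (f (z-(w, 0))) powr r) \<partial>lborel \<partial>lborel)"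
  by (intro nn_integral_mono pt)
 also have "... = (\<integral>\<^sup>+w. \<integral>\<^sup>+z. ennreal (mollifier d w*norm (f (z-(w, 0))) powr r) \<partial>lborel \<partial>lborel)"
  by (rule lborel_pair.Fubini') measurable
 also have "... = (\<integral>\<^sup>+w. ennreal (mollifier d (w::real^'n))*(\<integral>\<^sup>+z. ennreal (norm (f z) powr r) \<partial>lborel) \<partial>lborel)"
 proof (rule nn_integral_cong)
  fix w :: "real^'n"
  have "(\<integral>\<^sup>+z. ennreal (mollifier d w*norm (f (z-(w, 0))) powr r) \<partial>lborel)
    = (\<integral>\<^sup>+z. ennreal (mollifier d w)*ennreal (norm (f (z-(w, 0))) powr r) \<partial>lborel)"
   by (simp add: ennreal_mult mollifier_nonneg[OF d])
  also have "... = ennreal (mollifier d w)*(\<integral>\<^sup>+z. ennreal (norm (f (z-(w, 0))) powr r) \<partial>lborel)"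
   by (rule nn_integral_cmult) measurable
  also have "(\<integral>\<^sup>+z. ennreal (norm (f (z-(w, 0))) powr r) \<partial>lborel) = (\<integral>\<^sup>+z. ennreal (norm (f z) powr r) \<partial>lborel)"
   by (rule nn_integral_translate) measurable
  finally show "(\<integral>\<^sup>+z. ennreal (mollifier d w*norm (f (z-(w, 0))) powr r) \<partial>lborel)
   = ennreal (mollifier d w)*(\<integral>\<^sup>+z. ennreal (norm (f z) powr r) \<partial>lborel)" .
 qed
 also have "... = (\<integral>\<^sup>+w. ennreal (mollifier d (w::real^'n)) \<partial>lborel)*(\<integral>\<^sup>+z. ennreal (norm (f z) powr r) \<partial>lborel)"
  by (rule nn_integral_multc) measurable
 also have "(\<integral>\<^sup>+w. ennreal (mollifier d (w::real^'n)) \<partial>lborel) = 1"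
  using mollifier_nonneg[OF d] mollifier_integral[OF d, where 'n = 'n] mollifier_integrable[OF d]
  by (subst nn_integral_eq_integral) auto
 finally show ?thesis by simp
qed

text \<open>A continuous function of compact support is uniformly continuous, and the error is supported in a fixed compact set.\<close>

lemma mollify_continuous_approx:
 fixes g :: "(real^'n)\<times>real => 'b::euclidean_space"
 assumes g: "continuous_on UNIV g" "\<And>x. norm x > R ==> g x = 0" and r: "r\<ge>1" and e: "e > 0"
 shows "\<exists>d0>0. \<forall>d. 0 < d \<and> d < d0 --> (\<integral>\<^sup>+z. ennreal (norm (mollify d g z-g z) powr r) \<partial>lborel)\<le>ennreal e"
proof -
 have [measurable]: "g\<in>Borel" using g(1) by (rule borel_measurable_continuous_onI)
 define V where "V = measure lborel (cball (0::(real^'n)\<times>real) (\<bar>R\<bar>+1))"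
 have V: "V\<ge>0" "emeasure lborel (cball (0::(real^'n)\<times>real) (\<bar>R\<bar>+1)) = ennreal V"
  unfolding V_def using emeasure_lborel_cball_finite[of "0::(real^'n)\<times>real" "\<bar>R\<bar>+1"]
  by (auto simp: emeasure_eq_ennreal_measure less_top)
 define h where "h = (e/(V+1)) powr (1/r)"
 have h: "h > 0" "h powr r = e/(V+1)" using e V r by (auto simp: h_def powr_powr)
 have "uniformly_continuous_on UNIV g" by (rule uniformly_continuous_vanishing[OF g])
 then obtain d0 where d0: "d0 > 0" "\<And>x y. dist y x < d0 ==> dist (g y) (g x) < h"
  using h(1) unfolding uniformly_continuous_on_def by blast
 show ?thesis
 proof (intro exI[of _ "min d0 1"] conjI allI impI)
  fix d :: real assume "0 < d \<and> d < min d0 1"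
  then have d: "0 < d" "d < d0" "d < 1" by auto
  note [measurable] = mollifier_measurable[OF d(1)]
  have *: "norm (mollify d g z-g z)\<le>h*indicator (cball 0 (\<bar>R\<bar>+1)) z" for z
  proof -
   have [measurable]: "(\<lambda>w. g (z-(w, 0)))\<in>Borel"
    by (intro borel_measurable_continuous_onI continuous_intros continuous_on_compose2[OF g(1)]) auto
   let ?k = "h*indicator (cball 0 (\<bar>R\<bar>+1)) z :: real"
   have bd: "mollifier d w*norm (g (z-(w, 0))-g z)\<le>mollifier d w*?k" for w
   proof (cases "norm w < d")
    case True
    have nw: "norm (w, 0::real) = norm w" by (simp add: norm_Pair)
    then have "dist (z-(w, 0)) z < d0" using True d by (simp add: dist_norm norm_minus_commute)
    from d0(2)[OF this] have 1: "norm (g (z-(w, 0))-g z)\<le>h" by (simp add: dist_norm)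
    have "norm (g (z-(w, 0))-g z)\<le>?k"
    proof (cases "norm z\<le>\<bar>R\<bar>+1")
     case False
     have "norm z\<le>norm (z-(w, 0))+norm (w, 0::real)"
      using norm_triangle_ineq[of "z-(w, 0)" "(w, 0)"] by simp
     then have "norm (z-(w, 0)) > R" "norm z > R" using False True d nw by linarith+
     then show ?thesis using g(2) h by (simp add: indicator_def)
    qed (use 1 in simp)
    then show ?thesis by (intro mult_left_mono mollifier_nonneg[OF d(1)])
   qed (use mollifier_outside[OF d(1), of w] in simp)
   have intg: "L1 (\<lambda>w. mollifier d w*\<^sub>R (g (z-(w, 0))-g z))"
   proof (rule Bochner_Integration.integrable_bound)
    show "L1 (\<lambda>w::real^'n. mollifier d w*?k)" using mollifier_integrable[OF d(1)] by auto
    show "AE w in lborel. norm (mollifier d w*\<^sub>R (g (z-(w, 0))-g z))\<le>norm (mollifier d w*?k)"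
     using bd mollifier_nonneg[OF d(1), where 'n = 'n] h by (intro AE_I2) (auto simp: abs_mult)
   qed measurable
   have int0: "L1 (\<lambda>w::real^'n. mollifier d w*\<^sub>R g z)" using mollifier_integrable[OF d(1)] by auto
   have "L1 (\<lambda>w. mollifier d w*\<^sub>R (g (z-(w, 0))-g z)+mollifier d w*\<^sub>R g z)"
    using intg int0 by (rule Bochner_Integration.integrable_add)
   then have int1: "L1 (\<lambda>w. mollifier d w*\<^sub>R g (z-(w, 0)))"
    by (simp add: scaleR_diff_right)
   have "(LINT w|lborel. mollifier d (w::real^'n)*\<^sub>R g z) = g z"
    using mollifier_integral[OF d(1), where 'n = 'n] mollifier_integrable[OF d(1), where 'n = 'n] by simp
   then have "mollify d g z-g z = (LINT w|lborel. mollifier d w*\<^sub>R (g (z-(w, 0))-g z))"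
    unfolding mollify_eq[OF \<open>g \<in> borel_measurable borel\<close> d(1)] scaleR_diff_right
    using int1 int0 by simp
   also have "norm \<dots>\<le>(LINT w|lborel. norm (mollifier d w*\<^sub>R (g (z-(w, 0))-g z)))"
    by (rule integral_norm_bound)
   also have "\<dots>\<le>(LINT w|lborel. mollifier d (w::real^'n)*?k)"
    using mollifier_integrable[OF d(1), where 'n = 'n] bd
    by (intro Bochner_Integration.integral_mono integrable_norm[OF intg])
     (auto simp: mollifier_nonneg[OF d(1)])
   also have "... = ?k"
    using mollifier_integral[OF d(1), where 'n = 'n] by simp
   finally show ?thesis .
  qed
  have "(\<integral>\<^sup>+z. ennreal (norm (mollify d g z-g z) powr r) \<partial>lborel)
   \<le>(\<integral>\<^sup>+z. ennreal (h powr r)*indicator (cball (0::(real^'n)\<times>real) (\<bar>R\<bar>+1)) z \<partial>lborel)"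
  proof (rule nn_integral_mono)
   fix z
   have "norm (mollify d g z-g z) powr r\<le>(h*indicator (cball 0 (\<bar>R\<bar>+1)) z) powr r"
    using *[of z] r by (intro powr_mono2) auto
   then show "ennreal (norm (mollify d g z-g z) powr r)\<le>ennreal (h powr r)*indicator (cball 0 (\<bar>R\<bar>+1)) z"
    using r by (cases "z\<in>cball 0 (\<bar>R\<bar>+1)") (auto intro!: ennreal_leI)
  qed
  also have "... = ennreal (h powr r)*ennreal V" by (subst nn_integral_cmult_indicator) (auto simp: V)
  also have "... = ennreal (e*V/(V+1))" using V h e by (simp add: ennreal_mult[symmetric])
  also have "\<dots>\<le>ennreal e" using V e by (intro ennreal_leI) (simp add: field_simps)
  finally show "(\<integral>\<^sup>+z. ennreal (norm (mollify d g z-g z) powr r) \<partial>lborel)\<le>ennreal e" .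
 qed (use d0 in auto)
qed

text \<open>Mollification contracts the norm of \<open>L\<^sup>r\<close>, so convergence passes from continuous functions to their closure.\<close>

lemma mollify_Lp_tendsto:
 fixes f :: "(real^'n)\<times>real => 'b::euclidean_space"
 assumes int1: "L1 f" and int: "L1 (\<lambda>z. norm (f z) powr r)"
  and r: "r\<ge>1" and e: "e > 0"
 shows "\<exists>d0>0. \<forall>d. 0 < d \<and> d < d0 --> (\<integral>\<^sup>+z. ennreal (norm (mollify d f z-f z) powr r) \<partial>lborel)\<le>ennreal e"
proof -
 have fm [measurable]: "f\<in>Borel" using int1 by auto
 define c where "c = (2::real) powr r"
 have c: "c > 0" by (simp add: c_def)
 define e' where "e' = e/(2 * c + c * c + c * c)"
 have e': "e' > 0" using e c by (simp add: e'_def add_pos_pos)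
 obtain g R where g: "continuous_on UNIV g" "\<And>x. norm x > R ==> g x = 0"
  and fg: "(\<integral>\<^sup>+x. ennreal (norm (f x-g x) powr r) \<partial>lborel) < ennreal e'"
  using Lp_approx_continuous[OF fm int r e'] by blast
 obtain d0 where d0: "d0 > 0" "\<And>d. 0 < d ==> d < d0 \<Longrightarrow>
   (\<integral>\<^sup>+z. ennreal (norm (mollify d g z-g z) powr r) \<partial>lborel)\<le>ennreal e'"
  using mollify_continuous_approx[OF g r e'] by blast
 have gm [measurable]: "g\<in>Borel" using g(1) by (rule borel_measurable_continuous_onI)
 have intg: "L1 g"
 proof -
  have "L1 (\<lambda>x. indicator (cball 0 R) x*\<^sub>R g x)"
   by (rule borel_integrable_compact) (auto intro: continuous_on_subset[OF g(1)])
  moreover have "indicator (cball 0 R) x*\<^sub>R g x = g x" for x using g(2)[of x] by (auto simp: indicator_def)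
  ultimately show ?thesis by simp
 qed
 show ?thesis
 proof (intro exI[of _ d0] conjI allI impI d0)
  fix d assume "0 < d \<and> d < d0"
  then have d: "0 < d" "d < d0" by auto
  note [measurable] = mollify_measurable[OF fm d(1)] mollify_measurable[OF gm d(1)]
   mollify_measurable[OF borel_measurable_diff[OF fm gm] d(1)]
  let ?A = "\<lambda>z. norm (mollify d (\<lambda>z. f z-g z) z) powr r"
  let ?B = "\<lambda>z. norm (mollify d g z-g z) powr r"
  let ?C = "\<lambda>z. norm (f z-g z) powr r"
  have "(\<integral>\<^sup>+z. ennreal (norm (mollify d f z-f z) powr r) \<partial>lborel)
   \<le>(\<integral>\<^sup>+z. ennreal c*ennreal (?A z)+ennreal (c * c)*ennreal (?B z)+ennreal (c * c)*ennreal (?C z) \<partial>lborel)"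
  proof (rule nn_integral_mono_AE)
   show "AE z in lborel. ennreal (norm (mollify d f z-f z) powr r) \<le>
     ennreal c*ennreal (?A z)+ennreal (c * c)*ennreal (?B z)+ennreal (c * c)*ennreal (?C z)"
    using mollify_diff_AE[OF int1 intg d(1)]
   proof eventually_elim
    case (elim z)
    have "norm (mollify d f z-f z)\<le>norm (mollify d (\<lambda>z. f z-g z) z)+(norm (mollify d g z-g z)+norm (f z-g z))"
     unfolding elim by norm
    then have "norm (mollify d f z-f z) powr r\<le>(norm (mollify d (\<lambda>z. f z-g z) z)+(norm (mollify d g z-g z)+norm (f z-g z))) powr r"
     using r by (intro powr_mono2) auto
    also have "\<dots>\<le>c*(?A z+(norm (mollify d g z-g z)+norm (f z-g z)) powr r)"
     unfolding c_def using r by (intro powr_sum_le) auto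
    also have "\<dots>\<le>c*(?A z + c*(?B z+?C z))"
    proof -
     have "(norm (mollify d g z-g z)+norm (f z-g z)) powr r\<le>c*(?B z+?C z)"
      unfolding c_def using r by (intro powr_sum_le) auto
     then show ?thesis using c by (intro mult_left_mono add_left_mono) auto
    qed
    also have "... = c*?A z + c * c*?B z + c * c*?C z" by (simp add: algebra_simps)
    finally show ?case using c by (simp add: ennreal_mult[symmetric] ennreal_plus[symmetric] del: ennreal_plus)
   qed
  qed
  also have "... = ennreal c*(\<integral>\<^sup>+z. ennreal (?A z) \<partial>lborel)+ennreal (c * c)*(\<integral>\<^sup>+z. ennreal (?B z) \<partial>lborel)
    + ennreal (c * c)*(\<integral>\<^sup>+z. ennreal (?C z) \<partial>lborel)"
   by (simp add: nn_integral_add nn_integral_cmult)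
  also have "\<dots>\<le>ennreal c*ennreal e'+ennreal (c * c)*ennreal e'+ennreal (c * c)*ennreal e'"
  proof (intro add_mono mult_left_mono)
   show "(\<integral>\<^sup>+z. ennreal (?A z) \<partial>lborel)\<le>ennreal e'"
    using nn_integral_mollify_powr_le[OF borel_measurable_diff[OF fm gm] d(1) r] fg by simp
  qed (use d0(2)[OF d] fg in auto)
  also have "... = ennreal ((c + c * c + c * c)*e')"
   using c e' by (simp add: ennreal_mult[symmetric] ennreal_plus[symmetric] algebra_simps del: ennreal_plus)
  also have "\<dots>\<le>ennreal e"
  proof (rule ennreal_leI)
   have "(c + c * c + c * c)*e'\<le>(2 * c + c * c + c * c)*e'" using c e' by (intro mult_right_mono) auto
   also have "... = e" using c by (simp add: e'_def add_pos_pos less_imp_neq[symmetric])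
   finally show "(c + c * c + c * c)*e'\<le>e" .
  qed
  finally show "(\<integral>\<^sup>+z. ennreal (norm (mollify d f z-f z) powr r) \<partial>lborel)\<le>ennreal e" .
 qed
qed

text \<open>Choosing the errors of the \<open>j\<close>-th mollification at most \<open>2\<^sup>-\<^sup>j\<close> makes their sum integrable. This gives both convergence
almost everywhere and one integrable majorant \<open>H\<close>, so that later limits need only dominated convergence.\<close>

lemma good_mollifying_sequence:
 fixes u :: "(real^'n)\<times>real => real" and D A :: "(real^'n)\<times>real => real^'n"
 assumes u: "L1 u" "L1 (\<lambda>z. norm (u z) powr p)"
  and D: "L1 D" "L1 (\<lambda>z. norm (D z) powr p)"
  and A: "L1 A" "L1 (\<lambda>z. norm (A z) powr q)"
  and pq: "p\<ge>1" "q\<ge>1" and d0: "d0 > 0"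
 obtains d :: "nat => real" and H :: "(real^'n)\<times>real => real" where
  "\<And>j. 0 < d j" "\<And>j. d j < d0" "H\<in>Borel" "L1 H" "\<And>z. H z\<ge>0"
  "AE z in lborel. (\<lambda>j. mollify (d j) u z) \<longlonglongrightarrow> u z"
  "AE z in lborel. (\<lambda>j. mollify (d j) D z) \<longlonglongrightarrow> D z"
  "AE z in lborel. (\<lambda>j. mollify (d j) A z) \<longlonglongrightarrow> A z"
  "AE z in lborel. \<forall>j. norm (mollify (d j) u z) powr p\<le>H z \<and> norm (mollify (d j) D z) powr p\<le>H z
    \<and> norm (mollify (d j) A z) powr q\<le>H z"
proof -
 define Q where "Q j = (1/2::real)^j" for j
 have Q: "Q j > 0" for j by (simp add: Q_def)
 have "\<exists>d. 0 < d \<and> d < d0 \<and> (\<integral>\<^sup>+z. ennreal (norm (mollify d u z-u z) powr p) \<partial>lborel)\<le>ennreal (Q j)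
   \<and> (\<integral>\<^sup>+z. ennreal (norm (mollify d D z-D z) powr p) \<partial>lborel)\<le>ennreal (Q j)
   \<and> (\<integral>\<^sup>+z. ennreal (norm (mollify d A z-A z) powr q) \<partial>lborel)\<le>ennreal (Q j)" for j
 proof -
  obtain a where a: "a > 0" "\<And>d. 0 < d \<and> d < a ==> (\<integral>\<^sup>+z. ennreal (norm (mollify d u z-u z) powr p) \<partial>lborel)\<le>ennreal (Q j)"
   using mollify_Lp_tendsto[OF u pq(1) Q] by blast
  obtain b where b: "b > 0" "\<And>d. 0 < d \<and> d < b ==> (\<integral>\<^sup>+z. ennreal (norm (mollify d D z-D z) powr p) \<partial>lborel)\<le>ennreal (Q j)"
   using mollify_Lp_tendsto[OF D pq(1) Q] by blast
  obtain c where c: "c > 0" "\<And>d. 0 < d \<and> d < c ==> (\<integral>\<^sup>+z. ennreal (norm (mollify d A z-A z) powr q) \<partial>lborel)\<le>ennreal (Q j)"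
   using mollify_Lp_tendsto[OF A pq(2) Q] by blast
  \<comment> \<open>One mollification parameter has to serve all three functions.\<close>
  define d where "d = min (min a b) (min c d0)/2"
  have "0 < d" "d < a" "d < b" "d < c" "d < d0" using a(1) b(1) c(1) d0 by (auto simp: d_def)
  then show ?thesis using a(2)[of d] b(2)[of d] c(2)[of d] by blast
 qed
 then have "\<forall>j. \<exists>d. 0 < d \<and> d < d0 \<and> (\<integral>\<^sup>+z. ennreal (norm (mollify d u z-u z) powr p) \<partial>lborel)\<le>ennreal (Q j)
   \<and> (\<integral>\<^sup>+z. ennreal (norm (mollify d D z-D z) powr p) \<partial>lborel)\<le>ennreal (Q j)
   \<and> (\<integral>\<^sup>+z. ennreal (norm (mollify d A z-A z) powr q) \<partial>lborel)\<le>ennreal (Q j)" by blast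
 from choice[OF this] obtain d where d: "\<And>j. 0 < d j" "\<And>j. d j < d0"
  and du: "\<And>j. (\<integral>\<^sup>+z. ennreal (norm (mollify (d j) u z-u z) powr p) \<partial>lborel)\<le>ennreal (Q j)"
  and dD: "\<And>j. (\<integral>\<^sup>+z. ennreal (norm (mollify (d j) D z-D z) powr p) \<partial>lborel)\<le>ennreal (Q j)"
  and dA: "\<And>j. (\<integral>\<^sup>+z. ennreal (norm (mollify (d j) A z-A z) powr q) \<partial>lborel)\<le>ennreal (Q j)"
  by blast
 have ms [measurable]: "u\<in>Borel" "D\<in>Borel" "A\<in>Borel"
  using u(1) D(1) A(1) by auto
 note [measurable] = mollify_measurable[OF ms(1) d(1)] mollify_measurable[OF ms(2) d(1)] mollify_measurable[OF ms(3) d(1)]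
 define E where "E j z = ennreal (norm (mollify (d j) u z-u z) powr p)+ennreal (norm (mollify (d j) D z-D z) powr p)
   + ennreal (norm (mollify (d j) A z-A z) powr q)" for j z
 have [measurable]: "E j\<in>Borel" for j unfolding E_def by measurable
 define S where "S z = (\<Sum>j. E j z)" for z
 have [measurable]: "S\<in>Borel" unfolding S_def by measurable
 have "(\<integral>\<^sup>+z. S z \<partial>lborel) = (\<Sum>j. \<integral>\<^sup>+z. E j z \<partial>lborel)"
  unfolding S_def by (intro nn_integral_suminf) measurable
 also have "\<dots>\<le>(\<Sum>j. ennreal (3*Q j))"
 proof (intro suminf_le allI)
  fix j
  have "(\<integral>\<^sup>+z. E j z \<partial>lborel) = (\<integral>\<^sup>+z. ennreal (norm (mollify (d j) u z-u z) powr p) \<partial>lborel)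
    + (\<integral>\<^sup>+z. ennreal (norm (mollify (d j) D z-D z) powr p) \<partial>lborel)+(\<integral>\<^sup>+z. ennreal (norm (mollify (d j) A z-A z) powr q) \<partial>lborel)"
   unfolding E_def by (simp add: nn_integral_add)
  also have "\<dots>\<le>ennreal (Q j)+ennreal (Q j)+ennreal (Q j)"
   by (intro add_mono du dD dA)
  also have "... = ennreal (3*Q j)" using Q[of j] by (simp add: ennreal_plus[symmetric] del: ennreal_plus)
  finally show "(\<integral>\<^sup>+z. E j z \<partial>lborel)\<le>ennreal (3*Q j)" .
 qed auto
 also have "... = ennreal (\<Sum>j. 3*Q j)"
  using Q by (intro suminf_ennreal2) (auto simp: Q_def less_imp_le intro!: summable_mult summable_geometric)
 finally have Sfin: "(\<integral>\<^sup>+z. S z \<partial>lborel) < \<infinity>" by (simp add: le_less_trans)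
 then have ae: "AE z in lborel. S z\<noteq>\<infinity>" by (intro nn_integral_PInf_AE) auto
 define c where "c = max (2 powr p) ((2::real) powr q)"
 define H where "H z = c*(enn2real (S z)+norm (u z) powr p+norm (D z) powr p+norm (A z) powr q)" for z
 have c: "c > 0" by (simp add: c_def less_max_iff_disj)
 have intS: "L1 (\<lambda>z. enn2real (S z))"
 proof (rule integrableI_nonneg)
  have "(\<integral>\<^sup>+z. ennreal (enn2real (S z)) \<partial>lborel)\<le>(\<integral>\<^sup>+z. S z \<partial>lborel)"
   by (intro nn_integral_mono) (simp add: ennreal_enn2real_if)
  then show "(\<integral>\<^sup>+z. ennreal (enn2real (S z)) \<partial>lborel) < \<infinity>" using Sfin by (rule le_less_trans)
 qed auto
 have le: "E j z\<le>S z" for j z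
  unfolding S_def using sum_le_suminf[of "\<lambda>j. E j z" "{j}"] by simp
 show thesis
 proof (rule that[of d H])
  show "H\<in>Borel" unfolding H_def by measurable
  show "L1 H" unfolding H_def using intS u D A by auto
  show "H z\<ge>0" for z unfolding H_def using c by (auto intro!: mult_nonneg_nonneg add_nonneg_nonneg)
  have conv: "(\<lambda>j. E j z) \<longlonglongrightarrow> 0" if "S z\<noteq>\<infinity>" for z
  proof -
   have fin: "ennreal (enn2real (E j z)) = E j z" for j
    using that le[of j z] by (auto simp: ennreal_enn2real_if top_unique)
   have "summable (\<lambda>j. enn2real (E j z))"
    using that by (intro summable_suminf_not_top) (auto simp: S_def fin)
   then have "(\<lambda>j. ennreal (enn2real (E j z))) \<longlonglongrightarrow> ennreal 0"
    by (intro tendsto_ennrealI summable_LIMSEQ_zero)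
   then show ?thesis by (simp add: fin)
  qed
  have conv': "(\<lambda>j. f j) \<longlonglongrightarrow> x" if "\<And>j. ennreal (norm (f j-x) powr r)\<le>E j z" "r\<ge>1" "S z\<noteq>\<infinity>"
   for z and r :: real and f :: "nat => 'c::real_normed_vector" and x
  proof -
   have "(\<lambda>j. ennreal (norm (f j-x) powr r)) \<longlonglongrightarrow> 0"
    by (rule tendsto_sandwich[OF _ _ tendsto_const conv[OF that(3)]]) (use that in auto)
   then have "(\<lambda>j. norm (f j-x) powr r) \<longlonglongrightarrow> 0"
    unfolding ennreal_0[symmetric] by (subst (asm) tendsto_ennreal_iff) auto
   from tendsto_powr'[OF this tendsto_const, of "1/r"] that(2)
   have "(\<lambda>j. norm (f j-x)) \<longlonglongrightarrow> 0" by (simp add: powr_powr)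
   then show ?thesis using LIM_zero_cancel tendsto_norm_zero_iff by blast
  qed
  show "AE z in lborel. (\<lambda>j. mollify (d j) u z) \<longlonglongrightarrow> u z"
   using ae by eventually_elim (rule conv'[OF _ pq(1)], auto simp: E_def pq add.assoc intro: add_increasing2)
  show "AE z in lborel. (\<lambda>j. mollify (d j) D z) \<longlonglongrightarrow> D z"
   using ae by eventually_elim (rule conv'[OF _ pq(1)], auto simp: E_def pq add_ac intro: add_increasing2)
  show "AE z in lborel. (\<lambda>j. mollify (d j) A z) \<longlonglongrightarrow> A z"
   using ae by eventually_elim (rule conv'[OF _ pq(2)], auto simp: E_def pq add_ac intro: add_increasing2)
  have bd: "norm x powr r\<le>c*(enn2real (S z)+norm y powr r)"
   if "ennreal (norm (x-y) powr r)\<le>E j z" "S z\<noteq>\<infinity>" "r = p \<or> r = q"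
   for x y :: "'c::real_normed_vector" and r z j
  proof -
   have r: "r\<ge>1" using that pq by auto
   have "norm (x-y) powr r\<le>enn2real (S z)"
    using order_trans[OF that(1) le] that(2) by (cases "S z") (auto simp: ennreal_le_iff2)
   moreover have "norm x powr r\<le>(norm (x-y)+norm y) powr r"
    using r norm_triangle_ineq[of "x-y" y] by (intro powr_mono2) auto
   moreover have "\<dots>\<le>2 powr r*(norm (x-y) powr r+norm y powr r)"
    using r by (intro powr_sum_le) auto
   moreover have "2 powr r\<le>c" using that by (auto simp: c_def)
   ultimately have "norm x powr r\<le>c*(norm (x-y) powr r+norm y powr r)"
    by (meson add_nonneg_nonneg mult_right_mono order_trans powr_ge_zero)
   also have "\<dots>\<le>c*(enn2real (S z)+norm y powr r)"
    using \<open>norm (x - y) powr r \<le> enn2real (S z)\<close> c by (intro mult_left_mono) auto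
   finally show ?thesis .
  qed
  show "AE z in lborel. \<forall>j. norm (mollify (d j) u z) powr p\<le>H z \<and> norm (mollify (d j) D z) powr p\<le>H z
    \<and> norm (mollify (d j) A z) powr q\<le>H z"
   using ae
  proof eventually_elim
   case (elim z)
   show ?case
   proof (intro allI conjI)
    fix j
    have "norm (mollify (d j) u z) powr p\<le>c*(enn2real (S z)+norm (u z) powr p)"
     by (rule bd[of _ _ _ j]) (use elim in \<open>auto simp: E_def add.assoc intro: add_increasing2\<close>)
    also have "\<dots>\<le>H z" unfolding H_def using c by (intro mult_left_mono) (auto intro!: add_nonneg_nonneg)
    finally show "norm (mollify (d j) u z) powr p\<le>H z" .
    have "norm (mollify (d j) D z) powr p\<le>c*(enn2real (S z)+norm (D z) powr p)"
     by (rule bd[of _ _ _ j]) (use elim in \<open>auto simp: E_def add_ac intro: add_increasing2\<close>)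
    also have "\<dots>\<le>H z" unfolding H_def using c by (intro mult_left_mono) (auto intro!: add_nonneg_nonneg)
    finally show "norm (mollify (d j) D z) powr p\<le>H z" .
    have "norm (mollify (d j) A z) powr q\<le>c*(enn2real (S z)+norm (A z) powr q)"
     by (rule bd[of _ _ _ j]) (use elim in \<open>auto simp: E_def add_ac intro: add_increasing2\<close>)
    also have "\<dots>\<le>H z" unfolding H_def using c by (intro mult_left_mono) (auto intro!: add_nonneg_nonneg)
    finally show "norm (mollify (d j) A z) powr q\<le>H z" .
   qed
  qed
 qed (use d in auto)
qed

section \<open>Mollified functions in time and in space\<close>

lemma antiderivative_exists:
 fixes g :: "real => real"
 assumes "continuous_on UNIV g"
 shows "\<exists>F. \<forall>x. (F has_real_derivative g x) (at x)"
proof (intro exI allI)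
 fix x :: real
 let ?a = "min x 0-1" and ?b = "max x 0+1"
 have "((\<lambda>u. LBINT y=ereal 0..ereal u. g y) has_vector_derivative g x) (at x within {?a..?b})"
  by (rule interval_integral_FTC2) (use continuous_on_subset[OF assms] in auto)
 then show "((\<lambda>u. LBINT y=ereal 0..ereal u. g y) has_real_derivative g x) (at x)"
  by (subst (asm) at_within_Icc_at) (auto simp: has_real_derivative_iff_has_vector_derivative)
qed

lemma Lp_one_approx_continuous_real:
 fixes b :: "real => real"
 assumes b: "L1 b" and e: "e > 0"
 shows "\<exists>g. continuous_on UNIV g \<and> L1 g \<and> (LINT x|lborel. \<bar>b x-g x\<bar>) < e"
proof -
 have [measurable]: "b\<in>Borel" using b by auto
 have "L1 (\<lambda>x. norm (b x) powr 1)" using b by simp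
 from Lp_approx_continuous[OF _ this _ e] obtain g R where g: "continuous_on UNIV g" "\<And>x. norm x > R ==> g x = 0"
  "(\<integral>\<^sup>+x. ennreal (norm (b x-g x) powr 1) \<partial>lborel) < ennreal e" by (metis \<open>b \<in> borel_measurable borel\<close> order_refl)
 have "L1 (\<lambda>x. indicator (cball 0 R) x*\<^sub>R g x)"
  by (rule borel_integrable_compact) (auto intro: continuous_on_subset[OF g(1)])
 moreover have "(\<lambda>x. indicator (cball 0 R) x*\<^sub>R g x) = g" using g(2) by (auto simp: indicator_def fun_eq_iff)
 ultimately have ig: "L1 g" by (simp only:)
 have "L1 (\<lambda>x. \<bar>b x-g x\<bar>)" using b ig by auto
 then have "(\<integral>\<^sup>+x. ennreal \<bar>b x-g x\<bar> \<partial>lborel) = ennreal (LINT x|lborel. \<bar>b x-g x\<bar>)"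
  by (rule nn_integral_eq_integral) auto
 with g(3) have "ennreal (LINT x|lborel. \<bar>b x-g x\<bar>) < ennreal e" by simp
 then have "(LINT x|lborel. \<bar>b x-g x\<bar>) < e" using e by (simp add: ennreal_less_iff)
 with g(1) ig show ?thesis by blast
qed

text \<open>The chain rule for an absolutely continuous \<open>U\<close>, given as an integral: it holds for continuous integrands by the
fundamental theorem, and both sides are continuous under convergence of \<open>b\<close> in \<open>L\<^sup>1\<close>.\<close>

lemma chain_rule_integral_function:
 fixes b G G' :: "real => real"
 assumes b: "L1 b" and st: "s\<le>t"
  and G: "\<And>x. (G has_real_derivative G' x) (at x)" and cG': "continuous_on UNIV G'" and K: "\<And>x. \<bar>G' x\<bar>\<le>K"
  and U: "\<And>\<tau>. \<tau>\<in>{s..t} ==> U \<tau> = c+(LINT r|lborel. indicator {s..\<tau>} r*b r)"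
 shows "G (U t)-G (U s) = (LINT \<tau>|lborel. indicator {s..t} \<tau>*(G' (U \<tau>)*b \<tau>))"
proof -
 have [measurable]: "b\<in>Borel" using b by auto
 have [measurable]: "G'\<in>Borel" using cG' by (rule borel_measurable_continuous_onI)
 define V where "V \<tau> = c+(LINT r|lborel. indicator {s..\<tau>} r*b r)" for \<tau>
 have "\<exists>g. continuous_on UNIV g \<and> L1 g \<and> (LINT x|lborel. \<bar>b x-g x\<bar>) < 1/real (Suc j)" for j
  by (rule Lp_one_approx_continuous_real[OF b]) simp
 then have "\<forall>j. \<exists>g. continuous_on UNIV g \<and> L1 g \<and> (LINT x|lborel. \<bar>b x-g x\<bar>) < 1/real (Suc j)" by blast
 from choice[OF this] obtain g where g: "\<And>j. continuous_on UNIV (g j)" "\<And>j. L1 (g j)"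
  "\<And>j. (LINT x|lborel. \<bar>b x-g j x\<bar>) < 1/real (Suc j)" by blast
 have [measurable]: "g j\<in>Borel" for j using g(2)[of j] by auto
 define W where "W j \<tau> = c+(LINT r|lborel. indicator {s..\<tau>} r*g j r)" for j \<tau>
 have ii: "L1 (\<lambda>r. indicator {x..y} r*f r)" if "L1 f" for f :: "real => real" and x y
  using integrable_real_mult_indicator[of "{x..y}" lborel f] that by (simp add: mult.commute)
 have WV: "\<bar>W j \<tau>-V \<tau>\<bar>\<le>1/real (Suc j)" for j \<tau>
 proof -
  have "W j \<tau>-V \<tau> = (LINT r|lborel. indicator {s..\<tau>} r*g j r-indicator {s..\<tau>} r*b r)"
   unfolding W_def V_def using ii[OF g(2)[of j]] ii[OF b] by simp
  also have "\<bar>\<dots>\<bar>\<le>(LINT r|lborel. \<bar>indicator {s..\<tau>} r*g j r-indicator {s..\<tau>} r*b r\<bar>)"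
   using integral_norm_bound[of lborel "\<lambda>r. indicator {s..\<tau>} r*g j r-indicator {s..\<tau>} r*b r"] by simp
  also have "\<dots>\<le>(LINT r|lborel. \<bar>b r-g j r\<bar>)"
   using ii[OF g(2)[of j]] ii[OF b] b g(2)[of j] by (intro Bochner_Integration.integral_mono) (auto simp: indicator_def)
  finally show ?thesis using g(3)[of j] by linarith
 qed
 have Wlim: "(\<lambda>j. W j \<tau>) \<longlonglongrightarrow> V \<tau>" for \<tau>
 proof (rule LIM_zero_cancel, rule tendsto_rabs_zero_cancel, rule tendsto_sandwich[OF _ _ tendsto_const])
  show "(\<lambda>j. 1/real (Suc j)) \<longlonglongrightarrow> 0" using LIMSEQ_inverse_real_of_nat by (simp add: inverse_eq_divide)
 qed (use WV in auto)
 have eqj: "G (W j t)-G (W j s) = (LINT \<tau>|lborel. indicator {s..t} \<tau>*(G' (W j \<tau>)*g j \<tau>))"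
  and measW: "(\<lambda>\<tau>. indicator {s..t} \<tau>*(G' (W j \<tau>)*g j \<tau>))\<in>Borel"
    "(\<lambda>\<tau>. indicator {s..t} \<tau>*G' (W j \<tau>))\<in>Borel" for j
 proof -
  obtain B where B: "\<And>x. (B has_real_derivative g j x) (at x)" using antiderivative_exists[OF g(1)] by blast
  have contg: "isCont (g j) x" for x using g(1)[of j] by (simp add: continuous_on_eq_continuous_at)
  have WB: "W j \<tau> = c+(B \<tau>-B s)" if "s\<le>\<tau>" for \<tau>
   using integral_FTC_Icc_real[OF that, of B "g j"] B contg by (simp add: W_def mult.commute)
  have der: "((\<lambda>\<tau>. G (c+(B \<tau>-B s))) has_real_derivative G' (c+(B \<tau>-B s))*g j \<tau>) (at \<tau>)" for \<tau>
   by (rule DERIV_chain2[OF G]) (auto intro!: derivative_eq_intros B)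
  have contB: "isCont B x" for x using B DERIV_isCont by blast
  have contG': "isCont G' x" for x using cG' by (simp add: continuous_on_eq_continuous_at)
  have cW: "isCont (\<lambda>\<tau>. G' (c+(B \<tau>-B s))) \<tau>" for \<tau>
   by (rule isCont_o2[OF _ contG']) (intro continuous_intros contB)
  have "(LINT \<tau>|lborel. (G' (c+(B \<tau>-B s))*g j \<tau>)*indicator {s..t} \<tau>) = G (c+(B t-B s))-G (c+(B s-B s))"
   by (rule integral_FTC_Icc_real[OF st]) (use der cW contg in \<open>auto intro!: continuous_intros\<close>)
  moreover have "indicator {s..t} \<tau>*(G' (W j \<tau>)*g j \<tau>) = (G' (c+(B \<tau>-B s))*g j \<tau>)*indicator {s..t} \<tau>" for \<tau>
   using WB[of \<tau>] by (auto simp: indicator_def)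
  ultimately show "G (W j t)-G (W j s) = (LINT \<tau>|lborel. indicator {s..t} \<tau>*(G' (W j \<tau>)*g j \<tau>))"
   unfolding WB[OF st] WB[OF order_refl] by (simp only:)
  have mB: "(\<lambda>\<tau>. G' (c+(B \<tau>-B s)))\<in>Borel"
   using cW by (intro borel_measurable_continuous_onI) (simp add: continuous_on_eq_continuous_at)
  have *: "(\<lambda>\<tau>. indicator {s..t} \<tau>*G' (W j \<tau>)) = (\<lambda>\<tau>. indicator {s..t} \<tau>*G' (c+(B \<tau>-B s)))"
   using WB by (auto simp: indicator_def fun_eq_iff)
  show m1: "(\<lambda>\<tau>. indicator {s..t} \<tau>*G' (W j \<tau>))\<in>Borel"
   unfolding * using mB by measurable
  have "(\<lambda>\<tau>. (indicator {s..t} \<tau>*G' (W j \<tau>))*g j \<tau>)\<in>Borel"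
   using m1 by measurable
  then show "(\<lambda>\<tau>. indicator {s..t} \<tau>*(G' (W j \<tau>)*g j \<tau>))\<in>Borel"
   by (simp add: mult.assoc)
 qed
 have G'lim: "(\<lambda>j. G' (W j \<tau>)) \<longlonglongrightarrow> G' (V \<tau>)" for \<tau>
  using isCont_tendsto_compose[of "V \<tau>" G', OF _ Wlim] cG' by (simp add: continuous_on_eq_continuous_at)
 have Glim: "(\<lambda>j. G (W j \<tau>)) \<longlonglongrightarrow> G (V \<tau>)" for \<tau>
  using isCont_tendsto_compose[of "V \<tau>" G, OF _ Wlim] G DERIV_isCont by blast
 have mV: "(\<lambda>\<tau>. indicator {s..t} \<tau>*G' (V \<tau>))\<in>Borel"
  by (rule borel_measurable_LIMSEQ_real[where u = "\<lambda>j \<tau>. indicator {s..t} \<tau>*G' (W j \<tau>)"])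
   (use measW(2) in \<open>auto intro!: tendsto_intros G'lim\<close>)
 have mVb: "(\<lambda>\<tau>. indicator {s..t} \<tau>*(G' (V \<tau>)*b \<tau>))\<in>Borel"
 proof -
  have "(\<lambda>\<tau>. (indicator {s..t} \<tau>*G' (V \<tau>))*b \<tau>)\<in>Borel" using mV by measurable
  then show ?thesis by (simp add: mult.assoc)
 qed
 have K0: "K\<ge>0" using K[of 0] by linarith
 have mWb: "(\<lambda>\<tau>. indicator {s..t} \<tau>*(G' (W j \<tau>)*b \<tau>))\<in>Borel" for j
 proof -
  have "(\<lambda>\<tau>. (indicator {s..t} \<tau>*G' (W j \<tau>))*b \<tau>)\<in>Borel" using measW(2)[of j] by measurable
  then show ?thesis by (simp add: mult.assoc)
 qed
 have lim1: "(\<lambda>j. LINT \<tau>|lborel. indicator {s..t} \<tau>*(G' (W j \<tau>)*b \<tau>)) \<longlonglongrightarrow> (LINT \<tau>|lborel. indicator {s..t} \<tau>*(G' (V \<tau>)*b \<tau>))"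
 proof (rule integral_dominated_convergence)
  show "L1 (\<lambda>\<tau>. K*\<bar>b \<tau>\<bar>)" using b by auto
  show "AE \<tau> in lborel. (\<lambda>j. indicator {s..t} \<tau>*(G' (W j \<tau>)*b \<tau>)) \<longlonglongrightarrow> indicator {s..t} \<tau>*(G' (V \<tau>)*b \<tau>)"
   by (intro AE_I2 tendsto_intros G'lim)
  show "AE \<tau> in lborel. norm (indicator {s..t} \<tau>*(G' (W j \<tau>)*b \<tau>))\<le>K*\<bar>b \<tau>\<bar>" for j
   using K K0 by (intro AE_I2) (auto simp: indicator_def abs_mult intro!: mult_right_mono)
 qed (use mVb mWb in auto)
 have intW: "L1 (\<lambda>\<tau>. indicator {s..t} \<tau>*(G' (W j \<tau>)*f \<tau>))"
  if "L1 f" "(\<lambda>\<tau>. indicator {s..t} \<tau>*(G' (W j \<tau>)*f \<tau>))\<in>Borel" for f j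
 proof (rule Bochner_Integration.integrable_bound)
  show "L1 (\<lambda>\<tau>. K*\<bar>f \<tau>\<bar>)" using that by auto
  show "AE \<tau> in lborel. norm (indicator {s..t} \<tau>*(G' (W j \<tau>)*f \<tau>))\<le>norm (K*\<bar>f \<tau>\<bar>)"
   using K K0 by (intro AE_I2) (auto simp: indicator_def abs_mult intro!: mult_right_mono)
 qed (use that in auto)
 have lim2: "(\<lambda>j. (LINT \<tau>|lborel. indicator {s..t} \<tau>*(G' (W j \<tau>)*g j \<tau>))-(LINT \<tau>|lborel. indicator {s..t} \<tau>*(G' (W j \<tau>)*b \<tau>))) \<longlonglongrightarrow> 0"
 proof (rule tendsto_rabs_zero_cancel, rule tendsto_sandwich[OF _ _ tendsto_const])
  show "(\<lambda>j. K*(1/real (Suc j))) \<longlonglongrightarrow> 0"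
   using tendsto_mult[OF tendsto_const[of K] LIMSEQ_inverse_real_of_nat] by (simp add: inverse_eq_divide)
  show "\<forall>\<^sub>F j in sequentially. \<bar>(LINT \<tau>|lborel. indicator {s..t} \<tau>*(G' (W j \<tau>)*g j \<tau>))-(LINT \<tau>|lborel. indicator {s..t} \<tau>*(G' (W j \<tau>)*b \<tau>))\<bar>\<le>K*(1/real (Suc j))"
  proof (rule always_eventually, rule allI)
   fix j
   note i1 = intW[OF g(2)[of j] measW(1)] and i2 = intW[OF b mWb[of j]]
   have "\<bar>(LINT \<tau>|lborel. indicator {s..t} \<tau>*(G' (W j \<tau>)*g j \<tau>))-(LINT \<tau>|lborel. indicator {s..t} \<tau>*(G' (W j \<tau>)*b \<tau>))\<bar>
    = \<bar>LINT \<tau>|lborel. indicator {s..t} \<tau>*(G' (W j \<tau>)*g j \<tau>)-indicator {s..t} \<tau>*(G' (W j \<tau>)*b \<tau>)\<bar>"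
    using i1 i2 by simp
   also have "\<dots>\<le>(LINT \<tau>|lborel. \<bar>indicator {s..t} \<tau>*(G' (W j \<tau>)*g j \<tau>)-indicator {s..t} \<tau>*(G' (W j \<tau>)*b \<tau>)\<bar>)"
    using integral_norm_bound[of lborel "\<lambda>\<tau>. indicator {s..t} \<tau>*(G' (W j \<tau>)*g j \<tau>)-indicator {s..t} \<tau>*(G' (W j \<tau>)*b \<tau>)"] by simp
   also have "\<dots>\<le>(LINT \<tau>|lborel. K*\<bar>b \<tau>-g j \<tau>\<bar>)"
   proof (rule Bochner_Integration.integral_mono)
    fix \<tau>
    have "\<bar>G' (W j \<tau>)*g j \<tau>-G' (W j \<tau>)*b \<tau>\<bar> = \<bar>G' (W j \<tau>)\<bar>*\<bar>b \<tau>-g j \<tau>\<bar>"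
     by (metis abs_minus_commute abs_mult right_diff_distrib)
    also have "\<dots>\<le>K*\<bar>b \<tau>-g j \<tau>\<bar>" using K by (intro mult_right_mono) auto
    finally show "\<bar>indicator {s..t} \<tau>*(G' (W j \<tau>)*g j \<tau>)-indicator {s..t} \<tau>*(G' (W j \<tau>)*b \<tau>)\<bar>\<le>K*\<bar>b \<tau>-g j \<tau>\<bar>"
     using K0 by (auto simp: indicator_def)
   qed (use i1 i2 b g(2)[of j] in auto)
   also have "\<dots>\<le>K*(1/real (Suc j))"
    using mult_left_mono[OF less_imp_le[OF g(3)[of j]] K0] by simp
   finally show "\<bar>(LINT \<tau>|lborel. indicator {s..t} \<tau>*(G' (W j \<tau>)*g j \<tau>))-(LINT \<tau>|lborel. indicator {s..t} \<tau>*(G' (W j \<tau>)*b \<tau>))\<bar>\<le>K*(1/real (Suc j))" .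
  qed
 qed auto
 have "(\<lambda>j. G (W j t)-G (W j s)) \<longlonglongrightarrow> (LINT \<tau>|lborel. indicator {s..t} \<tau>*(G' (V \<tau>)*b \<tau>))"
  unfolding eqj using tendsto_add[OF lim1 lim2] by simp
 moreover have "(\<lambda>j. G (W j t)-G (W j s)) \<longlonglongrightarrow> G (V t)-G (V s)"
  by (intro tendsto_intros Glim)
 ultimately have "G (V t)-G (V s) = (LINT \<tau>|lborel. indicator {s..t} \<tau>*(G' (V \<tau>)*b \<tau>))"
  using LIMSEQ_unique by blast
 moreover have "U t = V t" "U s = V s" using U st by (auto simp: V_def)
 moreover have "indicator {s..t} \<tau>*(G' (V \<tau>)*b \<tau>) = indicator {s..t} \<tau>*(G' (U \<tau>)*b \<tau>)" for \<tau>
  using U[of \<tau>] by (auto simp: V_def indicator_def)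
 ultimately show ?thesis by simp
qed

lemma mollifier_grad_uniform:
 assumes d: "d > 0" and e: "e > 0"
 shows "\<exists>\<delta>>0. \<forall>x y :: real^'n. dist y x < \<delta> --> norm (grad (mollifier d) y-grad (mollifier d) x) < e"
proof -
 have "uniformly_continuous_on UNIV (grad (mollifier d) :: real^'n => real^'n)"
  by (rule uniformly_continuous_vanishing[OF mollifier_grad_continuous[OF d] mollifier_grad_outside[OF d]])
 from this[unfolded uniformly_continuous_on_def, rule_format, OF e] show ?thesis
  by (simp add: dist_norm)
qed

text \<open>The first order expansion is uniform in the base point, which is what differentiation under the integral sign needs.\<close>

lemma mollifier_uniform_taylor:
 assumes d: "d > 0" and e: "e > 0"
 shows "\<exists>\<delta>>0. \<forall>a h :: real^'n. norm h < \<delta> \<longrightarrow>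
  \<bar>mollifier d (a+h)-mollifier d a-grad (mollifier d) a\<bullet>h\<bar>\<le>e*norm h"
proof -
 obtain \<delta> where \<delta>: "\<delta> > 0" and \<delta>': "\<forall>x y :: real^'n. dist y x < \<delta> --> norm (grad (mollifier d) y-grad (mollifier d) x) < e"
  using mollifier_grad_uniform[OF d e] by blast
 show ?thesis
 proof (intro exI[of _ \<delta>] conjI allI impI \<delta>)
  fix a h :: "real^'n" assume h: "norm h < \<delta>"
  have "norm (mollifier d (a+h)-mollifier d a-grad (mollifier d) a\<bullet>((a+h)-a))\<le>norm ((a+h)-a)*e"
  proof (rule differentiable_bound_linearization[where S = "ball a \<delta>" and f' = "\<lambda>x h. grad (mollifier d) x\<bullet>h"])
   show "a+t*\<^sub>R (a+h-a)\<in>ball a \<delta>" if "t\<in>{0..1}" for t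
   proof -
    have "\<bar>t\<bar>*norm h\<le>1*norm h" using that by (intro mult_right_mono) auto
    then show ?thesis using h by (simp add: dist_norm)
   qed
   show "(mollifier d has_derivative (\<bullet>) (grad (mollifier d) x)) (at x within ball a \<delta>)" for x
    using mollifier_has_derivative[OF d] has_derivative_at_withinI by blast
   show "onorm ((\<bullet>) (grad (mollifier d) x)-(\<bullet>) (grad (mollifier d) a))\<le>e" if "x\<in>ball a \<delta>" for x
   proof (rule onorm_le)
    fix v
    have "norm (((\<bullet>) (grad (mollifier d) x)-(\<bullet>) (grad (mollifier d) a)) v) = \<bar>(grad (mollifier d) x-grad (mollifier d) a)\<bullet>v\<bar>"
     by (simp add: inner_diff_left)
    also have "\<dots>\<le>norm (grad (mollifier d) x-grad (mollifier d) a)*norm v" by (rule Cauchy_Schwarz_ineq2)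
    also have "\<dots>\<le>e*norm v"
     using \<delta>'[rule_format, of x a] that by (intro mult_right_mono) (auto simp: dist_norm norm_minus_commute)
    finally show "norm (((\<bullet>) (grad (mollifier d) x)-(\<bullet>) (grad (mollifier d) a)) v)\<le>e*norm v" .
   qed
  qed (use \<delta> in auto)
  then show "\<bar>mollifier d (a+h)-mollifier d a-grad (mollifier d) a\<bullet>h\<bar>\<le>e*norm h"
   by (simp add: mult.commute)
 qed
qed

lemma mollifier_grad_prod_integrable:
 fixes f0 :: "real^'n => real"
 assumes f0: "L1 f0" and d: "d > 0"
 shows "L1 (\<lambda>x. f0 x*\<^sub>R grad (mollifier d) (y-x))"
proof -
 have "L1 (\<lambda>x. (grad (mollifier d) (y-x) $ i)*\<^sub>R f0 x)" for i
 proof (rule mollifier_prod_integrable[OF f0, where R = d and g = "\<lambda>x. grad (mollifier d) x $ i"])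
  show "continuous_on UNIV (\<lambda>x. grad (mollifier d) x $ i)"
   by (intro continuous_intros mollifier_grad_continuous[OF d])
  show "norm x > d ==> grad (mollifier d) x $ i = 0" for x using mollifier_grad_outside[OF d, of x] by simp
 qed
 then have "L1 (\<lambda>x. (\<Sum>i\<in>UNIV. (grad (mollifier d) (y-x) $ i*f0 x)*\<^sub>R (axis i 1 :: real^'n)))"
  by (intro Bochner_Integration.integrable_sum integrable_scaleR_left) auto
 moreover have "(\<lambda>x. \<Sum>i\<in>UNIV. (grad (mollifier d) (y-x) $ i*f0 x)*\<^sub>R (axis i 1 :: real^'n)) = (\<lambda>x. f0 x*\<^sub>R grad (mollifier d) (y-x))"
  by (simp add: fun_eq_iff vec_eq_iff axis_def sum.delta if_distrib cong: if_cong)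
 ultimately show ?thesis by (simp only:)
qed

lemma mollify_has_derivative:
 fixes f :: "(real^'n)\<times>real => real"
 assumes f: "L1 (\<lambda>x. f (x, t))" and d: "d > 0"
 shows "((\<lambda>y. mollify d f (y, t)) has_derivative (\<lambda>h. mollify_grad d f (y, t)\<bullet>h)) (at y)"
 unfolding has_derivative_at_alt
proof (intro conjI allI impI bounded_linear_inner_right)
 fix e :: real assume e: "e > 0"
 define I where "I = (LINT x|lborel. \<bar>f (x, t)\<bar>)"
 have I: "I\<ge>0" unfolding I_def by (intro Bochner_Integration.integral_nonneg) auto
 have out: "norm x > d ==> mollifier d x = 0" for x :: "real^'n" using mollifier_outside[OF d, of x] by simp
 have "e/(I+1) > 0" using e I by simp
 from mollifier_uniform_taylor[OF d this] obtain \<delta> where \<delta>: "\<delta> > 0" "\<And>a h :: real^'n. norm h < \<delta> \<Longrightarrow>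
  \<bar>mollifier d (a+h)-mollifier d a-grad (mollifier d) a\<bullet>h\<bar>\<le>e/(I+1)*norm h" by blast
 show "\<exists>\<delta>>0. \<forall>z. norm (z-y) < \<delta> \<longrightarrow>
  norm (mollify d f (z, t)-mollify d f (y, t)-mollify_grad d f (y, t)\<bullet>(z-y))\<le>e*norm (z-y)"
 proof (intro exI[of _ \<delta>] conjI allI impI \<delta>(1))
  fix z assume z: "norm (z-y) < \<delta>"
  have i1: "L1 (\<lambda>x. mollifier d (w-x)*\<^sub>R f (x, t))" for w
   by (rule mollifier_prod_integrable[OF f mollifier_continuous[OF d] out])
  note i2 = mollifier_grad_prod_integrable[OF f d, of y]
  have i3: "L1 (\<lambda>x. (f (x, t)*\<^sub>R grad (mollifier d) (y-x))\<bullet>(z-y))"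
   using i2 by (rule integrable_inner_left)
  have E: "mollify d f (z, t)-mollify d f (y, t)-mollify_grad d f (y, t)\<bullet>(z-y)
   = (LINT x|lborel. mollifier d (z-x)*\<^sub>R f (x, t)-mollifier d (y-x)*\<^sub>R f (x, t)-(f (x, t)*\<^sub>R grad (mollifier d) (y-x))\<bullet>(z-y))"
  proof -
   have "mollify_grad d f (y, t)\<bullet>(z-y) = (LINT x|lborel. (f (x, t)*\<^sub>R grad (mollifier d) (y-x))\<bullet>(z-y))"
    unfolding mollify_grad_def fst_conv snd_conv by (rule integral_inner_left[OF i2, symmetric])
   then show ?thesis
    using Bochner_Integration.integral_diff[OF Bochner_Integration.integrable_diff[OF i1[of z] i1[of y]] i3]
      Bochner_Integration.integral_diff[OF i1[of z] i1[of y]]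
    unfolding mollify_def fst_conv snd_conv by linarith
  qed
  have "norm (mollify d f (z, t)-mollify d f (y, t)-mollify_grad d f (y, t)\<bullet>(z-y))\<le>(LINT x|lborel. norm (mollifier d (z-x)*\<^sub>R f (x, t)-mollifier d (y-x)*\<^sub>R f (x, t)-(f (x, t)*\<^sub>R grad (mollifier d) (y-x))\<bullet>(z-y)))"
   unfolding E by (rule integral_norm_bound)
  also have "\<dots>\<le>(LINT x|lborel. (e/(I+1)*norm (z-y))*\<bar>f (x, t)\<bar>)"
  proof (rule Bochner_Integration.integral_mono)
   fix x
   have E': "mollifier d (z-x)*\<^sub>R f (x, t)-mollifier d (y-x)*\<^sub>R f (x, t)-(f (x, t)*\<^sub>R grad (mollifier d) (y-x))\<bullet>(z-y)
    = (mollifier d ((y-x)+(z-y))-mollifier d (y-x)-grad (mollifier d) (y-x)\<bullet>(z-y))*f (x, t)"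
   proof -
    have "(y-x)+(z-y) = z-x" by simp
    then show ?thesis by (simp only: left_diff_distrib right_diff_distrib real_scaleR_def inner_scaleR_left mult.commute[of _ "f (x, t)"])
   qed
   show "norm (mollifier d (z-x)*\<^sub>R f (x, t)-mollifier d (y-x)*\<^sub>R f (x, t)-(f (x, t)*\<^sub>R grad (mollifier d) (y-x))\<bullet>(z-y))
    \<le>(e/(I+1)*norm (z-y))*\<bar>f (x, t)\<bar>"
    unfolding E' real_norm_def abs_mult by (rule mult_right_mono[OF \<delta>(2)[OF z, of "y-x"]]) simp
  next
   show "L1 (\<lambda>x. norm (mollifier d (z-x)*\<^sub>R f (x, t)-mollifier d (y-x)*\<^sub>R f (x, t)-(f (x, t)*\<^sub>R grad (mollifier d) (y-x))\<bullet>(z-y)))"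
    by (intro integrable_norm Bochner_Integration.integrable_diff i1 i3)
   show "L1 (\<lambda>x. (e/(I+1)*norm (z-y))*\<bar>f (x, t)\<bar>)"
    by (intro integrable_mult_right integrable_abs f)
  qed
  also have "... = e*norm (z-y)*(I/(I+1))" by (simp add: I_def)
  also have "\<dots>\<le>e*norm (z-y)*1" using I e by (intro mult_left_mono) auto
  finally show "norm (mollify d f (z, t)-mollify d f (y, t)-mollify_grad d f (y, t)\<bullet>(z-y))\<le>e*norm (z-y)" by simp
 qed
qed

lemma mollify_grad_continuous:
 fixes f :: "(real^'n)\<times>real => real"
 assumes f: "L1 (\<lambda>x. f (x, t))" and d: "d > 0"
 shows "continuous_on UNIV (\<lambda>y. mollify_grad d f (y, t))"
 unfolding continuous_on_iff
proof (intro ballI allI impI)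
 fix y :: "real^'n" and e :: real assume e: "e > 0"
 define I where "I = (LINT x|lborel. \<bar>f (x, t)\<bar>)"
 have I: "I\<ge>0" unfolding I_def by (intro Bochner_Integration.integral_nonneg) auto
 have eI: "e/(I+1) > 0" using e I by simp
 obtain \<delta> where \<delta>: "\<delta> > 0" and \<delta>': "\<forall>x y :: real^'n. dist y x < \<delta> --> norm (grad (mollifier d) y-grad (mollifier d) x) < e/(I+1)"
  using mollifier_grad_uniform[OF d eI] by blast
 show "\<exists>\<delta>>0. \<forall>z\<in>UNIV. dist z y < \<delta> --> dist (mollify_grad d f (z, t)) (mollify_grad d f (y, t)) < e"
 proof (intro exI[of _ \<delta>] conjI ballI impI \<delta>)
  fix z assume z: "dist z y < \<delta>"
  note i = mollifier_grad_prod_integrable[OF f d]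
  have E: "mollify_grad d f (z, t)-mollify_grad d f (y, t)
   = (LINT x|lborel. f (x, t)*\<^sub>R grad (mollifier d) (z-x)-f (x, t)*\<^sub>R grad (mollifier d) (y-x))"
   unfolding mollify_grad_def using i[of z] i[of y] by simp
  have "norm (mollify_grad d f (z, t)-mollify_grad d f (y, t))\<le>(LINT x|lborel. norm (f (x, t)*\<^sub>R grad (mollifier d) (z-x)-f (x, t)*\<^sub>R grad (mollifier d) (y-x)))"
   unfolding E by (rule integral_norm_bound)
  also have "\<dots>\<le>(LINT x|lborel. e/(I+1)*\<bar>f (x, t)\<bar>)"
  proof (rule Bochner_Integration.integral_mono)
   fix x
   have "dist (z-x) (y-x) < \<delta>" using z by (simp add: dist_norm)
   from \<delta>'[rule_format, OF this] have *: "norm (grad (mollifier d) (z-x)-grad (mollifier d) (y-x))\<le>e/(I+1)"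
    by simp
   have "norm (f (x, t)*\<^sub>R grad (mollifier d) (z-x)-f (x, t)*\<^sub>R grad (mollifier d) (y-x))
     = \<bar>f (x, t)\<bar>*norm (grad (mollifier d) (z-x)-grad (mollifier d) (y-x))"
    by (metis norm_scaleR scaleR_diff_right)
   also have "\<dots>\<le>\<bar>f (x, t)\<bar>*(e/(I+1))" using * by (intro mult_left_mono) auto
   finally show "norm (f (x, t)*\<^sub>R grad (mollifier d) (z-x)-f (x, t)*\<^sub>R grad (mollifier d) (y-x))\<le>e/(I+1)*\<bar>f (x, t)\<bar>"
    by (simp only: mult.commute)
  qed (use f i[of z] i[of y] in auto)
  also have "... = e*(I/(I+1))" by (simp add: I_def)
  also have "... < e*1" using I e by (intro mult_strict_left_mono) auto
  finally show "dist (mollify_grad d f (z, t)) (mollify_grad d f (y, t)) < e" by (simp add: dist_norm)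
 qed
qed

lemma mollifier_grad_minus: "d > 0 ==> grad (mollifier d) (- x :: real^'n) = - grad (mollifier d) x"
proof (rule grad_unique)
 assume d: "d > 0"
 have "((\<lambda>x. mollifier d (- x)) has_derivative (\<lambda>h. grad (mollifier d) (- (- x))\<bullet>(- h))) (at (- x))"
  by (rule has_derivative_compose[OF _ mollifier_has_derivative[OF d]]) (auto intro!: derivative_eq_intros)
 moreover have "(\<bullet>) (- grad (mollifier d) x) = (\<lambda>h. grad (mollifier d) (- (- x))\<bullet>(- h))"
  by (auto simp: fun_eq_iff)
 moreover have "(\<lambda>x. mollifier d (- x)) = (mollifier d :: real^'n => real)"
  using mollifier_minus[OF d] by (auto simp: fun_eq_iff)
 ultimately show "(mollifier d has_derivative (\<bullet>) (- grad (mollifier d) x)) (at (- x))"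
  by (simp only:)
qed

text \<open>The translated and reflected mollifier is a test function; the weak gradient moves to it. The hypothesis concerns
one time only.\<close>

lemma mollify_grad_eq_mollify:
 fixes f :: "(real^'n)\<times>real => real" and D :: "(real^'n)\<times>real => real^'n"
 assumes w: "\<And>\<phi>. \<phi>\<in>test_functions U ==> (LINT x|lborel. f (x, t)*\<^sub>R grad \<phi> x) = - (LINT x|lborel. \<phi> x*\<^sub>R D (x, t))"
  and d: "d > 0" and y: "cball y d \<subseteq> U"
 shows "mollify_grad d f (y, t) = mollify d D (y, t)"
proof -
 have g: "grad (\<lambda>x. mollifier d (x-y)) x = grad (mollifier d) (x-y)" for x
 proof (rule grad_unique)
  show "((\<lambda>x. mollifier d (x-y)) has_derivative (\<bullet>) (grad (mollifier d) (x-y))) (at x)"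
   by (rule has_derivative_compose[OF _ mollifier_has_derivative[OF d], of "\<lambda>x. x-y" "\<lambda>h. h"])
    (auto intro!: derivative_eq_intros)
 qed
 have "grad (mollifier d) (x-y) = - grad (mollifier d) (y-x)" "mollifier d (x-y) = mollifier d (y-x)" for x
  using mollifier_grad_minus[OF d, of "y-x"] mollifier_minus[OF d, of "y-x"] by simp_all
 moreover have "(LINT x|lborel. f (x, t)*\<^sub>R grad (mollifier d) (x-y)) = - (LINT x|lborel. mollifier d (x-y)*\<^sub>R D (x, t))"
  using w[OF mollifier_test_function[OF d y]] unfolding g .
 ultimately show ?thesis
  by (simp add: mollify_grad_def mollify_def)
qed

section \<open>Difference quotients and integration by parts\<close>

text \<open>The integral of a difference quotient of \<open>f\<close> vanishes by translation invariance; the quotients converge boundedly.\<close>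

lemma integral_inner_grad_eq_0:
 fixes f :: "'a::euclidean_space => real" and g :: "'a => 'a"
 assumes f: "\<And>x. (f has_derivative (\<lambda>h. g x\<bullet>h)) (at x)" and g: "continuous_on UNIV g"
  and z: "\<And>x. norm x > R ==> f x = 0" "\<And>x. norm x > R ==> g x = 0"
 shows "(LINT x|lborel. g x\<bullet>v) = 0"
proof -
 have cf: "continuous_on UNIV f" by (rule has_derivative_continuous_on, rule has_derivative_at_withinI, rule f)
 have [measurable]: "f\<in>Borel" "g\<in>Borel"
  using cf g by (auto intro: borel_measurable_continuous_onI)
 have "compact (g ` cball 0 R)" by (intro compact_continuous_image continuous_on_subset[OF g]) auto
 then obtain B0 where B0: "\<And>x. x\<in>cball 0 R ==> norm (g x)\<le>B0"
  using bounded_iff compact_imp_bounded by (metis imageI)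
 define B where "B = max B0 0"
 have B: "norm (g x)\<le>B" for x using B0[of x] z(2)[of x] by (cases "norm x\<le>R") (auto simp: B_def)
 have "B\<ge>0" by (simp add: B_def)
 have lip: "\<bar>f a-f b\<bar>\<le>B*norm (a-b)" for a b
 proof -
  have "norm (f a-f b)\<le>B*norm (a-b)"
  proof (rule differentiable_bound[where S = UNIV and f' = "\<lambda>x h. g x\<bullet>h"])
   show "onorm ((\<bullet>) (g x))\<le>B" for x
   proof (rule onorm_le)
    fix v
    have "norm (g x\<bullet>v)\<le>norm (g x)*norm v" by (simp add: Cauchy_Schwarz_ineq2)
    also have "\<dots>\<le>B*norm v" using B by (intro mult_right_mono) auto
    finally show "norm (g x\<bullet>v)\<le>B*norm v" .
   qed
  qed (use f in auto)
  then show ?thesis by simp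
 qed
 have intf: "L1 f"
 proof -
  have "L1 (\<lambda>x. indicator (cball 0 R) x*\<^sub>R f x)"
   by (rule borel_integrable_compact) (auto intro: continuous_on_subset[OF cf])
  moreover have "(\<lambda>x. indicator (cball 0 R) x*\<^sub>R f x) = f" using z(1) by (auto simp: indicator_def fun_eq_iff)
  ultimately show ?thesis by (simp only:)
 qed
 define h where "h n = 1/real (Suc n)" for n
 have h: "h n > 0" "h n\<le>1" for n by (auto simp: h_def)
 have hlim: "h \<longlonglongrightarrow> 0" using LIMSEQ_inverse_real_of_nat by (simp add: h_def[abs_def] inverse_eq_divide)
 define q where "q n x = (f (x-(- h n*\<^sub>R v))-f x)/h n" for n x
 have "(\<lambda>n. LINT x|lborel. q n x) \<longlonglongrightarrow> (LINT x|lborel. g x\<bullet>v)"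
 proof (rule integral_dominated_convergence)
  have "emeasure lborel (cball (0::'a) (R+norm v)) < \<infinity>" by (rule emeasure_lborel_cball_finite)
  then show "L1 (\<lambda>x::'a. (B*norm v)*indicator (cball 0 (R+norm v)) x)"
   by (auto simp: integrable_indicator_iff less_top)
  show "AE x in lborel. norm (q n x)\<le>(B*norm v)*indicator (cball 0 (R+norm v)) x" for n
  proof (rule AE_I2)
   fix x
   show "norm (q n x)\<le>(B*norm v)*indicator (cball 0 (R+norm v)) x"
   proof (cases "norm x\<le>R+norm v")
    case True
    have "\<bar>f (x-(- h n*\<^sub>R v))-f x\<bar>\<le>B*(h n*norm v)"
     using lip[of "x-(- h n*\<^sub>R v)" x] h[of n] by simp
    then show ?thesis using True h[of n] by (simp add: q_def field_simps)
   next
    case False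
    have "norm x\<le>norm (x-(- h n*\<^sub>R v))+h n*norm v"
     using norm_triangle_ineq4[of "x-(- h n*\<^sub>R v)" "h n*\<^sub>R v"] h[of n] by simp
    moreover have "h n*norm v\<le>1*norm v" using h[of n] by (intro mult_right_mono) auto
    ultimately have "norm (x-(- h n*\<^sub>R v)) > R" "norm x > R"
     using False norm_ge_zero[of v] by linarith+
    then show ?thesis using z(1) False by (simp add: q_def)
   qed
  qed
  show "AE x in lborel. (\<lambda>n. q n x) \<longlonglongrightarrow> g x\<bullet>v"
  proof (rule AE_I2)
   fix x
   have "((\<lambda>s. f (x + s*\<^sub>R v)) has_derivative (\<lambda>s. g (x+0*\<^sub>R v)\<bullet>(s*\<^sub>R v))) (at 0)"
    by (rule has_derivative_compose[OF _ f]) (auto intro!: derivative_eq_intros)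
   then have "((\<lambda>s. f (x + s*\<^sub>R v)) has_real_derivative g x\<bullet>v) (at 0)"
    unfolding has_field_derivative_def by (rule has_derivative_eq_rhs) (auto simp: fun_eq_iff)
   then have "((\<lambda>s. (f (x + s*\<^sub>R v)-f x)/s) \<longlongrightarrow> g x\<bullet>v) (at 0)"
    unfolding DERIV_def by simp
   moreover have "filterlim h (at 0) sequentially"
    using hlim h(1) by (auto simp: filterlim_at less_imp_neq[symmetric])
   ultimately have "(\<lambda>n. (f (x+h n*\<^sub>R v)-f x)/h n) \<longlonglongrightarrow> g x\<bullet>v"
    by (rule filterlim_compose)
   then show "(\<lambda>n. q n x) \<longlonglongrightarrow> g x\<bullet>v" by (simp add: q_def)
  qed
  show "q n\<in>borel_measurable lborel" for n unfolding q_def by measurable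
 qed measurable
 moreover have "(LINT x|lborel. q n x) = 0" for n
 proof -
  have "L1 (\<lambda>x. f (x-(- h n*\<^sub>R v)))" "(LINT x|lborel. f (x-(- h n*\<^sub>R v))) = (LINT x|lborel. f x)"
   using intf by (subst integrable_translate integral_translate; simp)+
  then show ?thesis unfolding q_def using intf by simp
 qed
 ultimately show ?thesis using LIMSEQ_unique tendsto_const by (simp add: LIMSEQ_const_iff)
qed

text \<open>Write the difference as an integral of the gradient along the segment and apply Jensen's inequality.\<close>

lemma translation_powr_le:
 fixes f :: "'a::euclidean_space => real" and g :: "'a => 'a"
 assumes f: "\<And>x. (f has_derivative (\<lambda>h. g x\<bullet>h)) (at x)" and g: "continuous_on UNIV g"
  and r: "r\<ge>1"
 shows "(\<integral>\<^sup>+x. ennreal (\<bar>f x-f (x-y)\<bar> powr r) \<partial>lborel)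
  \<le>ennreal (norm y powr r)*(\<integral>\<^sup>+x. ennreal (norm (g x) powr r) \<partial>lborel)"
proof -
 have cf: "continuous_on UNIV f" by (rule has_derivative_continuous_on, rule has_derivative_at_withinI, rule f)
 have [measurable]: "f\<in>Borel" "g\<in>Borel"
  using cf g by (auto intro: borel_measurable_continuous_onI)
 let ?I = "\<lambda>s::real. indicator {0..1} s :: real"
 have cgp: "continuous_on UNIV (\<lambda>s. g (x-s*\<^sub>R y))" for x
  by (rule continuous_on_compose2[OF g]) (auto intro!: continuous_intros)
 have pt: "ennreal (\<bar>f x-f (x-y)\<bar> powr r)\<le>(\<integral>\<^sup>+s. ennreal (?I s)*ennreal (norm y powr r*norm (g (x-s*\<^sub>R y)) powr r) \<partial>lborel)" for x
 proof -
  have [measurable]: "(\<lambda>s. g (x-s*\<^sub>R y))\<in>Borel"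
   using cgp by (rule borel_measurable_continuous_onI)
  have der: "((\<lambda>s. f (x-s*\<^sub>R y)) has_real_derivative-(g (x-s*\<^sub>R y)\<bullet>y)) (at s)" for s
  proof -
   have "((\<lambda>s. f (x-s*\<^sub>R y)) has_derivative (\<lambda>s'. g (x-s*\<^sub>R y)\<bullet>(- (s'*\<^sub>R y)))) (at s)"
    by (rule has_derivative_compose[OF _ f]) (auto intro!: derivative_eq_intros)
   then show ?thesis
    unfolding has_field_derivative_def by (rule has_derivative_eq_rhs) (auto simp: fun_eq_iff)
  qed
  have ct: "isCont (\<lambda>s. - (g (x-s*\<^sub>R y)\<bullet>y)) s" for s
   using cgp[of x] by (intro continuous_intros) (simp add: continuous_on_eq_continuous_at)
  have ftc: "(LINT s|lborel. - (g (x-s*\<^sub>R y)\<bullet>y)*indicator {0..1} s) = f (x-1*\<^sub>R y)-f (x-0*\<^sub>R y)"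
   by (rule integral_FTC_Icc_real) (use der ct in auto)
  let ?F = "\<lambda>s. norm y*norm (g (x-s*\<^sub>R y))"
  have intI: "L1 ?I" by simp
  have int: "L1 (\<lambda>s. ?I s*?F s powr r)"
  proof -
   have "L1 (\<lambda>s. indicator {0..1} s*\<^sub>R (?F s powr r))"
    by (rule borel_integrable_compact) (use r in \<open>auto intro!: continuous_intros continuous_on_powr' continuous_on_subset[OF cgp]\<close>)
   then show ?thesis by simp
  qed
  have "\<bar>f x-f (x-y)\<bar> = norm (LINT s|lborel. - (g (x-s*\<^sub>R y)\<bullet>y)*indicator {0..1} s)"
   unfolding ftc by simp
  also have "\<dots>\<le>(LINT s|lborel. norm (- (g (x-s*\<^sub>R y)\<bullet>y)*indicator {0..1} s))"
   by (rule integral_norm_bound)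
  also have "\<dots>\<le>(LINT s|lborel. ?I s*?F s)"
  proof (rule Bochner_Integration.integral_mono)
   show "L1 (\<lambda>s. ?I s*?F s)"
    by (rule jensen_powr(1)[OF _ intI _ _ _ int r]) auto
   show "L1 (\<lambda>s. norm (- (g (x-s*\<^sub>R y)\<bullet>y)*indicator {0..1} s))"
   proof -
    have "L1 (\<lambda>s. indicator {0..1} s*\<^sub>R (- (g (x-s*\<^sub>R y)\<bullet>y)))"
     by (rule borel_integrable_compact) (auto intro!: continuous_intros continuous_on_subset[OF cgp])
    then show ?thesis by (intro integrable_norm) (simp add: mult.commute)
   qed
   show "norm (- (g (x-s*\<^sub>R y)\<bullet>y)*indicator {0..1} s)\<le>?I s*?F s" for s
    using Cauchy_Schwarz_ineq2[of "g (x-s*\<^sub>R y)" y] by (auto simp: indicator_def mult.commute)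
  qed
  finally have "\<bar>f x-f (x-y)\<bar> powr r\<le>(LINT s|lborel. ?I s*?F s) powr r"
   using r by (intro powr_mono2) auto
  also have "\<dots>\<le>(LINT s|lborel. ?I s*?F s powr r)"
   by (rule jensen_powr(2)[OF _ intI _ _ _ int r]) auto
  finally have "ennreal (\<bar>f x-f (x-y)\<bar> powr r)\<le>ennreal (LINT s|lborel. ?I s*?F s powr r)"
   by (rule ennreal_leI)
  also have "... = (\<integral>\<^sup>+s. ennreal (?I s*?F s powr r) \<partial>lborel)"
   by (rule nn_integral_eq_integral[symmetric, OF int]) auto
  also have "... = (\<integral>\<^sup>+s. ennreal (?I s)*ennreal (norm y powr r*norm (g (x-s*\<^sub>R y)) powr r) \<partial>lborel)"
   by (intro nn_integral_cong) (simp add: ennreal_mult powr_mult)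
  finally show ?thesis .
 qed
 have cg2: "(\<lambda>p. g (fst p-snd p*\<^sub>R y))\<in>borel_measurable (borel \<Otimes>\<^sub>M borel)"
 proof -
  have "(\<lambda>p::'a\<times>real. g (fst p-snd p*\<^sub>R y))\<in>Borel"
   by (intro borel_measurable_continuous_onI continuous_on_compose2[OF g]) (auto intro!: continuous_intros)
  then show ?thesis by (simp add: borel_prod)
 qed
 note [measurable] = cg2
 have "(\<integral>\<^sup>+x. ennreal (\<bar>f x-f (x-y)\<bar> powr r) \<partial>lborel)
   \<le>(\<integral>\<^sup>+x. \<integral>\<^sup>+s. ennreal (?I s)*ennreal (norm y powr r*norm (g (x-s*\<^sub>R y)) powr r) \<partial>lborel \<partial>lborel)"
  by (intro nn_integral_mono pt)
 also have "... = (\<integral>\<^sup>+s. \<integral>\<^sup>+x. ennreal (?I s)*ennreal (norm y powr r*norm (g (x-s*\<^sub>R y)) powr r) \<partial>lborel \<partial>lborel)"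
  by (rule lborel_pair.Fubini') (simp add: case_prod_beta')
 also have "... = (\<integral>\<^sup>+s. ennreal (?I s)*(ennreal (norm y powr r)*(\<integral>\<^sup>+x. ennreal (norm (g x) powr r) \<partial>lborel)) \<partial>lborel)"
 proof (rule nn_integral_cong)
  fix s :: real
  have [measurable]: "(\<lambda>x. g (x-s*\<^sub>R y))\<in>Borel"
   by (intro borel_measurable_continuous_onI continuous_on_compose2[OF g]) (auto intro!: continuous_intros)
  have "(\<integral>\<^sup>+x. ennreal (?I s)*ennreal (norm y powr r*norm (g (x-s*\<^sub>R y)) powr r) \<partial>lborel)
   = (\<integral>\<^sup>+x. ennreal (?I s)*(ennreal (norm y powr r)*ennreal (norm (g (x-s*\<^sub>R y)) powr r)) \<partial>lborel)"
   by (simp add: ennreal_mult)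
  also have "... = ennreal (?I s)*(ennreal (norm y powr r)*(\<integral>\<^sup>+x. ennreal (norm (g (x-s*\<^sub>R y)) powr r) \<partial>lborel))"
   by (simp add: nn_integral_cmult)
  also have "(\<integral>\<^sup>+x. ennreal (norm (g (x-s*\<^sub>R y)) powr r) \<partial>lborel) = (\<integral>\<^sup>+x. ennreal (norm (g x) powr r) \<partial>lborel)"
   by (rule nn_integral_translate) measurable
  finally show "(\<integral>\<^sup>+x. ennreal (?I s)*ennreal (norm y powr r*norm (g (x-s*\<^sub>R y)) powr r) \<partial>lborel)
   = ennreal (?I s)*(ennreal (norm y powr r)*(\<integral>\<^sup>+x. ennreal (norm (g x) powr r) \<partial>lborel))" .
 qed
 also have "... = (\<integral>\<^sup>+s. ennreal (?I s) \<partial>lborel)*(ennreal (norm y powr r)*(\<integral>\<^sup>+x. ennreal (norm (g x) powr r) \<partial>lborel))"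
  by (rule nn_integral_multc) measurable
 also have "(\<integral>\<^sup>+s. ennreal (?I s) \<partial>lborel) = 1"
  by (subst nn_integral_eq_integral) auto
 finally show ?thesis by simp
qed

definition mollify_div :: "real => ((real^'n)\<times>real => real^'n) => (real^'n)\<times>real => real" where
 "mollify_div d A z = (LINT x|lborel. A (x, snd z)\<bullet>grad (mollifier d) (fst z-x))"

lemma mollify_div_measurable [measurable]:
 assumes [measurable]: "f\<in>Borel" "d > 0"
 shows "mollify_div d f\<in>Borel"
proof -
 have [measurable]: "f\<in>borel_measurable (borel \<Otimes>\<^sub>M borel)" by (simp add: borel_prod)
 have "(\<lambda>z. LINT x|lborel. f (x, snd z)\<bullet>grad (mollifier d) (fst z-x))\<in>borel_measurable (borel \<Otimes>\<^sub>M borel)"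
  by measurable
 then show ?thesis by (simp add: mollify_div_def[abs_def] borel_prod)
qed

lemma bounded_of_vanishing:
 fixes g :: "'a::euclidean_space => 'b::real_normed_vector"
 assumes "continuous_on UNIV g" "\<And>x. norm x > R ==> g x = 0"
 obtains B where "B > 0" "\<And>x. norm (g x)\<le>B"
proof -
 have "compact (g ` cball 0 R)" by (intro compact_continuous_image continuous_on_subset[OF assms(1)]) auto
 then obtain B0 where B0: "\<And>x. x\<in>cball 0 R ==> norm (g x)\<le>B0"
  using bounded_iff compact_imp_bounded by (metis imageI)
 have "norm (g x)\<le>max B0 1" for x using B0[of x] assms(2)[of x] by (cases "norm x\<le>R") auto
 then show thesis by (intro that[of "max B0 1"]) auto
qed

lemma integrable_pair_product:
 fixes f :: "'a::euclidean_space => real" and g :: "'b::euclidean_space => real"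
 assumes f: "L1 f" and g: "L1 g"
 shows "integrable (lborel \<Otimes>\<^sub>M lborel) (\<lambda>(x, y). f x*g y)"
proof (rule lborel_pair.Fubini_integrable)
 have [measurable]: "f\<in>Borel" "g\<in>Borel" using f g by auto
 show "(\<lambda>(x, y). f x*g y)\<in>borel_measurable (lborel \<Otimes>\<^sub>M lborel)" by measurable
 have "(\<lambda>x. LINT y|lborel. norm (case (x, y) of (x, y) => f x*g y)) = (\<lambda>x. \<bar>f x\<bar>*(LINT y|lborel. \<bar>g y\<bar>))"
  by (simp add: abs_mult fun_eq_iff)
 then show "L1 (\<lambda>x. LINT y|lborel. norm (case (x, y) of (x, y) => f x*g y))"
  using f by auto
 show "AE x in lborel. L1 (\<lambda>y. case (x, y) of (x, y) => f x*g y)"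
  using g by auto
qed

text \<open>Under the integral over \<open>x\<close> of \<open>A(x)\<close>, the function \<open>y \<mapsto> \<psi>(y) mollifier d (y - x)\<close> has a gradient of mean zero.\<close>

lemma mollify_div_integration_by_parts:
 fixes A :: "(real^'n)\<times>real => real^'n" and \<psi> :: "real^'n => real" and P :: "real^'n => real^'n"
 assumes A: "L1 (\<lambda>x. A (x, t))" and d: "d > 0"
  and \<psi>: "\<And>x. (\<psi> has_derivative (\<lambda>h. P x\<bullet>h)) (at x)" and P: "continuous_on UNIV P"
  and z: "\<And>x. norm x > R ==> \<psi> x = 0" "\<And>x. norm x > R ==> P x = 0"
 shows "(LINT y|lborel. \<psi> y*mollify_div d A (y, t)) = - (LINT y|lborel. P y\<bullet>mollify d A (y, t))"
proof -
 let ?m = "mollifier d :: real^'n => real" and ?g = "grad (mollifier d) :: real^'n => real^'n"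
 let ?A = "\<lambda>x. A (x, t)"
 have c\<psi>: "continuous_on UNIV \<psi>" by (rule has_derivative_continuous_on, rule has_derivative_at_withinI, rule \<psi>)
 have [measurable]: "\<psi>\<in>Borel" "P\<in>Borel" "?A\<in>Borel"
  using c\<psi> P A by (auto intro: borel_measurable_continuous_onI)
 note [measurable] = mollifier_measurable[OF d] mollifier_grad_measurable[OF d]
 have mout: "norm x > d ==> ?m x = 0" for x using mollifier_outside[OF d, of x] by simp
 obtain B1 where B1: "B1 > 0" "\<And>x. norm (\<psi> x)\<le>B1" using bounded_of_vanishing[OF c\<psi> z(1)] by blast
 obtain B2 where B2: "B2 > 0" "\<And>x. norm (P x)\<le>B2" using bounded_of_vanishing[OF P z(2)] by blast
 obtain B3 where B3: "B3 > 0" "\<And>x. norm (?m x)\<le>B3" using bounded_of_vanishing[OF mollifier_continuous[OF d] mout] by blast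
 obtain B4 where B4: "B4 > 0" "\<And>x. norm (?g x)\<le>B4"
  using bounded_of_vanishing[OF mollifier_grad_continuous[OF d] mollifier_grad_outside[OF d]] by blast
 have iball: "L1 (\<lambda>y. indicator (cball (0::real^'n) R) y :: real)"
  using emeasure_lborel_cball_finite[of "0::real^'n" R] by (auto simp: integrable_indicator_iff less_top)
 have dom: "integrable (lborel \<Otimes>\<^sub>M lborel) (\<lambda>(y, x). indicator (cball (0::real^'n) R) y*(C*norm (?A x)))" for C
  by (rule integrable_pair_product[OF iball]) (use A in auto)
 have int1: "integrable (lborel \<Otimes>\<^sub>M lborel) (\<lambda>(y, x). \<psi> y*(?A x\<bullet>?g (y-x)))"
 proof (rule Bochner_Integration.integrable_bound[OF dom[of "B1*B4"]])
  show "AE z in lborel \<Otimes>\<^sub>M lborel. norm (case z of (y, x) => \<psi> y*(?A x\<bullet>?g (y-x)))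
   \<le>norm (case z of (y, x) => indicator (cball (0::real^'n) R) y*(B1*B4*norm (?A x)))"
  proof (rule AE_I2, clarify)
   fix y x
   have "\<bar>?A x\<bullet>?g (y-x)\<bar>\<le>norm (?A x)*B4"
    using Cauchy_Schwarz_ineq2[of "?A x" "?g (y-x)"] mult_left_mono[OF B4(2)[of "y-x"] norm_ge_zero[of "?A x"]] by linarith
   then have "\<bar>\<psi> y\<bar>*\<bar>?A x\<bullet>?g (y-x)\<bar>\<le>B1*(norm (?A x)*B4)"
    using B1 by (intro mult_mono) auto
   then show "norm (\<psi> y*(?A x\<bullet>?g (y-x)))\<le>norm (indicator (cball (0::real^'n) R) y*(B1*B4*norm (?A x)))"
    using z(1)[of y] B1 B4 by (cases "norm y\<le>R") (auto simp: abs_mult mult_ac)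
  qed
 qed measurable
 have int2: "integrable (lborel \<Otimes>\<^sub>M lborel) (\<lambda>(y, x). P y\<bullet>(?m (y-x)*\<^sub>R ?A x))"
 proof (rule Bochner_Integration.integrable_bound[OF dom[of "B2*B3"]])
  show "AE z in lborel \<Otimes>\<^sub>M lborel. norm (case z of (y, x) => P y\<bullet>(?m (y-x)*\<^sub>R ?A x))
   \<le>norm (case z of (y, x) => indicator (cball (0::real^'n) R) y*(B2*B3*norm (?A x)))"
  proof (rule AE_I2, clarify)
   fix y x
   have "norm (?m (y-x)*\<^sub>R ?A x)\<le>B3*norm (?A x)"
    using mult_right_mono[OF B3(2)[of "y-x"] norm_ge_zero[of "?A x"]] by simp
   then have "norm (P y)*norm (?m (y-x)*\<^sub>R ?A x)\<le>B2*(B3*norm (?A x))"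
    using B2 by (intro mult_mono) auto
   then have "\<bar>P y\<bullet>(?m (y-x)*\<^sub>R ?A x)\<bar>\<le>B2*(B3*norm (?A x))"
    using Cauchy_Schwarz_ineq2[of "P y" "?m (y-x)*\<^sub>R ?A x"] by linarith
   then show "norm (P y\<bullet>(?m (y-x)*\<^sub>R ?A x))\<le>norm (indicator (cball (0::real^'n) R) y*(B2*B3*norm (?A x)))"
    using z(2)[of y] B2 B3 by (cases "norm y\<le>R") (auto simp: mult_ac)
  qed
 qed measurable
 have ibp: "(LINT y|lborel. \<psi> y*(?A x\<bullet>?g (y-x))) = - (LINT y|lborel. P y\<bullet>(?m (y-x)*\<^sub>R ?A x))" for x
 proof -
  have "((\<lambda>y. \<psi> y*?m (y-x)) has_derivative (\<lambda>h. (\<psi> y*\<^sub>R ?g (y-x)+?m (y-x)*\<^sub>R P y)\<bullet>h)) (at y)" for y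
  proof -
   have 1: "((\<lambda>y. ?m (y-x)) has_derivative (\<lambda>h. ?g (y-x)\<bullet>h)) (at y)"
    by (rule has_derivative_compose[OF _ mollifier_has_derivative[OF d], of "\<lambda>y. y-x" "\<lambda>h. h"]) (auto intro!: derivative_eq_intros)
   show ?thesis
    using has_derivative_mult[OF \<psi>[of y] 1] by (rule has_derivative_eq_rhs) (auto simp: fun_eq_iff inner_add_left)
  qed
  then have "(LINT y|lborel. (\<psi> y*\<^sub>R ?g (y-x)+?m (y-x)*\<^sub>R P y)\<bullet>?A x) = 0"
  proof (rule integral_inner_grad_eq_0[where R = R])
   show "continuous_on UNIV (\<lambda>y. \<psi> y*\<^sub>R ?g (y-x)+?m (y-x)*\<^sub>R P y)"
    by (intro continuous_intros c\<psi> P continuous_on_compose2[OF mollifier_grad_continuous[OF d]]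
      continuous_on_compose2[OF mollifier_continuous[OF d]]) auto
  qed (use z in auto)
  moreover have "(\<lambda>y. (\<psi> y*\<^sub>R ?g (y-x)+?m (y-x)*\<^sub>R P y)\<bullet>?A x) = (\<lambda>y. \<psi> y*(?A x\<bullet>?g (y-x))+P y\<bullet>(?m (y-x)*\<^sub>R ?A x))"
   by (auto simp: fun_eq_iff inner_add_left inner_commute[of "?A x"])
  moreover have "L1 (\<lambda>y. \<psi> y*(?A x\<bullet>?g (y-x)))"
  proof -
   have "L1 (\<lambda>y. indicator (cball 0 R) y*\<^sub>R (\<psi> y*(?A x\<bullet>?g (y-x))))"
    by (rule borel_integrable_compact) (auto intro!: continuous_intros continuous_on_subset[OF c\<psi>] continuous_on_compose2[OF mollifier_grad_continuous[OF d]])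
   moreover have "(\<lambda>y. indicator (cball 0 R) y*\<^sub>R (\<psi> y*(?A x\<bullet>?g (y-x)))) = (\<lambda>y. \<psi> y*(?A x\<bullet>?g (y-x)))"
    using z(1) by (auto simp: indicator_def fun_eq_iff)
   ultimately show ?thesis by (simp only:)
  qed
  moreover have "L1 (\<lambda>y. P y\<bullet>(?m (y-x)*\<^sub>R ?A x))"
  proof -
   have "L1 (\<lambda>y. indicator (cball 0 R) y*\<^sub>R (P y\<bullet>(?m (y-x)*\<^sub>R ?A x)))"
    by (rule borel_integrable_compact) (auto intro!: continuous_intros continuous_on_subset[OF P] continuous_on_compose2[OF mollifier_continuous[OF d]])
   moreover have "(\<lambda>y. indicator (cball 0 R) y*\<^sub>R (P y\<bullet>(?m (y-x)*\<^sub>R ?A x))) = (\<lambda>y. P y\<bullet>(?m (y-x)*\<^sub>R ?A x))"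
    using z(2) by (auto simp: indicator_def fun_eq_iff)
   ultimately show ?thesis by (simp only:)
  qed
  ultimately show ?thesis by (simp only: Bochner_Integration.integral_add)
 qed
 have iA: "L1 (\<lambda>x. ?m (y-x)*\<^sub>R ?A x)" for y
  by (rule mollifier_prod_integrable[OF A mollifier_continuous[OF d] mout])
 have "(LINT y|lborel. \<psi> y*mollify_div d A (y, t)) = (LINT y|lborel. LINT x|lborel. \<psi> y*(?A x\<bullet>?g (y-x)))"
  by (simp add: mollify_div_def)
 also have "... = (LINT x|lborel. LINT y|lborel. \<psi> y*(?A x\<bullet>?g (y-x)))"
  using lborel_pair.Fubini_integral[OF int1] by simp
 also have "... = - (LINT x|lborel. LINT y|lborel. P y\<bullet>(?m (y-x)*\<^sub>R ?A x))"
  by (simp only: ibp integral_minus)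
 also have "(LINT x|lborel. LINT y|lborel. P y\<bullet>(?m (y-x)*\<^sub>R ?A x)) = (LINT y|lborel. LINT x|lborel. P y\<bullet>(?m (y-x)*\<^sub>R ?A x))"
  using lborel_pair.Fubini_integral[OF int2] by simp
 also have "... = (LINT y|lborel. P y\<bullet>mollify d A (y, t))"
  by (simp only: mollify_def fst_conv snd_conv integral_inner_right[OF iA])
 finally show ?thesis .
qed

section \<open>Local solutions and their mollified energy identity\<close>

lemma AE_lborel_slice:
 fixes P :: "'a::euclidean_space\<times>real => bool"
 assumes "AE z in lborel. P z"
 shows "AE t in lborel. AE x in lborel. P (x, t)"
proof -
 obtain N where N: "N\<in>null_sets lborel" "{z\<in>space lborel. \<not> P z} \<subseteq> N"
  using assms by (auto simp: eventually_ae_filter)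
 have N': "N\<in>sets (lborel \<Otimes>\<^sub>M lborel)" using N(1) unfolding lborel_prod by auto
 have "AE z in lborel. z \<notin> N" using N(1) by (rule AE_not_in)
 then have "AE z in lborel \<Otimes>\<^sub>M lborel. z \<notin> N" unfolding lborel_prod .
 then have "AE x in lborel. AE t in lborel. (x, t) \<notin> N" by (rule lborel_pair.AE_pair)
 moreover have "{z\<in>space (lborel \<Otimes>\<^sub>M lborel). (fst z, snd z) \<notin> N}\<in>sets (lborel \<Otimes>\<^sub>M lborel)"
 proof -
  have "{z\<in>space (lborel \<Otimes>\<^sub>M lborel). (fst z, snd z) \<notin> N} = space (lborel \<Otimes>\<^sub>M lborel)-N" by auto
  then show ?thesis using sets.compl_sets[OF N'] by (simp only:)
 qed
 ultimately have "AE t in lborel. AE x in lborel. (x, t) \<notin> N"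
  by (subst (asm) lborel_pair.AE_commute) auto
 then show ?thesis
  by (rule AE_mp) (rule AE_I2, rule impI, erule AE_mp, rule AE_I2, use N in auto)
qed

lemma
 fixes f :: "'a::euclidean_space\<times>real => 'b::euclidean_space"
 assumes f: "L1 f"
 shows AE_integrable_slice: "AE t in lborel. L1 (\<lambda>x. f (x, t))"
  and integrable_slice_integral: "L1 (\<lambda>t. LINT x|lborel. f (x, t))"
  and integral_slice_integral: "(LINT t|lborel. LINT x|lborel. f (x, t)) = (LINT z|lborel. f z)"
proof -
 have f': "integrable (lborel \<Otimes>\<^sub>M lborel) (\<lambda>(x, t). f (x, t))" using f by (simp add: lborel_prod)
 show "AE t in lborel. L1 (\<lambda>x. f (x, t))" by (rule lborel_pair.AE_integrable_snd[OF f'])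
 show "L1 (\<lambda>t. LINT x|lborel. f (x, t))" by (rule lborel_pair.integrable_snd[OF f'])
 show "(LINT t|lborel. LINT x|lborel. f (x, t)) = (LINT z|lborel. f z)"
  using lborel_pair.integral_snd[OF f'] by (simp add: lborel_prod)
qed

text \<open>Young's inequality without its constants, which do not matter for integrability.\<close>

lemma abs_inner_le_powr:
 fixes a b :: "'a::real_inner"
 assumes "p > 1" "q = p/(p-1)"
 shows "\<bar>a\<bullet>b\<bar>\<le>norm a powr p+norm b powr q"
proof -
 have q: "q > 1" "1/p+1/q = 1" using assms(1) unfolding assms(2) by (auto simp: field_simps)
 have "\<bar>a\<bullet>b\<bar>\<le>norm a*norm b" by (rule Cauchy_Schwarz_ineq2)
 also have "\<dots>\<le>norm a powr p/p+norm b powr q/q"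
  using assms q by (intro Youngs_inequality) auto
 also have "\<dots>\<le>norm a powr p+norm b powr q"
  using divide_left_mono[of 1 p "norm a powr p"] divide_left_mono[of 1 q "norm b powr q"] assms(1) q by simp
 finally show ?thesis .
qed

text \<open>What remains of a weak solution after localization: Borel representatives of \<open>u\<close>, of its weak gradient \<open>D\<close> and of
the flux \<open>A\<close>, set to zero outside a cylinder, together with the equation integrated over time. The identity is required
only between times of a set \<open>T0\<close> of full measure, because representatives are determined only almost everywhere.\<close>

locale local_solution =
 fixes p q \<Lambda>0 \<Lambda>1 R0 \<theta> :: real
  and u :: "(real^'n)\<times>real => real" and D A :: "(real^'n)\<times>real => real^'n" and T0 :: "real set"
 assumes p: "p > 1" and q: "q = p/(p-1)" and \<Lambda>: "0 < \<Lambda>0" "0 < \<Lambda>1" and R0: "R0 > 0" and \<theta>: "\<theta> > 0"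
  and u_borel: "u\<in>Borel" and D_borel: "D\<in>Borel" and A_borel: "A\<in>Borel"
  and vanish: "\<And>z. z \<notin> ball 0 R0\<times>{-\<theta>..\<theta>} ==> u z = 0 \<and> D z = 0 \<and> A z = 0"
  and u_p: "L1 (\<lambda>z. norm (u z) powr p)" and D_p: "L1 (\<lambda>z. norm (D z) powr p)"
  and A_q: "L1 (\<lambda>z. norm (A z) powr q)" and u_2: "L1 (\<lambda>z. (u z)\<^sup>2)"
  and weak_grad: "AE t in lborel. \<forall>\<phi>\<in>test_functions (ball 0 R0).
    (LINT x|lborel. u (x, t)*\<^sub>R grad \<phi> x) = - (LINT x|lborel. \<phi> x*\<^sub>R D (x, t))"
  and struct: "AE z in lborel. A z\<bullet>D z\<ge>\<Lambda>0*norm (D z) powr p \<and> norm (A z)\<le>\<Lambda>1*norm (D z) powr (p-1)"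
  and T0: "AE t in lborel. t\<in>{-\<theta>..\<theta>} --> t\<in>T0" "T0 \<subseteq> {-\<theta>..\<theta>}"
  and evolution: "\<And>\<phi> s t. \<phi>\<in>test_functions (ball 0 R0) ==> s\<in>T0 ==> t\<in>T0 ==> s\<le>t \<Longrightarrow>
    (LINT x|lborel. u (x, t)*\<phi> x)-(LINT x|lborel. u (x, s)*\<phi> x)
    = - (LINT \<tau>|lborel. indicator {s..t} \<tau>*(LINT x|lborel. A (x, \<tau>)\<bullet>grad \<phi> x))"
begin

lemmas [measurable] = u_borel D_borel A_borel

lemma q1: "q > 1" using p unfolding q by (simp add: field_simps)

lemma cylinder_integrable: "L1 (\<lambda>z. indicator (ball (0::real^'n) R0\<times>{-\<theta>..\<theta>}) z :: real)"
proof -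
 have "bounded (ball (0::real^'n) R0\<times>{-\<theta>..\<theta>})" by (intro bounded_Times bounded_ball bounded_closed_interval)
 then have "emeasure lborel (ball (0::real^'n) R0\<times>{-\<theta>..\<theta>}) < \<infinity>" by (rule emeasure_bounded_finite)
 moreover have "ball (0::real^'n) R0\<times>{-\<theta>..\<theta>}\<in>sets borel"
  unfolding borel_prod[symmetric] by (intro pair_measureI) auto
 ultimately show ?thesis by (intro integrable_real_indicator) auto
qed

lemma L1_of_Lp:
 fixes f :: "(real^'n)\<times>real => 'b::euclidean_space"
 assumes [measurable]: "f\<in>Borel" and f: "L1 (\<lambda>z. norm (f z) powr r)" and r: "r\<ge>1"
  and z: "\<And>z. z \<notin> ball 0 R0\<times>{-\<theta>..\<theta>} ==> f z = 0"
 shows "L1 f"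
proof (rule Bochner_Integration.integrable_bound)
 show "L1 (\<lambda>z. indicator (ball (0::real^'n) R0\<times>{-\<theta>..\<theta>}) z+norm (f z) powr r)"
  using cylinder_integrable f by (rule Bochner_Integration.integrable_add)
 show "AE w in lborel. norm (f w)\<le>norm (indicator (ball 0 R0\<times>{-\<theta>..\<theta>}) w+norm (f w) powr r)"
 proof (rule AE_I2)
  fix w
  show "norm (f w)\<le>norm (indicator (ball 0 R0\<times>{-\<theta>..\<theta>}) w+norm (f w) powr r)"
   using le_one_plus_powr[OF norm_ge_zero r, of "f w"] z[of w]
   by (cases "w\<in>ball 0 R0\<times>{-\<theta>..\<theta>}") auto
 qed
qed auto

lemma u_1: "L1 u"
 by (rule L1_of_Lp[OF u_borel u_p less_imp_le[OF p]]) (simp add: vanish)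

lemma D_1: "L1 D"
 by (rule L1_of_Lp[OF D_borel D_p less_imp_le[OF p]]) (simp add: vanish)

lemma A_1: "L1 A"
 by (rule L1_of_Lp[OF A_borel A_q less_imp_le[OF q1]]) (simp add: vanish)

text \<open>The evolution identity tested with the mollifier centred at \<open>y\<close>; at a fixed point \<open>y\<close> it exhibits the mollified
solution as an integral function of time.\<close>

lemma mollified_evolution:
 assumes d: "d > 0" and y: "cball y d \<subseteq> ball 0 R0" and st: "s\<in>T0" "t\<in>T0" "s\<le>t"
 shows "mollify d u (y, t) = mollify d u (y, s)+(LINT \<tau>|lborel. indicator {s..t} \<tau>*mollify_div d A (y, \<tau>))"
proof -
 have g: "grad (\<lambda>x. mollifier d (x-y)) x = grad (mollifier d) (x-y)" for x
 proof (rule grad_unique)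
  show "((\<lambda>x. mollifier d (x-y)) has_derivative (\<bullet>) (grad (mollifier d) (x-y))) (at x)"
   by (rule has_derivative_compose[OF _ mollifier_has_derivative[OF d], of "\<lambda>x. x-y" "\<lambda>h. h"])
    (auto intro!: derivative_eq_intros)
 qed
 have m: "grad (mollifier d) (x-y) = - grad (mollifier d) (y-x)" "mollifier d (x-y) = mollifier d (y-x)" for x
  using mollifier_grad_minus[OF d, of "y-x"] mollifier_minus[OF d, of "y-x"] by simp_all
 have U: "(LINT x|lborel. u (x, r)*mollifier d (x-y)) = mollify d u (y, r)" for r
  by (simp add: mollify_def m mult.commute)
 have V: "(LINT x|lborel. A (x, r)\<bullet>grad (\<lambda>x. mollifier d (x-y)) x) = - mollify_div d A (y, r)" for r
  unfolding g m(1) by (simp add: mollify_div_def)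
 from evolution[OF mollifier_test_function[OF d y] st, unfolded U V] show ?thesis by simp
qed

lemma mollify_div_bound:
 assumes d: "d > 0"
 obtains B where "B > 0" "\<And>y \<tau>. L1 (\<lambda>x. A (x, \<tau>)) ==> \<bar>mollify_div d A (y, \<tau>)\<bar>\<le>B*(LINT x|lborel. norm (A (x, \<tau>)))"
proof -
 obtain B where B: "B > 0" "\<And>x::real^'n. norm (grad (mollifier d) x)\<le>B"
  using bounded_of_vanishing[OF mollifier_grad_continuous[OF d] mollifier_grad_outside[OF d]] by blast
 have "\<bar>mollify_div d A (y, \<tau>)\<bar>\<le>B*(LINT x|lborel. norm (A (x, \<tau>)))" if i: "L1 (\<lambda>x. A (x, \<tau>))" for y \<tau>
 proof -
  note [measurable] = mollifier_grad_measurable[OF d]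
  have b: "\<bar>A (x, \<tau>)\<bullet>grad (mollifier d) (y-x)\<bar>\<le>B*norm (A (x, \<tau>))" for x
   using Cauchy_Schwarz_ineq2[of "A (x, \<tau>)" "grad (mollifier d) (y-x)"]
    mult_left_mono[OF B(2)[of "y-x"] norm_ge_zero[of "A (x, \<tau>)"]] by (simp add: mult.commute)
  have iB: "L1 (\<lambda>x. B*norm (A (x, \<tau>)))" using i by auto
  have int: "L1 (\<lambda>x. A (x, \<tau>)\<bullet>grad (mollifier d) (y-x))"
  proof (rule Bochner_Integration.integrable_bound[OF iB])
   show "AE x in lborel. norm (A (x, \<tau>)\<bullet>grad (mollifier d) (y-x))\<le>norm (B*norm (A (x, \<tau>)))"
    using b B(1) by (intro AE_I2) auto
  qed measurable
  have "\<bar>mollify_div d A (y, \<tau>)\<bar>\<le>(LINT x|lborel. \<bar>A (x, \<tau>)\<bullet>grad (mollifier d) (y-x)\<bar>)"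
   using integral_norm_bound[of lborel "\<lambda>x. A (x, \<tau>)\<bullet>grad (mollifier d) (y-x)"] by (simp add: mollify_div_def)
  also have "\<dots>\<le>(LINT x|lborel. B*norm (A (x, \<tau>)))"
   using int iB b by (intro Bochner_Integration.integral_mono) auto
  finally show ?thesis by simp
 qed
 with B(1) show thesis by (rule that)
qed

text \<open>Chain rule in time at each point \<open>y\<close>, then Fubini, then integration by parts in \<open>y\<close> at each time.\<close>

lemma mollified_energy:
 fixes \<xi> :: "real^'n => real" and P :: "real^'n => real^'n"
 assumes d: "0 < d" "R+d < R0"
  and G: "\<And>x. (G has_real_derivative F x) (at x)" and F: "\<And>x. (F has_real_derivative g x) (at x)"
  and g: "continuous_on UNIV g" and K: "\<And>x. \<bar>F x\<bar>\<le>K"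
  and \<xi>: "\<And>x. (\<xi> has_derivative (\<lambda>h. P x\<bullet>h)) (at x)" and P: "continuous_on UNIV P"
  and z: "\<And>x. norm x > R ==> \<xi> x = 0" "\<And>x. norm x > R ==> P x = 0"
  and st: "s\<in>T0" "t\<in>T0" "s\<le>t"
 shows "(LINT y|lborel. \<xi> y*(G (mollify d u (y, t))-G (mollify d u (y, s))))
  = - (LINT \<tau>|lborel. indicator {s..t} \<tau>*(LINT y|lborel.
     (F (mollify d u (y, \<tau>))*\<^sub>R P y+(\<xi> y*g (mollify d u (y, \<tau>)))*\<^sub>R mollify d D (y, \<tau>))\<bullet>mollify d A (y, \<tau>)))"
proof -
 have c\<xi>: "continuous_on UNIV \<xi>" by (rule has_derivative_continuous_on, rule has_derivative_at_withinI, rule \<xi>)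
 have cF: "continuous_on UNIV F" using F by (auto simp: continuous_on_eq_continuous_at intro: DERIV_isCont)
 have cG: "continuous_on UNIV G" using G by (auto simp: continuous_on_eq_continuous_at intro: DERIV_isCont)
 have [measurable]: "\<xi>\<in>Borel" "F\<in>Borel"
  using c\<xi> cF by (auto intro: borel_measurable_continuous_onI)
 note [measurable] = mollify_measurable[OF u_borel d(1)] mollify_div_measurable[OF A_borel d(1)]
 have K0: "K\<ge>0" using K[of 0] by linarith
 let ?w = "\<lambda>y \<tau>. mollify d u (y, \<tau>)" and ?b = "\<lambda>y \<tau>. mollify_div d A (y, \<tau>)"
 obtain B where B: "B > 0" "\<And>y \<tau>. L1 (\<lambda>x. A (x, \<tau>)) ==> \<bar>?b y \<tau>\<bar>\<le>B*(LINT x|lborel. norm (A (x, \<tau>)))"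
  using mollify_div_bound[OF d(1)] by blast
 have iA: "L1 (\<lambda>\<tau>. B*(LINT x|lborel. norm (A (x, \<tau>))))"
  using integrable_slice_integral[OF integrable_norm[OF A_1]] by auto
 have bm: "?b y\<in>Borel" "(\<lambda>\<tau>. ?w y \<tau>)\<in>Borel" for y
 proof -
  have "mollify_div d A\<in>borel_measurable (borel \<Otimes>\<^sub>M borel)" "mollify d u\<in>borel_measurable (borel \<Otimes>\<^sub>M borel)"
   by (simp_all add: borel_prod)
  then show "?b y\<in>Borel" "(\<lambda>\<tau>. ?w y \<tau>)\<in>Borel" by measurable
 qed
 note [measurable] = bm
 have bB: "AE \<tau> in lborel. \<forall>y. \<bar>?b y \<tau>\<bar>\<le>B*(LINT x|lborel. norm (A (x, \<tau>)))"
  using AE_integrable_slice[OF A_1] by eventually_elim (use B(2) in blast)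
 have ib: "L1 (?b y)" for y
 proof (rule Bochner_Integration.integrable_bound[OF iA])
  show "AE \<tau> in lborel. norm (?b y \<tau>)\<le>norm (B*(LINT x|lborel. norm (A (x, \<tau>))))"
   using bB
  proof eventually_elim
   case (elim \<tau>)
   then have "\<bar>?b y \<tau>\<bar>\<le>B*(LINT x|lborel. norm (A (x, \<tau>)))" by blast
   then show ?case using abs_ge_self order_trans unfolding real_norm_def by blast
  qed
 qed measurable
 have time: "G (?w y t)-G (?w y s) = (LINT \<tau>|lborel. indicator {s..t} \<tau>*(F (?w y \<tau>)*?b y \<tau>))" if y: "norm y\<le>R" for y
 proof -
  have yU: "cball y d \<subseteq> ball 0 R0"
  proof
   fix x assume "x\<in>cball y d"
   then have "norm (x-y)\<le>d" by (simp add: dist_norm norm_minus_commute)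
   then show "x\<in>ball 0 R0" using norm_triangle_ineq[of "x-y" y] y d by simp
  qed
  define U where "U \<tau> = ?w y s+(LINT r|lborel. indicator {s..\<tau>} r*?b y r)" for \<tau>
  have "G (U t)-G (U s) = (LINT \<tau>|lborel. indicator {s..t} \<tau>*(F (U \<tau>)*?b y \<tau>))"
   by (rule chain_rule_integral_function[OF ib st(3) G cF K]) (simp add: U_def)
  moreover have "U \<tau> = ?w y \<tau>" if "\<tau>\<in>T0" "s\<le>\<tau>" for \<tau>
   using mollified_evolution[OF d(1) yU st(1) that] by (simp add: U_def)
  moreover have "(LINT \<tau>|lborel. indicator {s..t} \<tau>*(F (U \<tau>)*?b y \<tau>)) = (LINT \<tau>|lborel. indicator {s..t} \<tau>*(F (?w y \<tau>)*?b y \<tau>))"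
  proof (rule integral_cong_AE)
   have "AE \<tau> in lborel. indicator {s..t} \<tau>*(F (U \<tau>)*?b y \<tau>) = indicator {s..t} \<tau>*(F (?w y \<tau>)*?b y \<tau>)"
    using T0(1)
   proof eventually_elim
    case (elim \<tau>)
    show ?case
    proof (cases "\<tau>\<in>{s..t}")
     case True
     then have "\<tau>\<in>{-\<theta>..\<theta>}" using T0(2) st by (auto simp: subset_eq)
     then show ?thesis using elim calculation(2)[of \<tau>] True by simp
    qed simp
   qed
   then show "AE \<tau> in lborel. indicator {s..t} \<tau>*(F (U \<tau>)*?b y \<tau>) = indicator {s..t} \<tau>*(F (?w y \<tau>)*?b y \<tau>)" .
   show "(\<lambda>\<tau>. indicator {s..t} \<tau>*(F (?w y \<tau>)*?b y \<tau>))\<in>borel_measurable lborel" by measurable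
   have "continuous_on UNIV (\<lambda>\<tau>. LINT r|lborel. indicator {s..\<tau>} r*?b y r)"
   proof -
    have "((\<lambda>\<tau>. LINT r|lborel. indicator {s..\<tau>} r*?b y r) \<longlongrightarrow> (LINT r|lborel. indicator {s..\<tau>0} r*?b y r)) (at \<tau>0)" for \<tau>0
    proof (rule tendsto_at_iff_sequentially[THEN iffD2], intro allI impI, unfold comp_def)
     fix X :: "nat => real" assume X: "\<forall>i. X i\<in>UNIV-{\<tau>0}" "X \<longlonglongrightarrow> \<tau>0"
     show "(\<lambda>i. LINT r|lborel. indicator {s..X i} r*?b y r) \<longlonglongrightarrow> (LINT r|lborel. indicator {s..\<tau>0} r*?b y r)"
     proof (rule integral_dominated_convergence)
      show "L1 (\<lambda>r. \<bar>?b y r\<bar>)" using ib by auto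
      show "AE r in lborel. (\<lambda>i. indicator {s..X i} r*?b y r) \<longlonglongrightarrow> indicator {s..\<tau>0} r*?b y r"
       using AE_lborel_singleton[of \<tau>0]
      proof eventually_elim
       case (elim r)
       then consider "r < \<tau>0" | "r > \<tau>0" by linarith
       then show ?case
       proof cases
        case 1
        have "\<forall>\<^sub>F i in sequentially. X i > r" using X(2) 1 by (rule order_tendstoD)
        then have "\<forall>\<^sub>F i in sequentially. indicator {s..X i} r*?b y r = indicator {s..\<tau>0} r*?b y r"
         by eventually_elim (use 1 in \<open>auto simp: indicator_def\<close>)
        then show ?thesis by (rule tendsto_eventually)
       next
        case 2
        have "\<forall>\<^sub>F i in sequentially. X i < r" using X(2) 2 by (rule order_tendstoD)
        then have "\<forall>\<^sub>F i in sequentially. indicator {s..X i} r*?b y r = indicator {s..\<tau>0} r*?b y r"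
         by eventually_elim (use 2 in \<open>auto simp: indicator_def\<close>)
        then show ?thesis by (rule tendsto_eventually)
       qed
      qed
      show "AE r in lborel. norm (indicator {s..X i} r*?b y r)\<le>\<bar>?b y r\<bar>" for i
       by (rule AE_I2) (auto simp: indicator_def)
     qed measurable
    qed
    then show ?thesis by (simp add: continuous_on_eq_continuous_at isCont_def)
   qed
   then have "continuous_on UNIV U" unfolding U_def by (intro continuous_intros)
   then have [measurable]: "U\<in>Borel" by (rule borel_measurable_continuous_onI)
   show "(\<lambda>\<tau>. indicator {s..t} \<tau>*(F (U \<tau>)*?b y \<tau>))\<in>borel_measurable lborel" by measurable
  qed
  ultimately show ?thesis using st by simp
 qed
 obtain B1 where B1: "B1 > 0" "\<And>x. norm (\<xi> x)\<le>B1" using bounded_of_vanishing[OF c\<xi> z(1)] by blast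
 have iball: "L1 (\<lambda>y::real^'n. indicator (cball 0 R) y :: real)"
  using emeasure_lborel_cball_finite[of "0::real^'n" R] by (intro integrable_real_indicator) auto
 have m2: "mollify_div d A\<in>borel_measurable (borel \<Otimes>\<^sub>M borel)" "mollify d u\<in>borel_measurable (borel \<Otimes>\<^sub>M borel)"
  by (simp_all add: borel_prod)
 note [measurable] = m2
 have iprod: "integrable (lborel \<Otimes>\<^sub>M lborel) (\<lambda>(y, \<tau>). \<xi> y*(indicator {s..t} \<tau>*(F (?w y \<tau>)*?b y \<tau>)))"
 proof (rule Bochner_Integration.integrable_bound)
  show dom: "integrable (lborel \<Otimes>\<^sub>M lborel) (\<lambda>(y::real^'n, \<tau>). indicator (cball 0 R) y*((B1*K)*(B*(LINT x|lborel. norm (A (x, \<tau>))))))"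
   by (rule integrable_pair_product[OF iball]) (use iA in auto)
  show mm: "(\<lambda>(y, \<tau>). \<xi> y*(indicator {s..t} \<tau>*(F (?w y \<tau>)*?b y \<tau>)))\<in>borel_measurable (lborel \<Otimes>\<^sub>M lborel)"
   by measurable
  have lm: "(\<lambda>\<tau>. LINT x|lborel. norm (A (x, \<tau>)))\<in>Borel"
   using integrable_slice_integral[OF integrable_norm[OF A_1]] by auto
  note [measurable] = lm
  show "AE z in lborel \<Otimes>\<^sub>M lborel. norm (case z of (y, \<tau>) => \<xi> y*(indicator {s..t} \<tau>*(F (?w y \<tau>)*?b y \<tau>)))
   \<le>norm (case z of (y, \<tau>) => indicator (cball 0 R) y*((B1*K)*(B*(LINT x|lborel. norm (A (x, \<tau>))))))"
  proof (rule lborel_pair.AE_pair_measure)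
   show "{z\<in>space (lborel \<Otimes>\<^sub>M lborel). norm (case z of (y, \<tau>) => \<xi> y*(indicator {s..t} \<tau>*(F (?w y \<tau>)*?b y \<tau>)))
   \<le>norm (case z of (y, \<tau>) => indicator (cball 0 R) y*((B1*K)*(B*(LINT x|lborel. norm (A (x, \<tau>))))))}\<in>sets (lborel \<Otimes>\<^sub>M lborel)"
    by (rule borel_measurable_le[OF measurable_compose[OF mm borel_measurable_norm]
       measurable_compose[OF borel_measurable_integrable[OF dom] borel_measurable_norm]])
   show "AE y in lborel. AE \<tau> in lborel. norm (case (y, \<tau>) of (y, \<tau>) => \<xi> y*(indicator {s..t} \<tau>*(F (?w y \<tau>)*?b y \<tau>)))
   \<le>norm (case (y, \<tau>) of (y, \<tau>) => indicator (cball 0 R) y*((B1*K)*(B*(LINT x|lborel. norm (A (x, \<tau>))))))"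
   proof (rule AE_I2)
    fix y :: "real^'n"
    show "AE \<tau> in lborel. norm (case (y, \<tau>) of (y, \<tau>) => \<xi> y*(indicator {s..t} \<tau>*(F (?w y \<tau>)*?b y \<tau>)))
   \<le>norm (case (y, \<tau>) of (y, \<tau>) => indicator (cball 0 R) y*((B1*K)*(B*(LINT x|lborel. norm (A (x, \<tau>))))))"
     using bB
    proof eventually_elim
     case (elim \<tau>)
     have b: "\<bar>?b y \<tau>\<bar>\<le>B*(LINT x|lborel. norm (A (x, \<tau>)))" using elim by blast
     let ?L = "LINT x|lborel. norm (A (x, \<tau>))"
     have \<xi>B: "\<bar>\<xi> y\<bar>\<le>B1*indicator (cball 0 R) y" using B1(2)[of y] z(1)[of y] by (cases "norm y\<le>R") auto
     have fb: "\<bar>F (?w y \<tau>)\<bar>*\<bar>?b y \<tau>\<bar>\<le>K*(B*?L)"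
      by (rule mult_mono[OF K b K0]) simp
     have ifb: "indicator {s..t} \<tau>*(\<bar>F (?w y \<tau>)\<bar>*\<bar>?b y \<tau>\<bar>)\<le>1*(K*(B*?L))"
      by (rule mult_mono[OF _ fb]) (auto simp: indicator_def)
     have "norm (\<xi> y*(indicator {s..t} \<tau>*(F (?w y \<tau>)*?b y \<tau>))) = \<bar>\<xi> y\<bar>*(indicator {s..t} \<tau>*(\<bar>F (?w y \<tau>)\<bar>*\<bar>?b y \<tau>\<bar>))"
      by (simp add: abs_mult)
     moreover have "\<dots>\<le>(B1*indicator (cball 0 R) y)*(1*(K*(B*?L)))"
      by (rule mult_mono[OF \<xi>B ifb]) (use B1 in auto)
     moreover have "(B1*indicator (cball 0 R) y)*(1*(K*(B*?L))) = indicator (cball 0 R) y*((B1*K)*(B*?L))"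
      by simp
     ultimately have "norm (\<xi> y*(indicator {s..t} \<tau>*(F (?w y \<tau>)*?b y \<tau>)))\<le>indicator (cball 0 R) y*((B1*K)*(B*?L))"
      by linarith
     then show ?case unfolding prod.case real_norm_def using abs_ge_self order_trans by blast
    qed
   qed
  qed
 qed
 have "(LINT y|lborel. \<xi> y*(G (?w y t)-G (?w y s))) = (LINT y|lborel. LINT \<tau>|lborel. \<xi> y*(indicator {s..t} \<tau>*(F (?w y \<tau>)*?b y \<tau>)))"
 proof (rule Bochner_Integration.integral_cong[OF refl])
  fix y
  show "\<xi> y*(G (?w y t)-G (?w y s)) = (LINT \<tau>|lborel. \<xi> y*(indicator {s..t} \<tau>*(F (?w y \<tau>)*?b y \<tau>)))"
   using time[of y] z(1)[of y] by (cases "norm y\<le>R") auto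
 qed
 also have "... = (LINT \<tau>|lborel. LINT y|lborel. \<xi> y*(indicator {s..t} \<tau>*(F (?w y \<tau>)*?b y \<tau>)))"
  using lborel_pair.Fubini_integral[OF iprod] by simp
 also have "... = (LINT \<tau>|lborel. indicator {s..t} \<tau>*(LINT y|lborel. (\<xi> y*F (?w y \<tau>))*?b y \<tau>))"
 proof (rule Bochner_Integration.integral_cong[OF refl])
  fix \<tau>
  show "(LINT y|lborel. \<xi> y*(indicator {s..t} \<tau>*(F (?w y \<tau>)*?b y \<tau>))) = indicator {s..t} \<tau>*(LINT y|lborel. (\<xi> y*F (?w y \<tau>))*?b y \<tau>)"
   by (cases "\<tau>\<in>{s..t}") (simp_all add: mult.assoc)
 qed
 also have "... = (LINT \<tau>|lborel. - (indicator {s..t} \<tau>*(LINT y|lborel.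
     (F (?w y \<tau>)*\<^sub>R P y+(\<xi> y*g (?w y \<tau>))*\<^sub>R mollify d D (y, \<tau>))\<bullet>mollify d A (y, \<tau>))))"
 proof (rule integral_cong_AE)
  have mg: "g\<in>Borel" "P\<in>Borel"
   using g P by (auto intro: borel_measurable_continuous_onI)
  have mm: "mollify d D\<in>borel_measurable (borel \<Otimes>\<^sub>M borel)" "mollify d A\<in>borel_measurable (borel \<Otimes>\<^sub>M borel)"
   using mollify_measurable[OF D_borel d(1)] mollify_measurable[OF A_borel d(1)] by (simp_all add: borel_prod)
  note [measurable] = mg mm
  show "(\<lambda>\<tau>. indicator {s..t} \<tau>*(LINT y|lborel. (\<xi> y*F (?w y \<tau>))*?b y \<tau>))\<in>borel_measurable lborel"
   by measurable
  show "(\<lambda>\<tau>. - (indicator {s..t} \<tau>*(LINT y|lborel.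
     (F (?w y \<tau>)*\<^sub>R P y+(\<xi> y*g (?w y \<tau>))*\<^sub>R mollify d D (y, \<tau>))\<bullet>mollify d A (y, \<tau>))))\<in>borel_measurable lborel"
   by measurable
  show "AE \<tau> in lborel. indicator {s..t} \<tau>*(LINT y|lborel. (\<xi> y*F (?w y \<tau>))*?b y \<tau>) = - (indicator {s..t} \<tau>*(LINT y|lborel.
     (F (?w y \<tau>)*\<^sub>R P y+(\<xi> y*g (?w y \<tau>))*\<^sub>R mollify d D (y, \<tau>))\<bullet>mollify d A (y, \<tau>)))"
   using AE_integrable_slice[OF A_1] AE_integrable_slice[OF u_1] weak_grad
  proof eventually_elim
   case (elim \<tau>)
   let ?P = "\<lambda>y. F (?w y \<tau>)*\<^sub>R P y+(\<xi> y*g (?w y \<tau>))*\<^sub>R mollify_grad d u (y, \<tau>)"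
   have wd: "((\<lambda>y. ?w y \<tau>) has_derivative (\<lambda>h. mollify_grad d u (y, \<tau>)\<bullet>h)) (at y)" for y
    by (rule mollify_has_derivative[OF elim(2) d(1)])
   have wc: "continuous_on UNIV (\<lambda>y. ?w y \<tau>)"
    by (rule has_derivative_continuous_on, rule has_derivative_at_withinI, rule wd)
   have ibp: "(LINT y|lborel. (\<xi> y*F (?w y \<tau>))*?b y \<tau>) = - (LINT y|lborel. ?P y\<bullet>mollify d A (y, \<tau>))"
   proof (rule mollify_div_integration_by_parts[OF elim(1) d(1), where R = R])
    fix y
    have 1: "((\<lambda>y. F (?w y \<tau>)) has_derivative (\<lambda>h. g (?w y \<tau>)*(mollify_grad d u (y, \<tau>)\<bullet>h))) (at y)"
     using has_derivative_compose[OF wd F[of "?w y \<tau>", unfolded has_field_derivative_def]] .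
    show "((\<lambda>y. \<xi> y*F (?w y \<tau>)) has_derivative (\<bullet>) (?P y)) (at y)"
     using has_derivative_mult[OF \<xi>[of y] 1]
     by (rule has_derivative_eq_rhs) (auto simp: fun_eq_iff inner_add_left algebra_simps)
   next
    show "continuous_on UNIV ?P"
     by (intro continuous_intros P c\<xi> continuous_on_compose2[OF cF wc] continuous_on_compose2[OF g wc]
       mollify_grad_continuous[OF elim(2) d(1)]) auto
   qed (use z in auto)
   have eqP: "(\<lambda>y. ?P y\<bullet>mollify d A (y, \<tau>)) = (\<lambda>y. (F (?w y \<tau>)*\<^sub>R P y+(\<xi> y*g (?w y \<tau>))*\<^sub>R mollify d D (y, \<tau>))\<bullet>mollify d A (y, \<tau>))"
   proof (rule ext)
    fix y
    show "?P y\<bullet>mollify d A (y, \<tau>) = (F (?w y \<tau>)*\<^sub>R P y+(\<xi> y*g (?w y \<tau>))*\<^sub>R mollify d D (y, \<tau>))\<bullet>mollify d A (y, \<tau>)"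
    proof (cases "norm y\<le>R")
     case True
     have yU: "cball y d \<subseteq> ball 0 R0"
     proof
      fix x assume "x\<in>cball y d"
      then have "norm (x-y)\<le>d" by (simp add: dist_norm norm_minus_commute)
      then show "x\<in>ball 0 R0" using norm_triangle_ineq[of "x-y" y] True d by simp
     qed
     have "mollify_grad d u (y, \<tau>) = mollify d D (y, \<tau>)"
      by (rule mollify_grad_eq_mollify[OF _ d(1) yU]) (use elim(3) in blast)
     then show ?thesis by simp
    qed (use z in simp)
   qed
   show ?case unfolding ibp eqP by simp
  qed
 qed
 also have "... = - (LINT \<tau>|lborel. indicator {s..t} \<tau>*(LINT y|lborel.
     (F (?w y \<tau>)*\<^sub>R P y+(\<xi> y*g (?w y \<tau>))*\<^sub>R mollify d D (y, \<tau>))\<bullet>mollify d A (y, \<tau>)))"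
  by (rule integral_minus)
 finally show ?thesis .
qed

end

section \<open>Energy identity for truncations\<close>

text \<open>The second derivative \<open>g\<close> is a continuous approximation of the indicator of the positive axis, cut off at infinity so
that the first derivative stays bounded; \<open>F\<close> and \<open>G\<close> are its iterated antiderivatives.\<close>

lemma truncation_sequence_0:
 fixes i :: nat
 defines "e \<equiv> 1/real (Suc i)" and "n \<equiv> real (Suc i)"
 shows "\<exists>G F g :: real => real. (\<forall>x. (G has_real_derivative F x) (at x)) \<and> (\<forall>x. (F has_real_derivative g x) (at x))
  \<and> continuous_on UNIV g \<and> (\<forall>x. \<bar>F x\<bar>\<le>n) \<and> (\<forall>x. 0\<le>g x \<and> g x\<le>(if x > 0 then 1 else 0))
  \<and> (\<forall>x. e\<le>x \<and> x\<le>real i --> g x = 1)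
  \<and> (\<forall>x. 0\<le>F x \<and> F x\<le>max 0 x) \<and> (\<forall>x. e\<le>x \<and> x\<le>real i --> x-e\<le>F x)
  \<and> (\<forall>x. 0\<le>G x \<and> G x\<le>(max 0 x)\<^sup>2/2) \<and> (\<forall>x. e\<le>x \<and> x\<le>real i --> (x-e)\<^sup>2/2\<le>G x)"
proof -
 have e: "e > 0" "n > 0" "n*e = 1" "n = real i+1" by (auto simp: e_def n_def)
 \<comment> \<open>Equal to \<open>1\<close> on \<open>{e..n-1}\<close> and to \<open>0\<close> off \<open>{0..n}\<close>.\<close>
 define g where "g x = min 1 (max 0 (n*x))*max 0 (min 1 (n-x))" for x :: real
 have cg: "continuous_on UNIV g" unfolding g_def by (intro continuous_intros)
 have g01: "0\<le>g x" "g x\<le>1" for x unfolding g_def by (auto intro: mult_le_one)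
 have g0: "g x = 0" if "x\<le>0" for x using that e by (simp add: g_def mult_nonneg_nonpos)
 have gn: "g x = 0" if "x\<ge>n" for x using that by (simp add: g_def)
 have g1: "g x = 1" if "e\<le>x" "x\<le>real i" for x
 proof -
  have "n*e\<le>n*x" using that e by (intro mult_left_mono) auto
  then have "1\<le>n*x" using e(3) by linarith
  then show ?thesis using that e by (simp add: g_def)
 qed
 obtain F0 where F0: "\<And>x. (F0 has_real_derivative g x) (at x)" using antiderivative_exists[OF cg] by blast
 define F where "F x = F0 x-F0 0" for x
 have F: "(F has_real_derivative g x) (at x)" for x
  unfolding F_def by (auto intro!: derivative_eq_intros F0)
 have F00: "F 0 = 0" by (simp add: F_def)
 have mvF: "\<exists>c. a < c \<and> c < b \<and> F b-F a = (b-a)*g c" if "a < b" for a b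
  using MVT2[OF that, of F g] F by blast
 have Fneg: "F x = 0" if "x\<le>0" for x
 proof (cases "x = 0")
  case False
  then have "x < 0" using that by simp
  from mvF[OF this] obtain c where "x < c" "c < 0" "F 0-F x = (0-x)*g c" by blast
  then show ?thesis using g0[of c] F00 by simp
 qed (simp add: F00)
 have Fmono: "F a\<le>F b" if "a\<le>b" for a b
 proof (cases "a = b")
  case False
  then have "a < b" using that by simp
  from mvF[OF this] obtain c where "F b-F a = (b-a)*g c" by blast
  moreover have "(b-a)*g c\<ge>0" using that g01 by simp
  ultimately show ?thesis by linarith
 qed simp
 have Fle: "F x\<le>x" if "x > 0" for x
 proof -
  from mvF[OF that] obtain c where "F x-F 0 = (x-0)*g c" by blast
  moreover have "(x-0)*g c\<le>x*1" using that g01 by (simp add: mult_left_le)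
  ultimately show ?thesis using F00 by linarith
 qed
 have Fnn: "F x\<ge>0" for x using Fneg[of x] Fmono[of 0 x] F00 by (cases "x\<le>0") auto
 have Fmax: "F x\<le>max 0 x" for x using Fneg[of x] Fle[of x] by (cases "x\<le>0") auto
 have Fn: "F x\<le>n" for x
 proof (cases "x\<le>n")
  case True then show ?thesis using Fmax[of x] e by auto
 next
  case False
  then obtain c where "n < c" "F x-F n = (x-n)*g c" using mvF[of n x] by (meson not_le)
  then have "F x = F n" using gn[of c] by simp
  then show ?thesis using Fle[of n] e by simp
 qed
 have Flow: "x-e\<le>F x" if "e\<le>x" "x\<le>real i" for x
 proof (cases "x = e")
  case False
  then have "e < x" using that by simp
  from mvF[OF this] obtain c where "e < c" "c < x" "F x-F e = (x-e)*g c" by blast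
  then show ?thesis using g1[of c] that Fnn[of e] by simp
 qed (simp add: Fnn)
 have cF: "continuous_on UNIV F" using F by (auto simp: continuous_on_eq_continuous_at intro: DERIV_isCont)
 obtain G0 where G0: "\<And>x. (G0 has_real_derivative F x) (at x)" using antiderivative_exists[OF cF] by blast
 define G where "G x = G0 x-G0 0" for x
 have G: "(G has_real_derivative F x) (at x)" for x
  unfolding G_def by (auto intro!: derivative_eq_intros G0)
 have G00: "G 0 = 0" by (simp add: G_def)
 have mvG: "\<exists>c. a < c \<and> c < b \<and> G b-G a = (b-a)*F c" if "a < b" for a b
  using MVT2[OF that, of G F] G by blast
 have Gneg: "G x = 0" if "x\<le>0" for x
 proof (cases "x = 0")
  case False
  then have "x < 0" using that by simp
  from mvG[OF this] obtain c where "x < c" "c < 0" "G 0-G x = (0-x)*F c" by blast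
  then show ?thesis using Fneg[of c] G00 by simp
 qed (simp add: G00)
 have Gnn: "G x\<ge>0" for x
 proof (cases "x\<le>0")
  case False
  then obtain c where "G x-G 0 = (x-0)*F c" using mvG[of 0 x] by (meson not_le)
  moreover have "(x-0)*F c\<ge>0" using False Fnn by simp
  ultimately show ?thesis using G00 by linarith
 qed (simp add: Gneg)
 have Gle: "G x\<le>x\<^sup>2/2" if "x > 0" for x
 proof -
  note pos = that
  have "((\<lambda>x. x\<^sup>2/2-G x) has_real_derivative (y-F y)) (at y)" for y
   by (auto intro!: derivative_eq_intros G)
  then obtain c where c: "0 < c" "(x\<^sup>2/2-G x)-(0\<^sup>2/2-G 0) = (x-0)*(c-F c)"
   using MVT2[OF pos, of "\<lambda>x. x\<^sup>2/2-G x" "\<lambda>y. y-F y"] by blast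
  have "(x-0)*(c-F c)\<ge>0" using that Fle[OF c(1)] by simp
  then show ?thesis using c(2) G00 by simp
 qed
 have Glow: "(x-e)\<^sup>2/2\<le>G x" if "e\<le>x" "x\<le>real i" for x
 proof (cases "x = e")
  case False
  then have "e < x" using that by simp
  have "((\<lambda>x. G x-(x-e)\<^sup>2/2) has_real_derivative (F y-(y-e))) (at y)" for y
   by (auto intro!: derivative_eq_intros G simp: field_simps)
  then obtain c where c: "e < c" "c < x" "(G x-(x-e)\<^sup>2/2)-(G e-(e-e)\<^sup>2/2) = (x-e)*(F c-(c-e))"
   using MVT2[OF \<open>e < x\<close>, of "\<lambda>x. G x-(x-e)\<^sup>2/2" "\<lambda>y. F y-(y-e)"] by blast
  have "(x-e)*(F c-(c-e))\<ge>0" using that Flow[of c] c by simp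
  then show ?thesis using c(3) Gnn[of e] by simp
 qed (simp add: Gnn)
 show ?thesis
 proof (rule exI[of _ G], rule exI[of _ F], rule exI[of _ g], intro conjI allI impI)
  fix x :: real
  show "\<bar>F x\<bar>\<le>n" using Fn[of x] Fnn[of x] by simp
  show "g x\<le>(if x > 0 then 1 else 0)" using g01 g0 by auto
  show "G x\<le>(max 0 x)\<^sup>2/2" using Gneg[of x] Gle[of x] by (cases "x\<le>0") auto
 qed (use G F cg g01 g1 Fnn Fmax Flow Gnn Glow in auto)
qed

lemma truncation_sequence:
 fixes k :: real
 obtains G F g :: "nat => real => real" where
  "\<And>i x. (G i has_real_derivative F i x) (at x)" "\<And>i x. (F i has_real_derivative g i x) (at x)"
  "\<And>i. continuous_on UNIV (g i)" "\<And>i x. \<bar>F i x\<bar>\<le>real (Suc i)" "\<And>i x. \<bar>g i x\<bar>\<le>1"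
  "\<And>i x. 0\<le>F i x" "\<And>i x. F i x\<le>max 0 (x-k)" "\<And>i x. 0\<le>G i x" "\<And>i x. G i x\<le>(max 0 (x-k))\<^sup>2/2"
  "\<And>x. (\<lambda>i. g i x) \<longlonglongrightarrow> (if x > k then 1 else 0)" "\<And>x. (\<lambda>i. F i x) \<longlonglongrightarrow> max 0 (x-k)"
  "\<And>x. (\<lambda>i. G i x) \<longlonglongrightarrow> (max 0 (x-k))\<^sup>2/2"
proof -
 let ?e = "\<lambda>i. 1/real (Suc i)"
 let ?Q = "\<lambda>i (G::real => real, F::real => real, g::real => real). (\<forall>x. (G has_real_derivative F x) (at x)) \<and> (\<forall>x. (F has_real_derivative g x) (at x))
  \<and> continuous_on UNIV g \<and> (\<forall>x. \<bar>F x\<bar>\<le>real (Suc i)) \<and> (\<forall>x. 0\<le>g x \<and> g x\<le>(if x > 0 then 1 else 0))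
  \<and> (\<forall>x. ?e i\<le>x \<and> x\<le>real i --> g x = 1)
  \<and> (\<forall>x. 0\<le>F x \<and> F x\<le>max 0 x) \<and> (\<forall>x. ?e i\<le>x \<and> x\<le>real i --> x-?e i\<le>F x)
  \<and> (\<forall>x. 0\<le>G x \<and> G x\<le>(max 0 x)\<^sup>2/2) \<and> (\<forall>x. ?e i\<le>x \<and> x\<le>real i --> (x-?e i)\<^sup>2/2\<le>G x)"
 have "\<forall>i. \<exists>T. ?Q i T" using truncation_sequence_0 by (simp add: split_paired_Ex)
 from choice[OF this] obtain T where T: "\<And>i. ?Q i (T i)" by blast
 define G where "G i = fst (T i)" for i
 define F where "F i = fst (snd (T i))" for i
 define g where "g i = snd (snd (T i))" for i
 have Q: "?Q i (G i, F i, g i)" for i using T[of i] by (simp add: G_def F_def g_def)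
 have G: "(G i has_real_derivative F i x) (at x)" and F: "(F i has_real_derivative g i x) (at x)"
  and cg: "continuous_on UNIV (g i)" and Fb: "\<bar>F i x\<bar>\<le>real (Suc i)" and g: "0\<le>g i x" "g i x\<le>(if x > 0 then 1 else 0)"
  and g1: "?e i\<le>x ==> x\<le>real i ==> g i x = 1" and F0: "0\<le>F i x" "F i x\<le>max 0 x"
  and Fl: "?e i\<le>x ==> x\<le>real i ==> x-?e i\<le>F i x"
  and G0: "0\<le>G i x" "G i x\<le>(max 0 x)\<^sup>2/2" and Gl: "?e i\<le>x ==> x\<le>real i ==> (x-?e i)\<^sup>2/2\<le>G i x" for i x
  using Q[of i] unfolding prod.case by blast+
 have elim: "?e \<longlonglongrightarrow> 0" using LIMSEQ_inverse_real_of_nat by (simp add: inverse_eq_divide)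
 have ev: "\<forall>\<^sub>F i in sequentially. ?e i\<le>x \<and> x\<le>real i" if "x > 0" for x :: real
 proof (rule eventually_conj)
  show "\<forall>\<^sub>F i in sequentially. ?e i\<le>x" using order_tendstoD(2)[OF elim that] by eventually_elim simp
  obtain m :: nat where m: "x\<le>real m" using real_arch_simple by blast
  show "\<forall>\<^sub>F i in sequentially. x\<le>real i"
   using eventually_ge_at_top[of m] by eventually_elim (use m in linarith)
 qed
 have lg: "(\<lambda>i. g i x) \<longlonglongrightarrow> (if x > 0 then 1 else 0)" for x
 proof (cases "x > 0")
  case True
  have "\<forall>\<^sub>F i in sequentially. g i x = 1" using ev[OF True] by eventually_elim (use g1 in blast)
  then show ?thesis using True by (auto intro: tendsto_eventually)
 next
  case False
  then have "g i x = 0" for i using g[of i x] by simp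
  then show ?thesis using False by simp
 qed
 have lF: "(\<lambda>i. F i x) \<longlonglongrightarrow> max 0 x" for x
 proof (cases "x > 0")
  case True
  have "(\<lambda>i. x-?e i) \<longlonglongrightarrow> x-0" by (intro tendsto_intros elim)
  then have "(\<lambda>i. x-?e i) \<longlonglongrightarrow> max 0 x" using True by simp
  moreover have "\<forall>\<^sub>F i in sequentially. x-?e i\<le>F i x" using ev[OF True] by eventually_elim (use Fl in blast)
  ultimately show ?thesis
   by (rule tendsto_sandwich[rotated 2, OF _ tendsto_const]) (use F0 in auto)
 next
  case False
  then have "F i x = 0" for i using F0[of i x] by simp
  then show ?thesis using False by simp
 qed
 have lG: "(\<lambda>i. G i x) \<longlonglongrightarrow> (max 0 x)\<^sup>2/2" for x
 proof (cases "x > 0")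
  case True
  have "(\<lambda>i. (x-?e i)\<^sup>2/2) \<longlonglongrightarrow> (x-0)\<^sup>2/2" by (intro tendsto_intros elim) auto
  then have "(\<lambda>i. (x-?e i)\<^sup>2/2) \<longlonglongrightarrow> (max 0 x)\<^sup>2/2" using True by simp
  moreover have "\<forall>\<^sub>F i in sequentially. (x-?e i)\<^sup>2/2\<le>G i x" using ev[OF True] by eventually_elim (use Gl in blast)
  ultimately show ?thesis
   by (rule tendsto_sandwich[rotated 2, OF _ tendsto_const]) (use G0 in auto)
 next
  case False
  then have "G i x = 0" for i using G0[of i x] by simp
  then show ?thesis using False by simp
 qed
 have sh: "((\<lambda>x. f (x-k)) has_real_derivative f' (x-k)) (at x)" if "\<And>x. (f has_real_derivative f' x) (at x)" for f f' :: "real => real" and x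
 proof -
  have "((\<lambda>x. x-k) has_real_derivative 1) (at x)" by (auto intro!: derivative_eq_intros)
  from DERIV_chain2[of f "f' (x-k)" "\<lambda>x. x-k", OF that this] show ?thesis by simp
 qed
 show thesis
 proof (rule that[of "\<lambda>i x. G i (x-k)" "\<lambda>i x. F i (x-k)" "\<lambda>i x. g i (x-k)"])
  show "continuous_on UNIV (\<lambda>x. g i (x-k))" for i
   by (rule continuous_on_compose2[OF cg]) (auto intro!: continuous_intros)
  show "\<bar>g i (x-k)\<bar>\<le>1" for i x using g[of i "x-k"] by (auto split: if_splits)
  show "(\<lambda>i. g i (x-k)) \<longlonglongrightarrow> (if x > k then 1 else 0)" for x using lg[of "x-k"] by simp
 qed (use sh[OF G] sh[OF F] Fb F0 G0 lF lG in auto)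
qed

lemma fst_snd_borel [measurable]:
 "fst\<in>borel_measurable (borel :: ('a::euclidean_space\<times>'b::euclidean_space) measure)"
 "snd\<in>borel_measurable (borel :: ('a::euclidean_space\<times>'b::euclidean_space) measure)"
 by (intro borel_measurable_continuous_onI continuous_intros)+

lemma cball_times_interval_integrable:
 "L1 (\<lambda>z. indicator (cball (0::'a::euclidean_space) R\<times>{s..t::real}) z :: real)"
proof -
 have "compact (cball (0::'a) R\<times>{s..t})" by (intro compact_Times) auto
 then have "emeasure lborel (cball (0::'a) R\<times>{s..t}) < \<infinity>" "cball (0::'a) R\<times>{s..t}\<in>sets borel"
  by (auto intro: borel_compact emeasure_bounded_finite compact_imp_bounded simp del: infinity_ennreal_def)
 then show ?thesis by (intro integrable_real_indicator) auto
qed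

context local_solution
begin

text \<open>Pass to the limit in the mollified identity. Boundedness of \<open>F\<close> and \<open>g\<close> together with the common majorant \<open>H\<close> dominates
every term, also those containing the product of \<open>A\<close> and \<open>D\<close>.\<close>

lemma energy_identity:
 fixes \<xi> :: "real^'n => real" and P :: "real^'n => real^'n"
 assumes R: "R < R0"
  and G: "\<And>x. (G has_real_derivative F x) (at x)" and F: "\<And>x. (F has_real_derivative g x) (at x)"
  and g: "continuous_on UNIV g" and K: "\<And>x. \<bar>F x\<bar>\<le>K" "\<And>x. \<bar>g x\<bar>\<le>K"
  and \<xi>: "\<And>x. (\<xi> has_derivative (\<lambda>h. P x\<bullet>h)) (at x)" and P: "continuous_on UNIV P"
  and z: "\<And>x. norm x > R ==> \<xi> x = 0" "\<And>x. norm x > R ==> P x = 0"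
 shows "\<exists>T1. (AE t in lborel. t\<in>{-\<theta>..\<theta>} --> t\<in>T1) \<and> (\<forall>s\<in>T1. \<forall>t\<in>T1. s\<le>t \<longrightarrow>
  (LINT x|lborel. \<xi> x*(G (u (x, t))-G (u (x, s)))) =
  - (LINT z|lborel. indicator {s..t} (snd z) *
    (F (u z)*(P (fst z)\<bullet>A z)+(\<xi> (fst z)*g (u z))*(D z\<bullet>A z))))"
proof -
 have c\<xi>: "continuous_on UNIV \<xi>" by (rule has_derivative_continuous_on, rule has_derivative_at_withinI, rule \<xi>)
 have cF: "continuous_on UNIV F" using F by (auto simp: continuous_on_eq_continuous_at intro: DERIV_isCont)
 have cG: "continuous_on UNIV G" using G by (auto simp: continuous_on_eq_continuous_at intro: DERIV_isCont)
 have [measurable]: "\<xi>\<in>Borel" "F\<in>Borel" "G\<in>Borel"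
   "g\<in>Borel" "P\<in>Borel"
  using c\<xi> cF cG g P by (auto intro: borel_measurable_continuous_onI)
 have K0: "K\<ge>0" using K(1)[of 0] by linarith
 obtain B1 where B1: "B1 > 0" "\<And>x. norm (\<xi> x)\<le>B1" using bounded_of_vanishing[OF c\<xi> z(1)] by blast
 obtain B2 where B2: "B2 > 0" "\<And>x. norm (P x)\<le>B2" using bounded_of_vanishing[OF P z(2)] by blast
 have Gb: "\<bar>G v\<bar>\<le>\<bar>G 0\<bar>+K+K*\<bar>v\<bar> powr p" for v
 proof -
  have "\<bar>G v-G 0\<bar>\<le>K*\<bar>v-0\<bar>"
  proof -
   have "norm (G v-G 0)\<le>K*norm (v-0)"
    by (rule field_differentiable_bound[of UNIV G F]) (use G K has_field_derivative_at_within in auto)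
   then show ?thesis by simp
  qed
  moreover have "K*\<bar>v\<bar>\<le>K*(1+\<bar>v\<bar> powr p)"
   using le_one_plus_powr[of "\<bar>v\<bar>" p] p K0 by (intro mult_left_mono) auto
  ultimately show ?thesis by (simp add: algebra_simps)
 qed
 have d0: "R0-R > 0" using R by simp
 obtain d H where d: "\<And>j. 0 < d j" "\<And>j. d j < R0-R" and H: "H\<in>Borel" "L1 H" "\<And>z. H z\<ge>0"
  and lim: "AE z in lborel. (\<lambda>j. mollify (d j) u z) \<longlonglongrightarrow> u z"
  "AE z in lborel. (\<lambda>j. mollify (d j) D z) \<longlonglongrightarrow> D z"
  "AE z in lborel. (\<lambda>j. mollify (d j) A z) \<longlonglongrightarrow> A z"
  and bd: "AE z in lborel. \<forall>j. norm (mollify (d j) u z) powr p\<le>H z \<and> norm (mollify (d j) D z) powr p\<le>H z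
    \<and> norm (mollify (d j) A z) powr q\<le>H z"
  using good_mollifying_sequence[OF u_1 u_p D_1 D_p A_1 A_q less_imp_le[OF p] less_imp_le[OF q1] d0] by blast
 note [measurable] = H(1) mollify_measurable[OF u_borel d(1)] mollify_measurable[OF D_borel d(1)] mollify_measurable[OF A_borel d(1)]
 \<comment> \<open>Good times: the slices converge and are dominated.\<close>
 define T1 where "T1 = {t\<in>T0. L1 (\<lambda>x. H (x, t)) \<and> (AE x in lborel. (\<lambda>j. mollify (d j) u (x, t)) \<longlonglongrightarrow> u (x, t))
   \<and> (AE x in lborel. \<forall>j. norm (mollify (d j) u (x, t)) powr p\<le>H (x, t))}"
 have "AE z in lborel. \<forall>j. norm (mollify (d j) u z) powr p\<le>H z" using bd by eventually_elim blast
 note sl = AE_integrable_slice[OF H(2)] AE_lborel_slice[OF lim(1)] AE_lborel_slice[OF this]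
 have T1: "AE t in lborel. t\<in>{-\<theta>..\<theta>} --> t\<in>T1"
  using T0(1) sl by eventually_elim (auto simp: T1_def)
 have main: "(LINT x|lborel. \<xi> x*(G (u (x, t))-G (u (x, s)))) =
  - (LINT z|lborel. indicator {s..t} (snd z) *
    (F (u z)*(P (fst z)\<bullet>A z)+(\<xi> (fst z)*g (u z))*(D z\<bullet>A z)))"
  if st: "s\<in>T1" "t\<in>T1" "s\<le>t" for s t
 proof -
  define \<Phi> where "\<Phi> j z = indicator {s..t} (snd z) *
    (F (mollify (d j) u z)*(P (fst z)\<bullet>mollify (d j) A z)+(\<xi> (fst z)*g (mollify (d j) u z))*(mollify (d j) D z\<bullet>mollify (d j) A z))" for j z
  define \<Phi>0 where "\<Phi>0 z = indicator {s..t} (snd z) *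
    (F (u z)*(P (fst z)\<bullet>A z)+(\<xi> (fst z)*g (u z))*(D z\<bullet>A z))" for z
  have [measurable]: "\<Phi> j\<in>Borel" "\<Phi>0\<in>Borel" for j
   unfolding \<Phi>_def \<Phi>0_def by measurable
  define W where "W z = (K*B2+2*B1*K)*(indicator (cball (0::real^'n) R\<times>{s..t}) z+H z)" for z
  have iW: "L1 W" unfolding W_def
   by (intro integrable_mult_right Bochner_Integration.integrable_add cball_times_interval_integrable H(2))
  have \<Phi>W: "AE z in lborel. norm (\<Phi> j z)\<le>W z" for j
   using bd
  proof eventually_elim
   case (elim z)
   let ?a = "norm (mollify (d j) A z)"
   let ?I = "indicator (cball (0::real^'n) R\<times>{s..t}) z :: real"
   have HA: "norm (mollify (d j) A z) powr q\<le>H z" and HD: "norm (mollify (d j) D z) powr p\<le>H z"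
    using elim by blast+
   have a: "?a\<le>1+H z" using le_one_plus_powr[OF norm_ge_zero less_imp_le[OF q1], of "mollify (d j) A z"] HA by linarith
   have da: "\<bar>mollify (d j) D z\<bullet>mollify (d j) A z\<bar>\<le>H z+H z"
    using abs_inner_le_powr[OF p q, of "mollify (d j) D z" "mollify (d j) A z"] HA HD by linarith
   show ?case
   proof (cases "snd z\<in>{s..t} \<and> norm (fst z)\<le>R")
    case True
    then have I: "?I = 1" by (cases z) auto
    have "\<bar>P (fst z)\<bullet>mollify (d j) A z\<bar>\<le>B2*(1+H z)"
     using Cauchy_Schwarz_ineq2[of "P (fst z)" "mollify (d j) A z"] mult_mono[OF B2(2)[of "fst z"] a] B2(1) by auto
    then have 1: "\<bar>F (mollify (d j) u z)*(P (fst z)\<bullet>mollify (d j) A z)\<bar>\<le>K*(B2*(1+H z))"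
     unfolding abs_mult using K(1) K0 by (intro mult_mono) auto
    have 2: "\<bar>(\<xi> (fst z)*g (mollify (d j) u z))*(mollify (d j) D z\<bullet>mollify (d j) A z)\<bar>\<le>(B1*K)*(H z+H z)"
     unfolding abs_mult using K(2) K0 B1 da by (intro mult_mono) (auto simp: less_imp_le)
    have "norm (\<Phi> j z)\<le>K*(B2*(1+H z))+(B1*K)*(H z+H z)"
     using 1 2 True by (auto simp: \<Phi>_def)
    also have "\<dots>\<le>W z"
     unfolding W_def I using B1 K0 by (simp add: algebra_simps)
    finally show ?thesis .
   next
    case False
    then have "\<Phi> j z = 0" using z by (auto simp: \<Phi>_def)
    moreover have "W z\<ge>0" unfolding W_def using K0 B1 B2 H(3)[of z] by (intro mult_nonneg_nonneg add_nonneg_nonneg) auto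
    ultimately show ?thesis by simp
   qed
  qed
  have i\<Phi>: "L1 (\<Phi> j)" for j
  proof (rule Bochner_Integration.integrable_bound[OF iW])
   show "AE z in lborel. norm (\<Phi> j z)\<le>norm (W z)"
    using \<Phi>W[of j] by eventually_elim (metis abs_ge_self order_trans real_norm_def)
  qed simp
  have conv: "AE z in lborel. (\<lambda>j. \<Phi> j z) \<longlonglongrightarrow> \<Phi>0 z"
   using lim
  proof eventually_elim
   case (elim z)
   have FF: "(\<lambda>j. F (mollify (d j) u z)) \<longlonglongrightarrow> F (u z)"
    by (rule isCont_tendsto_compose[OF _ elim(1)]) (use cF in \<open>simp add: continuous_on_eq_continuous_at\<close>)
   have gg: "(\<lambda>j. g (mollify (d j) u z)) \<longlonglongrightarrow> g (u z)"
    by (rule isCont_tendsto_compose[OF _ elim(1)]) (use g in \<open>simp add: continuous_on_eq_continuous_at\<close>)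
   show ?case
    unfolding \<Phi>_def \<Phi>0_def
    by (intro tendsto_mult tendsto_add tendsto_inner tendsto_const FF gg elim)
  qed
  have lim1: "(\<lambda>j. LINT z|lborel. \<Phi> j z) \<longlonglongrightarrow> (LINT z|lborel. \<Phi>0 z)"
   by (rule integral_dominated_convergence[OF _ _ iW conv \<Phi>W]) auto
  have T1D: "L1 (\<lambda>x. H (x, r))" "AE x in lborel. (\<lambda>j. mollify (d j) u (x, r)) \<longlonglongrightarrow> u (x, r)"
   "AE x in lborel. \<forall>j. norm (mollify (d j) u (x, r)) powr p\<le>H (x, r)" if "r\<in>T1" for r
   using that by (auto simp: T1_def)
  have lim2: "(\<lambda>j. LINT x|lborel. \<xi> x*(G (mollify (d j) u (x, t))-G (mollify (d j) u (x, s)))) \<longlonglongrightarrow> (LINT x|lborel. \<xi> x*(G (u (x, t))-G (u (x, s))))"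
  proof (rule integral_dominated_convergence)
   let ?w = "\<lambda>x. (B1*(2*(\<bar>G 0\<bar>+K)))*indicator (cball (0::real^'n) R) x+(B1*K)*(H (x, t)+H (x, s))"
   have iball: "L1 (\<lambda>y::real^'n. indicator (cball 0 R) y :: real)"
    using emeasure_lborel_cball_finite[of "0::real^'n" R] by (intro integrable_real_indicator) auto
   show "L1 ?w"
    by (intro integrable_mult_right Bochner_Integration.integrable_add iball T1D(1) st)
   show "AE x in lborel. (\<lambda>j. \<xi> x*(G (mollify (d j) u (x, t))-G (mollify (d j) u (x, s)))) \<longlonglongrightarrow> \<xi> x*(G (u (x, t))-G (u (x, s)))"
    using T1D(2)[OF st(1)] T1D(2)[OF st(2)]
   proof eventually_elim
    case (elim x)
    have "(\<lambda>j. G (mollify (d j) u (x, s))) \<longlonglongrightarrow> G (u (x, s))"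
     by (rule isCont_tendsto_compose[OF _ elim(1)]) (use cG in \<open>simp add: continuous_on_eq_continuous_at\<close>)
    moreover have "(\<lambda>j. G (mollify (d j) u (x, t))) \<longlonglongrightarrow> G (u (x, t))"
     by (rule isCont_tendsto_compose[OF _ elim(2)]) (use cG in \<open>simp add: continuous_on_eq_continuous_at\<close>)
    ultimately show ?case by (intro tendsto_mult tendsto_diff tendsto_const)
   qed
   show "AE x in lborel. norm (\<xi> x*(G (mollify (d j) u (x, t))-G (mollify (d j) u (x, s))))\<le>?w x" for j
    using T1D(3)[OF st(1)] T1D(3)[OF st(2)]
   proof eventually_elim
    case (elim x)
    show ?case
    proof (cases "norm x\<le>R")
     case True
     have gb: "\<bar>G (mollify (d j) u (x, r))\<bar>\<le>\<bar>G 0\<bar>+K+K*H (x, r)" if "norm (mollify (d j) u (x, r)) powr p\<le>H (x, r)" for r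
      using Gb[of "mollify (d j) u (x, r)"] mult_left_mono[OF that K0] by simp
     have "\<bar>G (mollify (d j) u (x, t))-G (mollify (d j) u (x, s))\<bar>\<le>2*(\<bar>G 0\<bar>+K)+K*(H (x, t)+H (x, s))"
      using gb[of s] gb[of t] elim by (auto simp: algebra_simps intro: order_trans[OF abs_triangle_ineq4])
     then have "norm (\<xi> x*(G (mollify (d j) u (x, t))-G (mollify (d j) u (x, s))))\<le>B1*(2*(\<bar>G 0\<bar>+K)+K*(H (x, t)+H (x, s)))"
      unfolding norm_mult using B1 by (intro mult_mono) auto
     then show ?thesis using True by (simp add: algebra_simps)
    next
     case False
     then show ?thesis using z(1)[of x] B1 K0 H(3) by auto
    qed
   qed
  qed measurable
  have eq: "(LINT x|lborel. \<xi> x*(G (mollify (d j) u (x, t))-G (mollify (d j) u (x, s)))) = - (LINT z|lborel. \<Phi> j z)" for j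
  proof -
   have st0: "s\<in>T0" "t\<in>T0" using st by (auto simp: T1_def)
   have Rd: "R+d j < R0" using d(2)[of j] by simp
   have "(LINT x|lborel. \<xi> x*(G (mollify (d j) u (x, t))-G (mollify (d j) u (x, s)))) =
    - (LINT \<tau>|lborel. indicator {s..t} \<tau>*(LINT y|lborel.
     (F (mollify (d j) u (y, \<tau>))*\<^sub>R P y+(\<xi> y*g (mollify (d j) u (y, \<tau>)))*\<^sub>R mollify (d j) D (y, \<tau>))\<bullet>mollify (d j) A (y, \<tau>)))"
    by (rule mollified_energy[OF d(1) Rd G F g K(1) \<xi> P z st0 st(3)])
   moreover have "(LINT \<tau>|lborel. indicator {s..t} \<tau>*(LINT y|lborel.
     (F (mollify (d j) u (y, \<tau>))*\<^sub>R P y+(\<xi> y*g (mollify (d j) u (y, \<tau>)))*\<^sub>R mollify (d j) D (y, \<tau>))\<bullet>mollify (d j) A (y, \<tau>)))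
    = (LINT \<tau>|lborel. LINT y|lborel. \<Phi> j (y, \<tau>))"
   proof (rule Bochner_Integration.integral_cong[OF refl])
    fix \<tau>
    show "indicator {s..t} \<tau>*(LINT y|lborel.
     (F (mollify (d j) u (y, \<tau>))*\<^sub>R P y+(\<xi> y*g (mollify (d j) u (y, \<tau>)))*\<^sub>R mollify (d j) D (y, \<tau>))\<bullet>mollify (d j) A (y, \<tau>))
     = (LINT y|lborel. \<Phi> j (y, \<tau>))"
     by (cases "\<tau>\<in>{s..t}") (simp_all add: \<Phi>_def inner_add_left)
   qed
   ultimately show ?thesis using integral_slice_integral[OF i\<Phi>[of j]] by simp
  qed
  have "(\<lambda>j. LINT x|lborel. \<xi> x*(G (mollify (d j) u (x, t))-G (mollify (d j) u (x, s)))) \<longlonglongrightarrow>-(LINT z|lborel. \<Phi>0 z)"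
   unfolding eq by (intro tendsto_minus lim1)
  with lim2 show ?thesis unfolding \<Phi>0_def using LIMSEQ_unique by blast
 qed
 show ?thesis using T1 main by blast
qed

text \<open>The identity for \<open>G(u) = (u-k)\<^sub>+\<^sup>2 / 2\<close>, whose first derivative is unbounded and whose second derivative jumps at \<open>k\<close>.\<close>

lemma truncated_energy_identity:
 fixes \<xi> :: "real^'n => real" and P :: "real^'n => real^'n"
 assumes R: "R < R0" and k: "k\<ge>0"
  and \<xi>: "\<And>x. (\<xi> has_derivative (\<lambda>h. P x\<bullet>h)) (at x)" and P: "continuous_on UNIV P"
  and z: "\<And>x. norm x > R ==> \<xi> x = 0" "\<And>x. norm x > R ==> P x = 0"
 shows "\<exists>T1. (AE t in lborel. t\<in>{-\<theta>..\<theta>} --> t\<in>T1) \<and> (\<forall>s\<in>T1. L1 (\<lambda>x. (u (x, s))\<^sup>2)) \<and> (\<forall>s\<in>T1. \<forall>t\<in>T1. s\<le>t \<longrightarrow>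
  (LINT x|lborel. \<xi> x*((max 0 (u (x, t)-k))\<^sup>2/2-(max 0 (u (x, s)-k))\<^sup>2/2)) =
  - (LINT z|lborel. indicator {s..t} (snd z) *
    (max 0 (u z-k)*(P (fst z)\<bullet>A z)+(\<xi> (fst z)*(if u z > k then 1 else 0))*(D z\<bullet>A z))))"
proof -
 have c\<xi>: "continuous_on UNIV \<xi>" by (rule has_derivative_continuous_on, rule has_derivative_at_withinI, rule \<xi>)
 have [measurable]: "\<xi>\<in>Borel" "P\<in>Borel"
  using c\<xi> P by (auto intro: borel_measurable_continuous_onI)
 obtain B1 where B1: "B1 > 0" "\<And>x. norm (\<xi> x)\<le>B1" using bounded_of_vanishing[OF c\<xi> z(1)] by blast
 obtain B2 where B2: "B2 > 0" "\<And>x. norm (P x)\<le>B2" using bounded_of_vanishing[OF P z(2)] by blast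
 obtain G F g where GFg: "\<And>i x. (G i has_real_derivative F i x) (at x)" "\<And>i x. (F i has_real_derivative g i x) (at x)"
  "\<And>i. continuous_on UNIV (g i)" "\<And>i x. \<bar>F i x\<bar>\<le>real (Suc i)" "\<And>i x. \<bar>g i x\<bar>\<le>1"
  and b: "\<And>i x. 0\<le>F i x" "\<And>i x. F i x\<le>max 0 (x-k)" "\<And>i x. 0\<le>G i x" "\<And>i x. G i x\<le>(max 0 (x-k))\<^sup>2/2"
  and l: "\<And>x. (\<lambda>i. g i x) \<longlonglongrightarrow> (if x > k then 1 else 0)" "\<And>x. (\<lambda>i. F i x) \<longlonglongrightarrow> max 0 (x-k)"
  "\<And>x. (\<lambda>i. G i x) \<longlonglongrightarrow> (max 0 (x-k))\<^sup>2/2"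
  by (rule truncation_sequence[of k]) blast
 have [measurable]: "F i\<in>Borel" "G i\<in>Borel" "g i\<in>Borel" for i
  by (intro borel_measurable_continuous_onI; use DERIV_isCont[OF GFg(1)] DERIV_isCont[OF GFg(2)] GFg(3) in \<open>simp add: continuous_on_eq_continuous_at\<close>)+
 have "\<forall>i. \<exists>T1. (AE t in lborel. t\<in>{-\<theta>..\<theta>} --> t\<in>T1) \<and> (\<forall>s\<in>T1. \<forall>t\<in>T1. s\<le>t \<longrightarrow>
  (LINT x|lborel. \<xi> x*(G i (u (x, t))-G i (u (x, s)))) =
  - (LINT z|lborel. indicator {s..t} (snd z) *
    (F i (u z)*(P (fst z)\<bullet>A z)+(\<xi> (fst z)*g i (u z))*(D z\<bullet>A z))))"
 proof
  fix i
  have "\<bar>g i x\<bar>\<le>real (Suc i)" for x using GFg(5)[of i x] by simp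
  from energy_identity[OF R GFg(1) GFg(2) GFg(3) GFg(4) this \<xi> P z]
  show "\<exists>T1. (AE t in lborel. t\<in>{-\<theta>..\<theta>} --> t\<in>T1) \<and> (\<forall>s\<in>T1. \<forall>t\<in>T1. s\<le>t \<longrightarrow>
  (LINT x|lborel. \<xi> x*(G i (u (x, t))-G i (u (x, s)))) =
  - (LINT z|lborel. indicator {s..t} (snd z) *
    (F i (u z)*(P (fst z)\<bullet>A z)+(\<xi> (fst z)*g i (u z))*(D z\<bullet>A z))))" .
 qed
 from choice[OF this] obtain TT where TT: "\<And>i. AE t in lborel. t\<in>{-\<theta>..\<theta>} --> t\<in>TT i"
  "\<And>i s t. s\<in>TT i ==> t\<in>TT i ==> s\<le>t \<Longrightarrow>
  (LINT x|lborel. \<xi> x*(G i (u (x, t))-G i (u (x, s)))) =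
  - (LINT z|lborel. indicator {s..t} (snd z) *
    (F i (u z)*(P (fst z)\<bullet>A z)+(\<xi> (fst z)*g i (u z))*(D z\<bullet>A z)))" by blast
 define T1 where "T1 = (\<Inter>i. TT i) \<inter> {t. L1 (\<lambda>x. (u (x, t))\<^sup>2)}"
 have AET: "AE t in lborel. \<forall>i. t\<in>{-\<theta>..\<theta>} --> t\<in>TT i"
  using TT(1) by (simp only: AE_all_countable) blast
 have T1: "AE t in lborel. t\<in>{-\<theta>..\<theta>} --> t\<in>T1"
  using AET AE_integrable_slice[OF u_2] by eventually_elim (auto simp: T1_def)
 have ms: "\<bar>max 0 (v-k)\<bar>\<le>\<bar>v\<bar>" for v using k by auto
 have ms2: "(max 0 (v-k))\<^sup>2\<le>v\<^sup>2" for v using power2_le_iff_abs_le[of "\<bar>v\<bar>" "max 0 (v-k)"] ms[of v] by (simp add: power2_le_iff_abs_le)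
 have main: "(LINT x|lborel. \<xi> x*((max 0 (u (x, t)-k))\<^sup>2/2-(max 0 (u (x, s)-k))\<^sup>2/2)) =
  - (LINT z|lborel. indicator {s..t} (snd z) *
    (max 0 (u z-k)*(P (fst z)\<bullet>A z)+(\<xi> (fst z)*(if u z > k then 1 else 0))*(D z\<bullet>A z)))"
  if st: "s\<in>T1" "t\<in>T1" "s\<le>t" for s t
 proof -
  have i2: "L1 (\<lambda>x. (u (x, s))\<^sup>2)" "L1 (\<lambda>x. (u (x, t))\<^sup>2)" using st by (auto simp: T1_def)
  have lim1: "(\<lambda>i. LINT x|lborel. \<xi> x*(G i (u (x, t))-G i (u (x, s)))) \<longlonglongrightarrow>
    (LINT x|lborel. \<xi> x*((max 0 (u (x, t)-k))\<^sup>2/2-(max 0 (u (x, s)-k))\<^sup>2/2))"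
  proof (rule integral_dominated_convergence)
   show "L1 (\<lambda>x. B1*((u (x, t))\<^sup>2+(u (x, s))\<^sup>2))"
    by (intro integrable_mult_right Bochner_Integration.integrable_add i2)
   show "AE x in lborel. (\<lambda>i. \<xi> x*(G i (u (x, t))-G i (u (x, s)))) \<longlonglongrightarrow> \<xi> x*((max 0 (u (x, t)-k))\<^sup>2/2-(max 0 (u (x, s)-k))\<^sup>2/2)"
    by (intro AE_I2 tendsto_intros l)
   show "AE x in lborel. norm (\<xi> x*(G i (u (x, t))-G i (u (x, s))))\<le>B1*((u (x, t))\<^sup>2+(u (x, s))\<^sup>2)" for i
   proof (rule AE_I2)
    fix x
    have Gb: "\<bar>G i v\<bar>\<le>v\<^sup>2" for v using b(3)[of i v] b(4)[of i v] ms2[of v] zero_le_power2[of "max 0 (v-k)"] by linarith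
    have "\<bar>G i (u (x, t))-G i (u (x, s))\<bar>\<le>(u (x, t))\<^sup>2+(u (x, s))\<^sup>2"
     using Gb[of "u (x, t)"] Gb[of "u (x, s)"] by linarith
    then show "norm (\<xi> x*(G i (u (x, t))-G i (u (x, s))))\<le>B1*((u (x, t))\<^sup>2+(u (x, s))\<^sup>2)"
     unfolding norm_mult using B1 by (intro mult_mono) auto
   qed
  qed measurable
  have lim2: "(\<lambda>i. LINT z|lborel. indicator {s..t} (snd z) *
    (F i (u z)*(P (fst z)\<bullet>A z)+(\<xi> (fst z)*g i (u z))*(D z\<bullet>A z))) \<longlonglongrightarrow> (LINT z|lborel. indicator {s..t} (snd z) *
    (max 0 (u z-k)*(P (fst z)\<bullet>A z)+(\<xi> (fst z)*(if u z > k then 1 else 0))*(D z\<bullet>A z)))"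
  proof (rule integral_dominated_convergence)
   let ?w = "\<lambda>z. B2*(norm (u z) powr p+norm (A z) powr q)+B1*(norm (D z) powr p+norm (A z) powr q)"
   show "L1 ?w"
    by (intro integrable_mult_right Bochner_Integration.integrable_add u_p A_q D_p)
   show "AE z in lborel. (\<lambda>i. indicator {s..t} (snd z)*(F i (u z)*(P (fst z)\<bullet>A z)+(\<xi> (fst z)*g i (u z))*(D z\<bullet>A z)))
     \<longlonglongrightarrow> indicator {s..t} (snd z)*(max 0 (u z-k)*(P (fst z)\<bullet>A z)+(\<xi> (fst z)*(if u z > k then 1 else 0))*(D z\<bullet>A z))"
    by (intro AE_I2 tendsto_intros l)
   show "AE z in lborel. norm (indicator {s..t} (snd z)*(F i (u z)*(P (fst z)\<bullet>A z)+(\<xi> (fst z)*g i (u z))*(D z\<bullet>A z)))\<le>?w z" for i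
   proof (rule AE_I2)
    fix z :: "(real^'n)\<times>real"
    have f: "\<bar>F i (u z)\<bar>\<le>\<bar>u z\<bar>" using b(1)[of i "u z"] b(2)[of i "u z"] ms[of "u z"] by linarith
    have "\<bar>P (fst z)\<bullet>A z\<bar>\<le>B2*norm (A z)"
     using Cauchy_Schwarz_ineq2[of "P (fst z)" "A z"] mult_right_mono[OF B2(2)[of "fst z"] norm_ge_zero[of "A z"]] by linarith
    then have "\<bar>F i (u z)\<bar>*\<bar>P (fst z)\<bullet>A z\<bar>\<le>\<bar>u z\<bar>*(B2*norm (A z))"
     using f by (intro mult_mono) auto
    also have "... = B2*\<bar>u z\<bullet>norm (A z)\<bar>" by (simp add: abs_mult)
    also have "\<dots>\<le>B2*(norm (u z) powr p+norm (norm (A z)) powr q)"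
     using abs_inner_le_powr[OF p q, of "u z" "norm (A z)"] B2(1) by (intro mult_left_mono) auto
    finally have 1: "\<bar>F i (u z)\<bar>*\<bar>P (fst z)\<bullet>A z\<bar>\<le>B2*(norm (u z) powr p+norm (A z) powr q)" by simp
    have "\<bar>\<xi> (fst z)*g i (u z)\<bar>\<le>B1*1"
     unfolding abs_mult using B1 GFg(5) by (intro mult_mono) (auto simp: less_imp_le)
    then have 2: "\<bar>\<xi> (fst z)*g i (u z)\<bar>*\<bar>D z\<bullet>A z\<bar>\<le>(B1*1)*(norm (D z) powr p+norm (A z) powr q)"
     using abs_inner_le_powr[OF p q, of "D z" "A z"] B1 by (intro mult_mono) auto
    have "\<bar>F i (u z)*(P (fst z)\<bullet>A z)+(\<xi> (fst z)*g i (u z))*(D z\<bullet>A z)\<bar>\<le>?w z"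
     using 1 2 abs_triangle_ineq[of "F i (u z)*(P (fst z)\<bullet>A z)" "(\<xi> (fst z)*g i (u z))*(D z\<bullet>A z)"] by (simp add: abs_mult)
    moreover have "?w z\<ge>0" using B1 B2 by (intro add_nonneg_nonneg mult_nonneg_nonneg) auto
    ultimately show "norm (indicator {s..t} (snd z)*(F i (u z)*(P (fst z)\<bullet>A z)+(\<xi> (fst z)*g i (u z))*(D z\<bullet>A z)))\<le>?w z"
     by (auto simp: indicator_def)
   qed
  qed measurable
  have eq: "(LINT x|lborel. \<xi> x*(G i (u (x, t))-G i (u (x, s)))) =
  - (LINT z|lborel. indicator {s..t} (snd z) *
    (F i (u z)*(P (fst z)\<bullet>A z)+(\<xi> (fst z)*g i (u z))*(D z\<bullet>A z)))" for i
   by (rule TT(2)) (use st in \<open>auto simp: T1_def\<close>)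
  have "(\<lambda>i. LINT x|lborel. \<xi> x*(G i (u (x, t))-G i (u (x, s)))) \<longlonglongrightarrow>-(LINT z|lborel. indicator {s..t} (snd z) *
    (max 0 (u z-k)*(P (fst z)\<bullet>A z)+(\<xi> (fst z)*(if u z > k then 1 else 0))*(D z\<bullet>A z)))"
   unfolding eq by (intro tendsto_minus lim2)
  then show ?thesis by (rule LIMSEQ_unique[OF lim1])
 qed
 show ?thesis
 proof (intro exI[of _ T1] conjI ballI impI)
  show "L1 (\<lambda>x. (u (x, s))\<^sup>2)" if "s\<in>T1" for s using that unfolding T1_def by blast
 qed (rule T1, rule main)
qed

end

section \<open>Cutoffs and spatial oscillation of truncations\<close>

lemma DERIV_max0_square: "((\<lambda>s::real. (max 0 s)\<^sup>2) has_real_derivative 2*max 0 s) (at s)"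
proof -
 consider "s > 0" | "s < 0" | "s = 0" by linarith
 then show ?thesis
 proof cases
  case 1
  have ev: "\<forall>\<^sub>F x in nhds s. (max 0 x)\<^sup>2 = x\<^sup>2"
   using eventually_nhds_in_open[of "{0<..}" s] 1 by (auto elim: eventually_mono)
  have "((\<lambda>s. s\<^sup>2) has_real_derivative 2*max 0 s) (at s)"
   using 1 by (auto intro!: derivative_eq_intros)
  then show ?thesis using DERIV_cong_ev[OF refl ev refl] by blast
 next
  case 2
  have ev: "\<forall>\<^sub>F x in nhds s. (max 0 x)\<^sup>2 = 0"
   using eventually_nhds_in_open[of "{..<0}" s] 2 by (auto elim: eventually_mono)
  have "((\<lambda>s. 0) has_real_derivative 2*max 0 s) (at s)"
   using 2 by (auto intro!: derivative_eq_intros)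
  then show ?thesis using DERIV_cong_ev[OF refl ev refl] by blast
 next
  case 3
  have "((\<lambda>h. (max 0 h)\<^sup>2/h) \<longlongrightarrow> 0) (at (0::real))"
  proof (rule Lim_null_comparison)
   show "\<forall>\<^sub>F h in at (0::real). norm ((max 0 h)\<^sup>2/h)\<le>\<bar>h\<bar>"
    by (rule always_eventually) (auto simp: max_def power2_eq_square)
   show "((\<lambda>h. \<bar>h\<bar>) \<longlongrightarrow> 0) (at (0::real))" using tendsto_rabs[OF tendsto_ident_at, of 0 UNIV] by simp
  qed
  then show ?thesis using 3 by (simp add: has_field_derivative_iff)
 qed
qed

text \<open>The cutoff only has to be continuously differentiable, so a quadratic spline composed with an affine function of
\<open>|x|\<^sup>2\<close> suffices.\<close>

lemma cutoff_exists:
 fixes r R :: real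
 assumes "0\<le>r" "r < R"
 obtains \<psi> :: "real^'n => real" and Q :: "real^'n => real^'n" where
  "\<And>x. (\<psi> has_derivative (\<lambda>h. Q x\<bullet>h)) (at x)" "continuous_on UNIV Q"
  "\<And>x. 0\<le>\<psi> x" "\<And>x. \<psi> x\<le>1" "\<And>x. norm x\<le>r ==> \<psi> x = 1"
  "\<And>x. norm x\<ge>R ==> \<psi> x = 0" "\<And>x. norm x\<ge>R ==> Q x = 0" "\<And>x. norm (Q x)\<le>4/(R-r)"
proof -
 define m where "m s = (max 0 s)\<^sup>2" for s :: real
 \<comment> \<open>The continuously differentiable spline rising from \<open>0\<close> to \<open>1\<close> on \<open>{0..1}\<close>.\<close>
 define S where "S s = 2*m s-4*m (s-1/2)+2*m (s-1)" for s :: real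
 define S' where "S' s = 4*max 0 s-8*max 0 (s-1/2)+4*max 0 (s-1)" for s :: real
 have dm: "((\<lambda>s. m (s-c)) has_real_derivative 2*max 0 (s-c)) (at s)" for s c
 proof -
  have "((\<lambda>s. s-c) has_real_derivative 1) (at s)" by (auto intro!: derivative_eq_intros)
  from DERIV_chain2[of m "2*max 0 (s-c)" "\<lambda>s. s-c", OF _ this] show ?thesis
   using DERIV_max0_square[of "s-c"] by (simp add: m_def[abs_def])
 qed
 have dS: "(S has_real_derivative S' s) (at s)" for s
  unfolding S_def[abs_def] S'_def using dm[of 0 s] dm[of "1/2" s] dm[of 1 s] by (auto intro!: derivative_eq_intros)
 have S0: "S s = 0" "S' s = 0" if "s\<le>0" for s using that by (auto simp: S_def S'_def m_def)
 have S1: "S s = 1" if "s\<ge>1" for s using that by (simp add: S_def m_def power2_eq_square algebra_simps)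
 have Sb: "0\<le>S s \<and> S s\<le>1" for s
 proof -
  consider "s\<le>0" | "0 < s" "s\<le>1/2" | "1/2 < s" "s\<le>1" | "s > 1" by linarith
  then show ?thesis
  proof cases
   case 2
   then have "S s = 2 * s\<^sup>2" by (simp add: S_def m_def)
   moreover have "s\<^sup>2\<le>(1/2)\<^sup>2" using 2 by (intro power_mono) auto
   ultimately show ?thesis by (simp add: power2_eq_square)
  next
   case 3
   then have e: "S s = 1-2*(1-s)\<^sup>2" by (simp add: S_def m_def power2_eq_square algebra_simps)
   have "(1-s)\<^sup>2\<le>(1/2)\<^sup>2" using 3 by (intro power_mono) auto
   then show ?thesis unfolding e by (simp add: power2_eq_square)
  qed (use S0 S1 in auto)
 qed
 have S'b: "\<bar>S' s\<bar>\<le>2" for s by (auto simp: S'_def max_def)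
 have c: "R\<^sup>2-r\<^sup>2 > 0" using assms by (simp add: power_strict_mono)
 define a where "a x = (R\<^sup>2-(norm x)\<^sup>2)/(R\<^sup>2-r\<^sup>2)" for x :: "real^'n"
 define Q where "Q x = (- 2*S' (a x)/(R\<^sup>2-r\<^sup>2))*\<^sub>R x" for x :: "real^'n"
 have da: "(a has_derivative (\<lambda>h. - 2*(x\<bullet>h)/(R\<^sup>2-r\<^sup>2))) (at x)" for x
  unfolding a_def[abs_def] power2_norm_eq_inner using c
  by (auto intro!: derivative_eq_intros simp: inner_commute)
 have a_le: "a x\<le>0" if "norm x\<ge>R" for x
  using power_mono[OF that, of 2] assms c by (simp add: a_def divide_nonpos_pos)
 show thesis
 proof (rule that[of "\<lambda>x. S (a x)" Q])
  fix x
  show "((\<lambda>x. S (a x)) has_derivative (\<bullet>) (Q x)) (at x)"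
   using has_derivative_compose[OF da dS[of "a x", unfolded has_field_derivative_def]]
   by (rule has_derivative_eq_rhs) (auto simp: Q_def fun_eq_iff)
  show "S (a x) = 1" if "norm x\<le>r"
   using power_mono[OF that, of 2] c by (intro S1) (simp add: a_def)
  show "S (a x) = 0" "Q x = 0" if "norm x\<ge>R" using S0[OF a_le[OF that]] by (auto simp: Q_def)
  show "norm (Q x)\<le>4/(R-r)"
  proof (cases "norm x\<ge>R")
   case True
   then show ?thesis using S0[OF a_le[OF True]] assms by (simp add: Q_def)
  next
   case False
   have "norm (Q x) = 2*\<bar>S' (a x)\<bar>*norm x/(R\<^sup>2-r\<^sup>2)" using c by (simp add: Q_def abs_mult)
   also have "\<dots>\<le>2*2*R/(R\<^sup>2-r\<^sup>2)"
    using S'b[of "a x"] False c by (intro divide_right_mono mult_mono) auto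
   also have "\<dots>\<le>4*(R+r)/(R\<^sup>2-r\<^sup>2)"
    using assms c by (intro divide_right_mono) auto
   also have "... = 4/(R-r)"
   proof -
    have "R\<^sup>2-r\<^sup>2 = (R+r)*(R-r)" by (simp add: power2_eq_square algebra_simps)
    moreover have "R+r\<noteq>0" using assms by auto
    ultimately show ?thesis
     using nonzero_mult_divide_mult_cancel_left[OF \<open>R + r \<noteq> 0\<close>, of 4 "R-r"] by (simp only: mult.commute[of 4])
   qed
   finally show ?thesis .
  qed
 next
  have "continuous_on UNIV a" by (rule has_derivative_continuous_on, rule has_derivative_at_withinI, rule da)
  then show "continuous_on UNIV Q" unfolding Q_def S'_def using c by (intro continuous_intros) auto
 qed (use Sb in auto)
qed

lemma AE_translate:
 fixes P :: "'a::euclidean_space => bool"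
 assumes "AE z in lborel. P z"
 shows "AE z in lborel. P (z-a)"
proof -
 have "AE z in distr lborel borel (\<lambda>x. - a+x). P z" using assms by (simp only: lborel_distr_plus)
 from AE_distrD[OF _ this] show ?thesis by simp
qed

text \<open>Lower semicontinuity on the left (Fatou) and domination on the right let a translation inequality pass to limits.\<close>

lemma translation_bound_limit:
 fixes f :: "nat => 'a::euclidean_space => real" and g :: "nat => 'a => 'b::euclidean_space" and I :: "'a => real"
 assumes [measurable]: "\<And>j. f j\<in>Borel" "\<And>j. g j\<in>Borel"
   "f0\<in>Borel" "g0\<in>Borel" "I\<in>Borel"
  and I: "\<And>z. 0\<le>I z" and p: "p > 0"
  and f: "AE z in lborel. (\<lambda>j. f j z) \<longlonglongrightarrow> f0 z" and g: "AE z in lborel. (\<lambda>j. g j z) \<longlonglongrightarrow> g0 z"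
  and h: "L1 h" "\<And>j. AE z in lborel. I z*norm (g j z) powr p\<le>h z"
  and le: "\<And>j. (\<integral>\<^sup>+z. ennreal (I z*\<bar>f j z-f j (z-a)\<bar> powr p) \<partial>lborel)
   \<le>c*(\<integral>\<^sup>+z. ennreal (I z*norm (g j z) powr p) \<partial>lborel)"
  and c: "c < \<infinity>"
 shows "(\<integral>\<^sup>+z. ennreal (I z*\<bar>f0 z-f0 (z-a)\<bar> powr p) \<partial>lborel)
   \<le>c*(\<integral>\<^sup>+z. ennreal (I z*norm (g0 z) powr p) \<partial>lborel)"
proof -
 have [measurable]: "h\<in>Borel" using h(1) by auto
 have shift [measurable]: "(\<lambda>z. k (z-a))\<in>Borel" if "k\<in>Borel" for k :: "'a => real"
  using measurable_compose[OF borel_measurable_diff[OF measurable_ident borel_measurable_const[of a]] that] by simp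
 have "(\<integral>\<^sup>+z. ennreal (I z*\<bar>f0 z-f0 (z-a)\<bar> powr p) \<partial>lborel)
   = (\<integral>\<^sup>+z. liminf (\<lambda>j. ennreal (I z*\<bar>f j z-f j (z-a)\<bar> powr p)) \<partial>lborel)"
 proof (rule nn_integral_cong_AE)
  show "AE z in lborel. ennreal (I z*\<bar>f0 z-f0 (z-a)\<bar> powr p) = liminf (\<lambda>j. ennreal (I z*\<bar>f j z-f j (z-a)\<bar> powr p))"
   using f AE_translate[OF f, of a]
  proof eventually_elim
   case (elim z)
   have "(\<lambda>j. \<bar>f j z-f j (z-a)\<bar> powr p) \<longlonglongrightarrow> \<bar>f0 z-f0 (z-a)\<bar> powr p"
    by (rule tendsto_powr'[OF tendsto_rabs[OF tendsto_diff[OF elim]] tendsto_const]) (use p in auto)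
   then have "(\<lambda>j. ennreal (I z*\<bar>f j z-f j (z-a)\<bar> powr p)) \<longlonglongrightarrow> ennreal (I z*\<bar>f0 z-f0 (z-a)\<bar> powr p)"
    by (intro tendsto_ennrealI tendsto_mult tendsto_const)
   then show ?case by (simp add: lim_imp_Liminf)
  qed
 qed
 also have "\<dots>\<le>liminf (\<lambda>j. \<integral>\<^sup>+z. ennreal (I z*\<bar>f j z-f j (z-a)\<bar> powr p) \<partial>lborel)"
  by (rule nn_integral_liminf) measurable
 also have "\<dots>\<le>liminf (\<lambda>j. c*(\<integral>\<^sup>+z. ennreal (I z*norm (g j z) powr p) \<partial>lborel))"
  by (rule Liminf_mono) (simp add: le)
 also have "... = c*(\<integral>\<^sup>+z. ennreal (I z*norm (g0 z) powr p) \<partial>lborel)"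
 proof (rule lim_imp_Liminf)
  have "(\<lambda>j. \<integral>\<^sup>+z. ennreal (I z*norm (g j z) powr p) \<partial>lborel) \<longlonglongrightarrow> (\<integral>\<^sup>+z. ennreal (I z*norm (g0 z) powr p) \<partial>lborel)"
  proof (rule nn_integral_dominated_convergence[where w = "\<lambda>z. ennreal (h z)"])
   show "AE z in lborel. ennreal (I z*norm (g j z) powr p)\<le>ennreal (h z)" for j
    using h(2)[of j] by eventually_elim (rule ennreal_leI)
   have "(\<integral>\<^sup>+z. ennreal (h z) \<partial>lborel)\<le>(\<integral>\<^sup>+z. ennreal (norm (h z)) \<partial>lborel)"
    by (intro nn_integral_mono ennreal_leI) simp
   also have "... < \<infinity>" using h(1) by (simp add: integrable_iff_bounded)
   finally show "(\<integral>\<^sup>+z. ennreal (h z) \<partial>lborel) < \<infinity>" .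
   show "AE z in lborel. (\<lambda>j. ennreal (I z*norm (g j z) powr p)) \<longlonglongrightarrow> ennreal (I z*norm (g0 z) powr p)"
    using g
   proof eventually_elim
    case (elim z)
    have "(\<lambda>j. norm (g j z) powr p) \<longlonglongrightarrow> norm (g0 z) powr p"
     by (rule tendsto_powr'[OF tendsto_norm[OF elim] tendsto_const]) (use p in auto)
    then show ?case by (intro tendsto_ennrealI tendsto_mult tendsto_const)
   qed
  qed measurable
  then show "(\<lambda>j. c*(\<integral>\<^sup>+z. ennreal (I z*norm (g j z) powr p) \<partial>lborel)) \<longlonglongrightarrow> c*(\<integral>\<^sup>+z. ennreal (I z*norm (g0 z) powr p) \<partial>lborel)"
   using c by (intro ennreal_tendsto_cmult) auto
 qed auto
 finally show ?thesis .
qed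

lemma nn_integral_slices:
 fixes f :: "'a::euclidean_space\<times>real => ennreal"
 assumes "f\<in>Borel"
 shows "(\<integral>\<^sup>+t. \<integral>\<^sup>+x. f (x, t) \<partial>lborel \<partial>lborel) = (\<integral>\<^sup>+z. f z \<partial>lborel)"
proof -
 have "(\<lambda>(x, t). f (x, t))\<in>borel_measurable (lborel \<Otimes>\<^sub>M lborel)" using assms by (simp add: lborel_prod)
 from lborel_pair.nn_integral_snd[OF this] show ?thesis by (simp add: lborel_prod)
qed

context local_solution
begin

text \<open>For smooth functions this is \<open>translation_powr_le\<close> at each time; a truncation is reached through mollifications and
smooth approximations of \<open>s \<mapsto> (s-k)\<^sub>+\<close>. The field \<open>W\<close> is the weak gradient of \<open>w\<close>, but this is never needed.\<close>

lemma truncation_translation_bound: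
 fixes \<xi> :: "real^'n => real" and P :: "real^'n => real^'n"
 assumes R: "R < R0" and k: "k\<ge>0"
  and \<xi>: "\<And>x. (\<xi> has_derivative (\<lambda>h. P x\<bullet>h)) (at x)" and P: "continuous_on UNIV P"
  and z: "\<And>x. norm x > R ==> \<xi> x = 0" "\<And>x. norm x > R ==> P x = 0"
 defines "w \<equiv> \<lambda>z. max 0 (u z-k)*\<xi> (fst z)"
  and "W \<equiv> \<lambda>z. (\<xi> (fst z)*(if u z > k then 1 else 0))*\<^sub>R D z+max 0 (u z-k)*\<^sub>R P (fst z)"
 shows "(\<integral>\<^sup>+z. ennreal (indicator {a..b} (snd z)*\<bar>w z-w (z-(y, 0))\<bar> powr p) \<partial>lborel)
  \<le>ennreal (norm y powr p)*(\<integral>\<^sup>+z. ennreal (indicator {a..b} (snd z)*norm (W z) powr p) \<partial>lborel)"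
proof -
 have c\<xi>: "continuous_on UNIV \<xi>" by (rule has_derivative_continuous_on, rule has_derivative_at_withinI, rule \<xi>)
 have [measurable]: "\<xi>\<in>Borel" "P\<in>Borel"
  using c\<xi> P by (auto intro: borel_measurable_continuous_onI)
 obtain B1 where B1: "B1 > 0" "\<And>x. norm (\<xi> x)\<le>B1" using bounded_of_vanishing[OF c\<xi> z(1)] by blast
 obtain B2 where B2: "B2 > 0" "\<And>x. norm (P x)\<le>B2" using bounded_of_vanishing[OF P z(2)] by blast
 let ?I = "\<lambda>z::(real^'n)\<times>real. indicator {a..b} (snd z) :: real"
 have [measurable]: "?I\<in>Borel" by measurable
 obtain G F g where GFg: "\<And>i x. (G i has_real_derivative F i x) (at x)" "\<And>i x. (F i has_real_derivative g i x) (at x)"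
  "\<And>i. continuous_on UNIV (g i)" "\<And>i x. \<bar>F i x\<bar>\<le>real (Suc i)" "\<And>i x. \<bar>g i x\<bar>\<le>1"
  and b: "\<And>i x. 0\<le>F i x" "\<And>i x. F i x\<le>max 0 (x-k)" "\<And>i x. 0\<le>G i x" "\<And>i x. G i x\<le>(max 0 (x-k))\<^sup>2/2"
  and l: "\<And>x. (\<lambda>i. g i x) \<longlonglongrightarrow> (if x > k then 1 else 0)" "\<And>x. (\<lambda>i. F i x) \<longlonglongrightarrow> max 0 (x-k)"
  "\<And>x. (\<lambda>i. G i x) \<longlonglongrightarrow> (max 0 (x-k))\<^sup>2/2"
  by (rule truncation_sequence[of k]) blast
 have cF: "continuous_on UNIV (F i)" for i
  using DERIV_isCont[OF GFg(2)] by (simp add: continuous_on_eq_continuous_at)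
 have [measurable]: "F i\<in>Borel" "g i\<in>Borel" for i
  using cF GFg(3) by (auto intro: borel_measurable_continuous_onI)
 have d0: "R0-R > 0" using R by simp
 obtain d H where d: "\<And>j. 0 < d j" "\<And>j. d j < R0-R" and H: "H\<in>Borel" "L1 H" "\<And>z. H z\<ge>0"
  and lim: "AE z in lborel. (\<lambda>j. mollify (d j) u z) \<longlonglongrightarrow> u z"
  "AE z in lborel. (\<lambda>j. mollify (d j) D z) \<longlonglongrightarrow> D z"
  "AE z in lborel. (\<lambda>j. mollify (d j) A z) \<longlonglongrightarrow> A z"
  and bd: "AE z in lborel. \<forall>j. norm (mollify (d j) u z) powr p\<le>H z \<and> norm (mollify (d j) D z) powr p\<le>H z
    \<and> norm (mollify (d j) A z) powr q\<le>H z"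
  using good_mollifying_sequence[OF u_1 u_p D_1 D_p A_1 A_q less_imp_le[OF p] less_imp_le[OF q1] d0] by blast
 note [measurable] = H(1) mollify_measurable[OF u_borel d(1)] mollify_measurable[OF D_borel d(1)]
 have smooth: "(\<integral>\<^sup>+z. ennreal (?I z*\<bar>F i (mollify (d j) u z)*\<xi> (fst z)-F i (mollify (d j) u (z-(y, 0)))*\<xi> (fst (z-(y, 0)))\<bar> powr p) \<partial>lborel)
  \<le>ennreal (norm y powr p)*(\<integral>\<^sup>+z. ennreal (?I z*norm ((\<xi> (fst z)*g i (mollify (d j) u z))*\<^sub>R mollify (d j) D z+F i (mollify (d j) u z)*\<^sub>R P (fst z)) powr p) \<partial>lborel)" for i j
 proof -
  let ?f = "\<lambda>z. F i (mollify (d j) u z)*\<xi> (fst z)"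
  let ?g = "\<lambda>z. (\<xi> (fst z)*g i (mollify (d j) u z))*\<^sub>R mollify (d j) D z+F i (mollify (d j) u z)*\<^sub>R P (fst z)"
  have fm: "?f\<in>Borel" and gm: "?g\<in>Borel" by measurable
  have shift: "(\<lambda>z. ?f (z-(y, 0)))\<in>Borel"
   using measurable_compose[OF borel_measurable_diff[OF measurable_ident borel_measurable_const[of "(y, 0)"]] fm] by simp
  note [measurable] = fm gm shift
  have sl: "AE t in lborel. (\<integral>\<^sup>+x. ennreal (?I (x, t)*\<bar>?f (x, t)-?f ((x, t)-(y, 0))\<bar> powr p) \<partial>lborel)
   \<le>(\<integral>\<^sup>+x. ennreal (norm y powr p)*ennreal (?I (x, t)*norm (?g (x, t)) powr p) \<partial>lborel)"
   using AE_integrable_slice[OF u_1] weak_grad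
  proof eventually_elim
   case (elim t)
   have wd: "((\<lambda>y. mollify (d j) u (y, t)) has_derivative (\<lambda>h. mollify_grad (d j) u (y, t)\<bullet>h)) (at y)" for y
    by (rule mollify_has_derivative[OF elim(1) d(1)])
   have wc: "continuous_on UNIV (\<lambda>y. mollify (d j) u (y, t))"
    by (rule has_derivative_continuous_on, rule has_derivative_at_withinI, rule wd)
   let ?g' = "\<lambda>x. (\<xi> x*g i (mollify (d j) u (x, t)))*\<^sub>R mollify_grad (d j) u (x, t)+F i (mollify (d j) u (x, t))*\<^sub>R P x"
   have gg: "?g (x, t) = ?g' x" for x
   proof (cases "norm x\<le>R")
    case True
    have "cball x (d j) \<subseteq> ball 0 R0"
    proof
     fix v assume "v\<in>cball x (d j)"
     then have "norm (v-x)\<le>d j" by (simp add: dist_norm norm_minus_commute)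
     then show "v\<in>ball 0 R0" using norm_triangle_ineq[of "v-x" x] True d(2)[of j] by simp
    qed
    then have "mollify_grad (d j) u (x, t) = mollify (d j) D (x, t)"
     by (intro mollify_grad_eq_mollify[OF _ d(1)]) (use elim(2) in blast)
    then show ?thesis by simp
   qed (use z in simp)
   have "(\<integral>\<^sup>+x. ennreal (\<bar>?f (x, t)-?f (x-y, t)\<bar> powr p) \<partial>lborel)\<le>ennreal (norm y powr p)*(\<integral>\<^sup>+x. ennreal (norm (?g' x) powr p) \<partial>lborel)"
   proof (rule translation_powr_le)
    fix x
    have 1: "((\<lambda>y. F i (mollify (d j) u (y, t))) has_derivative (\<lambda>h. g i (mollify (d j) u (x, t))*(mollify_grad (d j) u (x, t)\<bullet>h))) (at x)"
     using has_derivative_compose[OF wd GFg(2)[of i "mollify (d j) u (x, t)", unfolded has_field_derivative_def]] .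
    show "((\<lambda>x. F i (mollify (d j) u (x, t))*\<xi> (fst (x, t))) has_derivative (\<bullet>) (?g' x)) (at x)"
     unfolding fst_conv
     using has_derivative_mult[OF 1 \<xi>[of x]]
     by (rule has_derivative_eq_rhs) (auto simp: fun_eq_iff inner_add_left algebra_simps)
   next
    show "continuous_on UNIV ?g'"
     by (intro continuous_intros P c\<xi> continuous_on_compose2[OF cF wc] continuous_on_compose2[OF GFg(3) wc]
       mollify_grad_continuous[OF elim(1) d(1)]) auto
   qed (use p in auto)
   then have key: "(\<integral>\<^sup>+x. ennreal (\<bar>?f (x, t)-?f (x-y, t)\<bar> powr p) \<partial>lborel)\<le>(\<integral>\<^sup>+x. ennreal (norm y powr p)*ennreal (norm (?g (x, t)) powr p) \<partial>lborel)"
    unfolding gg[symmetric]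
   proof (subst nn_integral_cmult)
    show "(\<lambda>x. ennreal (norm (?g (x, t)) powr p))\<in>borel_measurable lborel"
     using slice_measurable[OF gm, of t] by measurable
   qed
   show ?case
    using key by (cases "t\<in>{a..b}") auto
  qed
  have "(\<integral>\<^sup>+z. ennreal (?I z*\<bar>?f z-?f (z-(y, 0))\<bar> powr p) \<partial>lborel)
    = (\<integral>\<^sup>+t. \<integral>\<^sup>+x. ennreal (?I (x, t)*\<bar>?f (x, t)-?f ((x, t)-(y, 0))\<bar> powr p) \<partial>lborel \<partial>lborel)"
   by (rule nn_integral_slices[symmetric]) measurable
  also have "\<dots>\<le>(\<integral>\<^sup>+t. \<integral>\<^sup>+x. ennreal (norm y powr p)*ennreal (?I (x, t)*norm (?g (x, t)) powr p) \<partial>lborel \<partial>lborel)"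
   by (rule nn_integral_mono_AE[OF sl])
  also have "... = (\<integral>\<^sup>+z. ennreal (norm y powr p)*ennreal (?I z*norm (?g z) powr p) \<partial>lborel)"
   by (rule nn_integral_slices) measurable
  also have "... = ennreal (norm y powr p)*(\<integral>\<^sup>+z. ennreal (?I z*norm (?g z) powr p) \<partial>lborel)"
   by (rule nn_integral_cmult) measurable
  finally show ?thesis .
 qed
 have step1: "(\<integral>\<^sup>+z. ennreal (?I z*\<bar>F i (u z)*\<xi> (fst z)-F i (u (z-(y, 0)))*\<xi> (fst (z-(y, 0)))\<bar> powr p) \<partial>lborel)
  \<le>ennreal (norm y powr p)*(\<integral>\<^sup>+z. ennreal (?I z*norm ((\<xi> (fst z)*g i (u z))*\<^sub>R D z+F i (u z)*\<^sub>R P (fst z)) powr p) \<partial>lborel)" for i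
 proof (rule translation_bound_limit[where f = "\<lambda>j z. F i (mollify (d j) u z)*\<xi> (fst z)"
    and g = "\<lambda>j z. (\<xi> (fst z)*g i (mollify (d j) u z))*\<^sub>R mollify (d j) D z+F i (mollify (d j) u z)*\<^sub>R P (fst z)"
    and h = "\<lambda>z. 2 powr p*(B1 powr p*H z+(real (Suc i)*B2) powr p*indicator (cball 0 R\<times>{a..b}) z)"])
  have FF: "AE z in lborel. (\<lambda>j. F i (mollify (d j) u z)) \<longlonglongrightarrow> F i (u z)"
   using lim(1)
   by eventually_elim (rule isCont_tendsto_compose[rotated], assumption, use cF in \<open>simp add: continuous_on_eq_continuous_at\<close>)
  have gg: "AE z in lborel. (\<lambda>j. g i (mollify (d j) u z)) \<longlonglongrightarrow> g i (u z)"
   using lim(1)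
   by eventually_elim (rule isCont_tendsto_compose[rotated], assumption, use GFg(3) in \<open>simp add: continuous_on_eq_continuous_at\<close>)
  show "AE z in lborel. (\<lambda>j. F i (mollify (d j) u z)*\<xi> (fst z)) \<longlonglongrightarrow> F i (u z)*\<xi> (fst z)"
   using FF by eventually_elim (intro tendsto_mult tendsto_const)
  show "AE z in lborel. (\<lambda>j. (\<xi> (fst z)*g i (mollify (d j) u z))*\<^sub>R mollify (d j) D z+F i (mollify (d j) u z)*\<^sub>R P (fst z)) \<longlonglongrightarrow> (\<xi> (fst z)*g i (u z))*\<^sub>R D z+F i (u z)*\<^sub>R P (fst z)"
   using FF gg lim(2) by eventually_elim (intro tendsto_mult tendsto_add tendsto_scaleR tendsto_const)
  show "L1 (\<lambda>z::(real^'n)\<times>real. 2 powr p*(B1 powr p*H z+(real (Suc i)*B2) powr p*indicator (cball 0 R\<times>{a..b}) z))"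
   by (intro integrable_mult_right Bochner_Integration.integrable_add H(2) cball_times_interval_integrable)
  show "AE z in lborel. ?I z*norm ((\<xi> (fst z)*g i (mollify (d j) u z))*\<^sub>R mollify (d j) D z+F i (mollify (d j) u z)*\<^sub>R P (fst z)) powr p
   \<le>2 powr p*(B1 powr p*H z+(real (Suc i)*B2) powr p*indicator (cball 0 R\<times>{a..b}) z)" for j
   using bd
  proof eventually_elim
   case (elim w)
   show ?case
   proof (cases "snd w\<in>{a..b} \<and> norm (fst w)\<le>R")
    case True
    then have I: "indicator (cball (0::real^'n) R\<times>{a..b}) w = (1::real)" "?I w = 1" by (cases w; auto)+
    have "\<bar>\<xi> (fst w)*g i (mollify (d j) u w)\<bar>\<le>B1*1"
     unfolding abs_mult using B1 GFg(5) by (intro mult_mono) (auto simp: less_imp_le)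
    then have 1: "norm ((\<xi> (fst w)*g i (mollify (d j) u w))*\<^sub>R mollify (d j) D w)\<le>B1*norm (mollify (d j) D w)"
     unfolding norm_scaleR by (intro mult_right_mono) auto
    have 2: "norm (F i (mollify (d j) u w)*\<^sub>R P (fst w))\<le>real (Suc i)*B2"
     unfolding norm_scaleR using GFg(4) B2 by (intro mult_mono) auto
    have "norm ((\<xi> (fst w)*g i (mollify (d j) u w))*\<^sub>R mollify (d j) D w+F i (mollify (d j) u w)*\<^sub>R P (fst w)) powr p
     \<le>(B1*norm (mollify (d j) D w)+real (Suc i)*B2) powr p"
     using p norm_triangle_le[OF add_mono[OF 1 2]] by (intro powr_mono2) auto
    also have "\<dots>\<le>2 powr p*((B1*norm (mollify (d j) D w)) powr p+(real (Suc i)*B2) powr p)"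
     using p B1 B2 by (intro powr_sum_le) auto
    also have "\<dots>\<le>2 powr p*(B1 powr p*H w+(real (Suc i)*B2) powr p)"
     using elim B1 by (intro mult_left_mono add_right_mono) (auto simp: powr_mult)
    finally show ?thesis unfolding I by simp
   next
    case False
    then have "?I w*norm ((\<xi> (fst w)*g i (mollify (d j) u w))*\<^sub>R mollify (d j) D w+F i (mollify (d j) u w)*\<^sub>R P (fst w)) powr p = 0"
     using z by auto
    moreover have "0\<le>2 powr p*(B1 powr p*H w+(real (Suc i)*B2) powr p*indicator (cball 0 R\<times>{a..b}) w)"
     using H(3)[of w] by (intro mult_nonneg_nonneg add_nonneg_nonneg) auto
    ultimately show ?thesis by linarith
   qed
  qed
  show "(\<integral>\<^sup>+z. ennreal (?I z*\<bar>F i (mollify (d j) u z)*\<xi> (fst z)-F i (mollify (d j) u (z-(y, 0)))*\<xi> (fst (z-(y, 0)))\<bar> powr p) \<partial>lborel)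
  \<le>ennreal (norm y powr p)*(\<integral>\<^sup>+z. ennreal (?I z*norm ((\<xi> (fst z)*g i (mollify (d j) u z))*\<^sub>R mollify (d j) D z+F i (mollify (d j) u z)*\<^sub>R P (fst z)) powr p) \<partial>lborel)" for j
   by (rule smooth)
 qed (use p in auto)
 have mk: "\<bar>max 0 (v-k)\<bar>\<le>\<bar>v\<bar>" for v using k by auto
 show ?thesis
 proof (rule translation_bound_limit[where f = "\<lambda>i z. F i (u z)*\<xi> (fst z)"
    and g = "\<lambda>i z. (\<xi> (fst z)*g i (u z))*\<^sub>R D z+F i (u z)*\<^sub>R P (fst z)"
    and h = "\<lambda>z. 2 powr p*(B1 powr p*norm (D z) powr p+B2 powr p*norm (u z) powr p)"])
  show "AE z in lborel. (\<lambda>i. F i (u z)*\<xi> (fst z)) \<longlonglongrightarrow> w z"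
   unfolding w_def by (intro AE_I2 tendsto_mult tendsto_const l)
  show "AE z in lborel. (\<lambda>i. (\<xi> (fst z)*g i (u z))*\<^sub>R D z+F i (u z)*\<^sub>R P (fst z)) \<longlonglongrightarrow> W z"
   unfolding W_def by (intro AE_I2 tendsto_mult tendsto_add tendsto_scaleR tendsto_const l)
  show "L1 (\<lambda>z. 2 powr p*(B1 powr p*norm (D z) powr p+B2 powr p*norm (u z) powr p))"
   by (intro integrable_mult_right Bochner_Integration.integrable_add D_p u_p)
  show "AE z in lborel. ?I z*norm ((\<xi> (fst z)*g i (u z))*\<^sub>R D z+F i (u z)*\<^sub>R P (fst z)) powr p
   \<le>2 powr p*(B1 powr p*norm (D z) powr p+B2 powr p*norm (u z) powr p)" for i
  proof (rule AE_I2)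
   fix v
   have "\<bar>\<xi> (fst v)*g i (u v)\<bar>\<le>B1*1"
    unfolding abs_mult using B1 GFg(5) by (intro mult_mono) (auto simp: less_imp_le)
   then have 1: "norm ((\<xi> (fst v)*g i (u v))*\<^sub>R D v)\<le>B1*norm (D v)"
    unfolding norm_scaleR by (intro mult_right_mono) auto
   have "\<bar>F i (u v)\<bar>\<le>\<bar>u v\<bar>" using b(1)[of i "u v"] b(2)[of i "u v"] mk[of "u v"] by linarith
   then have 2: "norm (F i (u v)*\<^sub>R P (fst v))\<le>norm (u v)*B2"
    unfolding norm_scaleR using B2 by (intro mult_mono) auto
   have "norm ((\<xi> (fst v)*g i (u v))*\<^sub>R D v + F i (u v)*\<^sub>R P (fst v)) powr p\<le>(B1*norm (D v)+norm (u v)*B2) powr p"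
    using p norm_triangle_le[OF add_mono[OF 1 2]] by (intro powr_mono2) auto
   also have "\<dots>\<le>2 powr p*((B1*norm (D v)) powr p+(norm (u v)*B2) powr p)"
    using p B1 B2 by (intro powr_sum_le) auto
   also have "... = 2 powr p*(B1 powr p*norm (D v) powr p+B2 powr p*norm (u v) powr p)"
    using B1 B2 by (simp add: powr_mult mult.commute)
   finally have *: "norm ((\<xi> (fst v)*g i (u v))*\<^sub>R D v + F i (u v)*\<^sub>R P (fst v)) powr p\<le>\<dots>" .
   have "?I v * norm ((\<xi> (fst v)*g i (u v))*\<^sub>R D v + F i (u v)*\<^sub>R P (fst v)) powr p\<le>1*norm ((\<xi> (fst v)*g i (u v))*\<^sub>R D v + F i (u v)*\<^sub>R P (fst v)) powr p"
    by (intro mult_right_mono) (auto simp: indicator_def)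
   then show "?I v * norm ((\<xi> (fst v)*g i (u v))*\<^sub>R D v + F i (u v)*\<^sub>R P (fst v)) powr p
   \<le>2 powr p*(B1 powr p*norm (D v) powr p+B2 powr p*norm (u v) powr p)" using * by linarith
  qed
  show "w\<in>Borel" "W\<in>Borel" unfolding w_def W_def by measurable
 qed (use p step1 in auto)
qed

end

section \<open>The Caccioppoli inequality\<close>

text \<open>Young's inequality in the form in which one factor carries the exponent \<open>p - 1\<close> of the flux bound.\<close>

lemma young_powr:
 fixes X Y p :: real
 assumes "X\<ge>0" "Y\<ge>0" "p > 1"
 shows "X*Y powr (p-1)\<le>X powr p+Y powr p"
proof -
 have q: "p/(p-1) > 1" "1/p+1/(p/(p-1)) = 1" using assms by (auto simp: field_simps)
 have "X*Y powr (p-1)\<le>X powr p/p+(Y powr (p-1)) powr (p/(p-1))/(p/(p-1))"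
  using assms q by (intro Youngs_inequality) auto
 also have "(Y powr (p-1)) powr (p/(p-1)) = Y powr p" using assms by (simp add: powr_powr)
 also have "X powr p/p+Y powr p/(p/(p-1))\<le>X powr p+Y powr p"
  using divide_left_mono[of 1 p "X powr p"] divide_left_mono[of 1 "p/(p-1)" "Y powr p"] assms q by simp
 finally show ?thesis .
qed

text \<open>A natural exponent \<open>M \<ge> p\<close> for the cutoff \<open>\<psi>\<^sup>M\<close>, so that the factor \<open>\<psi> ^ (M - 1)\<close> produced by
differentiation is at most \<open>(\<psi> ^ M) powr ((p - 1) / p)\<close>, the power that Young's inequality can absorb.\<close>

definition cacc_exp :: "real => nat" where "cacc_exp p = nat \<lceil>p\<rceil>+1"

definition young_const :: "real => real => real => real" where
 "young_const p \<Lambda>0 \<Lambda>1 = (real (cacc_exp p)*\<Lambda>1*((\<Lambda>0/2) powr (1/p)) powr (- (p-1))) powr p"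

definition cacc_const :: "real => real => real => real" where
 "cacc_const p \<Lambda>0 \<Lambda>1 = 2*(1+young_const p \<Lambda>0 \<Lambda>1*4 powr p)
   + 2 powr p*(2*(1+young_const p \<Lambda>0 \<Lambda>1*4 powr p)/\<Lambda>0+(4*real (cacc_exp p)) powr p)"

lemma cacc_exp_ge: assumes "p > 1" shows "real (cacc_exp p)\<ge>p" "cacc_exp p\<ge>2"
proof -
 have "real (nat \<lceil>p\<rceil>)\<ge>p" by linarith
 then show "real (cacc_exp p)\<ge>p" by (simp add: cacc_exp_def)
 have "nat \<lceil>p\<rceil>\<ge>1" using assms by linarith
 then show "cacc_exp p\<ge>2" by (simp add: cacc_exp_def)
qed

text \<open>Coercivity of the diagonal term; the term with the gradient of the cutoff is absorbed into half of it by Young's inequality.\<close>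

lemma energy_density_lower_bound:
 fixes D A Q :: "'a::real_inner" and \<psi> v c p :: real
 assumes p: "p > 1" and L: "0 < \<Lambda>0" "0 < \<Lambda>1"
  and s: "A\<bullet>D\<ge>\<Lambda>0*norm D powr p" "norm A\<le>\<Lambda>1*norm D powr (p-1)"
  and \<psi>: "0\<le>\<psi>" "\<psi>\<le>1" and Q: "norm Q\<le>c" and v: "v\<ge>0"
 defines "M \<equiv> cacc_exp p"
 shows "\<Lambda>0/2*(\<psi>^M*norm D powr p)-young_const p \<Lambda>0 \<Lambda>1 * c powr p * v powr p
  \<le>v * (((real M*\<psi>^(M-1))*\<^sub>R Q)\<bullet>A)+\<psi>^M*(D\<bullet>A)"
proof -
 have M: "real M\<ge>p" "M\<ge>2" using cacc_exp_ge[OF p] by (auto simp: M_def)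
 have c0: "c\<ge>0" using Q norm_ge_zero order_trans by blast
 \<comment> \<open>This weight makes the term to be absorbed exactly half of the coercive one.\<close>
 define \<tau> where "\<tau> = (\<Lambda>0/2) powr (1/p)"
 have \<tau>: "\<tau> > 0" "\<tau> powr p = \<Lambda>0/2" using L p by (auto simp: \<tau>_def powr_powr)
 define y where "y = \<psi> powr (real M/p)"
 have y: "y\<ge>0" "y powr p = \<psi>^M"
 proof -
  show "y powr p = \<psi>^M"
  proof (cases "\<psi> = 0")
   case False
   then have "\<psi> powr real M = \<psi>^M" using \<psi> by (intro powr_realpow) auto
   then show ?thesis using p by (simp add: y_def powr_powr)
  qed (use M p in \<open>simp add: y_def\<close>)
 qed (simp add: y_def)
 have yM: "\<psi>^(M-1)\<le>y powr (p-1)"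
 proof (cases "\<psi> = 0")
  case False
  then have \<psi>0: "\<psi> > 0" using \<psi> by simp
  have "\<psi>^(M-1) = \<psi> powr real (M-1)" using \<psi>0 by (simp add: powr_realpow)
  also have "\<dots>\<le>\<psi> powr (real M/p*(p-1))"
  proof (rule powr_mono')
   have "real M/p*(p-1) = real M-real M/p" using p by (simp add: field_simps)
   moreover have "real M/p\<ge>1" using M p by simp
   ultimately show "real M/p*(p-1)\<le>real (M-1)" using M by (simp add: of_nat_diff)
  qed (use \<psi> in auto)
  also have "... = y powr (p-1)" by (simp add: y_def powr_powr)
  finally show ?thesis .
 qed (use M in \<open>simp add: power_0_left\<close>)
 define X where "X = c * v * (real M*\<Lambda>1*\<tau> powr (- (p-1)))"
 define Y where "Y = \<tau>*y*norm D"
 have X0: "X\<ge>0" unfolding X_def using c0 v L by simp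
 have Y0: "Y\<ge>0" unfolding Y_def using \<tau> y by simp
 have Xp: "X powr p = young_const p \<Lambda>0 \<Lambda>1 * c powr p * v powr p"
  unfolding X_def young_const_def M_def \<tau>_def using c0 v L by (simp add: powr_mult mult_ac)
 have Yp: "Y powr p = \<Lambda>0/2*(\<psi>^M*norm D powr p)"
  unfolding Y_def using \<tau> y by (simp add: powr_mult)
 have XY: "X*Y powr (p-1) = (c * v * real M*\<Lambda>1)*(y powr (p-1)*norm D powr (p-1))"
 proof -
  have "\<tau> powr (- (p-1))*\<tau> powr (p-1) = 1" using \<tau> by (simp add: powr_add[symmetric])
  moreover have "Y powr (p-1) = \<tau> powr (p-1)*(y powr (p-1)*norm D powr (p-1))"
   unfolding Y_def using \<tau> y by (simp add: powr_mult)
  ultimately show ?thesis unfolding X_def by (simp add: algebra_simps)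
 qed
 have "\<bar>v * (((real M*\<psi>^(M-1))*\<^sub>R Q)\<bullet>A)\<bar> = v * (real M*\<psi>^(M-1))*\<bar>Q\<bullet>A\<bar>"
  using v \<psi> by (simp add: abs_mult)
 also have "\<dots>\<le>v * (real M*y powr (p-1))*(c*(\<Lambda>1*norm D powr (p-1)))"
 proof (intro mult_mono mult_left_mono)
  have "norm Q*norm A\<le>c*(\<Lambda>1*norm D powr (p-1))"
   using Q s(2) c0 by (intro mult_mono) auto
  then show "\<bar>Q\<bullet>A\<bar>\<le>c*(\<Lambda>1*norm D powr (p-1))" using Cauchy_Schwarz_ineq2[of Q A] by linarith
 qed (use yM v \<psi> in auto)
 also have "... = X*Y powr (p-1)" unfolding XY by (simp add: mult_ac)
 also have "\<dots>\<le>X powr p+Y powr p" by (rule young_powr[OF X0 Y0 p])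
 finally have 1: "- (X powr p+Y powr p)\<le>v * (((real M*\<psi>^(M-1))*\<^sub>R Q)\<bullet>A)" by linarith
 have "\<psi>^M*(\<Lambda>0*norm D powr p)\<le>\<psi>^M*(D\<bullet>A)"
  using s(1) \<psi> by (intro mult_left_mono) (auto simp: inner_commute)
 moreover have "\<psi>^M*(\<Lambda>0*norm D powr p) = 2*(\<Lambda>0/2*(\<psi>^M*norm D powr p))" by simp
 ultimately show ?thesis using 1 unfolding Xp Yp by linarith
qed

context local_solution
begin

lemma max_powr_integrable:
 assumes "k\<ge>0"
 shows "L1 (\<lambda>z. max 0 (u z-k) powr p)" "L1 (\<lambda>z. (max 0 (u z-k))\<^sup>2)"
proof -
 have m: "\<bar>max 0 (v-k)\<bar>\<le>\<bar>v\<bar>" for v using assms by auto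
 show "L1 (\<lambda>z. max 0 (u z-k) powr p)"
 proof (rule Bochner_Integration.integrable_bound[OF u_p])
  show "AE z in lborel. norm (max 0 (u z-k) powr p)\<le>norm (norm (u z) powr p)"
   using m p by (intro AE_I2) (auto intro!: powr_mono2)
 qed measurable
 show "L1 (\<lambda>z. (max 0 (u z-k))\<^sup>2)"
 proof (rule Bochner_Integration.integrable_bound[OF u_2])
  show "AE z in lborel. norm ((max 0 (u z-k))\<^sup>2)\<le>norm ((u z)\<^sup>2)"
  proof (rule AE_I2)
   fix z
   have "(max 0 (u z-k))\<^sup>2\<le>(u z)\<^sup>2" by (rule iffD1[OF abs_le_square_iff m])
   then show "norm ((max 0 (u z-k))\<^sup>2)\<le>norm ((u z)\<^sup>2)" by simp
  qed
 qed measurable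
qed

lemma restrict_integrable:
 assumes f: "L1 f" and [measurable]: "h\<in>Borel" and h: "\<And>z. \<bar>h z\<bar>\<le>1"
 shows "L1 (\<lambda>z::(real^'n)\<times>real. h z*f z :: real)"
proof (rule Bochner_Integration.integrable_bound[OF f])
 show "AE z in lborel. norm (h z*f z)\<le>norm (f z)"
  using h by (intro AE_I2) (simp add: abs_mult mult_left_le_one_le)
 have [measurable]: "f\<in>Borel" using f by auto
 show "(\<lambda>z. h z*f z)\<in>borel_measurable lborel" by measurable
qed

text \<open>The truncated energy identity with \<open>\<xi> = \<psi>\<^sup>M\<close>, estimated pointwise by \<open>energy_density_lower_bound\<close>.\<close>

lemma energy_inequality:
 fixes \<psi> :: "real^'n => real" and Q :: "real^'n => real^'n"
 assumes R: "R < R0" and k: "k\<ge>0"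
  and \<psi>: "\<And>x. (\<psi> has_derivative (\<lambda>h. Q x\<bullet>h)) (at x)" "continuous_on UNIV Q" "\<And>x. 0\<le>\<psi> x" "\<And>x. \<psi> x\<le>1"
  and z: "\<And>x. norm x > R ==> \<psi> x = 0" "\<And>x. norm x > R ==> Q x = 0" and Q: "\<And>x. norm (Q x)\<le>c"
 defines "M \<equiv> cacc_exp p"
 shows "\<exists>T1. (AE t in lborel. t\<in>{-\<theta>..\<theta>} --> t\<in>T1) \<and> (\<forall>s\<in>T1. L1 (\<lambda>x. \<psi> x^M*(max 0 (u (x, s)-k))\<^sup>2)) \<and> (\<forall>s\<in>T1. \<forall>t\<in>T1. s\<le>t \<longrightarrow>
  (LINT x|lborel. \<psi> x^M*(max 0 (u (x, t)-k))\<^sup>2)/2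
   + \<Lambda>0/2*(LINT z|lborel. indicator {s..t} (snd z)*(\<psi> (fst z)^M*(if u z > k then 1 else 0)*norm (D z) powr p))
  \<le>(LINT x|lborel. \<psi> x^M*(max 0 (u (x, s)-k))\<^sup>2)/2
   + young_const p \<Lambda>0 \<Lambda>1 * c powr p*(LINT z|lborel. indicator {s..t} (snd z)*(indicator (cball 0 R) (fst z)*max 0 (u z-k) powr p)))"
proof -
 have M2: "M\<ge>2" using cacc_exp_ge[OF p] by (auto simp: M_def)
 let ?\<xi> = "\<lambda>x. \<psi> x^M" and ?P = "\<lambda>x. (real M*\<psi> x^(M-1))*\<^sub>R Q x"
 let ?C = "young_const p \<Lambda>0 \<Lambda>1 * c powr p"
 have c\<psi>: "continuous_on UNIV \<psi>" by (rule has_derivative_continuous_on, rule has_derivative_at_withinI, rule \<psi>)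
 have [measurable]: "\<psi>\<in>Borel" "Q\<in>Borel"
  using c\<psi> \<psi>(2) by (auto intro: borel_measurable_continuous_onI)
 have \<xi>: "(?\<xi> has_derivative (\<lambda>h. ?P x\<bullet>h)) (at x)" for x
  using has_derivative_power[OF \<psi>(1)[of x], of M] by (rule has_derivative_eq_rhs) (auto simp: fun_eq_iff mult_ac)
 have cP: "continuous_on UNIV ?P" by (intro continuous_intros c\<psi> \<psi>(2))
 have z\<xi>: "norm x > R ==> ?\<xi> x = 0" "norm x > R ==> ?P x = 0" for x using z[of x] M2 by auto
 have \<xi>1: "0\<le>?\<xi> x" "?\<xi> x\<le>1" for x using \<psi>(3,4) by (auto intro: power_le_one)
 obtain T1 where T1: "AE t in lborel. t\<in>{-\<theta>..\<theta>} --> t\<in>T1" "\<And>s. s\<in>T1 ==> L1 (\<lambda>x. (u (x, s))\<^sup>2)"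
  and E: "\<And>s t. s\<in>T1 ==> t\<in>T1 ==> s\<le>t \<Longrightarrow>
  (LINT x|lborel. ?\<xi> x*((max 0 (u (x, t)-k))\<^sup>2/2-(max 0 (u (x, s)-k))\<^sup>2/2)) =
  - (LINT z|lborel. indicator {s..t} (snd z) *
    (max 0 (u z-k)*(?P (fst z)\<bullet>A z)+(?\<xi> (fst z)*(if u z > k then 1 else 0))*(D z\<bullet>A z)))"
  using truncated_energy_identity[OF R k \<xi> cP z\<xi>] by blast
 have i2: "L1 (\<lambda>x. ?\<xi> x*(max 0 (u (x, s)-k))\<^sup>2)" if "s\<in>T1" for s
 proof (rule Bochner_Integration.integrable_bound[OF T1(2)[OF that]])
  show "AE x in lborel. norm (?\<xi> x*(max 0 (u (x, s)-k))\<^sup>2)\<le>norm ((u (x, s))\<^sup>2)"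
  proof (rule AE_I2)
   fix x
   have "\<bar>max 0 (u (x, s)-k)\<bar>\<le>\<bar>u (x, s)\<bar>" using k by auto
   then have "(max 0 (u (x, s)-k))\<^sup>2\<le>(u (x, s))\<^sup>2" by (rule iffD1[OF abs_le_square_iff])
   then have "?\<xi> x*(max 0 (u (x, s)-k))\<^sup>2\<le>1*(u (x, s))\<^sup>2" using \<xi>1[of x] by (intro mult_mono) auto
   then show "norm (?\<xi> x*(max 0 (u (x, s)-k))\<^sup>2)\<le>norm ((u (x, s))\<^sup>2)" using \<xi>1[of x] by simp
  qed
 qed measurable
 have main: "(LINT x|lborel. ?\<xi> x*(max 0 (u (x, t)-k))\<^sup>2)/2
   + \<Lambda>0/2*(LINT z|lborel. indicator {s..t} (snd z)*(?\<xi> (fst z)*(if u z > k then 1 else 0)*norm (D z) powr p))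
  \<le>(LINT x|lborel. ?\<xi> x*(max 0 (u (x, s)-k))\<^sup>2)/2
   + ?C*(LINT z|lborel. indicator {s..t} (snd z)*(indicator (cball 0 R) (fst z)*max 0 (u z-k) powr p))"
  if st: "s\<in>T1" "t\<in>T1" "s\<le>t" for s t
 proof -
  let ?X = "\<lambda>z. indicator {s..t} (snd z)*(max 0 (u z-k)*(?P (fst z)\<bullet>A z)+(?\<xi> (fst z)*(if u z > k then 1 else 0))*(D z\<bullet>A z))"
  let ?S = "\<lambda>z. indicator {s..t} (snd z)*(?\<xi> (fst z)*(if u z > k then 1 else 0)*norm (D z) powr p)"
  let ?V = "\<lambda>z. indicator {s..t} (snd z)*(indicator (cball (0::real^'n) R) (fst z)*max 0 (u z-k) powr p)"
  have iS: "L1 ?S"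
  proof -
   have "L1 (\<lambda>z. (indicator {s..t} (snd z)*(?\<xi> (fst z)*(if u z > k then 1 else 0)))*norm (D z) powr p)"
    by (rule restrict_integrable[OF D_p]) (use \<xi>1 in \<open>auto simp: indicator_def abs_mult\<close>)
   then show ?thesis by (simp add: mult_ac)
  qed
  have iV: "L1 ?V"
  proof -
   have "L1 (\<lambda>z. (indicator {s..t} (snd z)*indicator (cball (0::real^'n) R) (fst z))*max 0 (u z-k) powr p)"
    by (rule restrict_integrable[OF max_powr_integrable(1)[OF k]]) (auto simp: indicator_def)
   then show ?thesis by (simp add: mult_ac)
  qed
  have pw: "AE z in lborel. \<Lambda>0/2*?S z-?C*?V z\<le>?X z"
   using struct
  proof eventually_elim
   case (elim w)
   have "c\<ge>0" using Q[of 0] norm_ge_zero order_trans by blast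
   have C0: "?C\<ge>0" by (simp add: young_const_def)
   show ?case
   proof (cases "snd w\<in>{s..t} \<and> u w > k")
    case True
    have "\<Lambda>0/2*(?\<xi> (fst w)*norm (D w) powr p)-?C*max 0 (u w-k) powr p
     \<le>max 0 (u w-k)*(?P (fst w)\<bullet>A w)+?\<xi> (fst w)*(D w\<bullet>A w)"
     unfolding M_def
     by (rule energy_density_lower_bound[OF p \<Lambda>]) (use elim \<psi> Q in auto)
    moreover have "?\<xi> (fst w) = 0" "?P (fst w) = 0" if "\<not> norm (fst w)\<le>R"
     using z\<xi>[of "fst w"] that by simp_all
    ultimately show ?thesis using True C0
     by (cases "norm (fst w)\<le>R") (simp_all del: power_eq_0_iff scaleR_eq_0_iff)
   next
    case False
    then show ?thesis using C0 by auto
   qed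
  qed
  have iX: "L1 ?X"
  proof -
   obtain B1 where B1: "B1 > 0" "\<And>x. norm (?P x)\<le>B1" using bounded_of_vanishing[OF cP z\<xi>(2)] by blast
   show ?thesis
   proof (rule Bochner_Integration.integrable_bound)
    show "L1 (\<lambda>z. B1*(norm (u z) powr p+norm (A z) powr q)+(norm (D z) powr p+norm (A z) powr q))"
     by (intro integrable_mult_right Bochner_Integration.integrable_add u_p A_q D_p)
    show "AE z in lborel. norm (?X z)\<le>norm (B1*(norm (u z) powr p+norm (A z) powr q)+(norm (D z) powr p+norm (A z) powr q))"
    proof (rule AE_I2)
     fix w
     have "\<bar>?P (fst w)\<bullet>A w\<bar>\<le>B1*norm (A w)"
      using Cauchy_Schwarz_ineq2[of "?P (fst w)" "A w"] mult_right_mono[OF B1(2)[of "fst w"] norm_ge_zero[of "A w"]] by linarith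
     moreover have "\<bar>max 0 (u w-k)\<bar>\<le>\<bar>u w\<bar>" using k by auto
     ultimately have "\<bar>max 0 (u w-k)\<bar>*\<bar>?P (fst w)\<bullet>A w\<bar>\<le>\<bar>u w\<bar>*(B1*norm (A w))"
      by (intro mult_mono) auto
     also have "... = B1*\<bar>u w\<bullet>norm (A w)\<bar>" by (simp add: abs_mult)
     also have "\<dots>\<le>B1*(norm (u w) powr p+norm (norm (A w)) powr q)"
      using abs_inner_le_powr[OF p q, of "u w" "norm (A w)"] B1(1) by (intro mult_left_mono) auto
     finally have 1: "\<bar>max 0 (u w-k)*(?P (fst w)\<bullet>A w)\<bar>\<le>B1*(norm (u w) powr p+norm (A w) powr q)"
      unfolding abs_mult by simp
     have "\<bar>?\<xi> (fst w)*(if u w > k then 1 else 0)\<bar>\<le>1" using \<xi>1[of "fst w"] by (simp add: abs_mult)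
     then have "\<bar>?\<xi> (fst w)*(if u w > k then 1 else 0)\<bar>*\<bar>D w\<bullet>A w\<bar>\<le>1*(norm (D w) powr p+norm (A w) powr q)"
      using abs_inner_le_powr[OF p q, of "D w" "A w"] by (intro mult_mono) auto
     then have 2: "\<bar>(?\<xi> (fst w)*(if u w > k then 1 else 0))*(D w\<bullet>A w)\<bar>\<le>norm (D w) powr p+norm (A w) powr q"
      unfolding abs_mult by simp
     have 3: "\<bar>max 0 (u w-k)*(?P (fst w)\<bullet>A w)+(?\<xi> (fst w)*(if u w > k then 1 else 0))*(D w\<bullet>A w)\<bar>
      \<le>B1*(norm (u w) powr p+norm (A w) powr q)+(norm (D w) powr p+norm (A w) powr q)"
      using 1 2 by linarith
     have "\<bar>indicator {s..t} (snd w)\<bar>*\<bar>max 0 (u w-k)*(?P (fst w)\<bullet>A w)+(?\<xi> (fst w)*(if u w > k then 1 else 0))*(D w\<bullet>A w)\<bar>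
      \<le>1*(B1*(norm (u w) powr p+norm (A w) powr q)+(norm (D w) powr p+norm (A w) powr q))"
      by (rule mult_mono[OF _ 3]) (auto simp: indicator_def)
     then show "norm (?X w)\<le>norm (B1*(norm (u w) powr p+norm (A w) powr q)+(norm (D w) powr p+norm (A w) powr q))"
      unfolding real_norm_def abs_mult[of "indicator {s..t} (snd w)"] mult_1_left
      by (rule order_trans[OF _ abs_ge_self])
    qed
   qed measurable
  qed
  have "\<Lambda>0/2*(LINT z|lborel. ?S z)-?C*(LINT z|lborel. ?V z) = (LINT z|lborel. \<Lambda>0/2*?S z-?C*?V z)"
   using Bochner_Integration.integral_diff[OF integrable_mult_right[OF iS, of "\<Lambda>0/2"] integrable_mult_right[OF iV, of ?C]] by simp
  also have "\<dots>\<le>(LINT z|lborel. ?X z)"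
   by (rule integral_mono_AE[OF _ iX pw]) (intro Bochner_Integration.integrable_diff integrable_mult_right iS iV)
  finally have le: "\<Lambda>0/2*(LINT z|lborel. ?S z)-?C*(LINT z|lborel. ?V z)\<le>(LINT z|lborel. ?X z)" .
  have "(LINT x|lborel. ?\<xi> x*((max 0 (u (x, t)-k))\<^sup>2/2-(max 0 (u (x, s)-k))\<^sup>2/2))
   = (LINT x|lborel. (?\<xi> x*(max 0 (u (x, t)-k))\<^sup>2)/2-(?\<xi> x*(max 0 (u (x, s)-k))\<^sup>2)/2)"
   by (rule Bochner_Integration.integral_cong) (auto simp: right_diff_distrib)
  also have "... = (LINT x|lborel. ?\<xi> x*(max 0 (u (x, t)-k))\<^sup>2)/2-(LINT x|lborel. ?\<xi> x*(max 0 (u (x, s)-k))\<^sup>2)/2"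
   using Bochner_Integration.integral_diff[OF integrable_divide[OF i2[OF st(2)], of 2] integrable_divide[OF i2[OF st(1)], of 2]] by simp
  finally show ?thesis using E[OF st] le by linarith
 qed
 show ?thesis
 proof (intro exI[of _ T1] conjI ballI impI)
  show "L1 (\<lambda>x. \<psi> x^M*(max 0 (u (x, s)-k))\<^sup>2)" if "s\<in>T1" for s by (rule i2[OF that])
 qed (rule T1(1), rule main)
qed

end

lemma AE_exists_in_interval:
 fixes a b :: real
 assumes "AE t in lborel. P t" "a < b"
 shows "\<exists>t\<in>{a..b}. P t"
proof (rule ccontr)
 assume n: "\<not> (\<exists>t\<in>{a..b}. P t)"
 have "AE t in lborel. t \<notin> {a..b}" using assms(1) by eventually_elim (use n in blast)
 then have "emeasure lborel {a..b} = 0" by (subst (asm) AE_iff_measurable[where N = "{a..b}"]) auto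
 then show False using assms(2) by simp
qed

lemma AE_snd_neq: "AE z in (lborel :: ('a::euclidean_space\<times>real) measure). snd z\<noteq>c"
proof -
 have "AE z in lborel \<Otimes>\<^sub>M lborel. snd (z :: 'a\<times>real)\<noteq>c"
 proof (rule lborel_pair.AE_pair_measure)
  show "AE x in lborel. AE y in lborel. snd (x::'a, y)\<noteq>c"
   using AE_lborel_singleton[of c] by simp
 qed measurable
 then show ?thesis unfolding lborel_prod .
qed

lemma half_weighted_sum_le:
 fixes x y c :: real
 assumes "0\<le>x" "0\<le>y" "0\<le>c"
 shows "x/2 + c*y\<le>(1 + c)*(x+y)"
proof -
 have "0\<le>c*x" using assms by simp
 then show ?thesis using assms by (simp add: algebra_simps)
qed

lemma powr_le_self:
 fixes x p :: real
 assumes "0\<le>x" "x\<le>1" "p\<ge>1"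
 shows "x powr p\<le>x"
 using powr_mono'[of 1 p x] assms by simp

context local_solution
begin

text \<open>Averaging the energy inequality over the initial time \<open>s \<in> {a..b}\<close> turns the initial energy into \<open>V2 / (b - a)\<close>. Both
conclusions are stated with the same constant \<open>X\<close>, since only their combination enters the next estimate.\<close>

lemma de_giorgi_ingredients:
 assumes r: "0\<le>r" "r < R" "R < R0" and k: "k\<ge>0" and ab: "-\<theta>\<le>a" "a < b" "b < \<theta>"
 defines "V2 \<equiv> LINT z|lborel. indicator (cball (0::real^'n) R\<times>{a..\<theta>}) z*(max 0 (u z-k))\<^sup>2"
  and "Vp \<equiv> LINT z|lborel. indicator (cball (0::real^'n) R\<times>{a..\<theta>}) z*max 0 (u z-k) powr p"
 defines "X \<equiv> cacc_const p \<Lambda>0 \<Lambda>1*(V2/(b-a)+Vp/(R-r) powr p)"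
 obtains w :: "(real^'n)\<times>real => real" where
  "w\<in>Borel" "\<And>z. 0\<le>w z" "\<And>z. w z\<le>max 0 (u z-k)"
  "\<And>z. norm (fst z)\<le>r ==> w z = max 0 (u z-k)"
  "AE t in lborel. t\<in>{b..\<theta>} --> L1 (\<lambda>x. (w (x, t))\<^sup>2) \<and> (LINT x|lborel. (w (x, t))\<^sup>2)\<le>X"
  "\<And>y. (\<integral>\<^sup>+z. ennreal (indicator {b..\<theta>} (snd z)*\<bar>w z-w (z-(y, 0))\<bar> powr p) \<partial>lborel)\<le>ennreal (norm y powr p)*ennreal X"
proof -
 define M where "M = cacc_exp p"
 have M2: "M\<ge>2" using cacc_exp_ge[OF p] by (auto simp: M_def)
 obtain \<psi> :: "real^'n => real" and Q :: "real^'n => real^'n" where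
  \<psi>: "\<And>x. (\<psi> has_derivative (\<lambda>h. Q x\<bullet>h)) (at x)" "continuous_on UNIV Q"
  "\<And>x. 0\<le>\<psi> x" "\<And>x. \<psi> x\<le>1" "\<And>x. norm x\<le>r ==> \<psi> x = 1"
  "\<And>x. norm x\<ge>R ==> \<psi> x = 0" "\<And>x. norm x\<ge>R ==> Q x = 0" and Q: "\<And>x. norm (Q x)\<le>4/(R-r)"
  by (rule cutoff_exists[OF r(1,2)]) blast
 let ?\<xi> = "\<lambda>x. \<psi> x^M" and ?P = "\<lambda>x. (real M*\<psi> x^(M-1))*\<^sub>R Q x"
 have c\<psi>: "continuous_on UNIV \<psi>" by (rule has_derivative_continuous_on, rule has_derivative_at_withinI, rule \<psi>)
 have [measurable]: "\<psi>\<in>Borel" "Q\<in>Borel"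
  using c\<psi> \<psi>(2) by (auto intro: borel_measurable_continuous_onI)
 have \<xi>: "(?\<xi> has_derivative (\<lambda>h. ?P x\<bullet>h)) (at x)" for x
  using has_derivative_power[OF \<psi>(1)[of x], of M] by (rule has_derivative_eq_rhs) (auto simp: fun_eq_iff mult_ac)
 have cP: "continuous_on UNIV ?P" by (intro continuous_intros c\<psi> \<psi>(2))
 have z: "norm x > R ==> \<psi> x = 0" "norm x > R ==> Q x = 0" for x using \<psi>(6,7)[of x] by auto
 have z\<xi>: "norm x > R ==> ?\<xi> x = 0" "norm x > R ==> ?P x = 0" for x using z[of x] M2 by auto
 have \<xi>1: "0\<le>?\<xi> x" "?\<xi> x\<le>1" for x using \<psi>(3,4) by (auto intro: power_le_one)
 let ?v = "\<lambda>z. max 0 (u z-k)"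
 let ?chi = "\<lambda>z. (if u z > k then 1 else 0) :: real"
 let ?h = "\<lambda>z. ?\<xi> (fst z)*?chi z*norm (D z) powr p"
 have [measurable]: "?chi\<in>Borel" by measurable
 define w where "w z = ?v z*?\<xi> (fst z)" for z
 define W where "W z = (?\<xi> (fst z)*?chi z)*\<^sub>R D z+?v z*\<^sub>R ?P (fst z)" for z
 have wm [measurable]: "w\<in>Borel" unfolding w_def by measurable
 have Wm [measurable]: "W\<in>Borel" unfolding W_def by measurable
 define Y where "Y = young_const p \<Lambda>0 \<Lambda>1*4 powr p"
 have Y0: "Y\<ge>0" by (simp add: Y_def young_const_def)
 define E where "E t = (LINT x|lborel. ?\<xi> x*(?v (x, t))\<^sup>2)" for t
 define S where "S s t = (LINT z|lborel. indicator {s..t} (snd z)*?h z)" for s t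
 obtain T1 where T1: "AE t in lborel. t\<in>{-\<theta>..\<theta>} --> t\<in>T1" "\<And>s. s\<in>T1 ==> L1 (\<lambda>x. ?\<xi> x*(?v (x, s))\<^sup>2)"
  and en: "\<And>s t. s\<in>T1 ==> t\<in>T1 ==> s\<le>t ==> E t/2+\<Lambda>0/2*S s t\<le>E s/2
   + young_const p \<Lambda>0 \<Lambda>1*(4/(R-r)) powr p*(LINT z|lborel. indicator {s..t} (snd z)*(indicator (cball 0 R) (fst z)*?v z powr p))"
  using energy_inequality[OF r(3) k \<psi>(1-4) z Q] unfolding E_def S_def M_def by blast
 define J where "J = V2/(b-a)+Vp/(R-r) powr p"
 have ind: "indicator (cball (0::real^'n) R\<times>{s..t}) z = indicator {s..t} (snd z)*(indicator (cball 0 R) (fst z) :: real)" for s t z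
  by (cases z) (auto simp: indicator_def)
 note iv = max_powr_integrable[OF k]
 have i1: "L1 (\<lambda>z. indicator (cball (0::real^'n) R\<times>{s..t}) z*?v z powr p)"
  "L1 (\<lambda>z. indicator (cball (0::real^'n) R\<times>{s..t}) z*(?v z)\<^sup>2)" for s t
  unfolding ind by (rule restrict_integrable[OF iv(1)] restrict_integrable[OF iv(2)]; simp add: indicator_def)+
 have ih: "L1 ?h"
  by (rule restrict_integrable[OF D_p]) (use \<xi>1 in \<open>auto simp: abs_mult\<close>)
 have ish: "L1 (\<lambda>z. indicator {s..t} (snd z)*?h z)" for s t
  by (rule restrict_integrable[OF ih]) (auto simp: indicator_def)
 have h0: "?h z\<ge>0" for z using \<xi>1[of "fst z"] by simp
 have V20: "V2\<ge>0" "Vp\<ge>0" unfolding V2_def Vp_def by (auto intro!: Bochner_Integration.integral_nonneg)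
 have J0: "J\<ge>0" unfolding J_def using V20 r ab by simp
 have Rr: "(4/(R-r)) powr p = 4 powr p/(R-r) powr p" using r by (simp add: powr_divide)
 have fE: "L1 (\<lambda>z. indicator {a..b} (snd z)*(?\<xi> (fst z)*(?v z)\<^sup>2))"
  by (intro restrict_integrable iv) (use \<xi>1 in \<open>auto simp: indicator_def\<close>)
 have iE: "L1 (\<lambda>t. indicator {a..b} t*E t)" and EE: "(LINT t|lborel. indicator {a..b} t*E t) = (LINT z|lborel. indicator {a..b} (snd z)*(?\<xi> (fst z)*(?v z)\<^sup>2))"
  using integrable_slice_integral[OF fE] integral_slice_integral[OF fE] by (simp_all add: E_def)
 have EV: "(LINT t|lborel. indicator {a..b} t*E t)\<le>V2"
  unfolding EE V2_def
 proof (rule Bochner_Integration.integral_mono[OF fE i1(2)])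
  fix x :: "(real^'n)\<times>real"
  show "indicator {a..b} (snd x)*(?\<xi> (fst x)*(?v x)\<^sup>2)\<le>indicator (cball 0 R\<times>{a..\<theta>}) x*(?v x)\<^sup>2"
  proof (cases "norm (fst x)\<le>R")
   case True
   then show ?thesis
    unfolding ind using \<xi>1[of "fst x"] ab by (auto simp: indicator_def intro!: mult_left_le_one_le)
  next
   case False
   then have "?\<xi> (fst x) = 0" using z\<xi>(1)[of "fst x"] by simp
   then show ?thesis by (simp del: power_eq_0_iff)
  qed
 qed
 have bound: "E t/2+\<Lambda>0/2*S b t\<le>(1+Y)*J" if t: "t\<in>T1" "t\<in>{b..\<theta>}" for t
 proof -
  let ?L = "E t/2+\<Lambda>0/2*S b t"
  let ?B = "young_const p \<Lambda>0 \<Lambda>1*(4/(R-r)) powr p"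
  have B: "?B\<ge>0" by (simp add: young_const_def)
  have "AE s in lborel. indicator {a..b} s*?L\<le>indicator {a..b} s*E s/2+indicator {a..b} s*(?B*Vp)"
   using T1(1)
  proof eventually_elim
   case (elim s)
   show ?case
   proof (cases "s\<in>{a..b}")
    case True
    then have s: "s\<in>T1" "s\<le>t" using elim ab t by auto
    have "S b t\<le>S s t"
     unfolding S_def
    proof (rule Bochner_Integration.integral_mono[OF ish ish])
     show "indicator {b..t} (snd x)*?h x\<le>indicator {s..t} (snd x)*?h x" for x
      using True by (intro mult_right_mono h0) (auto simp: indicator_def)
    qed
    moreover have "(LINT z|lborel. indicator {s..t} (snd z)*(indicator (cball 0 R) (fst z)*?v z powr p))\<le>Vp"
     unfolding Vp_def
    proof (rule Bochner_Integration.integral_mono[OF _ i1(1)])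
     show "L1 (\<lambda>z. indicator {s..t} (snd z)*(indicator (cball 0 R) (fst z)*?v z powr p))"
      using i1(1)[of s t] unfolding ind by (simp add: mult.assoc)
     show "indicator {s..t} (snd x)*(indicator (cball 0 R) (fst x)*?v x powr p)\<le>indicator (cball 0 R\<times>{a..\<theta>}) x*?v x powr p" for x :: "(real^'n)\<times>real"
      unfolding ind using True t by (auto simp: indicator_def)
    qed
    then have "?B*(LINT z|lborel. indicator {s..t} (snd z)*(indicator (cball 0 R) (fst z)*?v z powr p))\<le>?B*Vp"
     using B by (rule mult_left_mono)
    ultimately have "?L\<le>E s/2+?B*Vp"
     using en[OF s(1) t(1) s(2)] mult_left_mono[of "S b t" "S s t" "\<Lambda>0/2"] \<Lambda> by linarith
    then show ?thesis using True by simp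
   qed simp
  qed
  moreover have "L1 (indicator {a..b} :: real => real)"
   by (rule integrable_real_indicator) (auto simp: emeasure_lborel_Icc_eq)
  then have ii: "L1 (\<lambda>s. indicator {a..b} s * c)" for c :: real by (rule integrable_mult_left)
  ultimately have "(LINT s|lborel. indicator {a..b} s*?L)\<le>(LINT s|lborel. indicator {a..b} s*E s/2+indicator {a..b} s*(?B*Vp))"
   using iE by (intro integral_mono_AE) auto
  also have "... = (LINT s|lborel. indicator {a..b} s*E s)/2+(b-a)*(?B*Vp)"
   using iE ab by simp
  also have "\<dots>\<le>V2/2+(b-a)*(?B*Vp)" using EV by simp
  finally have "(b-a)*?L\<le>V2/2+(b-a)*(?B*Vp)" using ab by simp
  then have "?L\<le>(V2/2+(b-a)*(?B*Vp))/(b-a)"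
   using ab by (simp add: pos_le_divide_eq mult.commute)
  also have "... = V2/(b-a)/2+Y*(Vp/(R-r) powr p)"
   unfolding Rr Y_def using ab by (simp add: add_divide_distrib)
  also have "\<dots>\<le>(1+Y)*J"
  proof -
   have "V2/(b-a)\<ge>0" "Vp/(R-r) powr p\<ge>0" using V20 ab by auto
   then show ?thesis unfolding J_def using Y0 by (intro half_weighted_sum_le)
  qed
  finally show ?thesis .
 qed
 have E0: "E t\<ge>0" for t unfolding E_def using \<xi>1 by (intro Bochner_Integration.integral_nonneg) auto
 have S0: "S s t\<ge>0" for s t unfolding S_def using h0 by (intro Bochner_Integration.integral_nonneg) auto
 have Ebound: "E t\<le>2*(1+Y)*J" if "t\<in>T1" "t\<in>{b..\<theta>}" for t
 proof -
  have "\<Lambda>0/2*S b t\<ge>0" using \<Lambda> S0[of b t] by simp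
  then show ?thesis using bound[OF that] by linarith
 qed
 have Sbound: "S b t\<le>2*(1+Y)/\<Lambda>0*J" if "t\<in>T1" "t\<in>{b..\<theta>}" for t
 proof -
  have "\<Lambda>0/2*S b t\<le>(1+Y)*J" using bound[OF that] E0[of t] by linarith
  then show ?thesis using \<Lambda> by (simp add: field_simps)
 qed
 \<comment> \<open>The final time \<open>\<theta>\<close> need not be a good time; it is approached by good ones.\<close>
 have Sfull: "S b \<theta>\<le>2*(1+Y)/\<Lambda>0*J"
 proof -
  have "\<forall>n. \<exists>t\<in>{max b (\<theta>-1/real (Suc n))..\<theta>}. t\<in>T1"
  proof
   fix n
   obtain t where "t\<in>{max b (\<theta>-1/real (Suc n))..\<theta>}" "t\<in>{-\<theta>..\<theta>} --> t\<in>T1"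
    using AE_exists_in_interval[OF T1(1), of "max b (\<theta>-1/real (Suc n))" \<theta>] ab by auto
   then show "\<exists>t\<in>{max b (\<theta>-1/real (Suc n))..\<theta>}. t\<in>T1" using ab by (intro bexI[of _ t]) auto
  qed
  then obtain t where t: "\<And>n. t n\<in>{max b (\<theta>-1/real (Suc n))..\<theta>}" "\<And>n. t n\<in>T1" by metis
  have tlim: "t \<longlonglongrightarrow> \<theta>"
  proof (rule tendsto_sandwich)
   have "(\<lambda>n. \<theta>-1/real (Suc n)) \<longlonglongrightarrow> \<theta>-0"
    by (intro tendsto_diff tendsto_const) (use LIMSEQ_inverse_real_of_nat in \<open>simp add: inverse_eq_divide\<close>)
   then show "(\<lambda>n. \<theta>-1/real (Suc n)) \<longlonglongrightarrow> \<theta>" by simp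
   show "(\<lambda>n. \<theta>) \<longlonglongrightarrow> \<theta>" by simp
  qed (use t(1) in \<open>auto intro!: always_eventually\<close>)
  have "(\<lambda>n. S b (t n)) \<longlonglongrightarrow> S b \<theta>"
   unfolding S_def
  proof (rule integral_dominated_convergence[OF _ _ ih])
   show "AE x in lborel. (\<lambda>n. indicator {b..t n} (snd x)*?h x) \<longlonglongrightarrow> indicator {b..\<theta>} (snd x)*?h x"
    using AE_snd_neq[of \<theta>]
   proof eventually_elim
    case (elim x)
    show ?case
    proof (cases "snd x < \<theta>")
     case True
     have "\<forall>\<^sub>F n in sequentially. snd x < t n" by (rule order_tendstoD(1)[OF tlim True])
     then have "\<forall>\<^sub>F n in sequentially. indicator {b..t n} (snd x)*?h x = indicator {b..\<theta>} (snd x)*?h x"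
      by eventually_elim (use True in \<open>auto simp: indicator_def\<close>)
     then show ?thesis by (rule tendsto_eventually)
    next
     case False
     then have "snd x > \<theta>" using elim by simp
     then have eq: "indicator {b..t n} (snd x) = (indicator {b..\<theta>} (snd x) :: real)" for n
      using t(1)[of n] by (auto simp: indicator_def)
     show ?thesis unfolding eq by (rule tendsto_const)
    qed
   qed
   show "AE x in lborel. norm (indicator {b..t n} (snd x)*?h x)\<le>?h x" for n
   proof (rule AE_I2)
    fix x
    show "norm (indicator {b..t n} (snd x)*?h x)\<le>?h x"
    proof (cases "snd x\<in>{b..t n}")
     case True
     then have i: "indicator {b..t n} (snd x) = (1::real)" by simp
     show ?thesis unfolding i mult_1_left real_norm_def abs_of_nonneg[OF h0] by (rule order_refl)
    next
     case False
     then have i: "indicator {b..t n} (snd x) = (0::real)" by simp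
     show ?thesis unfolding i mult_zero_left norm_zero by (rule h0)
    qed
   qed
  qed measurable
  then show ?thesis
   by (rule LIMSEQ_le_const2) (use Sbound t ab in auto)
 qed
 have Cc: "cacc_const p \<Lambda>0 \<Lambda>1 = 2*(1+Y)+2 powr p*(2*(1+Y)/\<Lambda>0+(4*real M) powr p)"
  unfolding cacc_const_def Y_def M_def by simp
 have XE: "2*(1+Y)*J\<le>X"
 proof -
  have "0\<le>2 powr p*(2*(1+Y)/\<Lambda>0+(4*real M) powr p)" using Y0 \<Lambda> by (intro mult_nonneg_nonneg add_nonneg_nonneg) auto
  then show ?thesis unfolding X_def J_def[symmetric] Cc using J0 by (intro mult_right_mono) auto
 qed
 have XW: "2 powr p*(2*(1+Y)/\<Lambda>0+(4*real M) powr p)*J\<le>X"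
  unfolding X_def J_def[symmetric] Cc using J0 Y0 by (intro mult_right_mono) auto
 have w0: "0\<le>w z" "w z\<le>?v z" for z
  unfolding w_def using \<xi>1[of "fst z"] by (auto simp: mult_left_le)
 have wE: "(w (x, t))\<^sup>2\<le>?\<xi> x*(?v (x, t))\<^sup>2" for x t
 proof -
  have "(w (x, t))\<^sup>2 = ?\<xi> x*(?\<xi> x*(?v (x, t))\<^sup>2)" by (simp add: w_def power2_eq_square mult_ac)
  also have "\<dots>\<le>?\<xi> x*(1*(?v (x, t))\<^sup>2)" using \<xi>1[of x] by (intro mult_left_mono mult_right_mono) auto
  finally show ?thesis by simp
 qed
 show thesis
 proof (rule that[of w])
  show "w\<in>Borel" by measurable
  show "0\<le>w z" "w z\<le>?v z" for z by (rule w0)+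
  show "norm (fst z)\<le>r ==> w z = ?v z" for z using \<psi>(5)[of "fst z"] by (simp add: w_def)
  show "AE t in lborel. t\<in>{b..\<theta>} --> L1 (\<lambda>x. (w (x, t))\<^sup>2) \<and> (LINT x|lborel. (w (x, t))\<^sup>2)\<le>X"
   using T1(1)
  proof (eventually_elim, intro impI)
   fix t assume t': "t\<in>{-\<theta>..\<theta>} --> t\<in>T1" "t\<in>{b..\<theta>}"
   then have t: "t\<in>T1" using ab by auto
   have iw: "L1 (\<lambda>x. (w (x, t))\<^sup>2)"
   proof (rule Bochner_Integration.integrable_bound[OF T1(2)[OF t]])
    show "AE x in lborel. norm ((w (x, t))\<^sup>2)\<le>norm (?\<xi> x*(?v (x, t))\<^sup>2)"
     using wE \<xi>1 by (intro AE_I2) simp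
   qed measurable
   have "(LINT x|lborel. (w (x, t))\<^sup>2)\<le>E t"
    unfolding E_def by (rule Bochner_Integration.integral_mono[OF iw T1(2)[OF t] wE])
   also have "\<dots>\<le>X" using Ebound[OF t t'(2)] XE by linarith
   finally show "L1 (\<lambda>x. (w (x, t))\<^sup>2) \<and> (LINT x|lborel. (w (x, t))\<^sup>2)\<le>X" using iw by blast
  qed
  fix y :: "real^'n"
  have "(\<integral>\<^sup>+z. ennreal (indicator {b..\<theta>} (snd z)*\<bar>w z-w (z-(y, 0))\<bar> powr p) \<partial>lborel)
   \<le>ennreal (norm y powr p)*(\<integral>\<^sup>+z. ennreal (indicator {b..\<theta>} (snd z)*norm (W z) powr p) \<partial>lborel)"
   unfolding w_def W_def by (rule truncation_translation_bound[OF r(3) k \<xi> cP z\<xi>])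
  also have "\<dots>\<le>ennreal (norm y powr p)*ennreal X"
  proof (rule mult_left_mono)
   let ?c = "(real M*(4/(R-r))) powr p"
   let ?d = "\<lambda>z. 2 powr p*(indicator {b..\<theta>} (snd z)*?h z+?c*(indicator (cball (0::real^'n) R\<times>{b..\<theta>}) z*?v z powr p))"
   have id: "L1 ?d"
    by (intro integrable_mult_right Bochner_Integration.integrable_add ish i1)
   have d0: "?d z\<ge>0" for z
   proof -
    have 1: "0\<le>indicator {b..\<theta>} (snd z)*?h z" by (rule mult_nonneg_nonneg[OF _ h0]) simp
    have 2: "0\<le>?c*(indicator (cball (0::real^'n) R\<times>{b..\<theta>}) z*?v z powr p)" by simp
    show ?thesis by (rule mult_nonneg_nonneg[OF _ add_nonneg_nonneg[OF 1 2]]) simp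
   qed
   have "(\<integral>\<^sup>+z. ennreal (indicator {b..\<theta>} (snd z)*norm (W z) powr p) \<partial>lborel)\<le>(\<integral>\<^sup>+z. ennreal (?d z) \<partial>lborel)"
   proof (intro nn_integral_mono ennreal_leI)
    fix z :: "(real^'n)\<times>real"
    show "indicator {b..\<theta>} (snd z)*norm (W z) powr p\<le>?d z"
    proof (cases "snd z\<in>{b..\<theta>} \<and> norm (fst z)\<le>R")
     case True
     then have I: "indicator (cball (0::real^'n) R\<times>{b..\<theta>}) z = (1::real)" by (cases z) auto
     have 1: "norm ((?\<xi> (fst z)*?chi z)*\<^sub>R D z) = ?\<xi> (fst z)*?chi z*norm (D z)" using \<xi>1[of "fst z"] by simp
     have "norm (?P (fst z))\<le>(real M*1)*(4/(R-r))"
     proof -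
      have "0\<le>\<psi> (fst z)^(M-1)" "\<psi> (fst z)^(M-1)\<le>1"
       using \<psi>(3,4)[of "fst z"] by (auto intro: power_le_one)
      then have "\<bar>real M*\<psi> (fst z)^(M-1)\<bar>\<le>real M*1"
       unfolding abs_mult by (intro mult_mono) auto
      then show ?thesis unfolding norm_scaleR by (rule mult_mono[OF _ Q]) simp_all
     qed
     then have "?v z*norm (?P (fst z))\<le>?v z*((real M*1)*(4/(R-r)))"
      by (rule mult_left_mono) simp
     moreover have "norm (?v z*\<^sub>R ?P (fst z)) = \<bar>?v z\<bar>*norm (?P (fst z))" by (rule norm_scaleR)
     moreover have "\<bar>?v z\<bar> = ?v z" by simp
     ultimately have 2: "norm (?v z*\<^sub>R ?P (fst z))\<le>?v z*(real M*(4/(R-r)))"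
      by (simp only: mult_1_right)
     have "norm (W z) powr p\<le>(?\<xi> (fst z)*?chi z*norm (D z)+?v z*(real M*(4/(R-r)))) powr p"
      unfolding W_def using p norm_triangle_le[OF add_mono[OF eq_refl[OF 1] 2]] by (intro powr_mono2) auto
     also have "\<dots>\<le>2 powr p*((?\<xi> (fst z)*?chi z*norm (D z)) powr p+(?v z*(real M*(4/(R-r)))) powr p)"
      using p \<xi>1[of "fst z"] r by (intro powr_sum_le) auto
     also have "\<dots>\<le>2 powr p*(?h z+?c*?v z powr p)"
     proof (intro mult_left_mono add_mono)
      have c01: "0\<le>?\<xi> (fst z)*?chi z" "?\<xi> (fst z)*?chi z\<le>1" using \<xi>1[of "fst z"] by (cases "u z > k"; simp)+
      have "(?\<xi> (fst z)*?chi z*norm (D z)) powr p = (?\<xi> (fst z)*?chi z) powr p*norm (D z) powr p"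
       by (rule powr_mult; use c01 in simp)
      also have "\<dots>\<le>?h z"
       using powr_le_self[OF c01] p by (intro mult_right_mono) auto
      finally show "(?\<xi> (fst z)*?chi z*norm (D z)) powr p\<le>?h z" .
      have "(?v z*(real M*(4/(R-r)))) powr p = ?v z powr p*?c"
       by (rule powr_mult; use r in simp)
      then show "(?v z*(real M*(4/(R-r)))) powr p\<le>?c*?v z powr p"
       by (simp only: mult.commute)
     qed simp
     finally show ?thesis using True I by simp
    next
     case False
     have "indicator {b..\<theta>} (snd z)*norm (W z) powr p = 0"
     proof (cases "snd z\<in>{b..\<theta>}")
      case True
      then have "?\<xi> (fst z) = 0" "?P (fst z) = 0" using False z\<xi>[of "fst z"] by simp_all
      then have "W z = 0" unfolding W_def by (simp only: mult_zero_left scaleR_zero_left scaleR_zero_right add_0_left)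
      then show ?thesis by simp
     qed simp
     then show ?thesis using d0[of z] by linarith
    qed
   qed
   also have "... = ennreal (LINT z|lborel. ?d z)" by (rule nn_integral_eq_integral[OF id]) (use d0 in auto)
   also have "\<dots>\<le>ennreal X"
   proof (rule ennreal_leI)
    have "(LINT z|lborel. ?d z) = 2 powr p*(S b \<theta>+?c*(LINT z|lborel. indicator (cball (0::real^'n) R\<times>{b..\<theta>}) z*?v z powr p))"
     unfolding S_def using ish i1 by simp
    also have "\<dots>\<le>2 powr p*(2*(1+Y)/\<Lambda>0*J+(4*real M) powr p*J)"
    proof (intro mult_left_mono add_mono Sfull)
     have "(LINT z|lborel. indicator (cball (0::real^'n) R\<times>{b..\<theta>}) z*?v z powr p)\<le>Vp"
      unfolding Vp_def
     proof (rule Bochner_Integration.integral_mono[OF i1(1) i1(1)])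
      show "indicator (cball 0 R\<times>{b..\<theta>}) x*?v x powr p\<le>indicator (cball 0 R\<times>{a..\<theta>}) x*?v x powr p" for x :: "(real^'n)\<times>real"
       using ab by (auto simp: indicator_def)
     qed
     then have "?c*(LINT z|lborel. indicator (cball (0::real^'n) R\<times>{b..\<theta>}) z*?v z powr p)\<le>?c*Vp"
      by (intro mult_left_mono) auto
     also have "... = (4*real M) powr p*(Vp/(R-r) powr p)"
     proof -
      have "real M*(4/(R-r)) = (4*real M)/(R-r)" by simp
      moreover have "((4*real M)/(R-r)) powr p = (4*real M) powr p/(R-r) powr p"
       by (rule powr_divide; use r in simp)
      ultimately have "?c = (4*real M) powr p/(R-r) powr p" by (simp only:)
      then show ?thesis by simp
     qed
     also have "\<dots>\<le>(4*real M) powr p*J"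
      unfolding J_def using V20 ab by (intro mult_left_mono) auto
     finally show "?c*(LINT z|lborel. indicator (cball (0::real^'n) R\<times>{b..\<theta>}) z*?v z powr p)\<le>(4*real M) powr p*J" .
    qed simp
    also have "... = 2 powr p*(2*(1+Y)/\<Lambda>0+(4*real M) powr p)*J" by (simp add: algebra_simps)
    finally show "(LINT z|lborel. ?d z)\<le>X" using XW by linarith
   qed
   finally show "(\<integral>\<^sup>+z. ennreal (indicator {b..\<theta>} (snd z)*norm (W z) powr p) \<partial>lborel)\<le>ennreal X" .
  qed simp
  finally show "(\<integral>\<^sup>+z. ennreal (indicator {b..\<theta>} (snd z)*\<bar>w z-w (z-(y, 0))\<bar> powr p) \<partial>lborel)\<le>ennreal (norm y powr p)*ennreal X" .
 qed
qed

end

section \<open>Gain of integrability\<close>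

text \<open>By Cauchy-Schwarz the mean of \<open>w\<close> over a ball of volume \<open>V\<close> is at most \<open>(X/V)\<^sup>1\<^sup>/\<^sup>2\<close>, which is \<open>s/2\<close> for \<open>V = 4X/s\<^sup>2\<close>. Hence
\<open>w \<le> 2(w - mean)\<close> where \<open>w > s\<close>, and the translation hypothesis with \<open>|y| \<le> \<epsilon>\<close> controls the right hand side.\<close>

lemma weak_type_estimate:
 fixes w :: "(real^'n)\<times>real => real" and p X s b \<theta> :: real
 defines "N \<equiv> real CARD('n)"
 assumes wm [measurable]: "w\<in>Borel" and w0: "\<And>z. 0\<le>w z" and p: "p\<ge>1" and X: "X > 0" and s: "s > 0"
  and E: "AE t in lborel. t\<in>{b..\<theta>} --> L1 (\<lambda>x. (w (x, t))\<^sup>2) \<and> (LINT x|lborel. (w (x, t))\<^sup>2)\<le>X"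
  and T: "\<And>y. (\<integral>\<^sup>+z. ennreal (indicator {b..\<theta>} (snd z)*\<bar>w z-w (z-(y, 0))\<bar> powr p) \<partial>lborel)\<le>ennreal (norm y powr p)*ennreal X"
 shows "(\<integral>\<^sup>+z. ennreal (indicator {b..\<theta>} (snd z)*(if w z > s then w z powr p else 0)) \<partial>lborel)
  \<le>ennreal (2 powr p*(4/unit_ball_vol N) powr (p/N) * s powr (- (2*p/N))*X powr (1+p/N))"
proof -
 have N: "N > 0" by (simp add: N_def)
 define \<omega> where "\<omega> = unit_ball_vol N"
 have \<omega>: "\<omega> > 0" using N by (simp add: \<omega>_def)
 \<comment> \<open>The radius of a ball of volume \<open>4X/s\<^sup>2\<close>.\<close>
 define \<epsilon> where "\<epsilon> = (4*X/(s\<^sup>2*\<omega>)) powr (1/N)"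
 have \<epsilon>: "\<epsilon> > 0" using X s \<omega> by (simp add: \<epsilon>_def)
 define V where "V = \<omega>*\<epsilon>^CARD('n)"
 have V: "V > 0" using \<omega> \<epsilon> by (simp add: V_def)
 have VX: "X/V = s\<^sup>2/4"
 proof -
  have "\<epsilon>^CARD('n) = \<epsilon> powr N" using \<epsilon> by (simp add: N_def powr_realpow)
  also have "... = 4*X/(s\<^sup>2*\<omega>)" unfolding \<epsilon>_def using N X s \<omega> by (simp add: powr_powr)
  finally have "V = 4*X/s\<^sup>2" unfolding V_def using \<omega> by simp
  then show ?thesis using X s by simp
 qed
 let ?B = "ball (0::real^'n) \<epsilon>"
 have eB: "emeasure lborel ?B = ennreal V"
  using emeasure_ball[of \<epsilon> "0::real^'n"] \<epsilon> by (simp add: V_def \<omega>_def N_def)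
 define \<eta> where "\<eta> y = indicator ?B y/V" for y :: "real^'n"
 have [measurable]: "\<eta>\<in>Borel"
  unfolding \<eta>_def by (intro borel_measurable_divide borel_measurable_indicator borel_measurable_const borel_open open_ball)
 have iB: "L1 (\<lambda>y. indicator ?B y :: real)" using eB by (intro integrable_real_indicator) auto
 have \<eta>i: "L1 \<eta>" unfolding \<eta>_def using iB by auto
 have \<eta>1: "integral\<^sup>L lborel \<eta> = 1"
 proof -
  have "measure lborel ?B = V" using eB V by (simp add: measure_def)
  then show ?thesis unfolding \<eta>_def using V iB by simp
 qed
 have \<eta>0: "\<eta> y\<ge>0" for y unfolding \<eta>_def using V by simp
 have \<eta>V: "\<eta> y\<le>1/V" for y unfolding \<eta>_def using V by (auto simp: indicator_def)
 have shm: "(\<lambda>y. w (x-y, t))\<in>Borel" for x t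
  using measurable_compose[OF _ slice_measurable[OF wm, of t], of "\<lambda>y. x-y" borel] by simp
 have pt: "ennreal (if w (x, t) > s then w (x, t) powr p else 0)
   \<le>ennreal (2 powr p)*(\<integral>\<^sup>+y. ennreal (\<eta> y*\<bar>w (x, t)-w (x-y, t)\<bar> powr p) \<partial>lborel)"
  if i2: "L1 (\<lambda>x. (w (x, t))\<^sup>2)" and le: "(LINT x|lborel. (w (x, t))\<^sup>2)\<le>X" for x t
 proof (cases "w (x, t) > s")
  case True
  note [measurable] = shm[of x t]
  have i2': "L1 (\<lambda>y. (w (x-y, t))\<^sup>2)" "(LINT y|lborel. (w (x-y, t))\<^sup>2) = (LINT y|lborel. (w (y, t))\<^sup>2)"
   using i2 integrable_reflect[of "\<lambda>x. (w (x, t))\<^sup>2" x] integral_reflect[of "\<lambda>x. (w (x, t))\<^sup>2" x] by simp_all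
  have e2: "w v powr 2 = (w v)\<^sup>2" for v using w0[of v] by (cases "w v = 0") (auto simp: powr_numeral)
  have i\<eta>: "L1 (\<lambda>y. \<eta> y*w (x-y, t) powr 2)"
  proof (rule Bochner_Integration.integrable_bound)
   show "L1 (\<lambda>y. 1/V*(w (x-y, t))\<^sup>2)" using i2'(1) by (rule integrable_mult_right)
   show "AE y in lborel. norm (\<eta> y*w (x-y, t) powr 2)\<le>norm (1/V*(w (x-y, t))\<^sup>2)"
   proof (rule AE_I2)
    fix y
    have "\<eta> y*(w (x-y, t))\<^sup>2\<le>1/V*(w (x-y, t))\<^sup>2" by (rule mult_right_mono[OF \<eta>V]) simp
    then show "norm (\<eta> y*w (x-y, t) powr 2)\<le>norm (1/V*(w (x-y, t))\<^sup>2)"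
     unfolding e2 using \<eta>0[of y] V by (simp add: abs_mult)
   qed
  qed measurable
  note j = jensen_powr[OF shm[of x t, unfolded measurable_lborel2[symmetric]] \<eta>i \<eta>0 \<eta>1 _ i\<eta>]
  have mi: "L1 (\<lambda>y. \<eta> y*w (x-y, t))" and m2: "(LINT y|lborel. \<eta> y*w (x-y, t)) powr 2\<le>(LINT y|lborel. \<eta> y*w (x-y, t) powr 2)"
   by (rule j; use w0 in simp)+
  let ?m = "LINT y|lborel. \<eta> y*w (x-y, t)"
  have m0: "?m\<ge>0" using \<eta>0 w0 by (intro Bochner_Integration.integral_nonneg) auto
  have "(LINT y|lborel. \<eta> y*w (x-y, t) powr 2)\<le>(LINT y|lborel. 1/V*(w (x-y, t))\<^sup>2)"
   using i\<eta> integrable_mult_right[OF i2'(1), of "1/V"]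
   by (rule Bochner_Integration.integral_mono) (unfold e2, intro mult_right_mono \<eta>V, simp)
  also have "\<dots>\<le>X/V" using i2'(2) le V by (simp add: divide_right_mono)
  finally have "?m powr 2\<le>s\<^sup>2/4" using m2 VX by linarith
  then have "?m\<^sup>2\<le>(s/2)\<^sup>2" using m0 by (cases "?m = 0") (auto simp: powr_numeral power_divide)
  then have ms: "?m\<le>s/2" using s power2_le_imp_le by fastforce
  show ?thesis
  proof (cases "(\<integral>\<^sup>+y. ennreal (\<eta> y*\<bar>w (x, t)-w (x-y, t)\<bar> powr p) \<partial>lborel) = \<infinity>")
   case inf: True
   then show ?thesis by (simp add: ennreal_mult_top)
  next
   case False
   have ip: "L1 (\<lambda>y. \<eta> y*\<bar>w (x, t)-w (x-y, t)\<bar> powr p)"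
    using False \<eta>0 by (intro integrableI_nonneg) (auto simp: less_top)
   have jm: "(\<lambda>y. \<bar>w (x, t)-w (x-y, t)\<bar>)\<in>borel_measurable lborel" by measurable
   have jp: "(LINT y|lborel. \<eta> y*\<bar>w (x, t)-w (x-y, t)\<bar>) powr p\<le>(LINT y|lborel. \<eta> y*\<bar>w (x, t)-w (x-y, t)\<bar> powr p)"
    and ji: "L1 (\<lambda>y. \<eta> y*\<bar>w (x, t)-w (x-y, t)\<bar>)"
    by (rule jensen_powr[OF jm \<eta>i \<eta>0 \<eta>1 _ ip p]; simp)+
   have "w (x, t)-?m = (LINT y|lborel. \<eta> y*w (x, t)-\<eta> y*w (x-y, t))"
    using \<eta>i \<eta>1 mi by simp
   also have "\<dots>\<le>(LINT y|lborel. \<eta> y*\<bar>w (x, t)-w (x-y, t)\<bar>)"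
   proof (rule Bochner_Integration.integral_mono)
    show "L1 (\<lambda>y. \<eta> y*w (x, t)-\<eta> y*w (x-y, t))" using \<eta>i mi by auto
    show "\<eta> y*w (x, t)-\<eta> y*w (x-y, t)\<le>\<eta> y*\<bar>w (x, t)-w (x-y, t)\<bar>" for y
     unfolding right_diff_distrib[symmetric] using \<eta>0 by (intro mult_left_mono) auto
   qed (rule ji)
   finally have "w (x, t)\<le>2*(LINT y|lborel. \<eta> y*\<bar>w (x, t)-w (x-y, t)\<bar>)" using ms True by linarith
   then have "w (x, t) powr p\<le>(2*(LINT y|lborel. \<eta> y*\<bar>w (x, t)-w (x-y, t)\<bar>)) powr p"
    using w0 p by (intro powr_mono2) auto
   also have "... = 2 powr p*(LINT y|lborel. \<eta> y*\<bar>w (x, t)-w (x-y, t)\<bar>) powr p"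
    using \<eta>0 by (subst powr_mult) (auto intro!: Bochner_Integration.integral_nonneg)
   also have "\<dots>\<le>2 powr p*(LINT y|lborel. \<eta> y*\<bar>w (x, t)-w (x-y, t)\<bar> powr p)"
    using jp by (intro mult_left_mono) auto
   finally have "ennreal (w (x, t) powr p)\<le>ennreal (2 powr p)*ennreal (LINT y|lborel. \<eta> y*\<bar>w (x, t)-w (x-y, t)\<bar> powr p)"
    by (simp add: ennreal_mult'[symmetric] ennreal_leI)
   also have "ennreal (LINT y|lborel. \<eta> y*\<bar>w (x, t)-w (x-y, t)\<bar> powr p) = (\<integral>\<^sup>+y. ennreal (\<eta> y*\<bar>w (x, t)-w (x-y, t)\<bar> powr p) \<partial>lborel)"
    by (rule nn_integral_eq_integral[symmetric, OF ip]) (use \<eta>0 in auto)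
   finally show ?thesis using True by simp
  qed
 qed simp
 let ?I = "\<lambda>z::(real^'n)\<times>real. indicator {b..\<theta>} (snd z) :: real"
 have m3: "(\<lambda>q. w (fst (fst q)-snd q, snd (fst q)))\<in>borel_measurable (borel \<Otimes>\<^sub>M borel)"
 proof -
  have "(\<lambda>q::((real^'n)\<times>real)\<times>(real^'n). (fst (fst q)-snd q, snd (fst q)))\<in>Borel"
   by (intro borel_measurable_continuous_onI continuous_intros)
  then have "(\<lambda>q::((real^'n)\<times>real)\<times>(real^'n). (fst (fst q)-snd q, snd (fst q)))\<in>borel_measurable (borel \<Otimes>\<^sub>M borel)"
   by (simp add: borel_prod)
  from measurable_compose[OF this wm] show ?thesis .
 qed
 note [measurable] = m3
 have m4: "(\<lambda>(z, y). ennreal (?I z)*ennreal (\<eta> y*\<bar>w z-w (fst z-y, snd z)\<bar> powr p))\<in>borel_measurable (lborel \<Otimes>\<^sub>M lborel)"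
  unfolding case_prod_beta' by measurable
 have AEz: "AE t in lborel. (\<integral>\<^sup>+x. ennreal (?I (x, t)*(if w (x, t) > s then w (x, t) powr p else 0)) \<partial>lborel)
  \<le>(\<integral>\<^sup>+x. ennreal (2 powr p)*(\<integral>\<^sup>+y. ennreal (?I (x, t))*ennreal (\<eta> y*\<bar>w (x, t)-w (x-y, t)\<bar> powr p) \<partial>lborel) \<partial>lborel)"
  using E
 proof eventually_elim
  case (elim t)
  show ?case
  proof (cases "t\<in>{b..\<theta>}")
   case True
   show ?thesis
   proof (rule nn_integral_mono)
    fix x
    show "ennreal (?I (x, t)*(if w (x, t) > s then w (x, t) powr p else 0))
     \<le>ennreal (2 powr p)*(\<integral>\<^sup>+y. ennreal (?I (x, t))*ennreal (\<eta> y*\<bar>w (x, t)-w (x-y, t)\<bar> powr p) \<partial>lborel)"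
     using pt[of t x] elim True by simp
   qed
  qed simp
 qed
 have mI: "(\<lambda>z. ennreal (?I z*(if w z > s then w z powr p else 0)))\<in>Borel" by measurable
 have m5: "(\<lambda>z. ennreal (2 powr p)*(\<integral>\<^sup>+y. ennreal (?I z)*ennreal (\<eta> y*\<bar>w z-w (fst z-y, snd z)\<bar> powr p) \<partial>lborel))\<in>Borel"
  by measurable
 have "(\<integral>\<^sup>+z. ennreal (?I z*(if w z > s then w z powr p else 0)) \<partial>lborel)
   = (\<integral>\<^sup>+t. \<integral>\<^sup>+x. ennreal (?I (x, t)*(if w (x, t) > s then w (x, t) powr p else 0)) \<partial>lborel \<partial>lborel)"
  by (rule nn_integral_slices[symmetric, OF mI])
 also have "\<dots>\<le>(\<integral>\<^sup>+t. \<integral>\<^sup>+x. ennreal (2 powr p)*(\<integral>\<^sup>+y. ennreal (?I (x, t))*ennreal (\<eta> y*\<bar>w (x, t)-w (fst (x, t)-y, snd (x, t))\<bar> powr p) \<partial>lborel) \<partial>lborel \<partial>lborel)"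
  using nn_integral_mono_AE[OF AEz] by simp
 also have "... = (\<integral>\<^sup>+z. ennreal (2 powr p)*(\<integral>\<^sup>+y. ennreal (?I z)*ennreal (\<eta> y*\<bar>w z-w (fst z-y, snd z)\<bar> powr p) \<partial>lborel) \<partial>lborel)"
  by (rule nn_integral_slices[OF m5])
 also have "... = ennreal (2 powr p)*(\<integral>\<^sup>+z. \<integral>\<^sup>+y. ennreal (?I z)*ennreal (\<eta> y*\<bar>w z-w (fst z-y, snd z)\<bar> powr p) \<partial>lborel \<partial>lborel)"
  by (rule nn_integral_cmult) measurable
 also have "(\<integral>\<^sup>+z. \<integral>\<^sup>+y. ennreal (?I z)*ennreal (\<eta> y*\<bar>w z-w (fst z-y, snd z)\<bar> powr p) \<partial>lborel \<partial>lborel)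
   = (\<integral>\<^sup>+y. \<integral>\<^sup>+z. ennreal (?I z)*ennreal (\<eta> y*\<bar>w z-w (fst z-y, snd z)\<bar> powr p) \<partial>lborel \<partial>lborel)"
  by (rule lborel_pair.Fubini'[OF m4, symmetric])
 also have "\<dots>\<le>(\<integral>\<^sup>+y. ennreal (\<eta> y)*(ennreal (\<epsilon> powr p)*ennreal X) \<partial>lborel)"
 proof (rule nn_integral_mono)
  fix y :: "real^'n"
  have sm: "(\<lambda>z. w (fst z-y, snd z))\<in>Borel"
   by (rule measurable_compose[OF _ wm]) (intro borel_measurable_continuous_onI continuous_intros)
  note [measurable] = sm
  have "(\<integral>\<^sup>+z. ennreal (?I z)*ennreal (\<eta> y*\<bar>w z-w (fst z-y, snd z)\<bar> powr p) \<partial>lborel)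
   = (\<integral>\<^sup>+z. ennreal (\<eta> y)*ennreal (?I z*\<bar>w z-w (fst z-y, snd z)\<bar> powr p) \<partial>lborel)"
   using \<eta>0[of y] by (intro nn_integral_cong) (simp add: ennreal_mult[symmetric] mult_ac)
  also have "... = ennreal (\<eta> y)*(\<integral>\<^sup>+z. ennreal (?I z*\<bar>w z-w (fst z-y, snd z)\<bar> powr p) \<partial>lborel)"
   by (rule nn_integral_cmult) measurable
  also have "\<dots>\<le>ennreal (\<eta> y)*(ennreal (\<epsilon> powr p)*ennreal X)"
  proof (cases "y\<in>?B")
   case True
   then have "norm y powr p\<le>\<epsilon> powr p" using p by (intro powr_mono2) auto
   moreover have "w (fst z-y, snd z) = w (z-(y, 0))" for z by (cases z) simp
   moreover have "ennreal (norm y powr p)*ennreal X\<le>ennreal (\<epsilon> powr p)*ennreal X"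
    using \<open>norm y powr p \<le> \<epsilon> powr p\<close> by (intro mult_right_mono ennreal_leI) auto
   ultimately show ?thesis
    using order_trans[OF T[of y]] by (intro mult_left_mono) (simp_all only: zero_le)
  qed (simp add: \<eta>_def)
  finally show "(\<integral>\<^sup>+z. ennreal (?I z)*ennreal (\<eta> y*\<bar>w z-w (fst z-y, snd z)\<bar> powr p) \<partial>lborel)\<le>ennreal (\<eta> y)*(ennreal (\<epsilon> powr p)*ennreal X)" .
 qed
 also have "... = (\<integral>\<^sup>+y. ennreal (\<eta> y) \<partial>lborel)*(ennreal (\<epsilon> powr p)*ennreal X)"
  by (rule nn_integral_multc) measurable
 also have "(\<integral>\<^sup>+y. ennreal (\<eta> y) \<partial>lborel) = 1"
  using \<eta>i \<eta>0 \<eta>1 by (subst nn_integral_eq_integral) auto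
 finally have "(\<integral>\<^sup>+z. ennreal (?I z*(if w z > s then w z powr p else 0)) \<partial>lborel)\<le>ennreal (2 powr p)*(1*(ennreal (\<epsilon> powr p)*ennreal X))"
  by (simp add: mult_left_mono)
 also have "... = ennreal (2 powr p*(\<epsilon> powr p*X))"
  using X by (simp add: ennreal_mult[symmetric])
 also have "2 powr p*(\<epsilon> powr p*X) = 2 powr p*(4/unit_ball_vol N) powr (p/N) * s powr (- (2*p/N))*X powr (1+p/N)"
 proof -
  have "\<epsilon> powr p = (4*X/(s\<^sup>2*\<omega>)) powr (p/N)" unfolding \<epsilon>_def by (simp add: powr_powr)
  also have "4*X/(s\<^sup>2*\<omega>) = (4/\<omega>)*(s powr (- 2)*X)"
   using s by (simp add: powr_minus powr_numeral field_simps)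
  also have "... powr (p/N) = (4/\<omega>) powr (p/N)*(s powr (- 2)*X) powr (p/N)"
   by (rule powr_mult; use s X \<omega> in simp)
  also have "(s powr (- 2)*X) powr (p/N) = (s powr (- 2)) powr (p/N)*X powr (p/N)"
   by (rule powr_mult; use s X in simp)
  also have "(s powr (- 2)) powr (p/N) = s powr (- (2*p/N))" by (simp add: powr_powr)
  finally have "\<epsilon> powr p = (4/\<omega>) powr (p/N)*(s powr (- (2*p/N))*X powr (p/N))" .
  moreover have "X powr (1+p/N) = X*X powr (p/N)" using X by (simp add: powr_add)
  ultimately show ?thesis unfolding \<omega>_def by (simp add: mult_ac)
 qed
 finally show ?thesis .
qed

definition dyadic_const :: "real => real => real => real" where
 "dyadic_const N p m = 2 powr p*(4/unit_ball_vol N) powr (p/N)*2 powr (m-p)/(1-2 powr (m-p-2*p/N))"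

text \<open>Split \<open>{w > s}\<close> into the sets \<open>{2\<^sup>js < w \<le> 2\<^sup>j\<^sup>+\<^sup>1s}\<close> and use the weak type estimate on each; the resulting geometric
series converges because \<open>m - p < 2p/N\<close>.\<close>

lemma strong_type_above_level:
 fixes w :: "(real^'n)\<times>real => real" and p m X s b \<theta> :: real
 defines "N \<equiv> real CARD('n)"
 assumes wm [measurable]: "w\<in>Borel" and w0: "\<And>z. 0\<le>w z" and p: "p\<ge>1" and X: "X > 0" and s: "s > 0"
  and m: "m\<ge>p" "m-p < 2*p/N"
  and E: "AE t in lborel. t\<in>{b..\<theta>} --> L1 (\<lambda>x. (w (x, t))\<^sup>2) \<and> (LINT x|lborel. (w (x, t))\<^sup>2)\<le>X"
  and T: "\<And>y. (\<integral>\<^sup>+z. ennreal (indicator {b..\<theta>} (snd z)*\<bar>w z-w (z-(y, 0))\<bar> powr p) \<partial>lborel)\<le>ennreal (norm y powr p)*ennreal X"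
 shows "(\<integral>\<^sup>+z. ennreal (indicator {b..\<theta>} (snd z)*(if w z > s then w z powr m else 0)) \<partial>lborel)
  \<le>ennreal (dyadic_const N p m * s powr (m-p-2*p/N)*X powr (1+p/N))"
proof -
 have N: "N > 0" by (simp add: N_def)
 define C where "C = 2 powr p*(4/unit_ball_vol N) powr (p/N)"
 have C: "C\<ge>0" by (simp add: C_def)
 let ?I = "\<lambda>z::(real^'n)\<times>real. indicator {b..\<theta>} (snd z) :: real"
 let ?l = "\<lambda>j::nat. 2^j * s"
 let ?g = "\<lambda>j z. ennreal ((2*?l j) powr (m-p))*ennreal (?I z*(if w z > ?l j then w z powr p else 0))"
 have pt: "ennreal (?I z*(if w z > s then w z powr m else 0))\<le>(\<Sum>j. ?g j z)" for z
 proof (cases "w z > s \<and> snd z\<in>{b..\<theta>}")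
  case True
  obtain n where "w z/s < 2^n" using real_arch_pow[of 2 "w z/s"] by auto
  then have "w z < 2^n * s" using s by (simp add: pos_divide_less_eq)
  moreover have "2^n * s > 0" using s by simp
  ultimately have ex: "\<exists>j. w z\<le>2*?l j" by (intro exI[of _ n]) linarith
  \<comment> \<open>The dyadic level of \<open>w z\<close>.\<close>
  define j where "j = (LEAST j. w z\<le>2*?l j)"
  have j1: "w z\<le>2*?l j" unfolding j_def by (rule LeastI_ex[OF ex])
  have j2: "w z > ?l j"
  proof (cases j)
   case 0 then show ?thesis using True by simp
  next
   case (Suc i)
   then have "\<not> w z\<le>2*?l i" using not_less_Least[of i "\<lambda>j. w z\<le>2*?l j"] by (simp add: j_def)
   then show ?thesis using Suc by (simp add: mult.assoc)
  qed
  have "w z powr m = w z powr (m-p)*w z powr p" by (simp add: powr_add[symmetric])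
  also have "\<dots>\<le>(2*?l j) powr (m-p)*w z powr p"
   using j1 w0 m by (intro mult_right_mono powr_mono2) auto
  finally have "ennreal (w z powr m)\<le>ennreal ((2*?l j) powr (m-p))*ennreal (w z powr p)"
   by (simp add: ennreal_mult[symmetric] ennreal_leI)
  then have "ennreal (?I z*(if w z > s then w z powr m else 0))\<le>?g j z" using True j2 by simp
  also have "\<dots>\<le>(\<Sum>j. ?g j z)" using sum_le_suminf[of "\<lambda>j. ?g j z" "{j}"] by simp
  finally show ?thesis .
 qed auto
 define a where "a = 2 powr (m-p-2*p/N)"
 have a: "a > 0" "a < 1" unfolding a_def using m by (auto simp: powr_less_one)
 have "(\<integral>\<^sup>+z. ennreal (?I z*(if w z > s then w z powr m else 0)) \<partial>lborel)\<le>(\<integral>\<^sup>+z. (\<Sum>j. ?g j z) \<partial>lborel)"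
  by (intro nn_integral_mono pt)
 also have "... = (\<Sum>j. \<integral>\<^sup>+z. ?g j z \<partial>lborel)" by (rule nn_integral_suminf) measurable
 also have "\<dots>\<le>(\<Sum>j. ennreal (C*2 powr (m-p) * s powr (m-p-2*p/N)*X powr (1+p/N)*a^j))"
 proof (intro suminf_le allI)
  fix j
  have l: "?l j > 0" using s by simp
  have "(\<integral>\<^sup>+z. ?g j z \<partial>lborel) = ennreal ((2*?l j) powr (m-p))*(\<integral>\<^sup>+z. ennreal (?I z*(if w z > ?l j then w z powr p else 0)) \<partial>lborel)"
   by (rule nn_integral_cmult) measurable
  also have "\<dots>\<le>ennreal ((2*?l j) powr (m-p))*ennreal (C*?l j powr (- (2*p/N))*X powr (1+p/N))"
   unfolding C_def N_def by (intro mult_left_mono weak_type_estimate[OF wm w0 p X l E T]) auto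
  also have "... = ennreal ((2*?l j) powr (m-p)*(C*?l j powr (- (2*p/N))*X powr (1+p/N)))"
   using C by (simp add: ennreal_mult[symmetric])
  also have "(2*?l j) powr (m-p)*(C*?l j powr (- (2*p/N))*X powr (1+p/N))
   = C*2 powr (m-p) * s powr (m-p-2*p/N)*X powr (1+p/N)*a^j"
  proof -
   have "(2*?l j) powr (m-p) = 2 powr (m-p)*?l j powr (m-p)" using l by (simp add: powr_mult)
   moreover have "?l j powr (m-p)*?l j powr (- (2*p/N)) = ?l j powr (m-p-2*p/N)"
    by (simp add: powr_add[symmetric])
   moreover have "?l j powr (m-p-2*p/N) = a^j * s powr (m-p-2*p/N)"
   proof -
    have "(2^j) powr (m-p-2*p/N) = a^j"
     unfolding a_def by (simp add: powr_realpow[symmetric] powr_powr mult.commute)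
    then show ?thesis using s by (simp add: powr_mult)
   qed
   ultimately show ?thesis by (simp add: mult_ac)
  qed
  finally show "(\<integral>\<^sup>+z. ?g j z \<partial>lborel)\<le>ennreal (C*2 powr (m-p) * s powr (m-p-2*p/N)*X powr (1+p/N)*a^j)" .
 qed auto
 also have "... = ennreal (\<Sum>j. C*2 powr (m-p) * s powr (m-p-2*p/N)*X powr (1+p/N)*a^j)"
  using C a by (intro suminf_ennreal2) (auto intro!: summable_mult summable_geometric)
 also have "(\<Sum>j. C*2 powr (m-p) * s powr (m-p-2*p/N)*X powr (1+p/N)*a^j)
   = C*2 powr (m-p) * s powr (m-p-2*p/N)*X powr (1+p/N)*(1/(1-a))"
  using a by (subst suminf_mult) (auto simp: suminf_geometric intro!: summable_geometric)
 also have "... = dyadic_const N p m * s powr (m-p-2*p/N)*X powr (1+p/N)"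
  unfolding dyadic_const_def C_def a_def by simp
 finally show ?thesis .
qed

section \<open>De Giorgi iteration\<close>

text \<open>By induction \<open>Y\<^sub>n \<le> Y\<^sub>0 b\<^sup>n\<close> with \<open>b = B\<^sup>-\<^sup>1\<^sup>/\<^sup>\<alpha>\<close>: the smallness of \<open>Y\<^sub>0\<close> compensates the growth of \<open>B\<^sup>n\<close>.\<close>

lemma fast_geometric_convergence:
 fixes Y :: "nat => real" and C B \<alpha> :: real
 assumes Y0: "\<And>n. Y n\<ge>0" and C: "C > 0" and B: "B > 1" and \<alpha>: "\<alpha> > 0"
  and step: "\<And>n. Y (Suc n)\<le>C*B^n*Y n powr (1+\<alpha>)"
  and start: "C*Y 0 powr \<alpha>\<le>B powr (- 1/\<alpha>)"
 shows "Y \<longlonglongrightarrow> 0"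
proof -
 define b where "b = B powr (- 1/\<alpha>)"
 have b: "0 < b" "b < 1" using B \<alpha> by (auto simp: b_def powr_less_one divide_neg_pos)
 have bnd: "Y n\<le>Y 0*b^n" for n
 proof (induction n)
  case (Suc n)
  have bb: "B^n*(b^n) powr \<alpha> = 1"
  proof -
   have "(b^n) powr \<alpha> = (b powr \<alpha>)^n" using b by (simp add: powr_realpow[symmetric] powr_powr mult.commute)
   also have "b powr \<alpha> = B powr (- 1/\<alpha>*\<alpha>)" by (simp only: b_def powr_powr)
   also have "- 1/\<alpha>*\<alpha> = - 1" using \<alpha> by simp
   also have "B powr (- 1) = 1/B" using B by (simp add: powr_neg_one)
   finally show ?thesis using B by (simp add: power_one_over)
  qed
  have "Y (Suc n)\<le>C*B^n*Y n powr (1+\<alpha>)" by (rule step)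
  also have "\<dots>\<le>C*B^n*(Y 0*b^n) powr (1+\<alpha>)"
   using Suc Y0 C B \<alpha> by (intro mult_left_mono powr_mono2) auto
  also have "(Y 0*b^n) powr (1+\<alpha>) = (Y 0*b^n)*(Y 0 powr \<alpha>*(b^n) powr \<alpha>)"
  proof -
   have "(Y 0*b^n) powr (1+\<alpha>) = (Y 0*b^n) powr 1*(Y 0*b^n) powr \<alpha>" by (rule powr_add)
   also have "(Y 0*b^n) powr 1 = Y 0*b^n" using Y0[of 0] b by simp
   also have "(Y 0*b^n) powr \<alpha> = Y 0 powr \<alpha>*(b^n) powr \<alpha>" by (rule powr_mult; use Y0[of 0] b in simp)
   finally show ?thesis .
  qed
  also have "C*B^n*((Y 0*b^n)*(Y 0 powr \<alpha>*(b^n) powr \<alpha>))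
   = (C*Y 0 powr \<alpha>)*(Y 0*b^n)*(B^n*(b^n) powr \<alpha>)" by (simp only: mult_ac)
  also have "... = (C*Y 0 powr \<alpha>)*(Y 0*b^n)" unfolding bb by simp
  also have "\<dots>\<le>b*(Y 0*b^n)" using start Y0[of 0] b unfolding b_def by (intro mult_right_mono) auto
  finally show ?case by (simp add: mult_ac)
 qed simp
 show ?thesis
 proof (rule tendsto_sandwich[OF _ _ tendsto_const])
  have "(\<lambda>n. Y 0*b^n) \<longlonglongrightarrow> Y 0*0" using b by (intro tendsto_mult tendsto_const LIMSEQ_realpow_zero) auto
  then show "(\<lambda>n. Y 0*b^n) \<longlonglongrightarrow> 0" by simp
 qed (use bnd Y0 in auto)
qed

text \<open>The rescaling \<open>g\<^sub>j = f\<^sub>j b\<^sup>-\<^sup>c\<^sup>j\<close> with \<open>c = 1/(1-\<alpha>)\<close> removes the factor \<open>b\<^sup>j\<close>. Its supremum \<open>S\<close> is finite because \<open>f\<close> is bounded, and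
\<open>S \<le> max 1 (B' S\<^sup>\<alpha>)\<close> can be solved for \<open>S\<close>.\<close>

lemma sublinear_iteration:
 fixes f :: "nat => real" and B b \<alpha> L :: real
 assumes f: "\<And>j. 0\<le>f j" "\<And>j. f j\<le>L" and B: "B\<ge>0" and b: "b\<ge>1" and \<alpha>: "0\<le>\<alpha>" "\<alpha> < 1"
  and step: "\<And>j. f j\<le>max 1 (B*b^j*f (Suc j) powr \<alpha>)"
 shows "f 0\<le>max 1 ((B*b powr (\<alpha>/(1-\<alpha>))) powr (1/(1-\<alpha>)))"
proof -
 define c where "c = 1/(1-\<alpha>)"
 have c: "c > 0" "c = 1+\<alpha> * c" using \<alpha> by (auto simp: c_def field_simps)
 define g where "g j = f j*b powr (- (c*real j))" for j
 define B' where "B' = B*b powr (\<alpha> * c)"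
 have B'0: "B'\<ge>0" using B by (simp add: B'_def)
 have bj: "0 < b powr (- (c*real j))" "b powr (- (c*real j))\<le>1" for j
  using b c by (auto simp: powr_le_one_le intro!: powr_le_one_le)
   (smt (verit) c(1) mult_nonneg_nonneg of_nat_0_le_iff powr_mono powr_zero_eq_one)+
 have g0: "g j\<ge>0" for j unfolding g_def using f(1)[of j] by simp
 have gL: "g j\<le>\<bar>L\<bar>" for j
 proof -
  have "g j\<le>f j*1" unfolding g_def using bj[of j] f(1)[of j] by (intro mult_left_mono) auto
  then show ?thesis using f(2)[of j] by linarith
 qed
 have bdd: "bdd_above (range g)" using gL by (auto intro!: bdd_aboveI)
 define S where "S = (SUP j. g j)"
 have gS: "g j\<le>S" for j unfolding S_def by (rule cSUP_upper[OF _ bdd]) simp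
 have S0: "S\<ge>0" using gS[of 0] g0[of 0] by linarith
 have gstep: "g j\<le>max 1 (B'*S powr \<alpha>)" for j
 proof -
  have "g j\<le>max 1 (B*b^j*f (Suc j) powr \<alpha>)*b powr (- (c*real j))"
   unfolding g_def using step[of j] bj[of j] by (intro mult_right_mono) auto
  also have "\<dots>\<le>max 1 (B'*S powr \<alpha>)"
  proof (cases "B*b^j*f (Suc j) powr \<alpha>\<le>1")
   case True
   then show ?thesis using bj[of j] by (simp add: max_def)
  next
   case False
   have "f (Suc j) = g (Suc j)*b powr (c*real (Suc j))"
    unfolding g_def using b by (simp add: powr_add[symmetric] mult.assoc)
   then have "f (Suc j) powr \<alpha> = g (Suc j) powr \<alpha>*(b powr (c*real (Suc j))) powr \<alpha>"
    using g0[of "Suc j"] by (simp add: powr_mult)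
   also have "\<dots>\<le>S powr \<alpha>*b powr (c*real (Suc j)*\<alpha>)"
    unfolding powr_powr using gS[of "Suc j"] g0[of "Suc j"] \<alpha> by (intro mult_right_mono powr_mono2) auto
   finally have fS: "f (Suc j) powr \<alpha>\<le>S powr \<alpha>*b powr (c*real (Suc j)*\<alpha>)" .
   have "B*b^j*f (Suc j) powr \<alpha>*b powr (- (c*real j))\<le>B*b^j*(S powr \<alpha>*b powr (c*real (Suc j)*\<alpha>))*b powr (- (c*real j))"
    using fS B b by (intro mult_right_mono mult_left_mono) auto
   also have "... = B*S powr \<alpha>*(b powr real j*b powr (c*real (Suc j)*\<alpha>)*b powr (- (c*real j)))"
    using b by (simp add: powr_realpow mult_ac)
   also have "b powr real j*b powr (c*real (Suc j)*\<alpha>)*b powr (- (c*real j)) = b powr (real j + c*real (Suc j)*\<alpha>-c*real j)"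
    by (simp add: powr_add[symmetric])
   also have "real j + c*real (Suc j)*\<alpha>-c*real j = \<alpha> * c"
   proof -
    have "real j + c*real (Suc j)*\<alpha>-c*real j = real j*(1+\<alpha> * c-c)+\<alpha> * c" by (simp add: algebra_simps)
    also have "... = \<alpha> * c" using c(2) by simp
    finally show ?thesis .
   qed
   finally have "B*b^j*f (Suc j) powr \<alpha>*b powr (- (c*real j))\<le>B'*S powr \<alpha>" by (simp add: B'_def mult_ac)
   moreover have "max 1 (B*b^j*f (Suc j) powr \<alpha>) = B*b^j*f (Suc j) powr \<alpha>" using False by simp
   ultimately show ?thesis by simp
  qed
  finally show ?thesis .
 qed
 have Sle: "S\<le>max 1 (B'*S powr \<alpha>)" unfolding S_def by (rule cSUP_least) (use gstep in \<open>auto simp: S_def\<close>)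
 have "S\<le>max 1 (B' powr c)"
 proof (cases "S\<le>1")
  case False
  then have S1: "S > 1" by simp
  then have "S\<le>B'*S powr \<alpha>" using Sle by auto
  then have "S*S powr (- \<alpha>)\<le>(B'*S powr \<alpha>)*S powr (- \<alpha>)" by (intro mult_right_mono) auto
  moreover have "S*S powr (- \<alpha>) = S powr (1-\<alpha>)" using S1 powr_add[of S 1 "- \<alpha>"] by simp
  moreover have "(B'*S powr \<alpha>)*S powr (- \<alpha>) = B'" using S1 by (simp add: mult.assoc powr_add[symmetric])
  ultimately have "S powr (1-\<alpha>)\<le>B'" by simp
  then have "(S powr (1-\<alpha>)) powr c\<le>B' powr c" using c by (intro powr_mono2) auto
  moreover have "(S powr (1-\<alpha>)) powr c = S" using S1 \<alpha> by (simp add: powr_powr c_def)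
  ultimately show ?thesis by simp
 qed simp
 moreover have "f 0 = g 0" by (simp add: g_def) (use b in simp)
 moreover have "B' powr c = (B*b powr (\<alpha>/(1-\<alpha>))) powr (1/(1-\<alpha>))" by (simp add: B'_def c_def)
 ultimately show ?thesis using gS[of 0] by simp
qed

definition de_giorgi_base :: "real => real => real => real" where
 "de_giorgi_base N p m = 2 powr ((2*p/N-(m-p))+(m+p)*(1+p/N))"

definition de_giorgi_const :: "real => real => real => real => real => real" where
 "de_giorgi_const N p \<Lambda>0 \<Lambda>1 m = (dyadic_const N p m * cacc_const p \<Lambda>0 \<Lambda>1 powr (1+p/N)*(de_giorgi_base N p m)\<^sup>2) powr (N/p)
   * de_giorgi_base N p m powr ((N/p)\<^sup>2)"

text \<open>Where the truncation exceeds the gap \<open>l\<close> between two levels, lower powers are controlled by the \<open>m\<close>-th power; this brings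
the two different exponents of the Caccioppoli inequality to the common exponent \<open>m\<close>.\<close>

lemma level_gap_powr_le:
 fixes v l a m d :: real
 assumes "0\<le>a" "a\<le>m" "d > 0" "d\<le>l" "l\<le>1" "v\<ge>l" "x\<le>v" "x\<ge>0"
 shows "x powr a\<le>d powr (- m) * v powr m"
proof -
 have v: "v > 0" using assms by linarith
 have "x powr a\<le>v powr a" using assms by (intro powr_mono2) auto
 also have "... = v powr (a-m) * v powr m" by (simp add: powr_add[symmetric])
 also have "\<dots>\<le>d powr (- m) * v powr m"
 proof (intro mult_right_mono)
  have "v powr (a-m)\<le>d powr (a-m)" using assms by (intro powr_mono2') auto
  also have "\<dots>\<le>d powr (- m)" using assms by (intro powr_mono') auto
  finally show "v powr (a-m)\<le>d powr (- m)" .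
 qed simp
 finally show ?thesis .
qed

lemma dyadic_const_pos:
 assumes "N > 0" "m-p < 2*p/N"
 shows "dyadic_const N p m > 0"
proof -
 have "2 powr (m-p-2*p/N) < (1::real)" using assms(2) by (auto simp: powr_less_one)
 moreover have "unit_ball_vol N > 0" using assms by simp
 ultimately show ?thesis by (simp add: dyadic_const_def)
qed

lemma cacc_const_pos:
 assumes "\<Lambda>0 > 0"
 shows "cacc_const p \<Lambda>0 \<Lambda>1 > 0"
proof -
 have "young_const p \<Lambda>0 \<Lambda>1*4 powr p\<ge>0" by (simp add: young_const_def)
 then show ?thesis unfolding cacc_const_def using assms
  by (intro add_pos_nonneg mult_nonneg_nonneg add_nonneg_nonneg) auto
qed

context local_solution
begin

lemma max_powr_m_integrable:
 assumes "k\<ge>0" "m = p \<or> m = 2"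
 shows "L1 (\<lambda>z. max 0 (u z-k) powr m)"
proof (cases "m = p")
 case True then show ?thesis using max_powr_integrable(1)[OF assms(1)] by simp
next
 case False
 then have m: "m = 2" using assms(2) by simp
 have "max 0 (u z-k) powr m = (max 0 (u z-k))\<^sup>2" for z
  by (cases "u z > k") (auto simp: m powr_numeral max_def)
 then show ?thesis using max_powr_integrable(2)[OF assms(1)] by simp
qed

lemma truncated_nn_le:
 fixes w :: "(real^'n)\<times>real => real"
 assumes w: "\<And>z. norm (fst z)\<le>r ==> w z = max 0 (u z-k)" "\<And>z. 0\<le>w z" and s: "s > 0" "l\<ge>k + s" and m: "m > 0"
 shows "ennreal (indicator (cball (0::real^'n) r\<times>{b..\<theta>}) z*max 0 (u z-l) powr m)
  \<le>ennreal (indicator {b..\<theta>} (snd z)*(if w z > s then w z powr m else 0))"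
proof (cases "norm (fst z)\<le>r \<and> snd z\<in>{b..\<theta>} \<and> u z > l")
 case True
 then have "w z = u z-k" "w z > s" "max 0 (u z-l)\<le>w z" "0\<le>max 0 (u z-l)" using w(1)[of z] s by auto
 then have "max 0 (u z-l) powr m\<le>w z powr m" using m by (intro powr_mono2) auto
 then show ?thesis using True \<open>w z > s\<close> by (cases z) (auto intro!: ennreal_leI)
next
 case False
 then have e: "indicator (cball (0::real^'n) r\<times>{b..\<theta>}) z*max 0 (u z-l) powr m = (0::real)"
  using m by (cases z) (auto simp: indicator_def)
 show ?thesis unfolding e by simp
qed

text \<open>Half of the gap between the levels serves to raise both powers to \<open>m\<close>, the other half as the threshold in
\<open>strong_type_above_level\<close>.\<close>

lemma de_giorgi_step:
 fixes m k k' :: real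
 defines "N \<equiv> real CARD('n)"
 assumes m: "m = p \<or> m = 2" "p\<le>m" "2\<le>m" "m-p < 2*p/N"
  and r: "0\<le>r" "r < R" "R < R0" and ab: "-\<theta>\<le>a" "a < b" "b < \<theta>"
  and k: "0\<le>k" "k < k'" and d: "0 < d" "d\<le>(k'-k)/2" "d\<le>1"
 defines "Y \<equiv> LINT z|lborel. indicator (cball (0::real^'n) R\<times>{a..\<theta>}) z*max 0 (u z-k) powr m"
  and "Y' \<equiv> LINT z|lborel. indicator (cball (0::real^'n) r\<times>{b..\<theta>}) z*max 0 (u z-k') powr m"
 shows "Y'\<le>dyadic_const N p m*((k'-k)/2) powr (m-p-2*p/N)
   * (cacc_const p \<Lambda>0 \<Lambda>1*(d powr (- m)*(1/(b-a)+1/(R-r) powr p))*Y) powr (1+p/N)"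
proof -
 have m0: "m > 0" using m by simp
 define h where "h = (k'-k)/2"
 have h: "h > 0" "d\<le>h" "k' = (k+h)+h" using k d by (auto simp: h_def field_simps)
 let ?v = "\<lambda>z. max 0 (u z-(k+h))"
 let ?I = "\<lambda>z. indicator (cball (0::real^'n) R\<times>{a..\<theta>}) z :: real"
 have im: "(\<lambda>z. indicator (cball (0::real^'n) S\<times>{c..\<theta>}) z :: real)\<in>Borel" for S c
  by (intro borel_measurable_indicator) (auto simp: borel_prod[symmetric])
 have iI: "L1 (\<lambda>z. indicator (cball (0::real^'n) S\<times>{c..\<theta>}) z*max 0 (u z-l) powr m)" if "l\<ge>0" for S c l
  by (rule restrict_integrable[OF max_powr_m_integrable[OF that m(1)] im]) (auto simp: indicator_def)
 have iY: "L1 (\<lambda>z. ?I z*max 0 (u z-k) powr m)" by (rule iI[OF k(1)])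
 have Y0: "Y\<ge>0" unfolding Y_def by (intro Bochner_Integration.integral_nonneg) auto
 have pw: "?v z powr c\<le>d powr (- m)*max 0 (u z-k) powr m" if c: "c = 2 \<or> c = p" for c z
 proof (cases "u z > k+h")
  case True
  show ?thesis
   by (rule level_gap_powr_le[of c m d d "max 0 (u z-k)" "?v z"]) (use True c m p d h in auto)
 next
  case False
  then have "?v z powr c = 0" by simp
  then show ?thesis by simp
 qed
 define V2 where "V2 = (LINT z|lborel. ?I z*(?v z)\<^sup>2)"
 define Vp where "Vp = (LINT z|lborel. ?I z*?v z powr p)"
 have kh: "k+h\<ge>0" using k h by simp
 have i2: "L1 (\<lambda>z. ?I z*(?v z)\<^sup>2)" and ip: "L1 (\<lambda>z. ?I z*?v z powr p)"
  by (rule restrict_integrable[OF max_powr_integrable(2)[OF kh] im] restrict_integrable[OF max_powr_integrable(1)[OF kh] im]; simp add: indicator_def)+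
 have sq: "(?v z)\<^sup>2 = ?v z powr 2" for z by (cases "u z > k+h") (auto simp: powr_numeral max_def)
 have V2: "V2\<le>d powr (- m)*Y"
 proof -
  have "V2\<le>(LINT z|lborel. d powr (- m)*(?I z*max 0 (u z-k) powr m))"
   unfolding V2_def
  proof (rule Bochner_Integration.integral_mono[OF i2 integrable_mult_right[OF iY]])
   fix z
   have "?I z*(?v z)\<^sup>2\<le>?I z*(d powr (- m)*max 0 (u z-k) powr m)"
    unfolding sq by (intro mult_left_mono pw) auto
   then show "?I z*(?v z)\<^sup>2\<le>d powr (- m)*(?I z*max 0 (u z-k) powr m)" by (simp only: mult.left_commute)
  qed
  then show ?thesis unfolding Y_def by simp
 qed
 have Vp: "Vp\<le>d powr (- m)*Y"
 proof -
  have "Vp\<le>(LINT z|lborel. d powr (- m)*(?I z*max 0 (u z-k) powr m))"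
   unfolding Vp_def
  proof (rule Bochner_Integration.integral_mono[OF ip integrable_mult_right[OF iY]])
   fix z
   have "?I z*?v z powr p\<le>?I z*(d powr (- m)*max 0 (u z-k) powr m)"
    by (intro mult_left_mono pw) auto
   then show "?I z*?v z powr p\<le>d powr (- m)*(?I z*max 0 (u z-k) powr m)" by (simp only: mult.left_commute)
  qed
  then show ?thesis unfolding Y_def by simp
 qed
 have cc: "cacc_const p \<Lambda>0 \<Lambda>1 > 0" by (rule cacc_const_pos[OF \<Lambda>(1)])
 define q where "q = d powr (- m)*(1/(b-a)+1/(R-r) powr p)"
 have q0: "q > 0" unfolding q_def using d r ab by (intro mult_pos_pos add_pos_pos) auto
 have XX: "cacc_const p \<Lambda>0 \<Lambda>1*(V2/(b-a)+Vp/(R-r) powr p)\<le>cacc_const p \<Lambda>0 \<Lambda>1*q*Y"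
 proof -
  have "V2/(b-a)+Vp/(R-r) powr p\<le>(d powr (- m)*Y)/(b-a)+(d powr (- m)*Y)/(R-r) powr p"
   using V2 Vp ab by (intro add_mono divide_right_mono) auto
  also have "... = q*Y" unfolding q_def by (simp add: algebra_simps)
  finally show ?thesis using cc by (simp add: mult.assoc)
 qed
 obtain w :: "(real^'n)\<times>real => real" where
  w: "w\<in>Borel" "\<And>z. 0\<le>w z" "\<And>z. w z\<le>?v z"
  "\<And>z. norm (fst z)\<le>r ==> w z = ?v z"
  and wE: "AE t in lborel. t\<in>{b..\<theta>} --> L1 (\<lambda>x. (w (x, t))\<^sup>2) \<and> (LINT x|lborel. (w (x, t))\<^sup>2)\<le>cacc_const p \<Lambda>0 \<Lambda>1*(V2/(b-a)+Vp/(R-r) powr p)"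
  and wT: "\<And>y. (\<integral>\<^sup>+z. ennreal (indicator {b..\<theta>} (snd z)*\<bar>w z-w (z-(y, 0))\<bar> powr p) \<partial>lborel)\<le>ennreal (norm y powr p)*ennreal (cacc_const p \<Lambda>0 \<Lambda>1*(V2/(b-a)+Vp/(R-r) powr p))"
  by (rule de_giorgi_ingredients[OF r kh ab, folded V2_def Vp_def]) blast
 have k'0: "k'\<ge>0" using k by simp
 have fin: "Y'\<le>dyadic_const N p m*h powr (m-p-2*p/N)*X powr (1+p/N)" if X: "X > 0" "cacc_const p \<Lambda>0 \<Lambda>1*q*Y\<le>X" for X
 proof -
  have le: "cacc_const p \<Lambda>0 \<Lambda>1*(V2/(b-a)+Vp/(R-r) powr p)\<le>X" using XX X by linarith
  have E: "AE t in lborel. t\<in>{b..\<theta>} --> L1 (\<lambda>x. (w (x, t))\<^sup>2) \<and> (LINT x|lborel. (w (x, t))\<^sup>2)\<le>X"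
   using wE by eventually_elim (use le in force)
  have T: "(\<integral>\<^sup>+z. ennreal (indicator {b..\<theta>} (snd z)*\<bar>w z-w (z-(y, 0))\<bar> powr p) \<partial>lborel)\<le>ennreal (norm y powr p)*ennreal X" for y
   using le by (intro order_trans[OF wT[of y]] mult_left_mono ennreal_leI) auto
  have "ennreal Y' = (\<integral>\<^sup>+z. ennreal (indicator (cball (0::real^'n) r\<times>{b..\<theta>}) z*max 0 (u z-k') powr m) \<partial>lborel)"
   unfolding Y'_def by (rule nn_integral_eq_integral[symmetric, OF iI[OF k'0]]) auto
  also have "\<dots>\<le>(\<integral>\<^sup>+z. ennreal (indicator {b..\<theta>} (snd z)*(if w z > h then w z powr m else 0)) \<partial>lborel)"
   by (rule nn_integral_mono, rule truncated_nn_le[OF w(4) w(2) h(1) _ m0]) (use h in auto)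
  also have "\<dots>\<le>ennreal (dyadic_const N p m*h powr (m-p-2*p/N)*X powr (1+p/N))"
   unfolding N_def
   by (rule strong_type_above_level[OF w(1,2) _ X(1) h(1) m(2) m(4)[unfolded N_def] E T]) (use p in auto)
  finally show ?thesis
  proof (rule ennreal_le_iff[THEN iffD1, rotated])
   show "0\<le>dyadic_const N p m*h powr (m-p-2*p/N)*X powr (1+p/N)"
    using dyadic_const_pos[OF _ m(4)] by (simp add: N_def)
  qed
 qed
 show ?thesis
 proof (cases "Y = 0")
  case False
  then have "cacc_const p \<Lambda>0 \<Lambda>1*q*Y > 0" using Y0 cc q0 by simp
  from fin[OF this order_refl] show ?thesis unfolding h_def q_def .
 next
  case True
  have "Y'\<le>Y"
   unfolding Y'_def Y_def
  proof (rule Bochner_Integration.integral_mono[OF iI[OF k'0] iY])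
   fix z :: "(real^'n)\<times>real"
   have "max 0 (u z-k') powr m\<le>max 0 (u z-k) powr m" using k m0 by (intro powr_mono2) auto
   then show "indicator (cball 0 r\<times>{b..\<theta>}) z*max 0 (u z-k') powr m\<le>?I z*max 0 (u z-k) powr m"
    using r ab by (intro mult_mono) (auto simp: indicator_def)
  qed
  then show ?thesis using True by simp
 qed
qed

text \<open>Levels \<open>K(1 - 2\<^sup>-\<^sup>n)\<close> on cylinders shrinking from \<open>\<sigma>2\<close> to \<open>\<sigma>1\<close>; \<open>K\<close> is chosen so that \<open>fast_geometric_convergence\<close> applies.
The lower end of the time interval moves, the upper end \<open>\<theta>\<close> stays: the energy inequality looks only backwards in time.\<close>

lemma de_giorgi_bound:
 fixes m \<rho> \<sigma>1 \<sigma>2 :: real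
 defines "N \<equiv> real CARD('n)"
 assumes m: "m = p \<or> m = 2" "p\<le>m" "2\<le>m" "m-p < 2*p/N"
  and \<rho>: "0 < \<rho>" "\<rho> < R0" and \<sigma>: "0 < \<sigma>1" "\<sigma>1 < \<sigma>2" "\<sigma>2\<le>1"
 defines "Y0 \<equiv> LINT z|lborel. indicator (cball (0::real^'n) (\<sigma>2*\<rho>)\<times>{-(\<sigma>2*\<theta>)..\<theta>}) z*max 0 (u z) powr m"
 shows "AE z in lborel. z\<in>cball 0 (\<sigma>1*\<rho>)\<times>{-(\<sigma>1*\<theta>)..\<theta>} \<longrightarrow>
  u z\<le>max 1 ((de_giorgi_const N p \<Lambda>0 \<Lambda>1 m*((\<sigma>2-\<sigma>1) powr (- p)*(1/\<theta>+1/\<rho> powr p)) powr (1+N/p)*Y0)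
    powr ((p/N)/(2*p/N-(m-p))))"
proof -
 have N: "N > 0" by (simp add: N_def)
 define \<alpha> where "\<alpha> = p/N"
 define \<beta> where "\<beta> = 2*p/N-(m-p)"
 have \<alpha>: "\<alpha> > 0" using p N by (simp add: \<alpha>_def)
 have \<beta>: "\<beta> > 0" using m by (simp add: \<beta>_def)
 have \<alpha>i: "N/p = 1/\<alpha>" by (simp add: \<alpha>_def)
 define g where "g = \<sigma>2-\<sigma>1"
 have g: "g > 0" "g\<le>1" using \<sigma> by (auto simp: g_def)
 define L where "L = g powr (- p)*(1/\<theta>+1/\<rho> powr p)"
 have L: "L > 0" unfolding L_def using g \<theta> \<rho> by (intro mult_pos_pos add_pos_pos) auto
 define Cd where "Cd = dyadic_const N p m"
 define Cc where "Cc = cacc_const p \<Lambda>0 \<Lambda>1"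
 define B where "B = de_giorgi_base N p m"
 define lb where "lb = \<beta>+(m+p)*(1+\<alpha>)"
 have Cd: "Cd > 0" unfolding Cd_def by (rule dyadic_const_pos[OF N m(4)])
 have Cc: "Cc > 0" unfolding Cc_def by (rule cacc_const_pos[OF \<Lambda>(1)])
 have lb: "lb > 0" unfolding lb_def using \<beta> m \<alpha> p by (intro add_pos_nonneg mult_nonneg_nonneg) auto
 have B: "B > 1" "B = 2 powr lb"
 proof -
  show "B = 2 powr lb" unfolding B_def de_giorgi_base_def lb_def \<alpha>_def \<beta>_def ..
  then show "B > 1" using lb by (simp add: gr_one_powr)
 qed
 define E where "E = Cd*Cc powr (1+\<alpha>)*B\<^sup>2"
 have E: "E > 0" using Cd Cc B by (simp add: E_def)
 \<comment> \<open>Makes the starting condition of the iteration equivalent to \<open>T powr \<alpha> \<le> K powr \<beta>\<close> below.\<close>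
 define K0 where "K0 = E powr (1/\<alpha>)*B powr ((1/\<alpha>)\<^sup>2)"
 have K0: "K0 > 0" "de_giorgi_const N p \<Lambda>0 \<Lambda>1 m = K0"
 proof -
  show "K0 > 0" unfolding K0_def using E B by simp
  show "de_giorgi_const N p \<Lambda>0 \<Lambda>1 m = K0"
   unfolding K0_def de_giorgi_const_def E_def Cd_def Cc_def B_def \<alpha>_def by simp
 qed
 have Y0: "Y0\<ge>0" unfolding Y0_def by (intro Bochner_Integration.integral_nonneg) auto
 define T where "T = K0*L powr (1+1/\<alpha>)*Y0"
 have T: "T\<ge>0" unfolding T_def using K0 Y0 by simp
 define K where "K = max 1 (T powr (\<alpha>/\<beta>))"
 have K: "K\<ge>1" by (simp add: K_def)
 define R where "R n = \<rho>*(\<sigma>1+g/2^n)" for n :: nat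
 define a where "a n = - (\<theta>*(\<sigma>1+g/2^n))" for n :: nat
 define k where "k n = K*(1-1/2^n)" for n :: nat
 define Y where "Y n = (LINT z|lborel. indicator (cball (0::real^'n) (R n)\<times>{a n..\<theta>}) z*max 0 (u z-k n) powr m)" for n
 have m0: "m > 0" using m by simp
 have Ynn: "Y n\<ge>0" for n unfolding Y_def by (intro Bochner_Integration.integral_nonneg) auto
 have k0: "k n\<ge>0" for n unfolding k_def using K by (intro mult_nonneg_nonneg) auto
 have gn: "g/2^Suc n < g/2^n" "g/2^n\<le>g" "0 < g/2^n" for n
  using g by (auto simp: field_simps)
 have step: "Y (Suc n)\<le>(E*K powr (- \<beta>)*L powr (1+\<alpha>))*B^n*Y n powr (1+\<alpha>)" for n
 proof -
  define x where "x = (2::real)^(n+2)"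
  have x: "x > 0" "x\<ge>1" unfolding x_def by (simp, rule one_le_power, simp)
  have half: "(k (Suc n)-k n)/2 = K/x" by (simp add: k_def x_def field_simps)
  have diffa: "a (Suc n)-a n = \<theta>*g*2/x" "R n-R (Suc n) = \<rho>*g*2/x"
   by (simp_all add: a_def R_def x_def field_simps)
  have Rn: "0\<le>R (Suc n)" "R (Suc n) < R n" "R n < R0"
  proof -
   show "0\<le>R (Suc n)" unfolding R_def using \<rho> \<sigma> g by (intro mult_nonneg_nonneg add_nonneg_nonneg) auto
   show "R (Suc n) < R n" unfolding R_def using \<rho> gn(1)[of n] by (intro mult_strict_left_mono) auto
   have "\<sigma>1+g/2^n\<le>1" using gn(2)[of n] \<sigma> unfolding g_def by linarith
   then have "R n\<le>\<rho>*1" unfolding R_def using \<rho> by (intro mult_left_mono) auto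
   then show "R n < R0" using \<rho> by simp
  qed
  have an: "- \<theta>\<le>a n" "a n < a (Suc n)" "a (Suc n) < \<theta>"
  proof -
   have "\<sigma>1+g/2^n\<le>1" using gn(2)[of n] \<sigma> unfolding g_def by linarith
   then have "\<theta>*(\<sigma>1+g/2^n)\<le>\<theta>*1" using \<theta> by (intro mult_left_mono) auto
   then show "- \<theta>\<le>a n" unfolding a_def by simp
   show "a n < a (Suc n)" unfolding a_def using \<theta> gn(1)[of n] by simp
   have "0 < \<theta>*(\<sigma>1+g/2^Suc n)" using \<theta> \<sigma> gn(3)[of "Suc n"] by (intro mult_pos_pos add_pos_pos)
   then show "a (Suc n) < \<theta>" unfolding a_def using \<theta> by linarith
  qed
  have "K/x > 0" using K x by simp
  then have kk: "k n < k (Suc n)" unfolding half[symmetric] by simp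
  have d: "0 < 1/x" "1/x\<le>(k (Suc n)-k n)/2" "1/x\<le>1"
   unfolding half using x K by (auto simp: divide_right_mono)
  have st: "Y (Suc n)\<le>Cd*(K/x) powr (- \<beta>)*(Cc*((1/x) powr (- m)*(1/(a (Suc n)-a n)+1/(R n-R (Suc n)) powr p))*Y n) powr (1+\<alpha>)"
   using de_giorgi_step[OF m(1,2,3) m(4)[unfolded N_def] Rn an k0 kk d, folded N_def]
   unfolding Y_def Cd_def Cc_def \<alpha>_def \<beta>_def half by (simp add: algebra_simps)
  have q: "1/(a (Suc n)-a n)+1/(R n-R (Suc n)) powr p\<le>x powr p*L"
  proof -
   have xp: "x\<le>x powr p" using powr_mono[of 1 p x] x p by simp
   have gp: "1/g\<le>g powr (- p)" using powr_mono'[of "- p" "- 1" g] g p by (simp add: powr_neg_one)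
   have "1/(a (Suc n)-a n) = (x/2)*(1/g)*(1/\<theta>)" unfolding diffa by simp
   also have "\<dots>\<le>x powr p*(g powr (- p))*(1/\<theta>)"
    using xp gp x g \<theta> by (intro mult_right_mono mult_mono) auto
   finally have 1: "1/(a (Suc n)-a n)\<le>x powr p*(g powr (- p))*(1/\<theta>)" .
   have "(\<rho>*g*2/x) powr p = (\<rho>*g*2) powr p/x powr p" by (rule powr_divide; use \<rho> g x in simp)
   also have "(\<rho>*g*2) powr p = \<rho> powr p*g powr p*2 powr p"
    using \<rho> g by (simp add: powr_mult)
   finally have "1/(R n-R (Suc n)) powr p = x powr p*(1/g powr p)*(1/\<rho> powr p)*(1/2 powr p)"
    unfolding diffa by simp
   also have "\<dots>\<le>x powr p*(1/g powr p)*(1/\<rho> powr p)*1"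
    using p by (intro mult_left_mono) (auto simp: ge_one_powr_ge_zero)
   finally have 2: "1/(R n-R (Suc n)) powr p\<le>x powr p*(g powr (- p))*(1/\<rho> powr p)"
    by (simp add: powr_minus divide_inverse)
   show ?thesis unfolding L_def using 1 2 by (simp add: algebra_simps)
  qed
  have "(1/x) powr (- m) = x powr m" using x by (simp add: powr_minus powr_divide)
  then have "(Cc*((1/x) powr (- m)*(1/(a (Suc n)-a n)+1/(R n-R (Suc n)) powr p))*Y n) powr (1+\<alpha>)
   \<le>(Cc*(x powr m*(x powr p*L))*Y n) powr (1+\<alpha>)"
   using q Cc Ynn[of n] \<alpha> an Rn x by (intro powr_mono2 mult_right_mono mult_left_mono mult_nonneg_nonneg add_nonneg_nonneg) auto
  also have "... = Cc powr (1+\<alpha>)*L powr (1+\<alpha>)*Y n powr (1+\<alpha>)*(x powr (m+p)) powr (1+\<alpha>)"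
  proof -
   have "Cc*(x powr m*(x powr p*L))*Y n = Cc*(L*(Y n*x powr (m+p)))" by (simp add: powr_add mult_ac)
   then have "(Cc*(x powr m*(x powr p*L))*Y n) powr (1+\<alpha>) = (Cc*(L*(Y n*x powr (m+p)))) powr (1+\<alpha>)" by (simp only:)
   also have "... = Cc powr (1+\<alpha>)*(L*(Y n*x powr (m+p))) powr (1+\<alpha>)"
    by (rule powr_mult; use Cc L Ynn[of n] in simp)
   also have "(L*(Y n*x powr (m+p))) powr (1+\<alpha>) = L powr (1+\<alpha>)*(Y n*x powr (m+p)) powr (1+\<alpha>)"
    by (rule powr_mult; use L Ynn[of n] in simp)
   also have "(Y n*x powr (m+p)) powr (1+\<alpha>) = Y n powr (1+\<alpha>)*(x powr (m+p)) powr (1+\<alpha>)"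
    by (rule powr_mult; use Ynn[of n] in simp)
   finally show ?thesis by (simp only: mult_ac)
  qed
  finally have pw: "(Cc*((1/x) powr (- m)*(1/(a (Suc n)-a n)+1/(R n-R (Suc n)) powr p))*Y n) powr (1+\<alpha>)
   \<le>Cc powr (1+\<alpha>)*L powr (1+\<alpha>)*Y n powr (1+\<alpha>)*(x powr (m+p)) powr (1+\<alpha>)" .
  have "(K/x) powr (- \<beta>) = K powr (- \<beta>)/x powr (- \<beta>)" by (rule powr_divide; use K x in simp)
  then have Kx: "(K/x) powr (- \<beta>) = K powr (- \<beta>)*x powr \<beta>" by (simp add: powr_minus divide_inverse)
  have "Y (Suc n)\<le>Cd*(K/x) powr (- \<beta>)*(Cc powr (1+\<alpha>)*L powr (1+\<alpha>)*Y n powr (1+\<alpha>)*(x powr (m+p)) powr (1+\<alpha>))"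
   by (rule order_trans[OF st], rule mult_left_mono[OF pw]) (use Cd in simp)
  also have "... = Cd*Cc powr (1+\<alpha>)*K powr (- \<beta>)*L powr (1+\<alpha>)*Y n powr (1+\<alpha>)*(x powr \<beta>*(x powr (m+p)) powr (1+\<alpha>))"
   unfolding Kx by (simp only: mult_ac)
  also have "x powr \<beta>*(x powr (m+p)) powr (1+\<alpha>) = x powr lb"
   unfolding lb_def powr_powr by (simp only: powr_add[of x \<beta>])
  also have "x powr lb = B^n*B\<^sup>2"
  proof -
   have "x powr lb = (2 powr real (n+2)) powr lb" unfolding x_def by (subst powr_realpow) auto
   also have "... = (2 powr lb) powr real (n+2)" by (simp only: powr_powr mult.commute)
   also have "... = B^(n+2)" unfolding B(2)[symmetric] using B(1) by (intro powr_realpow) simp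
   finally show ?thesis by (simp add: power_add power2_eq_square)
  qed
  finally show ?thesis unfolding E_def by (simp only: mult_ac)
 qed
 have Y00: "Y 0 = Y0"
 proof -
  have "R 0 = \<sigma>2*\<rho>" "a 0 = - (\<sigma>2*\<theta>)" "k 0 = 0" by (simp_all add: R_def a_def k_def g_def)
  then show ?thesis unfolding Y_def Y0_def by simp
 qed
 have start: "(E*K powr (- \<beta>)*L powr (1+\<alpha>))*Y 0 powr \<alpha>\<le>B powr (- 1/\<alpha>)"
 proof -
  have T\<alpha>: "T powr \<alpha> = E*B powr (1/\<alpha>)*L powr (1+\<alpha>)*Y0 powr \<alpha>"
  proof -
   have "T powr \<alpha> = (K0*L powr (1+1/\<alpha>)) powr \<alpha>*Y0 powr \<alpha>" unfolding T_def by (rule powr_mult; use K0 Y0 in simp)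
   also have "(K0*L powr (1+1/\<alpha>)) powr \<alpha> = K0 powr \<alpha>*(L powr (1+1/\<alpha>)) powr \<alpha>" by (rule powr_mult; use K0 in simp)
   also have "(L powr (1+1/\<alpha>)) powr \<alpha> = L powr (1+\<alpha>)"
    unfolding powr_powr using \<alpha> by (simp add: distrib_right add.commute)
   also have "K0 powr \<alpha> = (E powr (1/\<alpha>)) powr \<alpha>*(B powr ((1/\<alpha>)\<^sup>2)) powr \<alpha>"
    unfolding K0_def by (rule powr_mult; simp)
   also have "(E powr (1/\<alpha>)) powr \<alpha> = E" using \<alpha> E by (simp add: powr_powr)
   also have "(B powr ((1/\<alpha>)\<^sup>2)) powr \<alpha> = B powr (1/\<alpha>)" unfolding powr_powr using \<alpha> by (simp add: power2_eq_square)
   finally show ?thesis by (simp only: mult_ac)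
  qed
  have "T powr \<alpha> = (T powr (\<alpha>/\<beta>)) powr \<beta>" using \<beta> by (simp add: powr_powr)
  also have "\<dots>\<le>K powr \<beta>" using \<beta> by (intro powr_mono2) (auto simp: K_def)
  finally have TK: "T powr \<alpha>\<le>K powr \<beta>" .
  have "(E*K powr (- \<beta>)*L powr (1+\<alpha>))*Y 0 powr \<alpha> = (T powr \<alpha>*K powr (- \<beta>))*B powr (- (1/\<alpha>))"
  proof -
   have BB: "B powr (1/\<alpha>)*B powr (- (1/\<alpha>)) = 1" using B by (simp add: powr_add[symmetric])
   have "(T powr \<alpha>*K powr (- \<beta>))*B powr (- (1/\<alpha>))
    = (E*K powr (- \<beta>)*L powr (1+\<alpha>))*Y0 powr \<alpha>*(B powr (1/\<alpha>)*B powr (- (1/\<alpha>)))"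
    unfolding T\<alpha> by (simp only: mult_ac)
   then show ?thesis unfolding Y00 BB by (simp only: mult_1_right)
  qed
  also have "\<dots>\<le>(K powr \<beta>*K powr (- \<beta>))*B powr (- (1/\<alpha>))"
   using TK by (intro mult_right_mono) auto
  also have "... = B powr (- 1/\<alpha>)" using K by (simp add: powr_add[symmetric])
  finally show ?thesis .
 qed
 have Ylim: "Y \<longlonglongrightarrow> 0"
  by (rule fast_geometric_convergence[OF Ynn _ B(1) \<alpha> step start]) (use E K L in simp)
 define S where "S = cball (0::real^'n) (\<sigma>1*\<rho>)\<times>{-(\<sigma>1*\<theta>)..\<theta>}"
 have Sm: "(\<lambda>z. indicator (cball (0::real^'n) r\<times>{c..\<theta>}) z :: real)\<in>Borel" for r c
  by (intro borel_measurable_indicator) (auto simp: borel_prod[symmetric])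
 have iI: "L1 (\<lambda>z. indicator (cball (0::real^'n) r\<times>{c..\<theta>}) z*max 0 (u z-l) powr m)" if "l\<ge>0" for r c l
  by (rule restrict_integrable[OF max_powr_m_integrable[OF that m(1)] Sm]) (auto simp: indicator_def)
 have KK: "K\<ge>0" using K by simp
 have ZY: "(LINT z|lborel. indicator S z*max 0 (u z-K) powr m)\<le>Y n" for n
  unfolding Y_def S_def
 proof (rule Bochner_Integration.integral_mono[OF iI[OF KK] iI[OF k0]])
  fix z :: "(real^'n)\<times>real"
  have "k n\<le>K" unfolding k_def using K by (simp add: mult_left_le)
  then have 1: "max 0 (u z-K) powr m\<le>max 0 (u z-k n) powr m" using m0 by (intro powr_mono2) auto
  have 2: "\<sigma>1*\<rho>\<le>R n" "a n \<le>-(\<sigma>1*\<theta>)"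
   using \<rho> \<theta> gn(3)[of n] g by (auto simp: R_def a_def algebra_simps)
  show "indicator (cball 0 (\<sigma>1*\<rho>)\<times>{- (\<sigma>1*\<theta>)..\<theta>}) z*max 0 (u z-K) powr m\<le>indicator (cball 0 (R n)\<times>{a n..\<theta>}) z*max 0 (u z-k n) powr m"
  proof (rule mult_mono[OF _ 1])
   show "indicator (cball 0 (\<sigma>1*\<rho>)\<times>{- (\<sigma>1*\<theta>)..\<theta>}) z\<le>(indicator (cball 0 (R n)\<times>{a n..\<theta>}) z :: real)"
    using 2 by (auto simp: indicator_def)
  qed auto
 qed
 have "(LINT z|lborel. indicator S z*max 0 (u z-K) powr m)\<le>0"
  by (rule LIMSEQ_le_const[OF Ylim]) (use ZY in auto)
 moreover have "(LINT z|lborel. indicator S z*max 0 (u z-K) powr m)\<ge>0"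
  by (intro Bochner_Integration.integral_nonneg) auto
 ultimately have "(LINT z|lborel. indicator S z*max 0 (u z-K) powr m) = 0" by simp
 then have "AE z in lborel. indicator S z*max 0 (u z-K) powr m = 0"
  by (subst (asm) integral_nonneg_eq_0_iff_AE) (use iI[OF KK] in \<open>auto simp: S_def\<close>)
 then have "AE z in lborel. z\<in>S --> u z\<le>K"
  by eventually_elim (auto simp: indicator_def split: if_splits)
 moreover have "K = max 1 ((de_giorgi_const N p \<Lambda>0 \<Lambda>1 m*((\<sigma>2-\<sigma>1) powr (- p)*(1/\<theta>+1/\<rho> powr p)) powr (1+N/p)*Y0)
    powr ((p/N)/(2*p/N-(m-p))))"
  unfolding K_def T_def K0(2) L_def g_def \<alpha>i \<alpha>_def \<beta>_def by simp
 ultimately show ?thesis unfolding S_def by simp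
qed

end

section \<open>Interpolation down to the power p\<close>

text \<open>The infimum of the admissible bounds is itself admissible, by taking a countable intersection.\<close>

lemma least_essential_bound:
 fixes u :: "'b => real"
 assumes L: "AE z in M. z\<in>S --> u z\<le>L" "1\<le>L"
 obtains c where "1\<le>c" "c\<le>L" "AE z in M. z\<in>S --> u z\<le>c"
  "\<And>c'. 1\<le>c' ==> AE z in M. z\<in>S --> u z\<le>c' ==> c\<le>c'"
proof -
 define X where "X = {c. 1\<le>c \<and> (AE z in M. z\<in>S --> u z\<le>c)}"
 have LX: "L\<in>X" using L by (simp add: X_def)
 have bdd: "bdd_below X" by (auto simp: X_def intro!: bdd_belowI[of _ 1])
 have low: "Inf X\<le>c" if "c\<in>X" for c by (rule cInf_lower[OF that bdd])
 have "AE z in M. z\<in>S --> u z\<le>Inf X+1/real (Suc n)" for n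
 proof -
  have "Inf X < Inf X+1/real (Suc n)" by simp
  then obtain c where c: "c\<in>X" "c < Inf X+1/real (Suc n)" using cInf_lessD[of X] LX by blast
  then have "AE z in M. z\<in>S --> u z\<le>c" by (simp add: X_def)
  then show ?thesis by eventually_elim (use c in auto)
 qed
 then have "AE z in M. \<forall>n. z\<in>S --> u z\<le>Inf X+1/real (Suc n)" unfolding AE_all_countable ..
 then have "AE z in M. z\<in>S --> u z\<le>Inf X"
 proof eventually_elim
  case (elim z)
  show ?case
  proof
   assume "z\<in>S"
   then have le: "u z\<le>Inf X+1/real (Suc n)" for n using elim by blast
   have "(\<lambda>n. Inf X+1/real (Suc n)) \<longlonglongrightarrow> Inf X+0"
    by (intro tendsto_add tendsto_const LIMSEQ_Suc[OF lim_1_over_n])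
   then show "u z\<le>Inf X" by (intro LIMSEQ_le_const) (use le in auto)
  qed
 qed
 moreover have "1\<le>Inf X" using LX by (intro cInf_greatest) (auto simp: X_def)
 ultimately show thesis using low LX by (intro that[of "Inf X"]) (auto simp: X_def)
qed

definition sup_const :: "real => real => real => real => real => real" where
 "sup_const N p \<Lambda>0 \<Lambda>1 m = de_giorgi_const N p \<Lambda>0 \<Lambda>1 m*4 powr (p+N)
   * 2 powr ((p+N)*((m-p)*(p/N))/(2*p/N-(m-p)*(1+p/N)))"

context local_solution
begin

text \<open>With \<open>M\<^sub>j\<close> the least bound \<open>\<ge> 1\<close> on the \<open>j\<close>-th cylinder, \<open>\<integral>u\<^sub>+\<^sup>m \<le> M\<^sub>j\<^sub>+\<^sub>1\<^sup>m\<^sup>-\<^sup>p \<integral>|u|\<^sup>p\<close> and \<open>de_giorgi_bound\<close> between neighbouring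
cylinders give the hypothesis of \<open>sublinear_iteration\<close>. For \<open>p \<ge> 2\<close> the exponent \<open>\<alpha>\<close> is \<open>0\<close>.\<close>

lemma local_sup_bound:
 fixes m \<rho> \<sigma> :: real
 defines "N \<equiv> real CARD('n)"
 assumes m: "m = p \<or> m = 2" "p\<le>m" "2\<le>m" "(m-p)*(1+p/N) < 2*p/N"
  and \<rho>: "0 < \<rho>" "\<rho> < R0" and \<sigma>: "0 < \<sigma>" "\<sigma> < 1"
 defines "Z \<equiv> LINT z|lborel. indicator (ball (0::real^'n) \<rho>\<times>{-\<theta>..\<theta>}) z*\<bar>u z\<bar> powr p"
 shows "AE z in lborel. z\<in>cball 0 (\<sigma>*\<rho>)\<times>{-(\<sigma>*\<theta>)..\<theta>} \<longrightarrow>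
  u z\<le>max 1 ((sup_const N p \<Lambda>0 \<Lambda>1 m*(1-\<sigma>) powr (- (p+N))*(1/\<theta>+1/\<rho> powr p) powr (1+N/p)*Z)
    powr ((p/N)/(2*p/N-(m-p)*(1+p/N))))"
proof -
 have N: "N > 0" by (simp add: N_def)
 define \<beta> where "\<beta> = 2*p/N-(m-p)"
 define \<gamma> where "\<gamma> = (p/N)/\<beta>"
 define \<alpha> where "\<alpha> = (m-p)*\<gamma>"
 have pN: "p/N > 0" using p N by simp
 have mp: "(m-p)*(p/N)\<ge>0" by (rule mult_nonneg_nonneg) (use m pN in auto)
 have \<beta>': "\<beta>-(m-p)*(p/N) > 0" using m(4) by (simp add: \<beta>_def distrib_left)
 then have \<beta>: "\<beta> > 0" using mp by linarith
 have m_small: "m-p < 2*p/real CARD('n)" using \<beta> by (simp add: \<beta>_def N_def)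
 have \<gamma>: "\<gamma> > 0" unfolding \<gamma>_def by (rule divide_pos_pos[OF pN \<beta>])
 have \<alpha>: "\<alpha>\<ge>0" "\<alpha> < 1"
 proof -
  show "\<alpha>\<ge>0" using m \<gamma> by (simp add: \<alpha>_def)
  have "\<alpha> = ((m-p)*(p/N))/\<beta>" by (simp add: \<alpha>_def \<gamma>_def)
  also have "... < 1" unfolding divide_less_eq_1_pos[OF \<beta>] using \<beta>' by linarith
  finally show "\<alpha> < 1" .
 qed
 have one_\<alpha>: "1-\<alpha> = (\<beta>-(m-p)*(p/N))/\<beta>"
  using \<beta> by (simp add: \<alpha>_def \<gamma>_def diff_divide_distrib)
 have \<beta>2: "2*p/N-(m-p)*(1+p/N) = \<beta>-(m-p)*(p/N)" by (simp add: \<beta>_def distrib_left)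
 define dc where "dc = de_giorgi_const N p \<Lambda>0 \<Lambda>1 m"
 have dc: "dc\<ge>0" by (simp add: dc_def de_giorgi_const_def)
 define H where "H = 1/\<theta>+1/\<rho> powr p"
 have H: "H > 0" unfolding H_def using \<theta> \<rho> by (intro add_pos_pos) auto
 define X where "X = ((4/(1-\<sigma>)) powr p*H) powr (1+N/p)"
 have X: "X\<ge>0" by (simp add: X_def)
 have Z: "Z\<ge>0" unfolding Z_def by (intro Bochner_Integration.integral_nonneg) auto
 \<comment> \<open>Staying below \<open>(1 + \<sigma>)/2\<close> leaves room for the a priori bound \<open>L\<close>.\<close>
 define S where "S j = \<sigma>+(1-\<sigma>)/2*(1-1/2^j)" for j :: nat
 define Q where "Q s = cball (0::real^'n) (s*\<rho>)\<times>{-(s*\<theta>)..\<theta>}" for s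
 define Y where "Y s = (LINT z|lborel. indicator (Q s) z*max 0 (u z) powr m)" for s
 have Y0: "Y s\<ge>0" for s unfolding Y_def by (intro Bochner_Integration.integral_nonneg) auto
 have bound: "AE z in lborel. z\<in>Q s1 --> u z\<le>max 1 ((dc*((s2-s1) powr (- p)*H) powr (1+N/p)*Y s2) powr \<gamma>)"
  if "0 < s1" "s1 < s2" "s2\<le>1" for s1 s2
  using de_giorgi_bound[OF m(1,2,3) m_small \<rho> that] unfolding N_def[symmetric] Q_def Y_def dc_def H_def \<gamma>_def \<beta>_def .
 have pw: "0 < 1/(2::real)^j" "1/(2::real)^j\<le>1" for j by auto
 have S: "S j > 0" "S j < (1+\<sigma>)/2" "S j < S (Suc j)" "S (Suc j)-S j = (1-\<sigma>)/4/2^j" "S (Suc j)\<le>1" for j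
 proof -
  have "(1-\<sigma>)/2*(1-1/2^j)\<ge>0" using \<sigma> pw[of j] by (intro mult_nonneg_nonneg) auto
  then show "S j > 0" unfolding S_def using \<sigma> by linarith
  have lt: "S i < (1+\<sigma>)/2" for i
  proof -
   have "(1-\<sigma>)/2*(1-1/2^i) < (1-\<sigma>)/2*1" using \<sigma> pw[of i] by (intro mult_strict_left_mono) auto
   then show ?thesis unfolding S_def by (simp add: field_simps)
  qed
  show "S j < (1+\<sigma>)/2" by (rule lt)
  show "S (Suc j)\<le>1" using lt[of "Suc j"] \<sigma> by simp
  show gap: "S (Suc j)-S j = (1-\<sigma>)/4/2^j" by (simp add: S_def field_simps)
  have "(1-\<sigma>)/4/2^j > 0" using \<sigma> by simp
  then show "S j < S (Suc j)" using gap by linarith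
 qed
 define L where "L = max 1 ((dc*((1-(1+\<sigma>)/2) powr (- p)*H) powr (1+N/p)*Y 1) powr \<gamma>)"
 have AEL: "AE z in lborel. z\<in>Q ((1+\<sigma>)/2) --> u z\<le>L" unfolding L_def by (rule bound) (use \<sigma> in auto)
 have QS: "Q (S j) \<subseteq> Q ((1+\<sigma>)/2)" for j
 proof -
  have "S j*\<rho>\<le>(1+\<sigma>)/2*\<rho>" "S j*\<theta>\<le>(1+\<sigma>)/2*\<theta>" using S(2)[of j] \<rho> \<theta> by (auto intro!: mult_right_mono)
  then show ?thesis unfolding Q_def by (intro Sigma_mono) auto
 qed
 have "\<forall>j. \<exists>c. 1\<le>c \<and> c\<le>L \<and> (AE z in lborel. z\<in>Q (S j) --> u z\<le>c) \<and>
   (\<forall>c'. 1\<le>c' --> (AE z in lborel. z\<in>Q (S j) --> u z\<le>c') --> c\<le>c')"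
 proof
  fix j
  have 1: "AE z in lborel. z\<in>Q (S j) --> u z\<le>L" using AEL by eventually_elim (use QS[of j] in auto)
  have 2: "1\<le>L" by (simp add: L_def)
  show "\<exists>c. 1\<le>c \<and> c\<le>L \<and> (AE z in lborel. z\<in>Q (S j) --> u z\<le>c) \<and>
   (\<forall>c'. 1\<le>c' --> (AE z in lborel. z\<in>Q (S j) --> u z\<le>c') --> c\<le>c')"
   by (rule least_essential_bound[OF 1 2]) blast
 qed
 from choice[OF this] obtain M where "\<forall>j. 1\<le>M j \<and> M j\<le>L \<and> (AE z in lborel. z\<in>Q (S j) --> u z\<le>M j) \<and>
   (\<forall>c'. 1\<le>c' --> (AE z in lborel. z\<in>Q (S j) --> u z\<le>c') --> M j\<le>c')" ..
 then have M: "1\<le>M j" "M j\<le>L" "AE z in lborel. z\<in>Q (S j) --> u z\<le>M j"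
   "1\<le>c' ==> AE z in lborel. z\<in>Q (S j) --> u z\<le>c' ==> M j\<le>c'" for j c' by auto
 have YZ: "Y (S j)\<le>M j powr (m-p)*Z" for j
 proof -
  have "Y (S j)\<le>(LINT z|lborel. M j powr (m-p)*(indicator (ball (0::real^'n) \<rho>\<times>{-\<theta>..\<theta>}) z*\<bar>u z\<bar> powr p))"
   unfolding Y_def
  proof (rule integral_mono_AE)
   have ind: "(\<lambda>z. indicator (cball (0::real^'n) r\<times>{c..\<theta>}) z :: real)\<in>Borel" for r c
    by (intro borel_measurable_indicator) (auto simp: borel_prod[symmetric])
   have "L1 (\<lambda>z. max 0 (u z) powr m)" using max_powr_m_integrable[of 0 m] m by simp
   from restrict_integrable[OF this ind[of "S j*\<rho>" "-(S j*\<theta>)"]]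
   show "L1 (\<lambda>z. indicator (Q (S j)) z*max 0 (u z) powr m)" unfolding Q_def by (auto simp: indicator_def)
   have "L1 (\<lambda>z. \<bar>u z\<bar> powr p)" using u_p by simp
   moreover have "(\<lambda>z. indicator (ball (0::real^'n) \<rho>\<times>{-\<theta>..\<theta>}) z :: real)\<in>Borel"
    by (intro borel_measurable_indicator) (auto simp: borel_prod[symmetric])
   ultimately have "L1 (\<lambda>z. indicator (ball (0::real^'n) \<rho>\<times>{-\<theta>..\<theta>}) z*\<bar>u z\<bar> powr p)"
    by (rule restrict_integrable) (auto simp: indicator_def)
   then
   show "L1 (\<lambda>z. M j powr (m-p)*(indicator (ball (0::real^'n) \<rho>\<times>{-\<theta>..\<theta>}) z*\<bar>u z\<bar> powr p))"
    by (rule integrable_mult_right)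
   have sub: "Q (S j) \<subseteq> ball 0 \<rho>\<times>{-\<theta>..\<theta>}"
   proof -
    have "S j < 1" using S(2)[of j] \<sigma> by simp
    then have "S j*\<rho> < 1*\<rho>" "S j*\<theta> < 1*\<theta>" using \<rho> \<theta> by (auto intro: mult_strict_right_mono)
    then show ?thesis unfolding Q_def by (intro Sigma_mono) auto
   qed
   show "AE z in lborel. indicator (Q (S j)) z*max 0 (u z) powr m
     \<le>M j powr (m-p)*(indicator (ball (0::real^'n) \<rho>\<times>{-\<theta>..\<theta>}) z*\<bar>u z\<bar> powr p)"
    using M(3)[of j]
   proof eventually_elim
    case (elim z)
    show ?case
    proof (cases "z\<in>Q (S j) \<and> u z > 0")
     case False then show ?thesis by (auto simp: indicator_def)
    next
     case True
     have "u z powr m = u z powr (m-p)*u z powr p" by (simp add: powr_add[symmetric])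
     also have "\<dots>\<le>M j powr (m-p)*u z powr p" using True elim m by (intro mult_right_mono powr_mono2) auto
     finally show ?thesis using True sub by (auto simp: indicator_def)
    qed
   qed
  qed
  also have "... = M j powr (m-p)*Z" unfolding Z_def by (rule integral_mult_right_zero)
  finally show ?thesis .
 qed
 define B where "B = (dc*X*Z) powr \<gamma>"
 define b where "b = (2::real) powr ((p+N)*\<gamma>)"
 have step: "M j\<le>max 1 (B*b^j*M (Suc j) powr \<alpha>)" for j
 proof (rule M(4))
  have gp: "(S (Suc j)-S j) powr (- p) = (4/(1-\<sigma>)) powr p*(2^j) powr p"
  proof -
   have "(S (Suc j)-S j) powr (- p) = (1/((4/(1-\<sigma>))*2^j)) powr (- p)" unfolding S(4) using \<sigma> by simp
   also have "... = ((4/(1-\<sigma>))*2^j) powr p" using \<sigma> by (simp add: powr_minus powr_divide)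
   also have "... = (4/(1-\<sigma>)) powr p*(2^j) powr p" by (rule powr_mult; use \<sigma> in simp)
   finally show ?thesis .
  qed
  have pe: "p*(1+N/p) = p+N" using p by (simp add: distrib_left)
  have "((S (Suc j)-S j) powr (- p)*H) powr (1+N/p) = (((4/(1-\<sigma>)) powr p*H)*(2^j) powr p) powr (1+N/p)"
   unfolding gp by (simp only: mult_ac)
  also have "... = X*((2^j) powr p) powr (1+N/p)" unfolding X_def by (rule powr_mult; use H in simp)
  also have "((2^j) powr p) powr (1+N/p) = (2^j) powr (p+N)" unfolding powr_powr pe ..
  finally have e1: "((S (Suc j)-S j) powr (- p)*H) powr (1+N/p) = X*(2^j) powr (p+N)" .
  have "(dc*((S (Suc j)-S j) powr (- p)*H) powr (1+N/p)*Y (S (Suc j))) powr \<gamma>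
   \<le>(dc*(X*(2^j) powr (p+N))*(M (Suc j) powr (m-p)*Z)) powr \<gamma>"
   unfolding e1 using YZ[of "Suc j"] dc X Y0 \<gamma> by (intro powr_mono2 mult_left_mono mult_nonneg_nonneg) auto
  also have "dc*(X*(2^j) powr (p+N))*(M (Suc j) powr (m-p)*Z)
    = (dc*X*Z)*((2^j) powr (p+N)*M (Suc j) powr (m-p))" by (simp only: mult_ac)
  also have "((dc*X*Z)*((2^j) powr (p+N)*M (Suc j) powr (m-p))) powr \<gamma>
    = B*((2^j) powr (p+N)*M (Suc j) powr (m-p)) powr \<gamma>"
   unfolding B_def by (rule powr_mult; use dc X Z in simp)
  also have "((2^j) powr (p+N)*M (Suc j) powr (m-p)) powr \<gamma> = (((2::real)^j) powr (p+N)) powr \<gamma>*(M (Suc j) powr (m-p)) powr \<gamma>"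
   by (rule powr_mult; simp)
  also have "(((2::real)^j) powr (p+N)) powr \<gamma> = b^j"
  proof -
   have "(((2::real)^j) powr (p+N)) powr \<gamma> = ((2 powr real j) powr (p+N)) powr \<gamma>" by (subst powr_realpow) auto
   also have "... = b powr real j" unfolding b_def powr_powr by (simp only: mult_ac)
   also have "... = b^j" by (intro powr_realpow) (simp add: b_def)
   finally show ?thesis .
  qed
  also have "(M (Suc j) powr (m-p)) powr \<gamma> = M (Suc j) powr \<alpha>" unfolding powr_powr \<alpha>_def ..
  finally have le: "(dc*((S (Suc j)-S j) powr (- p)*H) powr (1+N/p)*Y (S (Suc j))) powr \<gamma>
   \<le>B*b^j*M (Suc j) powr \<alpha>" by (simp only: mult.assoc)
  show "AE z in lborel. z\<in>Q (S j) --> u z\<le>max 1 (B*b^j*M (Suc j) powr \<alpha>)"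
   using bound[OF S(1) S(3) S(5), of j] by eventually_elim (use le in force)
 qed simp
 have "M 0\<le>max 1 ((B*b powr (\<alpha>/(1-\<alpha>))) powr (1/(1-\<alpha>)))"
 proof (rule sublinear_iteration[OF _ M(2) _ _ \<alpha> step])
  show "0\<le>M j" for j using M(1)[of j] by simp
  show "b\<ge>1" unfolding b_def using p N \<gamma> by (intro ge_one_powr_ge_zero) auto
 qed (simp add: B_def)
 moreover have "(B*b powr (\<alpha>/(1-\<alpha>))) powr (1/(1-\<alpha>)) =
   (sup_const N p \<Lambda>0 \<Lambda>1 m*(1-\<sigma>) powr (- (p+N))*H powr (1+N/p)*Z) powr ((p/N)/(2*p/N-(m-p)*(1+p/N)))"
 proof -
  have pe: "p*(1+N/p) = p+N" using p by (simp add: distrib_left)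
  have "b powr (\<alpha>/(1-\<alpha>)) = (2 powr ((p+N)*(\<alpha>/(1-\<alpha>)))) powr \<gamma>" unfolding b_def powr_powr by (simp only: mult_ac)
  then have "B*b powr (\<alpha>/(1-\<alpha>)) = (dc*X*Z*2 powr ((p+N)*(\<alpha>/(1-\<alpha>)))) powr \<gamma>"
   unfolding B_def by (simp only:) (rule powr_mult[symmetric]; use dc X Z in simp)
  then have chain: "(B*b powr (\<alpha>/(1-\<alpha>))) powr (1/(1-\<alpha>)) = (dc*X*Z*2 powr ((p+N)*(\<alpha>/(1-\<alpha>)))) powr (\<gamma>*(1/(1-\<alpha>)))"
   by (simp only: powr_powr)
  have g2: "\<gamma>*(1/(1-\<alpha>)) = (p/N)/(2*p/N-(m-p)*(1+p/N))"
   unfolding one_\<alpha> \<beta>2 \<gamma>_def using \<beta> by simp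
  have a2: "\<alpha>/(1-\<alpha>) = ((m-p)*(p/N))/(2*p/N-(m-p)*(1+p/N))"
  proof -
   have "\<alpha> = ((m-p)*(p/N))/\<beta>" by (simp add: \<alpha>_def \<gamma>_def)
   then show ?thesis unfolding one_\<alpha> \<beta>2 using \<beta> by simp
  qed
  have X2: "X = 4 powr (p+N)*(1-\<sigma>) powr (- (p+N))*H powr (1+N/p)"
  proof -
   have "X = ((4/(1-\<sigma>)) powr p) powr (1+N/p)*H powr (1+N/p)" unfolding X_def by (rule powr_mult; use H in simp)
   also have "((4/(1-\<sigma>)) powr p) powr (1+N/p) = (4/(1-\<sigma>)) powr (p+N)" unfolding powr_powr pe ..
   also have "... = 4 powr (p+N)/(1-\<sigma>) powr (p+N)" by (rule powr_divide; use \<sigma> in simp)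
   also have "... = 4 powr (p+N)*(1-\<sigma>) powr (- (p+N))" by (simp only: powr_minus divide_inverse)
   finally show ?thesis .
  qed
  have "dc*X*Z*2 powr ((p+N)*(\<alpha>/(1-\<alpha>)))
   = sup_const N p \<Lambda>0 \<Lambda>1 m*(1-\<sigma>) powr (- (p+N))*H powr (1+N/p)*Z"
   unfolding X2 a2 sup_const_def dc_def times_divide_eq_right by (simp only: mult_ac)
  then show ?thesis unfolding chain g2 by (simp only:)
 qed
 moreover have "S 0 = \<sigma>" by (simp add: S_def)
 ultimately have "AE z in lborel. z\<in>Q \<sigma> --> u z\<le>max 1 ((sup_const N p \<Lambda>0 \<Lambda>1 m*(1-\<sigma>) powr (- (p+N))*H powr (1+N/p)*Z)
   powr ((p/N)/(2*p/N-(m-p)*(1+p/N))))"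
  using M(3)[of 0] by (auto elim!: eventually_mono)
 then show ?thesis unfolding Q_def H_def .
qed

end

section \<open>From weak solutions to Borel representatives\<close>

lemma borel_measurable_completion_AE:
 fixes f g :: "'a => 'b::euclidean_space"
 assumes g: "g\<in>borel_measurable M" and eq: "AE x in M. f x = g x"
 shows "f\<in>borel_measurable (completion M)"
proof (rule measurableI)
 fix B :: "'b set"
 assume "B\<in>sets borel"
 then have "g -` B \<inter> space M\<in>sets M" using g by (rule measurable_sets[rotated])
 then have gB: "g -` B \<inter> space M\<in>sets (completion M)" by (rule sets_completionI_sets)
 obtain N where N: "N\<in>null_sets M" "{x\<in>space M. f x\<noteq>g x} \<subseteq> N"
  using eq by (auto simp: eventually_ae_filter)
 have sub: "S\<in>sets (completion M)" if "S \<subseteq> N" for S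
  by (rule sets_completionI_sub[OF N(1) that])
 have "f -` B \<inter> space M = ((g -` B \<inter> space M)-(N \<inter> (g -` B \<inter> space M)-f -` B)) \<union> (N \<inter> (f -` B \<inter> space M))"
  using N(2) by auto
 also have "\<dots>\<in>sets (completion M)"
  by (intro sets.Un sets.Diff gB sub) auto
 finally show "f -` B \<inter> space (completion M)\<in>sets (completion M)" by simp
qed simp

text \<open>Fubini's theorem is used for Borel functions on the product, while the solution is only Lebesgue measurable.\<close>

lemma borel_representative:
 fixes f :: "'a::euclidean_space => 'b::euclidean_space"
 assumes f: "f\<in>borel_measurable (lebesgue_on S)" and S: "S\<in>sets lebesgue" and W: "W\<in>sets borel" "W \<subseteq> S"
 obtains g where "g\<in>Borel" "\<And>z. z \<notin> W ==> g z = 0" "AE z in lborel. z\<in>W --> g z = f z"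
proof -
 have fS: "(\<lambda>x. if x\<in>S then f x else 0)\<in>borel_measurable lebesgue" by (rule borel_measurable_if_I[OF f S])
 have "\<forall>b. \<exists>h. h\<in>borel_measurable lborel \<and> (AE x in lborel. (if x\<in>S then f x else 0)\<bullet>b = h x)"
 proof
  fix b :: 'b
  have "(\<lambda>x. (if x\<in>S then f x else 0)\<bullet>b)\<in>borel_measurable (completion lborel)"
   using fS by (intro borel_measurable_inner) auto
  from completion_ex_borel_measurable_real[OF this]
  show "\<exists>h. h\<in>borel_measurable lborel \<and> (AE x in lborel. (if x\<in>S then f x else 0)\<bullet>b = h x)" by blast
 qed
 from choice[OF this] obtain h where h: "\<forall>b. h b\<in>borel_measurable lborel \<and> (AE x in lborel. (if x\<in>S then f x else 0)\<bullet>b = h b x)" ..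
 define g where "g x = indicator W x*\<^sub>R (\<Sum>b\<in>Basis. h b x*\<^sub>R b)" for x
 have [measurable]: "h b\<in>Borel" for b using h by simp
 show thesis
 proof (rule that)
  show "g\<in>Borel" unfolding g_def using W(1) by measurable
  show "g z = 0" if "z \<notin> W" for z using that by (simp add: g_def)
  have "AE x in lborel. \<forall>b\<in>Basis. (if x\<in>S then f x else 0)\<bullet>b = h b x"
   by (rule AE_finite_allI) (use h in auto)
  then show "AE z in lborel. z\<in>W --> g z = f z"
  proof eventually_elim
   case (elim z)
   show ?case
   proof
    assume z: "z\<in>W"
    then have "g z = (\<Sum>b\<in>Basis. (f z\<bullet>b)*\<^sub>R b)"
     unfolding g_def using elim W(2) by (auto intro!: sum.cong)
    then show "g z = f z" by (simp add: euclidean_representation)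
   qed
  qed
 qed
qed

text \<open>The hypotheses speak of Lebesgue measurable functions on a set, the estimates of Borel functions on the whole
space.\<close>

lemma
 fixes f :: "'a::euclidean_space => 'b::euclidean_space"
 assumes U: "U\<in>sets borel" and g: "g\<in>Borel" "\<And>x. x \<notin> U ==> g x = 0" and eq: "AE x in lborel. x\<in>U --> g x = f x"
 shows integral_lebesgue_on_eq: "integral\<^sup>L (lebesgue_on U) f = integral\<^sup>L lborel g"
  and integrable_lebesgue_on_eq: "integrable (lebesgue_on U) f \<longleftrightarrow> L1 g"
  and measurable_lebesgue_on_eq: "f\<in>borel_measurable (lebesgue_on U)"
proof -
 have UL: "U \<inter> space lebesgue\<in>sets lebesgue" using U by simp
 have eq': "AE x in lborel. indicator U x*\<^sub>R f x = g x"
  using eq by eventually_elim (use g(2) in \<open>auto simp: indicator_def\<close>)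
 have fm: "(\<lambda>x. indicator U x*\<^sub>R f x)\<in>borel_measurable lebesgue"
  by (rule borel_measurable_completion_AE[OF _ eq']) (use g(1) in simp)
 have gm: "g\<in>borel_measurable lebesgue" using g(1) by (intro measurable_completion) simp
 have eqL: "AE x in lebesgue. indicator U x*\<^sub>R f x = g x" using eq' by (rule AE_completion)
 have gb: "g\<in>borel_measurable lborel" using g(1) by simp
 show "integral\<^sup>L (lebesgue_on U) f = integral\<^sup>L lborel g"
  unfolding integral_restrict_space[OF UL] integral_cong_AE[OF fm gm eqL] by (rule integral_completion[OF gb])
 show "integrable (lebesgue_on U) f \<longleftrightarrow> L1 g"
  unfolding integrable_restrict_space[OF UL] integrable_cong_AE[OF fm gm eqL] by (rule integrable_completion[OF gb])
 show "f\<in>borel_measurable (lebesgue_on U)"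
  unfolding borel_measurable_restrict_space_iff[OF UL] by (rule fm)
qed

lemma integrable_representative:
 fixes f :: "'a::euclidean_space => 'b::euclidean_space"
 assumes f: "integrable (lebesgue_on S) (\<lambda>z. norm (f z) powr p)" and S: "S\<in>sets lebesgue" and W: "W\<in>sets borel" "W \<subseteq> S"
  and g: "g\<in>Borel" "\<And>z. z \<notin> W ==> g z = 0" "AE z in lborel. z\<in>W --> g z = f z"
 shows "L1 (\<lambda>z. norm (g z) powr p)"
proof -
 have SL: "S \<inter> space lebesgue\<in>sets lebesgue" using S by simp
 have "integrable lebesgue (\<lambda>z. indicator S z*\<^sub>R norm (f z) powr p)" using f unfolding integrable_restrict_space[OF SL] .
 then have "integrable lebesgue (\<lambda>z. indicator W z*\<^sub>R (indicator S z*\<^sub>R norm (f z) powr p))"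
  by (rule integrable_mult_indicator[rotated]) (use W in simp)
 also have "(\<lambda>z. indicator W z*\<^sub>R (indicator S z*\<^sub>R norm (f z) powr p)) = (\<lambda>z. indicator W z*\<^sub>R norm (f z) powr p)"
  using W by (auto simp: indicator_def fun_eq_iff)
 finally have "integrable (lebesgue_on W) (\<lambda>z. norm (f z) powr p)"
  by (subst integrable_restrict_space) (use W in auto)
 moreover have "AE z in lborel. z\<in>W --> norm (g z) powr p = norm (f z) powr p"
  using g(3) by eventually_elim simp
 ultimately show ?thesis
  using integrable_lebesgue_on_eq[OF W(1), of "\<lambda>z. norm (g z) powr p" "\<lambda>z. norm (f z) powr p"] g by simp
qed

lemma test_function_properties:
 fixes \<phi> :: "real^'n => real"
 assumes "\<phi>\<in>test_functions U"
 shows "continuous_on UNIV \<phi>" "continuous_on UNIV (grad \<phi>)" "\<And>x. x \<notin> U ==> \<phi> x = 0" "\<And>x. x \<notin> U ==> grad \<phi> x = 0"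
  "\<exists>B>0. \<forall>x. \<bar>\<phi> x\<bar>\<le>B \<and> norm (grad \<phi> x)\<le>B"
  "U \<subseteq> V ==> \<phi>\<in>test_functions V"
proof -
 have ck: "C_k k \<phi>" for k using assms by (simp add: test_functions_def)
 have cs: "compact (closure {x. \<phi> x\<noteq>0})" "closure {x. \<phi> x\<noteq>0} \<subseteq> U" using assms by (auto simp: test_functions_def)
 show c: "continuous_on UNIV \<phi>" using ck[of 0] by simp
 have d1: "C_k 0 (\<lambda>x. frechet_derivative \<phi> (at x) v)" for v using ck[of "Suc 0"] by simp
 show cg: "continuous_on UNIV (grad \<phi>)"
  unfolding grad_def using d1 by (intro continuous_on_vec_lambda) simp
 have out: "\<phi> x = 0" "grad \<phi> x = 0" if x: "x \<notin> closure {x. \<phi> x\<noteq>0}" for x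
 proof -
  show "\<phi> x = 0" using x closure_subset[of "{x. \<phi> x\<noteq>0}"] by auto
  have op: "open (- closure {x. \<phi> x\<noteq>0})" by (rule open_Compl, rule closed_closure)
  have "(\<phi> has_derivative (\<lambda>h. 0)) (at x)"
  proof (rule has_derivative_transform_within_open[OF has_derivative_const[of 0] op])
   show "x \<in>-closure {x. \<phi> x\<noteq>0}" using x by simp
   show "0 = \<phi> y" if "y \<in>-closure {x. \<phi> x\<noteq>0}" for y using that closure_subset[of "{x. \<phi> x\<noteq>0}"] by auto
  qed
  from frechet_derivative_at[OF this]
  have "frechet_derivative \<phi> (at x) = (\<lambda>h. 0)" by simp
  then show "grad \<phi> x = 0" by (simp add: grad_def vec_eq_iff)
 qed
 show "\<phi> x = 0" "grad \<phi> x = 0" if "x \<notin> U" for x using out[of x] that cs by auto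
 obtain R where R: "\<And>x. x\<in>closure {x. \<phi> x\<noteq>0} ==> norm x\<le>R"
  using compact_imp_bounded[OF cs(1)] by (auto simp: bounded_iff)
 have v: "\<phi> x = 0" "grad \<phi> x = 0" if "norm x > R" for x using out[of x] R[of x] that by auto
 obtain B1 where B1: "B1 > 0" "\<And>x. norm (\<phi> x)\<le>B1" using bounded_of_vanishing[OF c v(1)] by metis
 obtain B2 where B2: "B2 > 0" "\<And>x. norm (grad \<phi> x)\<le>B2" using bounded_of_vanishing[OF cg v(2)] by metis
 show "\<exists>B>0. \<forall>x. \<bar>\<phi> x\<bar>\<le>B \<and> norm (grad \<phi> x)\<le>B"
  using B1 B2 by (intro exI[of _ "max B1 B2"]) (auto simp: le_max_iff_disj)
 show "\<phi>\<in>test_functions V" if "U \<subseteq> V" using assms that by (auto simp: test_functions_def)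
qed

text \<open>A substitute for the Cauchy-Schwarz inequality whose right hand side is still linear in the norm of \<open>f\<close>, which is all
that is needed for continuity.\<close>

lemma integral_product_bound:
 fixes f g :: "'a => real"
 assumes f: "f\<in>borel_measurable M" "integrable M (\<lambda>x. (f x)\<^sup>2)" and g: "g\<in>borel_measurable M" "integrable M (\<lambda>x. (g x)\<^sup>2)"
 shows "integrable M (\<lambda>x. f x*g x)"
  "\<bar>LINT x|M. f x*g x\<bar>\<le>sqrt (LINT x|M. (f x)\<^sup>2)*(1+(LINT x|M. (g x)\<^sup>2))"
proof -
 have bnd: "\<bar>f x*g x\<bar>\<le>(f x)\<^sup>2+(g x)\<^sup>2" for x
 proof -
  have "2*(\<bar>f x\<bar>*\<bar>g x\<bar>)\<le>(f x)\<^sup>2+(g x)\<^sup>2" using sum_squares_bound[of "\<bar>f x\<bar>" "\<bar>g x\<bar>"] by (simp add: mult.assoc)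
  moreover have "\<bar>f x\<bar>*\<bar>g x\<bar>\<ge>0" by simp
  ultimately show ?thesis unfolding abs_mult by linarith
 qed
 show i: "integrable M (\<lambda>x. f x*g x)"
  by (rule Bochner_Integration.integrable_bound[OF Bochner_Integration.integrable_add[OF f(2) g(2)]])
   (use f(1) g(1) bnd in auto)
 define F where "F = (LINT x|M. (f x)\<^sup>2)"
 define G where "G = (LINT x|M. (g x)\<^sup>2)"
 have F: "F\<ge>0" and G: "G\<ge>0" unfolding F_def G_def by (intro Bochner_Integration.integral_nonneg; simp)+
 show "\<bar>LINT x|M. f x*g x\<bar>\<le>sqrt (LINT x|M. (f x)\<^sup>2)*(1+(LINT x|M. (g x)\<^sup>2))"
  unfolding F_def[symmetric] G_def[symmetric]
 proof (cases "F = 0")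
  case True
  have "AE x in M. (f x)\<^sup>2 = 0"
   using True unfolding F_def by (subst (asm) integral_nonneg_eq_0_iff_AE[OF f(2)]) auto
  then have "AE x in M. f x*g x = 0" by eventually_elim simp
  then have "(LINT x|M. f x*g x) = 0" by (rule integral_eq_zero_AE)
  then show "\<bar>LINT x|M. f x*g x\<bar>\<le>sqrt F*(1+G)" using F G by simp
 next
  case False
  define n where "n = sqrt F"
  have n: "n > 0" "n*n = F" using False F by (auto simp: n_def)
  have "\<bar>LINT x|M. f x*g x\<bar>\<le>(LINT x|M. \<bar>f x*g x\<bar>)" by (rule integral_abs_bound)
  also have "\<dots>\<le>(LINT x|M. (f x)\<^sup>2/n+n*(g x)\<^sup>2)"
  proof (rule Bochner_Integration.integral_mono)
   show "integrable M (\<lambda>x. \<bar>f x*g x\<bar>)" using i by simp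
   show "integrable M (\<lambda>x. (f x)\<^sup>2/n+n*(g x)\<^sup>2)" using f(2) g(2) by simp
   fix x
   have "2*((\<bar>f x\<bar>/sqrt n)*(sqrt n*\<bar>g x\<bar>))\<le>(\<bar>f x\<bar>/sqrt n)\<^sup>2+(sqrt n*\<bar>g x\<bar>)\<^sup>2"
    using sum_squares_bound[of "\<bar>f x\<bar>/sqrt n" "sqrt n*\<bar>g x\<bar>"] by (simp only: mult.assoc)
   moreover have "(\<bar>f x\<bar>/sqrt n)*(sqrt n*\<bar>g x\<bar>) = \<bar>f x*g x\<bar>" using n by (simp add: abs_mult)
   moreover have "(\<bar>f x\<bar>/sqrt n)\<^sup>2 = (f x)\<^sup>2/n" "(sqrt n*\<bar>g x\<bar>)\<^sup>2 = n*(g x)\<^sup>2"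
    using n by (auto simp: power_divide power_mult_distrib)
   moreover have "\<bar>f x*g x\<bar>\<ge>0" by simp
   ultimately show "\<bar>f x*g x\<bar>\<le>(f x)\<^sup>2/n+n*(g x)\<^sup>2" by linarith
  qed
  also have "... = F/n+n*G" unfolding F_def G_def using f(2) g(2) by simp
  also have "F/n = n" using n by (simp add: field_simps)
  finally show "\<bar>LINT x|M. f x*g x\<bar>\<le>sqrt F*(1+G)" unfolding n_def by (simp add: distrib_left)
 qed
qed

lemma Lp_norm_two:
 fixes f :: "'a::euclidean_space => real"
 shows "Lp_norm 2 U f = sqrt (LINT x|lebesgue_on U. (f x)\<^sup>2)"
proof -
 have "norm (f x) powr 2 = (f x)\<^sup>2" for x by (cases "f x = 0") (auto simp: powr_numeral)
 moreover have "(LINT x|lebesgue_on U. (f x)\<^sup>2)\<ge>0" by (intro Bochner_Integration.integral_nonneg) simp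
 ultimately show ?thesis unfolding Lp_norm_def by (simp add: powr_half_sqrt)
qed

lemma in_Lp_two:
 fixes f :: "'a::euclidean_space => real"
 shows "in_Lp 2 U f \<longleftrightarrow> f\<in>borel_measurable (lebesgue_on U) \<and> integrable (lebesgue_on U) (\<lambda>x. (f x)\<^sup>2)"
proof -
 have "norm (f x) powr 2 = (f x)\<^sup>2" for x by (cases "f x = 0") (auto simp: powr_numeral)
 then show ?thesis unfolding in_Lp_def by simp
qed

text \<open>This is the only way in which the strong convergences of the definition of a weak solution enter.\<close>

lemma Lp_norm_two_pairing_tendsto:
 fixes f :: "real => 'a::euclidean_space => real"
 assumes lim: "((\<lambda>s. Lp_norm 2 U (f s)) \<longlongrightarrow> 0) F" and f: "\<forall>\<^sub>F s in F. in_Lp 2 U (f s)" and g: "in_Lp 2 U g"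
 shows "((\<lambda>s. LINT x|lebesgue_on U. f s x*g x) \<longlongrightarrow> 0) F"
proof (rule Lim_null_comparison)
 show "((\<lambda>s. Lp_norm 2 U (f s)*(1+(LINT x|lebesgue_on U. (g x)\<^sup>2))) \<longlongrightarrow> 0) F"
  using tendsto_mult_left_zero[OF lim] .
 show "\<forall>\<^sub>F s in F. norm (LINT x|lebesgue_on U. f s x*g x)\<le>Lp_norm 2 U (f s)*(1+(LINT x|lebesgue_on U. (g x)\<^sup>2))"
  using f by eventually_elim (use g integral_product_bound(2)[of _ "lebesgue_on U" g] in \<open>auto simp: in_Lp_two Lp_norm_two\<close>)
qed

lemma in_Lp_two_diff:
 fixes f g :: "'a::euclidean_space => real"
 assumes "in_Lp 2 U f" "in_Lp 2 U g"
 shows "in_Lp 2 U (\<lambda>x. c*f x-d*g x)"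
proof -
 have "integrable (lebesgue_on U) (\<lambda>x. c\<^sup>2*(f x)\<^sup>2+d\<^sup>2*(g x)\<^sup>2-2 * c*d*(f x*g x))"
  using assms integral_product_bound(1)[of f "lebesgue_on U" g] by (auto simp: in_Lp_two)
 moreover have "(c*f x-d*g x)\<^sup>2 = c\<^sup>2*(f x)\<^sup>2+d\<^sup>2*(g x)\<^sup>2-2 * c*d*(f x*g x)" for x
  by (simp add: power2_eq_square algebra_simps)
 ultimately show ?thesis using assms by (auto simp: in_Lp_two)
qed

lemma interval_bounded_of_locally_bounded:
 fixes f :: "real => real"
 assumes "a\<le>b" and loc: "\<And>x. a\<le>x ==> x\<le>b ==> \<exists>C. \<forall>\<^sub>F y in nhds x. f y\<le>C"
 shows "\<exists>C. \<forall>x\<in>{a..b}. f x\<le>C"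
 using assms(1)
proof (induction rule: Bolzano)
 case (trans a b c)
 then obtain C1 C2 where "\<forall>x\<in>{a..b}. f x\<le>C1" "\<forall>x\<in>{b..c}. f x\<le>C2" by blast
 then have "\<forall>x\<in>{a..c}. f x\<le>max C1 C2" by (auto simp: le_max_iff_disj)
 then show ?case by blast
next
 case (local x)
 then obtain C where "\<forall>\<^sub>F y in nhds x. f y\<le>C" using loc by blast
 then obtain d where d: "d > 0" "\<And>y. dist y x < d ==> f y\<le>C" by (auto simp: eventually_nhds_metric)
 have "\<exists>C. \<forall>y\<in>{s..t}. f y\<le>C" if "s\<le>x \<and> x\<le>t \<and> t-s < d" for s t
  by (rule exI[of _ C]) (use that d(2) in \<open>auto simp: dist_real_def\<close>)
 then show ?case using d(1) by blast
qed

lemma pairing_continuous: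
 assumes C: "C0_L2_loc \<Omega> T u" and U: "compactly_contained U \<Omega>" and g: "in_Lp 2 U g" and t: "t\<in>{-T<..<T}"
 shows "isCont (\<lambda>s. LINT x|lebesgue_on U. u (x, s)*g x) t"
proof -
 have C': "in_Lp 2 U (\<lambda>x. u (x, s))" "((\<lambda>r. Lp_norm 2 U (\<lambda>x. u (x, r)-u (x, s))) \<longlongrightarrow> 0) (at s)" if "s\<in>{-T<..<T}" for s
  using C U that unfolding C0_L2_loc_def by blast+
 have ev: "\<forall>\<^sub>F s in at t. s\<in>{-T<..<T}"
  by (rule eventually_at_in_open'[OF _ t]) simp
 have "((\<lambda>s. LINT x|lebesgue_on U. (u (x, s)-u (x, t))*g x) \<longlongrightarrow> 0) (at t)"
 proof (rule Lp_norm_two_pairing_tendsto[OF C'(2)[OF t] _ g])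
  show "\<forall>\<^sub>F s in at t. in_Lp 2 U (\<lambda>x. u (x, s)-u (x, t))"
   using ev by eventually_elim (use in_Lp_two_diff[OF C'(1) C'(1)[OF t], of _ 1 1] in simp)
 qed
 moreover have "\<forall>\<^sub>F s in at t. (LINT x|lebesgue_on U. (u (x, s)-u (x, t))*g x)
   = (LINT x|lebesgue_on U. u (x, s)*g x)-(LINT x|lebesgue_on U. u (x, t)*g x)"
  using ev
 proof eventually_elim
  case (elim s)
  have "integrable (lebesgue_on U) (\<lambda>x. u (x, r)*g x)" if "r\<in>{-T<..<T}" for r
   using integral_product_bound(1)[of "\<lambda>x. u (x, r)" "lebesgue_on U" g] C'(1)[OF that] g by (simp add: in_Lp_two)
  then show ?case using elim t by (simp add: left_diff_distrib)
 qed
 ultimately have "((\<lambda>s. (LINT x|lebesgue_on U. u (x, s)*g x)-(LINT x|lebesgue_on U. u (x, t)*g x)) \<longlongrightarrow> 0) (at t)"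
  by (rule Lim_transform_eventually)
 then show ?thesis unfolding isCont_def by (rule LIM_zero_cancel)
qed

lemma square_integrals_bounded:
 assumes C: "C0_L2_loc \<Omega> T u" and U: "compactly_contained U \<Omega>" and ab: "a\<le>b" "{a..b} \<subseteq> {-T<..<T}"
 shows "\<exists>B. \<forall>t\<in>{a..b}. (LINT x|lebesgue_on U. (u (x, t))\<^sup>2)\<le>B"
proof (rule interval_bounded_of_locally_bounded[OF ab(1)])
 fix t assume "a\<le>t" "t\<le>b"
 then have t: "t\<in>{-T<..<T}" using ab by auto
 have C': "in_Lp 2 U (\<lambda>x. u (x, s))" "((\<lambda>r. Lp_norm 2 U (\<lambda>x. u (x, r)-u (x, s))) \<longlongrightarrow> 0) (at s)" if "s\<in>{-T<..<T}" for s
  using C U that unfolding C0_L2_loc_def by blast+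
 let ?f = "\<lambda>t. LINT x|lebesgue_on U. (u (x, t))\<^sup>2"
 have ev: "\<forall>\<^sub>F s in at t. s\<in>{-T<..<T}"
  by (rule eventually_at_in_open'[OF _ t]) simp
 have ev2: "\<forall>\<^sub>F s in at t. Lp_norm 2 U (\<lambda>x. u (x, s)-u (x, t)) < 1"
  using C'(2)[OF t] by (rule order_tendstoD) simp
 have "\<forall>\<^sub>F s in at t. ?f s\<le>2+2*?f t"
  using ev ev2
 proof eventually_elim
  case (elim s)
  have i: "integrable (lebesgue_on U) (\<lambda>x. (u (x, s))\<^sup>2)" "integrable (lebesgue_on U) (\<lambda>x. (u (x, t))\<^sup>2)"
   using C'(1)[OF elim(1)] C'(1)[OF t] by (auto simp: in_Lp_two)
  have id: "integrable (lebesgue_on U) (\<lambda>x. (u (x, s)-u (x, t))\<^sup>2)"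
   using in_Lp_two_diff[OF C'(1)[OF elim(1)] C'(1)[OF t], of 1 1] by (simp add: in_Lp_two)
  have "?f s\<le>(LINT x|lebesgue_on U. 2*(u (x, s)-u (x, t))\<^sup>2+2*(u (x, t))\<^sup>2)"
  proof (rule Bochner_Integration.integral_mono[OF i(1)])
   show "integrable (lebesgue_on U) (\<lambda>x. 2*(u (x, s)-u (x, t))\<^sup>2+2*(u (x, t))\<^sup>2)" using i id by simp
   fix x
   have "0\<le>(u (x, s)-2*u (x, t))\<^sup>2" by simp
   then show "(u (x, s))\<^sup>2\<le>2*(u (x, s)-u (x, t))\<^sup>2+2*(u (x, t))\<^sup>2"
    by (simp add: power2_eq_square algebra_simps)
  qed
  also have "... = 2*(LINT x|lebesgue_on U. (u (x, s)-u (x, t))\<^sup>2)+2*?f t" using i id by simp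
  also have "(LINT x|lebesgue_on U. (u (x, s)-u (x, t))\<^sup>2)\<le>1"
   using elim(2) unfolding Lp_norm_two by simp
  finally show ?case by simp
 qed
 moreover have "?f t\<ge>0" by (intro Bochner_Integration.integral_nonneg) simp
 ultimately have "\<forall>\<^sub>F s in nhds t. ?f s\<le>2+2*?f t"
  unfolding eventually_nhds_conv_at by simp
 then show "\<exists>B. \<forall>\<^sub>F s in nhds t. ?f s\<le>B" by blast
qed

text \<open>The derivative in \<open>L\<^sup>2\<close> determines the derivative of every scalar pairing.\<close>

lemma L2_derivative_pairing:
 assumes d: "has_L2_loc_time_derivative \<Omega> v w t" and U: "compactly_contained U \<Omega>" and g: "in_Lp 2 U g"
  and F: "\<forall>\<^sub>F s in nhds t. (LINT x|lebesgue_on U. v (x, s)*g x) = F s" "(F has_real_derivative F') (at t)"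
 shows "(LINT x|lebesgue_on U. w x*g x) = F'"
proof -
 have w: "in_Lp 2 U w" and v: "\<forall>\<^sub>F s in nhds t. in_Lp 2 U (\<lambda>x. v (x, s))"
  and lim: "((\<lambda>s. Lp_norm 2 U (\<lambda>x. (v (x, s)-v (x, t))/(s-t)-w x)) \<longlongrightarrow> 0) (at t)"
  using d U unfolding has_L2_loc_time_derivative_def by blast+
 have vt: "in_Lp 2 U (\<lambda>x. v (x, t))" "(LINT x|lebesgue_on U. v (x, t)*g x) = F t"
  using eventually_nhds_x_imp_x[OF v] eventually_nhds_x_imp_x[OF F(1)] by auto
 have vat: "\<forall>\<^sub>F s in at t. in_Lp 2 U (\<lambda>x. v (x, s))" and Fat: "\<forall>\<^sub>F s in at t. (LINT x|lebesgue_on U. v (x, s)*g x) = F s"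
  using v F(1) unfolding eventually_nhds_conv_at by auto
 have q: "in_Lp 2 U (\<lambda>x. (v (x, s)-v (x, t))/(s-t)-w x)" if "in_Lp 2 U (\<lambda>x. v (x, s))" for s
  using in_Lp_two_diff[OF in_Lp_two_diff[OF that vt(1), of 1 1] w, of "1/(s-t)" 1] by simp
 have "((\<lambda>s. LINT x|lebesgue_on U. ((v (x, s)-v (x, t))/(s-t)-w x)*g x) \<longlongrightarrow> 0) (at t)"
  by (rule Lp_norm_two_pairing_tendsto[OF lim _ g]) (use vat q in \<open>auto elim: eventually_mono\<close>)
 moreover have "\<forall>\<^sub>F s in at t. (LINT x|lebesgue_on U. ((v (x, s)-v (x, t))/(s-t)-w x)*g x)
   = (F s-F t)/(s-t)-(LINT x|lebesgue_on U. w x*g x)"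
  using vat Fat
 proof eventually_elim
  case (elim s)
  have i: "integrable (lebesgue_on U) (\<lambda>x. f x*g x)" if "in_Lp 2 U f" for f
   using integral_product_bound(1)[of f "lebesgue_on U" g] that g by (simp add: in_Lp_two)
  have "(LINT x|lebesgue_on U. ((v (x, s)-v (x, t))/(s-t)-w x)*g x)
   = (LINT x|lebesgue_on U. (v (x, s)*g x-v (x, t)*g x)/(s-t)-w x*g x)"
   by (intro Bochner_Integration.integral_cong) (auto simp: left_diff_distrib)
  also have "... = ((LINT x|lebesgue_on U. v (x, s)*g x)-(LINT x|lebesgue_on U. v (x, t)*g x))/(s-t)-(LINT x|lebesgue_on U. w x*g x)"
   using i[OF elim(1)] i[OF vt(1)] i[OF w] by simp
  finally show ?case unfolding vt(2) elim(2) .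
 qed
 ultimately have "((\<lambda>s. (F s-F t)/(s-t)-(LINT x|lebesgue_on U. w x*g x)) \<longlongrightarrow> 0) (at t)"
  by (rule Lim_transform_eventually)
 then have "((\<lambda>s. (F s-F t)/(s-t)) \<longlongrightarrow> (LINT x|lebesgue_on U. w x*g x)) (at t)" by (rule LIM_zero_cancel)
 moreover have "((\<lambda>s. (F s-F t)/(s-t)) \<longlongrightarrow> F') (at t)" using F(2) unfolding has_field_derivative_iff .
 ultimately show ?thesis by (rule tendsto_unique[rotated]) simp
qed

lemma
 fixes f g :: "'a::euclidean_space\<times>real => 'b::euclidean_space" and \<psi> :: "'a => 'b"
 assumes g: "L1 g" and eq: "AE z in lborel. z\<in>U\<times>J --> g z = f z"
  and r: "{r..r+h} \<subseteq> J" "r\<in>{-T<..<T-h}" and h: "h > 0" and U: "U\<in>sets borel"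
  and \<psi>: "continuous_on UNIV \<psi>" "\<And>x. norm (\<psi> x)\<le>B" "\<And>x. x \<notin> U ==> \<psi> x = 0"
 shows steklov_pairing_integrable: "integrable (lebesgue_on U) (\<lambda>x. steklov T h f (x, r)\<bullet>\<psi> x)"
  and steklov_pairing: "(LINT x|lebesgue_on U. steklov T h f (x, r)\<bullet>\<psi> x)
   = 1/h*(LINT \<tau>|lborel. indicator {r..r+h} \<tau>*(LINT x|lborel. g (x, \<tau>)\<bullet>\<psi> x))"
proof -
 have [measurable]: "g\<in>Borel" using g by auto
 have [measurable]: "\<psi>\<in>Borel" by (rule borel_measurable_continuous_onI[OF \<psi>(1)])
 have [measurable]: "fst\<in>(borel :: ('a\<times>real) measure) \<rightarrow>\<^sub>M borel" "snd\<in>(borel :: ('a\<times>real) measure) \<rightarrow>\<^sub>M borel"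
  by (auto simp: borel_prod[symmetric])
 define k where "k z = indicator {r..r+h} (snd z)*(g z\<bullet>\<psi> (fst z))" for z
 have km: "k\<in>Borel" unfolding k_def by measurable
 have B: "B\<ge>0" using \<psi>(2)[of undefined] norm_ge_zero[of "\<psi> undefined"] by linarith
 have k: "L1 k"
 proof (rule Bochner_Integration.integrable_bound[OF integrable_mult_right[OF integrable_norm[OF g], of B]])
  show "k\<in>borel_measurable lborel" using km by simp
  show "AE z in lborel. norm (k z)\<le>norm (B*norm (g z))"
  proof (rule AE_I2)
   fix z
   have "\<bar>g z\<bullet>\<psi> (fst z)\<bar>\<le>norm (g z)*norm (\<psi> (fst z))" by (rule Cauchy_Schwarz_ineq2)
   also have "\<dots>\<le>norm (g z)*B" using \<psi>(2) by (intro mult_left_mono) auto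
   finally show "norm (k z)\<le>norm (B*norm (g z))" using B by (auto simp: k_def indicator_def mult.commute)
  qed
 qed
 have k': "integrable (lborel \<Otimes>\<^sub>M lborel) (\<lambda>(x, \<tau>). k (x, \<tau>))" using k by (simp add: lborel_prod)
 have g': "integrable (lborel \<Otimes>\<^sub>M lborel) (\<lambda>(x, \<tau>). g (x, \<tau>))" using g by (simp add: lborel_prod)
 define K where "K x = 1/h*(LINT \<tau>|lborel. k (x, \<tau>))" for x
 have iK: "L1 K" unfolding K_def by (intro integrable_mult_right lborel_pair.integrable_fst[OF k'])
 have K0: "K x = 0" if "x \<notin> U" for x unfolding K_def k_def using \<psi>(3)[OF that] by simp
 have "AE z in lborel \<Otimes>\<^sub>M lborel. z\<in>U\<times>J --> g z = f z" using eq unfolding lborel_prod .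
 then have "AE x in lborel. AE \<tau> in lborel. (x, \<tau>)\<in>U\<times>J --> g (x, \<tau>) = f (x, \<tau>)" by (rule lborel_pair.AE_pair)
 moreover have "AE x in lborel. L1 (\<lambda>\<tau>. g (x, \<tau>))" by (rule lborel_pair.AE_integrable_fst[OF g'])
 ultimately have KE: "AE x in lborel. x\<in>U --> K x = steklov T h f (x, r)\<bullet>\<psi> x"
 proof eventually_elim
  case (elim x)
  show ?case
  proof
   assume x: "x\<in>U"
   have [measurable]: "(\<lambda>\<tau>. g (x, \<tau>))\<in>Borel" using elim(2) by auto
   have "(LINT \<tau>|lebesgue_on {r..r+h}. f (x, \<tau>)) = (LINT \<tau>|lborel. indicator {r..r+h} \<tau>*\<^sub>R g (x, \<tau>))"
   proof (rule integral_lebesgue_on_eq)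
    show "AE \<tau> in lborel. \<tau>\<in>{r..r+h} --> indicator {r..r+h} \<tau>*\<^sub>R g (x, \<tau>) = f (x, \<tau>)"
     using elim(1) by eventually_elim (use x r in auto)
   qed auto
   moreover have "L1 (\<lambda>\<tau>. indicator {r..r+h} \<tau>*\<^sub>R g (x, \<tau>))"
    by (rule integrable_mult_indicator[OF _ elim(2)]) simp
   then have "(LINT \<tau>|lborel. indicator {r..r+h} \<tau>*\<^sub>R g (x, \<tau>))\<bullet>\<psi> x = (LINT \<tau>|lborel. (indicator {r..r+h} \<tau>*\<^sub>R g (x, \<tau>))\<bullet>\<psi> x)"
    by (intro integral_inner_left[symmetric]) simp
   ultimately show "K x = steklov T h f (x, r)\<bullet>\<psi> x"
    using r(2) unfolding K_def k_def steklov_def by simp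
  qed
 qed
 show "integrable (lebesgue_on U) (\<lambda>x. steklov T h f (x, r)\<bullet>\<psi> x)"
  using integrable_lebesgue_on_eq[OF U _ K0 KE] iK by auto
 have "(LINT x|lebesgue_on U. steklov T h f (x, r)\<bullet>\<psi> x) = (LINT x|lborel. K x)"
  using integral_lebesgue_on_eq[OF U _ K0 KE] iK by auto
 also have "... = 1/h*(LINT x|lborel. LINT \<tau>|lborel. k (x, \<tau>))" unfolding K_def by simp
 also have "(LINT x|lborel. LINT \<tau>|lborel. k (x, \<tau>)) = (LINT z|lborel. k z)"
  using lborel_pair.integral_fst[OF k'] by (simp add: lborel_prod)
 also have "... = (LINT \<tau>|lborel. LINT x|lborel. k (x, \<tau>))" by (rule integral_slice_integral[OF k, symmetric])
 also have "... = (LINT \<tau>|lborel. indicator {r..r+h} \<tau>*(LINT x|lborel. g (x, \<tau>)\<bullet>\<psi> x))"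
  unfolding k_def by simp
 finally show "(LINT x|lebesgue_on U. steklov T h f (x, r)\<bullet>\<psi> x)
   = 1/h*(LINT \<tau>|lborel. indicator {r..r+h} \<tau>*(LINT x|lborel. g (x, \<tau>)\<bullet>\<psi> x))" .
qed

lemma bounded_test_function_in_L2:
 fixes \<phi> :: "real^'n => real"
 assumes \<phi>: "\<phi>\<in>test_functions U" and U: "U\<in>sets borel" "bounded U"
 shows "in_Lp 2 U \<phi>"
proof -
 note pr = test_function_properties[OF \<phi>]
 obtain B where B: "\<And>x. \<bar>\<phi> x\<bar>\<le>B" using pr(5) by blast
 have m: "\<phi>\<in>Borel" by (rule borel_measurable_continuous_onI[OF pr(1)])
 have i: "L1 (\<lambda>x. (\<phi> x)\<^sup>2)"
 proof (rule Bochner_Integration.integrable_bound)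
  have "L1 (\<lambda>x. indicator U x :: real)"
   using U emeasure_bounded_finite[OF U(2)] by (intro integrable_real_indicator) auto
  then show "L1 (\<lambda>x. B\<^sup>2*indicator U x)" by simp
  show "AE x in lborel. norm ((\<phi> x)\<^sup>2)\<le>norm (B\<^sup>2*indicator U x)"
  proof (rule AE_I2)
   fix x show "norm ((\<phi> x)\<^sup>2)\<le>norm (B\<^sup>2*indicator U x)"
    using pr(3)[of x] B[of x] power_mono[of "\<bar>\<phi> x\<bar>" B 2] by (cases "x\<in>U") auto
  qed
 qed (use m in simp)
 have "integrable (lebesgue_on U) (\<lambda>x. (\<phi> x)\<^sup>2)"
  using integrable_lebesgue_on_eq[OF U(1), of "\<lambda>x. (\<phi> x)\<^sup>2" "\<lambda>x. (\<phi> x)\<^sup>2"] m pr(3) i by simp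
 moreover have "\<phi>\<in>borel_measurable (lebesgue_on U)"
  using measurable_lebesgue_on_eq[OF U(1), of \<phi> \<phi>] m pr(3) by simp
 ultimately show ?thesis by (simp add: in_Lp_two)
qed

text \<open>Let \<open>f(t) = \<integral>u(x,t)\<phi>(x) dx\<close> and \<open>h = t - s\<close>. The pairing of the Steklov average with \<open>\<phi>\<close> is the mean of the continuous
function \<open>f\<close> over \<open>{r..r+h}\<close>, so its derivative at \<open>r = s\<close> is \<open>(f(t) - f(s))/h\<close>; the equation at time \<open>s\<close> identifies this
with the mean of the flux term over \<open>{s..t}\<close>. No limit \<open>h \<longrightarrow> 0\<close> is taken.\<close>

lemma weak_solution_evolution:
 fixes u :: "(real^'n)\<times>real => real" and A :: "(real^'n)\<times>real => real^'n => real^'n"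
 assumes sol: "weak_solution p \<Omega> T A u Du" and \<Omega>: "open \<Omega>" and U: "compactly_contained U \<Omega>"
  and \<phi>: "\<phi>\<in>test_functions U" and st: "-T < s" "s < t" "t < T"
  and u1: "L1 u1" "AE z in lborel. z\<in>U\<times>{-T<..<T} --> u1 z = u z"
  and B: "L1 B" "AE z in lborel. z\<in>U\<times>{s..t} --> B z = A z (Du z)"
 shows "(LINT x|lebesgue_on U. u (x, t)*\<phi> x)-(LINT x|lebesgue_on U. u (x, s)*\<phi> x)
  = - (LINT \<tau>|lborel. indicator {s..t} \<tau>*(LINT x|lborel. B (x, \<tau>)\<bullet>grad \<phi> x))"
proof -
 define h where "h = t-s"
 have h: "h > 0" "s+h = t" using st by (auto simp: h_def)
 have Uo: "open U" and UO: "U \<subseteq> \<Omega>" and Ub: "bounded U"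
  using U closure_subset[of U] compact_imp_bounded[of "closure U"] bounded_subset unfolding compactly_contained_def by blast+
 have Um: "U\<in>sets borel" using Uo by simp
 note pr = test_function_properties[OF \<phi>]
 obtain M where M: "\<And>x. \<bar>\<phi> x\<bar>\<le>M" "\<And>x. norm (grad \<phi> x)\<le>M" using pr(5) by blast
 have \<phi>2: "in_Lp 2 U \<phi>" by (rule bounded_test_function_in_L2[OF \<phi> Um Ub])
 have C: "C0_L2_loc \<Omega> T u" using sol by (simp add: weak_solution_def)
 obtain w where w: "has_L2_loc_time_derivative \<Omega> (steklov T h u) w s"
  "\<And>\<phi>. \<phi>\<in>test_functions \<Omega> ==> (LINT x|lebesgue_on \<Omega>. w x*\<phi> x+inner (steklov T h (\<lambda>z. A z (Du z)) (x, s)) (grad \<phi> x)) = 0"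
 proof -
  have "h\<in>{0<..<2*T}" "s\<in>{-T<..<T-h}" using st by (auto simp: h_def)
  then show thesis using sol that unfolding weak_solution_def by blast
 qed
 define f where "f \<tau> = (LINT x|lebesgue_on U. u (x, \<tau>)*\<phi> x)" for \<tau>
 have fc: "isCont f \<tau>" if "\<tau>\<in>{-T<..<T}" for \<tau>
  unfolding f_def by (rule pairing_continuous[OF C U \<phi>2 that])
 \<comment> \<open>Freezing \<open>f\<close> outside a compact interval around \<open>{s..t}\<close> makes an antiderivative available.\<close>
 define c where "c = (s-T)/2"
 define d where "d = (t+T)/2"
 have cd: "-T < c" "c < s" "t < d" "d < T" using st by (auto simp: c_def d_def)
 define f' where "f' \<tau> = f (max c (min d \<tau>))" for \<tau>
 have f'f: "f' \<tau> = f \<tau>" if "c\<le>\<tau>" "\<tau>\<le>d" for \<tau> using that by (simp add: f'_def)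
 have f'c: "continuous_on UNIV f'"
  unfolding f'_def
 proof (rule continuous_on_compose2[of "{c..d}" f])
  show "continuous_on {c..d} f"
   by (intro continuous_at_imp_continuous_on ballI fc) (use cd in auto)
  show "continuous_on UNIV (\<lambda>\<tau>. max c (min d \<tau>))" by (intro continuous_intros)
  show "(\<lambda>\<tau>. max c (min d \<tau>)) ` UNIV \<subseteq> {c..d}" using cd st by auto
 qed
 obtain P where P: "\<And>\<tau>. (P has_real_derivative f' \<tau>) (at \<tau>)" using antiderivative_exists[OF f'c] by blast
 define F where "F r = 1/h*(P (r+h)-P r)" for r
 have slices: "AE \<tau> in lborel. \<tau>\<in>{-T<..<T} --> (LINT x|lborel. u1 (x, \<tau>)\<bullet>\<phi> x) = f \<tau>"
  using AE_lborel_slice[OF u1(2)]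
 proof eventually_elim
  case (elim \<tau>)
  show ?case
  proof
   assume \<tau>: "\<tau>\<in>{-T<..<T}"
   have [measurable]: "u1\<in>Borel" using u1(1) by auto
   have [measurable]: "\<phi>\<in>Borel" by (rule borel_measurable_continuous_onI[OF pr(1)])
   have "(\<lambda>x. u1 (x, \<tau>))\<in>Borel"
    by (rule measurable_compose[OF _ \<open>u1 \<in> borel_measurable borel\<close>]) (simp add: borel_prod[symmetric])
   then have m: "(\<lambda>x. u1 (x, \<tau>)\<bullet>\<phi> x)\<in>Borel" by measurable
   show "(LINT x|lborel. u1 (x, \<tau>)\<bullet>\<phi> x) = f \<tau>"
    unfolding f_def
   proof (rule integral_lebesgue_on_eq[OF Um m, symmetric])
    show "u1 (x, \<tau>)\<bullet>\<phi> x = 0" if "x \<notin> U" for x using pr(3)[OF that] by simp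
    show "AE x in lborel. x\<in>U --> u1 (x, \<tau>)\<bullet>\<phi> x = u (x, \<tau>)*\<phi> x"
     using elim by eventually_elim (use \<tau> in auto)
   qed
  qed
 qed
 have F_eq: "(LINT x|lebesgue_on U. steklov T h u (x, r)*\<phi> x) = F r" if r: "c < r" "r+h < d" for r
 proof -
  have "(LINT x|lebesgue_on U. steklov T h u (x, r)\<bullet>\<phi> x)
   = 1/h*(LINT \<tau>|lborel. indicator {r..r+h} \<tau>*(LINT x|lborel. u1 (x, \<tau>)\<bullet>\<phi> x))"
   by (rule steklov_pairing[OF u1 _ _ h(1) Um pr(1), of r T M]) (use r cd M(1) pr(3) in auto)
  also have "(LINT \<tau>|lborel. indicator {r..r+h} \<tau>*(LINT x|lborel. u1 (x, \<tau>)\<bullet>\<phi> x)) = (LINT \<tau>|lborel. f' \<tau>*indicator {r..r+h} \<tau>)"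
  proof (rule integral_cong_AE)
   have [measurable]: "f'\<in>Borel" by (rule borel_measurable_continuous_onI[OF f'c])
   show "(\<lambda>\<tau>. f' \<tau>*indicator {r..r+h} \<tau>)\<in>borel_measurable lborel" by measurable
   show "AE \<tau> in lborel. indicator {r..r+h} \<tau>*(LINT x|lborel. u1 (x, \<tau>)\<bullet>\<phi> x) = f' \<tau>*indicator {r..r+h} \<tau>"
    using slices
   proof eventually_elim
    case (elim \<tau>)
    show ?case
    proof (cases "\<tau>\<in>{r..r+h}")
     case True
     then have "\<tau>\<in>{-T<..<T}" "f' \<tau> = f \<tau>" using r cd by (auto intro!: f'f)
     then show ?thesis using elim by simp
    qed simp
   qed
   have "(\<lambda>z. u1 z\<bullet>\<phi> (fst z))\<in>Borel"
   proof -
    have [measurable]: "u1\<in>Borel" using u1(1) by auto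
    have [measurable]: "\<phi>\<in>Borel" by (rule borel_measurable_continuous_onI[OF pr(1)])
    have [measurable]: "fst\<in>(borel :: ((real^'n)\<times>real) measure) \<rightarrow>\<^sub>M borel" by (simp add: borel_prod[symmetric])
    show ?thesis by measurable
   qed
   moreover have "(\<lambda>z::real\<times>(real^'n). (snd z, fst z))\<in>borel \<rightarrow>\<^sub>M borel"
    by (intro borel_measurable_continuous_onI continuous_intros)
   ultimately have "(\<lambda>z::real\<times>(real^'n). u1 (snd z, fst z)\<bullet>\<phi> (fst (snd z, fst z)))\<in>Borel"
    by (rule measurable_compose[rotated])
   then have "(\<lambda>(\<tau>, x). u1 (x, \<tau>)\<bullet>\<phi> x)\<in>borel_measurable (lborel \<Otimes>\<^sub>M lborel)"
    unfolding lborel_prod by (simp add: split_beta)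
   then have "(\<lambda>\<tau>. LINT x|lborel. u1 (x, \<tau>)\<bullet>\<phi> x)\<in>borel_measurable lborel"
    by (rule lborel.borel_measurable_lebesgue_integral)
   then show "(\<lambda>\<tau>. indicator {r..r+h} \<tau>*(LINT x|lborel. u1 (x, \<tau>)\<bullet>\<phi> x))\<in>borel_measurable lborel" by measurable
  qed
  also have "... = P (r+h)-P r"
   by (rule integral_FTC_Icc_real) (use h P f'c in \<open>auto simp: continuous_on_eq_continuous_at\<close>)
  finally show ?thesis by (simp add: F_def)
 qed
 have wf': "(LINT x|lebesgue_on U. w x*\<phi> x) = 1/h*(f' (s+h)-f' s)"
 proof (rule L2_derivative_pairing[OF w(1) U \<phi>2])
  have "\<forall>\<^sub>F r in nhds s. r\<in>{c<..<d-h}" by (rule eventually_nhds_in_open) (use cd h in auto)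
  then show "\<forall>\<^sub>F r in nhds s. (LINT x|lebesgue_on U. steklov T h u (x, r)*\<phi> x) = F r"
   by eventually_elim (auto intro!: F_eq)
  have "((\<lambda>r. P (r+h)) has_real_derivative f' (s+h)) (at s)" using P[of "s+h"] by (simp add: DERIV_shift)
  then show "(F has_real_derivative 1/h*(f' (s+h)-f' s)) (at s)"
   unfolding F_def by (intro DERIV_cmult DERIV_diff P)
 qed
 have "f' (s+h) = f t" "f' s = f s" using cd h st by (auto intro!: f'f)
 then have wf: "(LINT x|lebesgue_on U. w x*\<phi> x) = 1/h*(f t-f s)" using wf' by (simp only:)
 have st': "{s..s+h} \<subseteq> {s..t}" "s\<in>{-T<..<T-h}" using st h by (auto simp: h_def)
 have Ai: "integrable (lebesgue_on U) (\<lambda>x. steklov T h (\<lambda>z. A z (Du z)) (x, s)\<bullet>grad \<phi> x)"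
  and Ae: "(LINT x|lebesgue_on U. steklov T h (\<lambda>z. A z (Du z)) (x, s)\<bullet>grad \<phi> x)
   = 1/h*(LINT \<tau>|lborel. indicator {s..s+h} \<tau>*(LINT x|lborel. B (x, \<tau>)\<bullet>grad \<phi> x))"
  using steklov_pairing_integrable[OF B st' h(1) Um pr(2) M(2) pr(4)] steklov_pairing[OF B st' h(1) Um pr(2) M(2) pr(4)] by auto
 have w2: "in_Lp 2 U w" using w(1) U unfolding has_L2_loc_time_derivative_def by blast
 have wi: "integrable (lebesgue_on U) (\<lambda>x. w x*\<phi> x)"
  using integral_product_bound(1)[of w "lebesgue_on U" \<phi>] w2 \<phi>2 by (simp add: in_Lp_two)
 let ?G = "\<lambda>x. w x*\<phi> x + steklov T h (\<lambda>z. A z (Du z)) (x, s)\<bullet>grad \<phi> x"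
 have "(LINT x|lebesgue_on U. ?G x) = (LINT x|lebesgue. indicator U x*\<^sub>R ?G x)"
  using Um by (intro integral_restrict_space) simp
 also have "(\<lambda>x. indicator U x*\<^sub>R ?G x) = (\<lambda>x. indicator \<Omega> x*\<^sub>R ?G x)"
 proof
  fix x show "indicator U x*\<^sub>R ?G x = indicator \<Omega> x*\<^sub>R ?G x"
   using UO pr(3)[of x] pr(4)[of x] by (cases "x\<in>U") auto
 qed
 also have "(LINT x|lebesgue. indicator \<Omega> x*\<^sub>R ?G x) = (LINT x|lebesgue_on \<Omega>. ?G x)"
  using \<Omega> by (intro integral_restrict_space[symmetric]) auto
 also have "... = 0" by (rule w(2)[OF pr(6)[OF UO]])
 finally have "(LINT x|lebesgue_on U. w x*\<phi> x)+(LINT x|lebesgue_on U. steklov T h (\<lambda>z. A z (Du z)) (x, s)\<bullet>grad \<phi> x) = 0"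
  using wi Ai by simp
 then have "1/h*((f t-f s)+(LINT \<tau>|lborel. indicator {s..t} \<tau>*(LINT x|lborel. B (x, \<tau>)\<bullet>grad \<phi> x))) = 0"
  unfolding wf Ae h(2) by (simp only: distrib_left)
 then have "(f t-f s)+(LINT \<tau>|lborel. indicator {s..t} \<tau>*(LINT x|lborel. B (x, \<tau>)\<bullet>grad \<phi> x)) = 0"
  using h(1) by simp
 then show ?thesis unfolding f_def by linarith
qed

text \<open>Borel representatives on \<open>ball 0 R0\<close>. The times in \<open>T0\<close> are those at which the representative agrees with the
continuous curve; square integrability in space-time follows from continuity in time on the compact interval.\<close>

lemma weak_solution_local_solution:
 fixes u :: "(real^'n)\<times>real => real" and A :: "(real^'n)\<times>real => real^'n => real^'n"
 assumes sol: "weak_solution p \<Omega> T A u Du" and str: "structure_conditions p \<Lambda>0 \<Lambda>1 \<Omega> T A Du" and \<Omega>: "open \<Omega>"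
  and p: "p > 1" and \<Lambda>: "0 < \<Lambda>0" "0 < \<Lambda>1" and R0: "R0 > 0" "cball 0 R0 \<subseteq> \<Omega>" and \<theta>: "0 < \<theta>" "\<theta> < T"
 obtains v D B T0 where "local_solution p (p/(p-1)) \<Lambda>0 \<Lambda>1 R0 \<theta> v D B T0"
  "AE z in lborel. z\<in>ball 0 R0\<times>{-\<theta>..\<theta>} --> v z = u z"
  "u\<in>borel_measurable (lebesgue_on (ball 0 R0\<times>{-T<..<T}))"
proof -
 define q where "q = p/(p-1)"
 have q: "q > 1" "(p-1)*q = p" using p by (auto simp: q_def field_simps)
 define U where "U = ball (0::real^'n) R0"
 define I where "I = {-T<..<T}"
 define J where "J = {-\<theta>..\<theta>}"
 have U: "compactly_contained U \<Omega>"
  unfolding compactly_contained_def U_def using R0 by simp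
 have Um: "U\<in>sets borel" and UO: "U \<subseteq> \<Omega>" using R0 by (auto simp: U_def)
 have JI: "J \<subseteq> I" using \<theta> by (auto simp: I_def J_def)
 have UI: "U\<times>I\<in>sets borel" "U\<times>J\<in>sets borel" by (auto simp: borel_prod[symmetric] U_def I_def J_def)
 have UIL: "U\<times>I\<in>sets lebesgue" using UI by simp
 have OI: "open (\<Omega>\<times>I)" unfolding I_def by (intro open_Times \<Omega>) simp
 then have OIL: "\<Omega>\<times>I\<in>sets lebesgue" by auto
 have sub: "U\<times>J \<subseteq> U\<times>I" "U\<times>J \<subseteq> \<Omega>\<times>I" using JI UO by auto
 have iUI: "L1 (\<lambda>z. indicator (U\<times>I) z :: real)" "L1 (\<lambda>z. indicator (U\<times>J) z :: real)"
  using UI emeasure_bounded_finite[of "U\<times>I"] emeasure_bounded_finite[of "U\<times>J"]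
  by (auto intro!: integrable_real_indicator simp: U_def I_def J_def bounded_Times)
 have fin: "L1 g" if g: "g\<in>Borel" "L1 (\<lambda>z. norm (g z) powr r)" "r\<ge>1"
  "\<And>z. z \<notin> S ==> g z = 0" "L1 (\<lambda>z. indicator S z :: real)" for g :: "(real^'n)\<times>real => 'b::euclidean_space" and r S
 proof (rule Bochner_Integration.integrable_bound[OF Bochner_Integration.integrable_add[OF g(5) g(2)]])
  show "AE z in lborel. norm (g z)\<le>norm (indicator S z+norm (g z) powr r)"
  proof (rule AE_I2)
   fix z show "norm (g z)\<le>norm (indicator S z+norm (g z) powr r)"
    using le_one_plus_powr[OF norm_ge_zero[of "g z"] g(3)] g(4)[of z] by (cases "z\<in>S") auto
  qed
 qed (use g(1) in simp)
 have LW: "Lp_W1p_loc p \<Omega> T u Du" and C0: "C0_L2_loc \<Omega> T u" using sol by (auto simp: weak_solution_def)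
 have inL: "in_Lp p (U\<times>I) u" "in_Lp p (U\<times>I) Du" "AE t in lebesgue_on I. W1p p U (\<lambda>x. u (x, t)) (\<lambda>x. Du (x, t))"
  using LW U unfolding Lp_W1p_loc_def I_def by blast+
 obtain u1 where u1: "u1\<in>Borel" "\<And>z. z \<notin> U\<times>I ==> u1 z = 0" "AE z in lborel. z\<in>U\<times>I --> u1 z = u z"
  using borel_representative[OF _ UIL UI(1) order_refl, of u] inL(1) unfolding in_Lp_def by blast
 obtain D where D: "D\<in>Borel" "\<And>z. z \<notin> U\<times>J ==> D z = 0" "AE z in lborel. z\<in>U\<times>J --> D z = Du z"
  using borel_representative[OF _ UIL UI(2) sub(1), of Du] inL(2) unfolding in_Lp_def by blast
 have str': "(\<lambda>z. A z (Du z))\<in>borel_measurable (lebesgue_on (\<Omega>\<times>I))"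
  "AE z in lborel. z\<in>\<Omega>\<times>I --> A z (Du z)\<bullet>Du z\<ge>\<Lambda>0*norm (Du z) powr p \<and> norm (A z (Du z))\<le>\<Lambda>1*norm (Du z) powr (p-1)"
 proof -
  show "(\<lambda>z. A z (Du z))\<in>borel_measurable (lebesgue_on (\<Omega>\<times>I))" using str unfolding structure_conditions_def I_def by blast
  have "AE z in lebesgue_on (\<Omega>\<times>I). A z (Du z)\<bullet>Du z\<ge>\<Lambda>0*norm (Du z) powr p \<and> norm (A z (Du z))\<le>\<Lambda>1*norm (Du z) powr (p-1)"
   using str unfolding structure_conditions_def I_def by blast
  then show "AE z in lborel. z\<in>\<Omega>\<times>I --> A z (Du z)\<bullet>Du z\<ge>\<Lambda>0*norm (Du z) powr p \<and> norm (A z (Du z))\<le>\<Lambda>1*norm (Du z) powr (p-1)"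
   by (subst (asm) AE_restrict_space_iff) (use OIL in \<open>auto simp: AE_completion_iff\<close>)
 qed
 obtain B where B: "B\<in>Borel" "\<And>z. z \<notin> U\<times>J ==> B z = 0" "AE z in lborel. z\<in>U\<times>J --> B z = A z (Du z)"
  using borel_representative[OF str'(1) OIL UI(2) sub(2)] by blast
 define v where "v z = indicator (U\<times>J) z*u1 z" for z
 have v: "v\<in>Borel" "\<And>z. z \<notin> U\<times>J ==> v z = 0" "AE z in lborel. z\<in>U\<times>J --> v z = u z"
 proof -
  show "v\<in>Borel" unfolding v_def using u1(1) UI(2) by measurable
  show "AE z in lborel. z\<in>U\<times>J --> v z = u z" using u1(3) by eventually_elim (use sub(1) in \<open>auto simp: v_def\<close>)
 qed (simp add: v_def)
 have u1p: "L1 (\<lambda>z. norm (u1 z) powr p)"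
  by (rule integrable_representative[OF _ UIL UI(1) order_refl u1]) (use inL(1) in \<open>simp add: in_Lp_def\<close>)
 have vp: "L1 (\<lambda>z. norm (v z) powr p)"
  by (rule integrable_representative[OF _ UIL UI(2) sub(1) v]) (use inL(1) in \<open>simp add: in_Lp_def\<close>)
 have Dp: "L1 (\<lambda>z. norm (D z) powr p)"
  by (rule integrable_representative[OF _ UIL UI(2) sub(1) D]) (use inL(2) in \<open>simp add: in_Lp_def\<close>)
 have u1i: "L1 u1" using fin[OF u1(1) u1p _ u1(2) iUI(1)] p by simp
 have str2: "AE z in lborel. B z\<bullet>D z\<ge>\<Lambda>0*norm (D z) powr p \<and> norm (B z)\<le>\<Lambda>1*norm (D z) powr (p-1)"
  using str'(2) B(3) D(3)
 proof eventually_elim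
  case (elim z)
  show ?case
  proof (cases "z\<in>U\<times>J")
   case True
   then have "z\<in>\<Omega>\<times>I" using sub(2) by blast
   then show ?thesis using elim True by simp
  next
   case False then show ?thesis using B(2) D(2) by simp
  qed
 qed
 have Bq: "L1 (\<lambda>z. norm (B z) powr q)"
 proof (rule Bochner_Integration.integrable_bound)
  show "L1 (\<lambda>z. \<Lambda>1 powr q*norm (D z) powr p)" using Dp by simp
  have [measurable]: "B\<in>Borel" by (rule B(1))
  show "(\<lambda>z. norm (B z) powr q)\<in>borel_measurable lborel" by measurable
  show "AE z in lborel. norm (norm (B z) powr q)\<le>norm (\<Lambda>1 powr q*norm (D z) powr p)"
   using str2
  proof eventually_elim
   case (elim z)
   have "norm (B z) powr q\<le>(\<Lambda>1*norm (D z) powr (p-1)) powr q" using elim q by (intro powr_mono2) auto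
   also have "... = \<Lambda>1 powr q*(norm (D z) powr (p-1)) powr q" by (rule powr_mult; use \<Lambda> in simp)
   also have "(norm (D z) powr (p-1)) powr q = norm (D z) powr p" unfolding powr_powr q(2) ..
   finally show ?case by simp
  qed
 qed
 have Bi: "L1 B" using fin[OF B(1) Bq _ B(2) iUI(2)] q by simp
 define T0 where "T0 = {t\<in>J. AE x in lborel. x\<in>U --> v (x, t) = u (x, t)}"
 have T0: "AE t in lborel. t\<in>{-\<theta>..\<theta>} --> t\<in>T0"
  using AE_lborel_slice[OF v(3)]
 proof eventually_elim
  case (elim t)
  show ?case
  proof
   assume "t\<in>{-\<theta>..\<theta>}"
   then have t: "t\<in>J" by (simp add: J_def)
   have "AE x in lborel. x\<in>U --> v (x, t) = u (x, t)" using elim by eventually_elim (use t in auto)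
   then show "t\<in>T0" using t by (simp add: T0_def)
  qed
 qed
 have slice: "(\<lambda>x. f (x, t))\<in>Borel" if "f\<in>Borel" for f :: "(real^'n)\<times>real => 'b::euclidean_space" and t
  by (rule measurable_compose[OF _ that]) (simp add: borel_prod[symmetric])
 have u2: "L1 (\<lambda>z. (v z)\<^sup>2)"
 proof -
  have "\<exists>C. \<forall>t\<in>{-\<theta>..\<theta>}. (LINT x|lebesgue_on U. (u (x, t))\<^sup>2)\<le>C"
   by (rule square_integrals_bounded[OF C0 U]) (use \<theta> in auto)
  then obtain C where C: "\<And>t. t\<in>{-\<theta>..\<theta>} ==> (LINT x|lebesgue_on U. (u (x, t))\<^sup>2)\<le>C" by blast
  have [measurable]: "v\<in>Borel" by (rule v(1))
  have sl: "AE t in lborel. (\<integral>\<^sup>+x. ennreal ((v (x, t))\<^sup>2) \<partial>lborel)\<le>ennreal (indicator {-\<theta>..\<theta>} t*C)"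
   using T0
  proof eventually_elim
   case (elim t)
   show ?case
   proof (cases "t\<in>{-\<theta>..\<theta>}")
    case False
    then have "v (x, t) = 0" for x using v(2)[of "(x, t)"] by (auto simp: J_def)
    then show ?thesis by simp
   next
    case True
    then have t: "AE x in lborel. x\<in>U --> (v (x, t))\<^sup>2 = (u (x, t))\<^sup>2" "t\<in>{-T<..<T}"
     using elim \<theta> by (auto simp: T0_def elim: eventually_mono)
    have m: "(\<lambda>x. (v (x, t))\<^sup>2)\<in>Borel" using slice[OF v(1), of t] by measurable
    have z: "(v (x, t))\<^sup>2 = 0" if "x \<notin> U" for x using v(2)[of "(x, t)"] that by auto
    have "in_Lp 2 U (\<lambda>x. u (x, t))" using C0 U t(2) unfolding C0_L2_loc_def by blast
    then have "L1 (\<lambda>x. (v (x, t))\<^sup>2)"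
     using integrable_lebesgue_on_eq[OF Um m z t(1)] by (simp add: in_Lp_two)
    then have "(\<integral>\<^sup>+x. ennreal ((v (x, t))\<^sup>2) \<partial>lborel) = ennreal (LINT x|lborel. (v (x, t))\<^sup>2)"
     by (rule nn_integral_eq_integral) simp
    also have "\<dots>\<le>ennreal (indicator {-\<theta>..\<theta>} t*C)"
     using C[OF True] True integral_lebesgue_on_eq[OF Um m z t(1)] by (intro ennreal_leI) simp
    finally show ?thesis .
   qed
  qed
  have "(\<integral>\<^sup>+z. ennreal ((v z)\<^sup>2) \<partial>lborel) = (\<integral>\<^sup>+t. \<integral>\<^sup>+x. ennreal ((v (x, t))\<^sup>2) \<partial>lborel \<partial>lborel)"
   by (rule nn_integral_slices[symmetric]) measurable
  also have "\<dots>\<le>(\<integral>\<^sup>+t. ennreal (indicator {-\<theta>..\<theta>} t*C) \<partial>lborel)" by (rule nn_integral_mono_AE[OF sl])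
  also have "\<dots>\<le>(\<integral>\<^sup>+t. ennreal \<bar>C\<bar>*indicator {-\<theta>..\<theta>} t \<partial>lborel)"
   by (intro nn_integral_mono) (auto simp: indicator_def intro!: ennreal_leI)
  also have "... < \<infinity>" using \<theta> by (subst nn_integral_cmult_indicator) (auto simp: ennreal_mult_less_top)
  finally have "(\<integral>\<^sup>+z. ennreal (norm ((v z)\<^sup>2)) \<partial>lborel) < \<infinity>" by simp
  then show ?thesis by (intro integrableI_bounded) auto
 qed
 have wg: "AE t in lborel. \<forall>\<phi>\<in>test_functions (ball 0 R0).
    (LINT x|lborel. v (x, t)*\<^sub>R grad \<phi> x) = - (LINT x|lborel. \<phi> x*\<^sub>R D (x, t))"
 proof -
  have IL: "I \<inter> space lebesgue\<in>sets lebesgue" by (simp add: I_def)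
  have "AE t in lborel. t\<in>I --> W1p p U (\<lambda>x. u (x, t)) (\<lambda>x. Du (x, t))"
   using inL(3) unfolding AE_restrict_space_iff[OF IL] AE_completion_iff .
  then show ?thesis using T0 AE_lborel_slice[OF D(3)]
  proof eventually_elim
   case (elim t)
   show ?case
   proof (cases "t\<in>J")
    case False
    then have "v (x, t) = 0" "D (x, t) = 0" for x using v(2)[of "(x, t)"] D(2)[of "(x, t)"] by auto
    then show ?thesis by simp
   next
    case True
    have wk: "weak_gradient U (\<lambda>x. u (x, t)) (\<lambda>x. Du (x, t))" using elim(1) True JI by (auto simp: W1p_def)
    have vt: "AE x in lborel. x\<in>U --> v (x, t) = u (x, t)" using elim(2) True by (simp add: T0_def J_def)
    have Dt: "AE x in lborel. x\<in>U --> D (x, t) = Du (x, t)" using elim(3) by eventually_elim (use True in auto)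
    show ?thesis
    proof
     fix \<phi> :: "real^'n => real" assume "\<phi>\<in>test_functions (ball 0 R0)"
     then have \<phi>: "\<phi>\<in>test_functions U" by (simp add: U_def)
     note pr = test_function_properties[OF \<phi>]
     have [measurable]: "\<phi>\<in>Borel" by (rule borel_measurable_continuous_onI[OF pr(1)])
     have [measurable]: "grad \<phi>\<in>Borel" by (rule borel_measurable_continuous_onI[OF pr(2)])
     have [measurable]: "(\<lambda>x. v (x, t))\<in>Borel" "(\<lambda>x. D (x, t))\<in>Borel"
      by (rule slice[OF v(1)], rule slice[OF D(1)])
     have "(LINT x|lebesgue_on U. u (x, t)*\<^sub>R grad \<phi> x) = (LINT x|lborel. v (x, t)*\<^sub>R grad \<phi> x)"
     proof (rule integral_lebesgue_on_eq[OF Um])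
      show "AE x in lborel. x\<in>U --> v (x, t)*\<^sub>R grad \<phi> x = u (x, t)*\<^sub>R grad \<phi> x"
       using vt by eventually_elim simp
      show "v (x, t)*\<^sub>R grad \<phi> x = 0" if "x \<notin> U" for x using pr(4)[OF that] by simp
     qed measurable
     moreover have "(LINT x|lebesgue_on U. \<phi> x*\<^sub>R Du (x, t)) = (LINT x|lborel. \<phi> x*\<^sub>R D (x, t))"
     proof (rule integral_lebesgue_on_eq[OF Um])
      show "AE x in lborel. x\<in>U --> \<phi> x*\<^sub>R D (x, t) = \<phi> x*\<^sub>R Du (x, t)"
       using Dt by eventually_elim simp
      show "\<phi> x*\<^sub>R D (x, t) = 0" if "x \<notin> U" for x using pr(3)[OF that] by simp
     qed measurable
     ultimately show "(LINT x|lborel. v (x, t)*\<^sub>R grad \<phi> x) = - (LINT x|lborel. \<phi> x*\<^sub>R D (x, t))"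
      using wk \<phi> unfolding weak_gradient_def by simp
    qed
   qed
  qed
 qed
 have "local_solution p q \<Lambda>0 \<Lambda>1 R0 \<theta> v D B T0"
 proof
  show "q = p/(p-1)" by (simp add: q_def)
  show "v z = 0 \<and> D z = 0 \<and> B z = 0" if "z \<notin> ball 0 R0\<times>{-\<theta>..\<theta>}" for z
   using that v(2) D(2) B(2) by (simp add: U_def J_def)
  show "T0 \<subseteq> {-\<theta>..\<theta>}" by (auto simp: T0_def J_def)
  fix \<phi> :: "real^'n => real" and s t
  assume \<phi>': "\<phi>\<in>test_functions (ball 0 R0)" and sT: "s\<in>T0" and tT: "t\<in>T0" and st: "s\<le>t"
  have \<phi>: "\<phi>\<in>test_functions U" using \<phi>' by (simp add: U_def)
  note pr = test_function_properties[OF \<phi>]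
  have at: "(LINT x|lborel. v (x, r)*\<phi> x) = (LINT x|lebesgue_on U. u (x, r)*\<phi> x)" if r: "r\<in>T0" for r
  proof (rule integral_lebesgue_on_eq[OF Um, symmetric])
   have [measurable]: "\<phi>\<in>Borel" by (rule borel_measurable_continuous_onI[OF pr(1)])
   have [measurable]: "(\<lambda>x. v (x, r))\<in>Borel" by (rule slice[OF v(1)])
   show "(\<lambda>x. v (x, r)*\<phi> x)\<in>Borel" by measurable
   have "AE x in lborel. x\<in>U --> v (x, r) = u (x, r)" using r by (simp add: T0_def)
   then show "AE x in lborel. x\<in>U --> v (x, r)*\<phi> x = u (x, r)*\<phi> x" by eventually_elim simp
   show "v (x, r)*\<phi> x = 0" if "x \<notin> U" for x using pr(3)[OF that] by simp
  qed
  show "(LINT x|lborel. v (x, t)*\<phi> x)-(LINT x|lborel. v (x, s)*\<phi> x)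
    = - (LINT \<tau>|lborel. indicator {s..t} \<tau>*(LINT x|lborel. B (x, \<tau>)\<bullet>grad \<phi> x))"
  proof (cases "s = t")
   case True
   have "AE \<tau> in lborel. \<tau>\<noteq>t" by (rule AE_lborel_singleton)
   then have "AE \<tau> in lborel. indicator {s..t} \<tau>*(LINT x|lborel. B (x, \<tau>)\<bullet>grad \<phi> x) = 0"
    by eventually_elim (use True in auto)
   then have "(LINT \<tau>|lborel. indicator {s..t} \<tau>*(LINT x|lborel. B (x, \<tau>)\<bullet>grad \<phi> x)) = 0"
    by (rule integral_eq_zero_AE)
   then show ?thesis using True by simp
  next
   case False
   have sJ: "s\<in>J" "t\<in>J" using sT tT by (auto simp: T0_def)
   have uI: "AE z in lborel. z\<in>U\<times>{-T<..<T} --> u1 z = u z" using u1(3) by (simp add: I_def)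
   have BI: "AE z in lborel. z\<in>U\<times>{s..t} --> B z = A z (Du z)"
    using B(3) by eventually_elim (use sJ in \<open>auto simp: J_def\<close>)
   have "-T < s" "s < t" "t < T" using False st sJ \<theta> by (auto simp: J_def)
   from weak_solution_evolution[OF sol \<Omega> U \<phi> this u1i uI Bi BI] show ?thesis unfolding at[OF sT] at[OF tT] .
  qed
 qed (use p \<Lambda> R0 \<theta> v D B vp Dp Bq u2 wg str2 T0 in auto)
 then show thesis using that v(3) inL(1) unfolding q_def U_def J_def I_def in_Lp_def by blast
qed

section \<open>The supremum bound\<close>

text \<open>The factor \<open>\<rho>\<^sup>N\<theta>\<close> is the volume of the cylinder up to a constant; with it the two terms on the left become exactly the
two terms of the intrinsic geometry factor.\<close>

lemma parabolic_scaling: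
 fixes N p \<rho> \<theta> :: real
 assumes N: "N > 0" and p: "p > 1" and pos: "\<rho> > 0" "\<theta> > 0"
 shows "(1/\<theta>+1/\<rho> powr p) powr (1+N/p)*(\<rho> powr N*\<theta>)
  \<le>2 powr (1+N/p)*(\<theta>/\<rho> powr p+(\<rho> powr p/\<theta>) powr (N/p))"
proof -
 let ?s = "1+N/p"
 have "(1/\<theta>+1/\<rho> powr p) powr ?s\<le>2 powr ?s*((1/\<theta>) powr ?s+(1/\<rho> powr p) powr ?s)"
  by (rule powr_sum_le) (use N p pos in auto)
 then have "(1/\<theta>+1/\<rho> powr p) powr ?s*(\<rho> powr N*\<theta>)
   \<le>2 powr ?s*((1/\<theta>) powr ?s+(1/\<rho> powr p) powr ?s)*(\<rho> powr N*\<theta>)"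
  using pos by (intro mult_right_mono) auto
 also have "... = 2 powr ?s*((1/\<rho> powr p) powr ?s*(\<rho> powr N*\<theta>)+(1/\<theta>) powr ?s*(\<rho> powr N*\<theta>))"
  by (simp add: algebra_simps)
 also have "(1/\<rho> powr p) powr ?s*(\<rho> powr N*\<theta>) = \<theta>/\<rho> powr p"
 proof -
  have "(1/\<rho> powr p) powr ?s = (\<rho> powr (- p)) powr ?s" by (simp add: powr_minus_divide)
  also have "... = \<rho> powr (- p-N)" unfolding powr_powr using p by (simp add: distrib_left)
  finally have "(1/\<rho> powr p) powr ?s*(\<rho> powr N*\<theta>) = (\<rho> powr (- p-N)*\<rho> powr N)*\<theta>" by simp
  also have "\<rho> powr (- p-N)*\<rho> powr N = \<rho> powr (- p)" by (simp add: powr_add[symmetric])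
  finally show ?thesis by (simp add: powr_minus_divide)
 qed
 also have "(1/\<theta>) powr ?s*(\<rho> powr N*\<theta>) = (\<rho> powr p/\<theta>) powr (N/p)"
 proof -
  have "(1/\<theta>) powr ?s = (1/\<theta>) powr 1*(1/\<theta>) powr (N/p)" by (rule powr_add)
  then have 1: "(1/\<theta>) powr ?s = (1/\<theta>)*(1/\<theta>) powr (N/p)" using pos by simp
  have "(\<rho> powr p/\<theta>) powr (N/p) = (\<rho> powr p*(1/\<theta>)) powr (N/p)" by simp
  also have "... = (\<rho> powr p) powr (N/p)*(1/\<theta>) powr (N/p)" by (rule powr_mult; use pos in simp)
  also have "(\<rho> powr p) powr (N/p) = \<rho> powr N" unfolding powr_powr using p by simp
  finally show ?thesis unfolding 1 using pos by simp
 qed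
 finally show ?thesis .
qed

text \<open>For \<open>p < 2\<close> the difference of the cross products is \<open>(p(N+1) - 2N)(p+N)/N\<close>, nonnegative by the
lower bound on \<open>p\<close>.\<close>

lemma exponent_comparison:
 fixes N p m e :: real
 assumes N: "N\<ge>1" and p: "2*N/(N+1) < p" and m: "m = max p 2"
 defines "e \<equiv> p*(N+1)/(2*N*(p-1))" and "\<delta> \<equiv> 2*p/N-(m-p)*(1+p/N)"
 shows "p > 1" "\<delta> > 0" "0 < (p/N)/\<delta>" "(p/N)/\<delta>\<le>e"
proof -
 have pN: "2*N < p*(N+1)" using p N by (simp add: pos_divide_less_eq)
 show p1: "p > 1"
 proof (rule ccontr)
  assume "\<not> p > 1"
  then have "p*(N+1)\<le>1*(N+1)" using N by (intro mult_right_mono) auto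
  then have "2*N < 1*(N+1)" using pN by linarith
  then show False using N by simp
 qed
 have ge: "2*(p-1)\<le>(N+1)*\<delta>"
 proof (cases "p\<ge>2")
  case True
  have "(N+1)*\<delta> = 2*p+2*p/N" using True N by (simp add: \<delta>_def m field_simps)
  moreover have "2*p/N\<ge>0" using p1 N by simp
  ultimately show ?thesis by (simp add: algebra_simps)
 next
  case False
  then have m2: "m = 2" using m by simp
  have "N*((N+1)*\<delta>-2*(p-1)) = (N+1)*(N*\<delta>)-2*N*(p-1)" by (simp add: algebra_simps)
  also have "N*\<delta> = 2*p-(2-p)*(N+p)" using N by (simp add: \<delta>_def m2 field_simps)
  also have "(N+1)*(2*p-(2-p)*(N+p))-2*N*(p-1) = (p*(N+1)-2*N)*(p+N)"
   by (simp add: algebra_simps)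
  finally have "N*((N+1)*\<delta>-2*(p-1)) = (p*(N+1)-2*N)*(p+N)" .
  moreover have "(p*(N+1)-2*N)*(p+N)\<ge>0" using pN p1 N by (intro mult_nonneg_nonneg) auto
  ultimately have "N*((N+1)*\<delta>-2*(p-1))\<ge>0" by simp
  then have "(N+1)*\<delta>-2*(p-1)\<ge>0" using N by (simp add: zero_le_mult_iff)
  then show ?thesis by linarith
 qed
 have "0 < 2*(p-1)" using p1 by simp
 then have "0 < (N+1)*\<delta>" using ge by linarith
 then show \<delta>: "\<delta> > 0" using N by (simp add: zero_less_mult_iff)
 show "0 < (p/N)/\<delta>" using p1 N \<delta> by simp
 have "(p/N)/\<delta> = (p/N)*(2*(p-1))/(\<delta>*(2*(p-1)))" using p1 by simp
 also have "\<dots>\<le>(p/N)*((N+1)*\<delta>)/(\<delta>*(2*(p-1)))"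
  using ge p1 N \<delta> by (intro divide_right_mono mult_left_mono) auto
 also have "... = e" using \<delta> p1 N by (simp add: e_def field_simps)
 finally show "(p/N)/\<delta>\<le>e" .
qed

lemma measure_cylinder:
 assumes "\<rho> > 0" "\<theta> > 0"
 shows "measure lebesgue (cylinder \<rho> \<theta> :: ((real^'n)\<times>real) set) = unit_ball_vol (real CARD('n))*\<rho> powr real CARD('n)*(2*\<theta>)"
proof -
 have "emeasure lborel (ball (0::real^'n) \<rho>\<times>{-\<theta>..\<theta>}) = emeasure (lborel \<Otimes>\<^sub>M lborel) (ball (0::real^'n) \<rho>\<times>{-\<theta>..\<theta>})"
  by (simp add: lborel_prod)
 also have "... = emeasure lborel (ball (0::real^'n) \<rho>)*emeasure lborel {-\<theta>..\<theta>}"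
  by (intro lborel.emeasure_pair_measure_Times) auto
 also have "... = ennreal (unit_ball_vol (real CARD('n))*\<rho>^CARD('n))*ennreal (2*\<theta>)"
  using assms by (simp add: emeasure_ball)
 also have "... = ennreal (unit_ball_vol (real CARD('n))*\<rho>^CARD('n)*(2*\<theta>))"
  using assms by (intro ennreal_mult[symmetric]) auto
 also have "\<rho>^CARD('n) = \<rho> powr real CARD('n)" using assms by (simp add: powr_realpow)
 finally have "emeasure lborel (ball (0::real^'n) \<rho>\<times>{-\<theta>..\<theta>}) = ennreal (unit_ball_vol (real CARD('n))*\<rho> powr real CARD('n)*(2*\<theta>))" .
 moreover have "ball (0::real^'n) \<rho>\<times>{-\<theta>..\<theta>}\<in>sets lborel" by (auto simp: borel_prod[symmetric])
 ultimately show ?thesis unfolding cylinder_def measure_def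
  using assms by (subst emeasure_completion) auto
qed

lemma cball_enlarge:
 fixes \<Omega> :: "'a::euclidean_space set"
 assumes "open \<Omega>" "cball 0 \<rho> \<subseteq> \<Omega>" "\<rho> > 0"
 obtains R where "R > \<rho>" "cball 0 R \<subseteq> \<Omega>"
proof -
 obtain e where e: "e > 0" "(\<Union>x\<in>cball 0 \<rho>. cball x e) \<subseteq> \<Omega>"
  using compact_subset_open_imp_cball_epsilon_subset[OF compact_cball assms(1,2)] by blast
 show thesis
 proof (rule that[of "\<rho>+e"])
  show "cball 0 (\<rho>+e) \<subseteq> \<Omega>"
  proof
   fix x :: 'a assume "x\<in>cball 0 (\<rho>+e)"
   then have x: "norm x\<le>\<rho>+e" by simp
   define y where "y = (\<rho>/(\<rho>+e))*\<^sub>R x"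
   have "norm y = \<rho>*(norm x/(\<rho>+e))" using assms e by (simp add: y_def)
   also have "\<dots>\<le>\<rho>*1" using x assms e by (intro mult_left_mono) (auto simp: divide_le_eq_1)
   finally have y: "y\<in>cball 0 \<rho>" by simp
   have "x-y = (1-\<rho>/(\<rho>+e))*\<^sub>R x" by (simp add: y_def scaleR_left_diff_distrib)
   also have "1-\<rho>/(\<rho>+e) = e/(\<rho>+e)" using assms e by (simp add: field_simps)
   finally have "norm (x-y) = e*(norm x/(\<rho>+e))" using assms e by simp
   also have "\<dots>\<le>e*1" using x assms e by (intro mult_left_mono) (auto simp: divide_le_eq_1)
   finally have "x\<in>cball y e" by (simp add: dist_norm norm_minus_commute)
   then show "x\<in>\<Omega>" using e(2) y by blast
  qed
 qed (use e in simp)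
qed

lemma max_one_powr_mono:
 fixes x g e :: real
 assumes "0\<le>x" "x\<le>y" "0 < g" "g\<le>e"
 shows "max 1 (x powr g)\<le>max 1 (y powr e)"
proof (cases "x\<le>1")
 case True
 then have "x powr g\<le>1" using assms by (intro powr_le1) auto
 then show ?thesis by simp
next
 case False
 have "x powr g\<le>x powr e" using False assms by (intro powr_mono) auto
 also have "\<dots>\<le>y powr e" using assms by (intro powr_mono2) auto
 finally show ?thesis by simp
qed

theorem theorem1p4:
  fixes p \<Lambda>0 \<Lambda>1 N :: real
  defines "N \<equiv> real CARD('n::finite)"
  assumes "2 * N / (N + 1) < p" and "0 < \<Lambda>0" and "\<Lambda>0 \<le> \<Lambda>1"
  shows "\<exists>C>0. \<forall>(\<Omega> :: (real^'n) set) T A u Du \<sigma> \<rho> \<theta>.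
    open \<Omega> \<longrightarrow> T > 0 \<longrightarrow>
    structure_conditions p \<Lambda>0 \<Lambda>1 \<Omega> T A Du \<longrightarrow>
    weak_solution p \<Omega> T A u Du \<longrightarrow>
    (AE z in lebesgue_on (\<Omega> \<times> {-T<..<T}). u z \<ge> 0) \<longrightarrow>
    0 < \<sigma> \<longrightarrow> \<sigma> < 1 \<longrightarrow> 0 < \<rho> \<longrightarrow> 0 < \<theta> \<longrightarrow>
    closure (ball 0 \<rho>) \<times> {-\<theta>..\<theta>} \<subseteq> \<Omega> \<times> {-T<..<T} \<longrightarrow>
    (let AA = \<theta> / \<rho> powr p + (\<rho> powr p / \<theta>) powr (N / p);
         e = p * (N + 1) / (2 * N * (p - 1))
     in esssup (lebesgue_on (cylinder (\<sigma> * \<rho>) (\<sigma> * \<theta>))) (\<lambda>z. ereal (u z)) \<le>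
        ereal (max
          (C * (AA powr e /
              (\<sigma> powr (p * (N + 1)\<^sup>2 / (2 * N * (p - 1))) *
               (1 - \<sigma>) powr (p * (N + p) * (N + 1) / (2 * N * (p - 1))))) *
            (1 / measure lebesgue (cylinder \<rho> \<theta> :: ((real^'n) \<times> real) set) *
              (LINT z|lebesgue_on (cylinder \<rho> \<theta>). \<bar>u z\<bar> powr p)) powr e)
          1))"
proof -
 define m where "m = max p 2"
 define e where "e = p*(N+1)/(2*N*(p-1))"
 define \<delta> where "\<delta> = 2*p/N-(m-p)*(1+p/N)"
 have N1: "N\<ge>1" unfolding N_def by (simp add: Suc_leI)
 note ex = exponent_comparison[OF N1 assms(2) m_def, folded e_def \<delta>_def]
 have p: "p > 1" by (rule ex(1))
 have m: "m = p \<or> m = 2" "p\<le>m" "2\<le>m" "(m-p)*(1+p/N) < 2*p/N"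
  using ex(2) by (auto simp: m_def \<delta>_def)
 define K where "K = \<bar>sup_const N p \<Lambda>0 \<Lambda>1 m\<bar>+1"
 define K2 where "K2 = K*2 powr (1+N/p)*(2*unit_ball_vol N)"
 have K: "K > 0" "sup_const N p \<Lambda>0 \<Lambda>1 m\<le>K" by (auto simp: K_def)
 have ub: "unit_ball_vol N > 0" using N1 by simp
 have K2: "K2 > 0" using K ub by (simp add: K2_def)
 have main: "esssup (lebesgue_on (cylinder (\<sigma>*\<rho>) (\<sigma>*\<theta>))) (\<lambda>z. ereal (u z)) \<le>
    ereal (max
     (K2 powr e*((\<theta>/\<rho> powr p+(\<rho> powr p/\<theta>) powr (N/p)) powr e /
       (\<sigma> powr (p*(N+1)\<^sup>2/(2*N*(p-1))) *
        (1-\<sigma>) powr (p*(N+p)*(N+1)/(2*N*(p-1))))) *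
      (1/measure lebesgue (cylinder \<rho> \<theta> :: ((real^'n)\<times>real) set) *
       (LINT z|lebesgue_on (cylinder \<rho> \<theta>). \<bar>u z\<bar> powr p)) powr e)
     1)"
  if \<Omega>: "open \<Omega>" and str: "structure_conditions p \<Lambda>0 \<Lambda>1 \<Omega> T A Du" and sol: "weak_solution p \<Omega> T A u Du"
   and \<sigma>: "0 < \<sigma>" "\<sigma> < 1" and pos: "0 < \<rho>" "0 < \<theta>"
   and sub: "closure (ball 0 \<rho>)\<times>{-\<theta>..\<theta>} \<subseteq> \<Omega>\<times>{-T<..<T}"
  for \<Omega> :: "(real^'n) set" and T A u Du \<sigma> \<rho> \<theta>
 proof -
  have cb: "cball (0::real^'n) \<rho>\<times>{-\<theta>..\<theta>} \<subseteq> \<Omega>\<times>{-T<..<T}" using sub pos by (simp add: closure_ball)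
  have "(0, \<theta>)\<in>\<Omega>\<times>{-T<..<T}" by (rule subsetD[OF cb]) (use pos in simp)
  then have \<theta>T: "\<theta> < T" by simp
  have c\<Omega>: "cball (0::real^'n) \<rho> \<subseteq> \<Omega>"
  proof
   fix x :: "real^'n" assume "x\<in>cball 0 \<rho>"
   then have "(x, \<theta>)\<in>\<Omega>\<times>{-T<..<T}" by (intro subsetD[OF cb]) (use pos in simp)
   then show "x\<in>\<Omega>" by simp
  qed
  obtain R0 where big: "R0 > \<rho>" "cball (0::real^'n) R0 \<subseteq> \<Omega>" by (rule cball_enlarge[OF \<Omega> c\<Omega> pos(1)])
  have \<Lambda>: "0 < \<Lambda>0" "0 < \<Lambda>1" using assms(3,4) by auto
  have R0_pos: "R0 > 0" using big pos by simp
  obtain v D B T0 where loc: "local_solution p (p/(p-1)) \<Lambda>0 \<Lambda>1 R0 \<theta> v D B T0"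
   and vu: "AE z in lborel. z\<in>ball 0 R0\<times>{-\<theta>..\<theta>} --> v z = u z"
   and um: "u\<in>borel_measurable (lebesgue_on (ball 0 R0\<times>{-T<..<T}))"
   by (rule weak_solution_local_solution[OF sol str \<Omega> p \<Lambda> R0_pos big(2) pos(2) \<theta>T])
  interpret local_solution p "p/(p-1)" \<Lambda>0 \<Lambda>1 R0 \<theta> v D B T0 by (rule loc)
  define Z where "Z = (LINT z|lebesgue_on (cylinder \<rho> \<theta>). \<bar>u z\<bar> powr p)"
  define Q where "Q = measure lebesgue (cylinder \<rho> \<theta> :: ((real^'n)\<times>real) set)"
  define AA where "AA = \<theta>/\<rho> powr p+(\<rho> powr p/\<theta>) powr (N/p)"
  define H where "H = 1/\<theta>+1/\<rho> powr p"
  have Zv: "(LINT z|lborel. indicator (ball (0::real^'n) \<rho>\<times>{-\<theta>..\<theta>}) z*\<bar>v z\<bar> powr p) = Z"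
   unfolding Z_def
  proof (rule integral_lebesgue_on_eq[symmetric])
   show cyl: "(cylinder \<rho> \<theta> :: ((real^'n)\<times>real) set)\<in>sets borel" by (auto simp: cylinder_def borel_prod[symmetric])
   show "(\<lambda>z. indicator (ball (0::real^'n) \<rho>\<times>{-\<theta>..\<theta>}) z*\<bar>v z\<bar> powr p)\<in>Borel"
    using cyl unfolding cylinder_def by measurable
   show "AE z in lborel. z\<in>cylinder \<rho> \<theta> --> indicator (ball (0::real^'n) \<rho>\<times>{-\<theta>..\<theta>}) z*\<bar>v z\<bar> powr p = \<bar>u z\<bar> powr p"
    using vu by eventually_elim (use big in \<open>auto simp: cylinder_def\<close>)
  qed (auto simp: cylinder_def)
  have Z0: "Z\<ge>0" unfolding Z_def by (intro Bochner_Integration.integral_nonneg) simp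
  have Qe: "Q = unit_ball_vol N*\<rho> powr N*(2*\<theta>)" unfolding Q_def N_def by (rule measure_cylinder[OF pos])
  have Q: "Q > 0" unfolding Qe using ub pos by simp
  have AA: "AA\<ge>0" unfolding AA_def using pos by (intro add_nonneg_nonneg) auto
  define X where "X = sup_const N p \<Lambda>0 \<Lambda>1 m*(1-\<sigma>) powr (- (p+N))*H powr (1+N/p)*Z"
  define Y where "Y = K2*AA*(1-\<sigma>) powr (- (p+N))*(1/Q*Z)"
  have X0: "X\<ge>0" unfolding X_def sup_const_def de_giorgi_const_def using Z0 by simp
  have XY: "X\<le>Y"
  proof -
   have HQ: "H powr (1+N/p)*Q\<le>2 powr (1+N/p)*(2*unit_ball_vol N)*AA"
   proof -
    have "H powr (1+N/p)*Q = (2*unit_ball_vol N)*(H powr (1+N/p)*(\<rho> powr N*\<theta>))"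
     unfolding Qe by (simp only: mult_ac)
    also have "\<dots>\<le>(2*unit_ball_vol N)*(2 powr (1+N/p)*AA)"
     unfolding H_def AA_def using parabolic_scaling[of N p \<rho> \<theta>] N1 p pos ub by (intro mult_left_mono) auto
    finally show ?thesis by (simp only: mult_ac)
   qed
   have "X = sup_const N p \<Lambda>0 \<Lambda>1 m*((H powr (1+N/p)*Q)*((1-\<sigma>) powr (- (p+N))*(1/Q*Z)))"
    unfolding X_def using Q by simp
   also have "\<dots>\<le>K*((2 powr (1+N/p)*(2*unit_ball_vol N)*AA)*((1-\<sigma>) powr (- (p+N))*(1/Q*Z)))"
    by (rule mult_mono[OF K(2) mult_right_mono[OF HQ]]) (use K Q Z0 in auto)
   also have "... = Y" unfolding Y_def K2_def by (simp only: mult_ac)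
   finally show ?thesis .
  qed
  have Ye: "Y powr e\<le>K2 powr e*(AA powr e/(\<sigma> powr (p*(N+1)\<^sup>2/(2*N*(p-1)))*(1-\<sigma>) powr (p*(N+p)*(N+1)/(2*N*(p-1)))))*(1/Q*Z) powr e"
  proof -
   define s where "s = \<sigma> powr (p*(N+1)\<^sup>2/(2*N*(p-1)))"
   have s: "0 < s" "s\<le>1" unfolding s_def using \<sigma> p N1 by (auto intro!: powr_le1)
   define w where "w = (1-\<sigma>) powr (p*(N+p)*(N+1)/(2*N*(p-1)))"
   have w: "w > 0" using \<sigma> by (simp add: w_def)
   have "Y powr e = (K2*AA*(1-\<sigma>) powr (- (p+N))) powr e*(1/Q*Z) powr e"
    unfolding Y_def by (rule powr_mult; use K2 AA Q Z0 in simp)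
   also have "(K2*AA*(1-\<sigma>) powr (- (p+N))) powr e = (K2*AA) powr e*((1-\<sigma>) powr (- (p+N))) powr e"
    by (rule powr_mult; use K2 AA in simp)
   also have "(K2*AA) powr e = K2 powr e*AA powr e" by (rule powr_mult; use K2 AA in simp)
   also have "((1-\<sigma>) powr (- (p+N))) powr e = 1/w"
   proof -
    have "(p+N)*e = p*(N+p)*(N+1)/(2*N*(p-1))"
     unfolding e_def times_divide_eq_right by (simp only: mult_ac add_ac)
    then have "- (p+N)*e = - (p*(N+p)*(N+1)/(2*N*(p-1)))" by (simp only: mult_minus_left)
    then show ?thesis unfolding powr_powr w_def by (simp only: powr_minus_divide)
   qed
   finally have "Y powr e = K2 powr e*(AA powr e*(1/w))*(1/Q*Z) powr e" by (simp only: mult_ac)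
   also have "\<dots>\<le>K2 powr e*(AA powr e*(1/(s*w)))*(1/Q*Z) powr e"
   proof -
    have "s*w\<le>1*w" using s w by (intro mult_right_mono) auto
    then have "1/w\<le>1/(s*w)" using s w by (intro divide_left_mono) auto
    then show ?thesis by (intro mult_right_mono mult_left_mono) auto
   qed
   finally show ?thesis unfolding s_def w_def by simp
  qed
  have "max 1 (X powr ((p/N)/\<delta>))\<le>max 1 (Y powr e)" by (rule max_one_powr_mono[OF X0 XY ex(3,4)])
  also have "\<dots>\<le>max 1 (K2 powr e*(AA powr e/(\<sigma> powr (p*(N+1)\<^sup>2/(2*N*(p-1)))*(1-\<sigma>) powr (p*(N+p)*(N+1)/(2*N*(p-1)))))*(1/Q*Z) powr e)"
   using Ye by simp
  finally have le: "max 1 (X powr ((p/N)/\<delta>))\<le>max (K2 powr e*(AA powr e/(\<sigma> powr (p*(N+1)\<^sup>2/(2*N*(p-1)))*(1-\<sigma>) powr (p*(N+p)*(N+1)/(2*N*(p-1)))))*(1/Q*Z) powr e) 1"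
   by (simp only: max.commute)
  have "AE z in lborel. z\<in>cball 0 (\<sigma>*\<rho>)\<times>{-(\<sigma>*\<theta>)..\<theta>} --> v z\<le>max 1 (X powr ((p/N)/\<delta>))"
   using local_sup_bound[OF m(1,2,3) m(4)[unfolded N_def] pos(1) big(1) \<sigma>, folded N_def] unfolding Zv X_def H_def \<delta>_def .
  then have "AE z in lborel. z\<in>cylinder (\<sigma>*\<rho>) (\<sigma>*\<theta>) --> ereal (u z)\<le>ereal (max 1 (X powr ((p/N)/\<delta>)))"
   using vu
  proof eventually_elim
   case (elim z)
   show ?case
   proof
    assume z: "z\<in>cylinder (\<sigma>*\<rho>) (\<sigma>*\<theta>)"
    have "\<sigma>*\<rho>\<le>1*\<rho>" "\<sigma>*\<theta>\<le>1*\<theta>" using \<sigma> pos by (intro mult_right_mono; simp)+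
    then have "z\<in>cball 0 (\<sigma>*\<rho>)\<times>{-(\<sigma>*\<theta>)..\<theta>}" "z\<in>ball 0 R0\<times>{-\<theta>..\<theta>}"
     using z big by (auto simp: cylinder_def)
    then have "u z\<le>max 1 (X powr ((p/N)/\<delta>))" using elim by simp
    then show "ereal (u z)\<le>ereal (max 1 (X powr ((p/N)/\<delta>)))" by (simp only: ereal_less_eq)
   qed
  qed
  then have AEc: "AE z in lebesgue_on (cylinder (\<sigma>*\<rho>) (\<sigma>*\<theta>)). ereal (u z)\<le>ereal (max 1 (X powr ((p/N)/\<delta>)))"
   by (subst AE_restrict_space_iff) (auto simp: AE_completion_iff cylinder_def borel_prod[symmetric])
  have "(cylinder (\<sigma>*\<rho>) (\<sigma>*\<theta>) :: ((real^'n)\<times>real) set) \<subseteq> ball 0 R0\<times>{-T<..<T}"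
  proof -
   have "\<sigma>*\<rho>\<le>1*\<rho>" "\<sigma>*\<theta>\<le>1*\<theta>" using \<sigma> pos by (intro mult_right_mono; simp)+
   then show ?thesis using big \<theta>T by (auto simp: cylinder_def)
  qed
  then have "u\<in>borel_measurable (lebesgue_on (cylinder (\<sigma>*\<rho>) (\<sigma>*\<theta>)))" by (rule measurable_restrict_mono[OF um])
  then have "(\<lambda>z. ereal (u z))\<in>borel_measurable (lebesgue_on (cylinder (\<sigma>*\<rho>) (\<sigma>*\<theta>)))" by simp
  from esssup_I[OF this AEc]
  have "esssup (lebesgue_on (cylinder (\<sigma>*\<rho>) (\<sigma>*\<theta>))) (\<lambda>z. ereal (u z))\<le>ereal (max 1 (X powr ((p/N)/\<delta>)))" .
  also have "\<dots>\<le>ereal (max (K2 powr e*(AA powr e/(\<sigma> powr (p*(N+1)\<^sup>2/(2*N*(p-1)))*(1-\<sigma>) powr (p*(N+p)*(N+1)/(2*N*(p-1)))))*(1/Q*Z) powr e) 1)"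
   using le by (simp only: ereal_less_eq)
  finally show ?thesis unfolding AA_def Q_def Z_def .
 qed
 show ?thesis
  unfolding Let_def e_def[symmetric]
  by (rule exI[of _ "K2 powr e"], intro conjI allI impI) (use K2 in simp, rule main)
qed

end
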